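(* Let $X$ be a finite set with $|X|\ge 2$ and let $G$ be a countable group acting self-similarly on $X^\omega$. If $\mu\big((X^\omega)_{G\text{-gen}}\big)=1$, then there exists a unique tracial state on the gauge invariant subalgebra of $\mathcal O_{G_{\min}}$, and there exists a unique tracial state on the gauge invariant subalgebra of $\mathcal O_{G_{\max}}$.
   Context: $X^*=\bigcup_{n\ge 0}X^n$ is the set of finite words, and $X^\omega\cong X^{\mathbb N}$ is the set of unilateral infinite words over $X$ with the product topology. A faithful action of a group $G$ on $X^\omega$ is self-similar if for every $g\in G$, $x\in X$ there exist $h\in G$, $v\in X$ with $g(xw)=v\,h(w)$ for all $w\in X^\omega$; these are unique and written $h(g,x)$, $v(g,x)$. $\mu$ is the Bernoulli measure on $X^\omega$ (product of the uniform probability measures on $X$). A point $w$ is $g$-generic if $g(w)\ne w$ or some neighborhood of $w$ consists of fixed points of $g$; $(X^\omega)_{G\text{-gen}}$ is the set of points that are $g$-generic for all $g\in G$. For $u\in X^*$ let $T_u:X^\omega\to X^\omega$, $w\mapsto uw$, let $T_u^*$ be its inverse defined on $uX^\omega=\{uw: w\in X^\omega\}$, and let $\langle G,X\rangle=\{T_{u_1}gT_{u_2}^*: u_1,u_2\in X^*,\ g\in G\}$ (partially defined maps). A point $w$ is strictly $G$-generic if for every $f\in\langle G,X\rangle$, either $f$ is not defined at $w$, or $f(w)\neq w$, or $f$ fixes every point of a neighborhood of $w$. Strictly $G$-generic points exist. $\mathcal O_{G_{\max}}$ is the universal C$^*$-algebra generated by $G$ (all relations of $G$ being preserved) and $\{S_x\}_{x\in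 X}$ subject to $g^*g=gg^*=1$, $S_x^*S_y=\delta_{x,y}$, $\sum_{x\in X}S_xS_x^*=1$, $gS_x=S_{v(g,x)}h(g,x)$ for $x,y\in X$, $g\in G$. For a strictly $G$-generic $w$ let $\langle G,X\rangle(w)=\{f(w): f\in\langle G,X\rangle \text{ defined at } w\}$, and let $\pi_w$ be the representation of $\mathcal O_{G_{\max}}$ on $\ell^2(\langle G,X\rangle(w))$ with $S_x\delta_{w_1}=\delta_{xw_1}$, $g\delta_{w_1}=\delta_{g(w_1)}$. The C$^*$-algebra $\mathcal O_{G_{\min}}:=\pi_w(\mathcal O_{G_{\max}})$ does not depend (up to canonical isomorphism) on the choice of $w$; the images of $S_x$ and $g$ in it are denoted by the same symbols. The canonical gauge action $\Gamma$ of $\mathbb R$ on $\mathcal O_{G_{\min}}$ or $\mathcal O_{G_{\max}}$ is given by $\Gamma_t(g)=g$, $\Gamma_t(S_x)=e^{it}S_x$. The gauge invariant subalgebra is the C$^*$-subalgebra of elements fixed by all $\Gamma_t$, $t\in\mathbb R$. *)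

theory Defs
  imports
    "HOL-Probability.Probability"
    "HOL-Algebra.Group_Action"
    "HOL-Algebra.Ring"
    "HOL-Library.Omega_Words_Fun"
begin

section \<open>Star-algebras, C*-seminorms and completions\<close>

record 'a star_algebra = "'a ring" +
  scal :: "complex \<Rightarrow> 'a \<Rightarrow> 'a"
  adj :: "'a \<Rightarrow> 'a"

record 'a normed_star_algebra = "'a star_algebra" +
  nrm :: "'a \<Rightarrow> real"

definition diff :: "('a, 'm) star_algebra_scheme \<Rightarrow> 'a \<Rightarrow> 'a \<Rightarrow> 'a" where
  "diff A a b = a \<oplus>\<^bsub>A\<^esub> scal A (- 1) b"

definition cstar_seminorm :: "('a, 'm) star_algebra_scheme \<Rightarrow> ('a \<Rightarrow> real) \<Rightarrow> bool" where
  "cstar_seminorm A p \<longleftrightarrow>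
     (\<forall>a\<in>carrier A. 0 \<le> p a) \<and>
     (\<forall>a\<in>carrier A. \<forall>b\<in>carrier A. p (a \<oplus>\<^bsub>A\<^esub> b) \<le> p a + p b) \<and>
     (\<forall>c. \<forall>a\<in>carrier A. p (scal A c a) = cmod c * p a) \<and>
     (\<forall>a\<in>carrier A. \<forall>b\<in>carrier A. p (a \<otimes>\<^bsub>A\<^esub> b) \<le> p a * p b) \<and>
     (\<forall>a\<in>carrier A. p (adj A a \<otimes>\<^bsub>A\<^esub> a) = (p a)\<^sup>2)"

definition cauchy_seqs :: "('a, 'm) star_algebra_scheme \<Rightarrow> ('a \<Rightarrow> real) \<Rightarrow> (nat \<Rightarrow> 'a) set" where
  "cauchy_seqs A p = {\<xi>. (\<forall>n. \<xi> n \<in> carrier A) \<and>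
     (\<forall>\<epsilon>>0. \<exists>N. \<forall>m\<ge>N. \<forall>n\<ge>N. p (diff A (\<xi> m) (\<xi> n)) < \<epsilon>)}"

definition null_rel :: "('a, 'm) star_algebra_scheme \<Rightarrow> ('a \<Rightarrow> real) \<Rightarrow> ((nat \<Rightarrow> 'a) \<times> (nat \<Rightarrow> 'a)) set"
  where "null_rel A p = {(\<xi>, \<eta>). \<xi> \<in> cauchy_seqs A p \<and> \<eta> \<in> cauchy_seqs A p \<and>
     (\<lambda>n. p (diff A (\<xi> n) (\<eta> n))) \<longlonglongrightarrow> 0}"

abbreviation cauchy_class ::
  "('a, 'm) star_algebra_scheme \<Rightarrow> ('a \<Rightarrow> real) \<Rightarrow> (nat \<Rightarrow> 'a) \<Rightarrow> (nat \<Rightarrow> 'a) set" where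
  "cauchy_class A p \<xi> \<equiv> null_rel A p `` {\<xi>}"

text \<open>
  The separated completion of a star-algebra with respect to a seminorm \<open>p\<close>. The null ideal
  of \<open>p\<close> is divided out by the passage to classes of Cauchy sequences.
\<close>

definition completion ::
  "('a, 'm) star_algebra_scheme \<Rightarrow> ('a \<Rightarrow> real) \<Rightarrow> (nat \<Rightarrow> 'a) set normed_star_algebra" where
  "completion A p =
    \<lparr> carrier = cauchy_seqs A p // null_rel A p,
      mult = (\<lambda>C D. \<Union>\<xi>\<in>C. \<Union>\<eta>\<in>D. cauchy_class A p (\<lambda>n. \<xi> n \<otimes>\<^bsub>A\<^esub> \<eta> n)),
      one = cauchy_class A p (\<lambda>n. \<one>\<^bsub>A\<^esub>),
      zero = cauchy_class A p (\<lambda>n. \<zero>\<^bsub>A\<^esub>),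
      add = (\<lambda>C D. \<Union>\<xi>\<in>C. \<Union>\<eta>\<in>D. cauchy_class A p (\<lambda>n. \<xi> n \<oplus>\<^bsub>A\<^esub> \<eta> n)),
      scal = (\<lambda>c C. \<Union>\<xi>\<in>C. cauchy_class A p (\<lambda>n. scal A c (\<xi> n))),
      adj = (\<lambda>C. \<Union>\<xi>\<in>C. cauchy_class A p (\<lambda>n. adj A (\<xi> n))),
      nrm = (\<lambda>C. THE r. \<forall>\<xi>\<in>C. (\<lambda>n. p (\<xi> n)) \<longlonglongrightarrow> r) \<rparr>"


section \<open>Universal C*-algebras given by generators and relations\<close>

text \<open>
  The free unital complex star-algebra on a set \<open>Z\<close>: finitely supported functions on words in
  the letters \<open>(z, b)\<close> with \<open>z \<in> Z\<close>, where \<open>(z, False)\<close> stands for \<open>z\<close> and \<open>(z, True)\<close> for its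
  adjoint.
\<close>

type_synonym 'z free_elem = "('z \<times> bool) list \<Rightarrow> complex"

definition free_star_algebra :: "'z set \<Rightarrow> 'z free_elem star_algebra" where
  "free_star_algebra Z =
    \<lparr> carrier = {f. finite {w. f w \<noteq> 0} \<and> (\<forall>w. f w \<noteq> 0 \<longrightarrow> fst ` set w \<subseteq> Z)},
      mult = (\<lambda>f g w. \<Sum>k\<le>length w. f (take k w) * g (drop k w)),
      one = (\<lambda>w. if w = [] then 1 else 0),
      zero = (\<lambda>w. 0),
      add = (\<lambda>f g w. f w + g w),
      scal = (\<lambda>c f w. c * f w),
      adj = (\<lambda>f w. cnj (f (rev (map (apsnd Not) w)))) \<rparr>"

definition free_gen :: "'z \<Rightarrow> 'z free_elem" where
  "free_gen z = (\<lambda>w. if w = [(z, False)] then 1 else 0)"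

text \<open>
  A relation \<open>a = b\<close> is a pair \<open>(a, b)\<close> of elements of the free star-algebra. The universal
  C*-algebra is the completion with respect to the largest C*-seminorm under which all relations
  hold. The supremum is meaningful when the relations bound the norms of the generators, as
  those used below do. C*-seminorms for which the relations hold are exactly the functions
  \<open>a \<mapsto> \<parallel>\<rho> a\<parallel>\<close> for star-homomorphisms \<open>\<rho>\<close> into C*-algebras satisfying the relations; taking the
  supremum over seminorms avoids a quantification over all C*-algebras.
\<close>

definition universal_seminorm ::
  "'z set \<Rightarrow> ('z free_elem \<times> 'z free_elem) set \<Rightarrow> 'z free_elem \<Rightarrow> real" where
  "universal_seminorm Z R f =
     Sup {p f | p. cstar_seminorm (free_star_algebra Z) p \<and>
                   (\<forall>(a, b)\<in>R. p (diff (free_star_algebra Z) a b) = 0)}"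

definition universal_cstar ::
  "'z set \<Rightarrow> ('z free_elem \<times> 'z free_elem) set \<Rightarrow> (nat \<Rightarrow> 'z free_elem) set normed_star_algebra"
  where "universal_cstar Z R = completion (free_star_algebra Z) (universal_seminorm Z R)"

definition universal_gen ::
  "'z set \<Rightarrow> ('z free_elem \<times> 'z free_elem) set \<Rightarrow> 'z \<Rightarrow> (nat \<Rightarrow> 'z free_elem) set" where
  "universal_gen Z R z =
     cauchy_class (free_star_algebra Z) (universal_seminorm Z R) (\<lambda>n. free_gen z)"

definition free_eval :: "('b, 'm) star_algebra_scheme \<Rightarrow> ('z \<Rightarrow> 'b) \<Rightarrow> 'z free_elem \<Rightarrow> 'b" where
  "free_eval B \<theta> f = (\<Oplus>\<^bsub>B\<^esub>w\<in>{w. f w \<noteq> 0}. scal B (f w)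
     (foldr (\<lambda>(z, b) r. (if b then adj B (\<theta> z) else \<theta> z) \<otimes>\<^bsub>B\<^esub> r) w \<one>\<^bsub>B\<^esub>))"

text \<open>
  The homomorphism from the universal C*-algebra to \<open>B\<close> determined by images \<open>\<theta> z\<close> of the
  generators: extend to the free star-algebra and then by continuity.
\<close>

definition universal_hom ::
  "('b, 'm) normed_star_algebra_scheme \<Rightarrow> ('z \<Rightarrow> 'b) \<Rightarrow> (nat \<Rightarrow> 'z free_elem) set \<Rightarrow> 'b" where
  "universal_hom B \<theta> C = (THE b. b \<in> carrier B \<and>
     (\<forall>\<xi>\<in>C. (\<lambda>n. nrm B (diff B (free_eval B \<theta> (\<xi> n)) b)) \<longlonglongrightarrow> 0))"


section \<open>Bounded operators on the Hilbert space of square summable functions\<close>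

definition ell2 :: "'i set \<Rightarrow> ('i \<Rightarrow> complex) set" where
  "ell2 I = {f. (\<forall>i. i \<notin> I \<longrightarrow> f i = 0) \<and> (\<lambda>i. (cmod (f i))\<^sup>2) summable_on I}"

definition ell2_inner :: "'i set \<Rightarrow> ('i \<Rightarrow> complex) \<Rightarrow> ('i \<Rightarrow> complex) \<Rightarrow> complex" where
  "ell2_inner I f g = (\<Sum>\<^sub>\<infinity>i\<in>I. cnj (f i) * g i)"

definition ell2_norm :: "'i set \<Rightarrow> ('i \<Rightarrow> complex) \<Rightarrow> real" where
  "ell2_norm I f = sqrt (\<Sum>\<^sub>\<infinity>i\<in>I. (cmod (f i))\<^sup>2)"

definition ell2_delta :: "'i \<Rightarrow> 'i \<Rightarrow> complex" where
  "ell2_delta i = (\<lambda>j. if j = i then 1 else 0)"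

definition bounded_ops :: "'i set \<Rightarrow> (('i \<Rightarrow> complex) \<Rightarrow> ('i \<Rightarrow> complex)) set" where
  "bounded_ops I = {T \<in> ell2 I \<rightarrow>\<^sub>E ell2 I.
     (\<forall>f\<in>ell2 I. \<forall>g\<in>ell2 I. T (\<lambda>i. f i + g i) = (\<lambda>i. T f i + T g i)) \<and>
     (\<forall>c. \<forall>f\<in>ell2 I. T (\<lambda>i. c * f i) = (\<lambda>i. c * T f i)) \<and>
     (\<exists>K. \<forall>f\<in>ell2 I. ell2_norm I (T f) \<le> K * ell2_norm I f)}"

definition bounded_op_algebra ::
  "'i set \<Rightarrow> (('i \<Rightarrow> complex) \<Rightarrow> ('i \<Rightarrow> complex)) normed_star_algebra" where
  "bounded_op_algebra I =
    \<lparr> carrier = bounded_ops I,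
      mult = (\<lambda>S T. compose (ell2 I) S T),
      one = (\<lambda>f\<in>ell2 I. f),
      zero = (\<lambda>f\<in>ell2 I. \<lambda>i. 0),
      add = (\<lambda>S T. \<lambda>f\<in>ell2 I. \<lambda>i. S f i + T f i),
      scal = (\<lambda>c T. \<lambda>f\<in>ell2 I. \<lambda>i. c * T f i),
      adj = (\<lambda>T. THE T'. T' \<in> bounded_ops I \<and>
                (\<forall>f\<in>ell2 I. \<forall>g\<in>ell2 I. ell2_inner I (T' f) g = ell2_inner I f (T g))),
      nrm = (\<lambda>T. Sup {ell2_norm I (T f) | f. f \<in> ell2 I \<and> ell2_norm I f \<le> 1}) \<rparr>"

text \<open>
  For a map \<open>\<phi>\<close> from \<open>I\<close> to \<open>I\<close> that is injective on \<open>I\<close>, the bounded operator sending the basis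
  vector at \<open>i\<close> to the basis vector at \<open>\<phi> i\<close>.
\<close>

definition basis_op :: "'i set \<Rightarrow> ('i \<Rightarrow> 'i) \<Rightarrow> ('i \<Rightarrow> complex) \<Rightarrow> ('i \<Rightarrow> complex)" where
  "basis_op I \<phi> = (\<lambda>f\<in>ell2 I. \<lambda>j. if j \<in> \<phi> ` I then f (inv_into I \<phi> j) else 0)"

lemma ell2_delta_in_ell2:
  assumes "i \<in> I"
  shows "ell2_delta i \<in> ell2 I"
proof -
  have "(\<lambda>j. (cmod (ell2_delta i j))\<^sup>2) summable_on I \<longleftrightarrow>
        (\<lambda>j. (cmod (ell2_delta i j))\<^sup>2) summable_on {i}"
    by (rule summable_on_cong_neutral) (use assms in \<open>auto simp: ell2_delta_def\<close>)
  then show ?thesis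
    using assms by (auto simp: ell2_def ell2_delta_def)
qed

lemma basis_op_delta:
  assumes "inj_on \<phi> I" and "\<phi> ` I \<subseteq> I" and "i \<in> I"
  shows "basis_op I \<phi> (ell2_delta i) = ell2_delta (\<phi> i)"
  using assms ell2_delta_in_ell2[OF assms(3)]
  by (auto simp: basis_op_def ell2_delta_def fun_eq_iff inv_into_f_f)


section \<open>Self-similar actions\<close>

text \<open>
  The alphabet is a finite type \<open>'x\<close>, so that the space of infinite words is the type
  \<open>nat \<Rightarrow> 'x\<close>; \<open>u \<frown> w\<close> is concatenation of a finite with an infinite word.
\<close>

definition self_similar_action ::
  "('g, 'm) monoid_scheme \<Rightarrow> ('g \<Rightarrow> (nat \<Rightarrow> 'x) \<Rightarrow> (nat \<Rightarrow> 'x)) \<Rightarrow> bool" where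
  "self_similar_action G \<phi> \<longleftrightarrow> faithful_action G UNIV \<phi> \<and>
     (\<forall>g\<in>carrier G. \<forall>x. \<exists>h\<in>carrier G. \<exists>y. \<forall>w. \<phi> g ([x] \<frown> w) = [y] \<frown> \<phi> h w)"

definition word_topology :: "(nat \<Rightarrow> 'x) topology" where
  "word_topology = product_topology (\<lambda>_. discrete_topology UNIV) UNIV"

definition bernoulli :: "(nat \<Rightarrow> 'x::finite) measure" where
  "bernoulli = PiM UNIV (\<lambda>_. uniform_count_measure UNIV)"

definition generic_points ::
  "('g, 'm) monoid_scheme \<Rightarrow> ('g \<Rightarrow> (nat \<Rightarrow> 'x) \<Rightarrow> (nat \<Rightarrow> 'x)) \<Rightarrow> (nat \<Rightarrow> 'x) set" where
  "generic_points G \<phi> = {w. \<forall>g\<in>carrier G. \<phi> g w \<noteq> w \<or>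
     (\<exists>U. openin word_topology U \<and> w \<in> U \<and> (\<forall>v\<in>U. \<phi> g v = v))}"

definition prepend :: "'x list \<Rightarrow> (nat \<Rightarrow> 'x) \<Rightarrow> (nat \<Rightarrow> 'x) option" where
  "prepend u w = Some (u \<frown> w)"

definition unprepend :: "'x list \<Rightarrow> (nat \<Rightarrow> 'x) \<Rightarrow> (nat \<Rightarrow> 'x) option" where
  "unprepend u w = (if \<exists>v. w = u \<frown> v then Some (THE v. w = u \<frown> v) else None)"

definition partial_maps ::
  "('g, 'm) monoid_scheme \<Rightarrow> ('g \<Rightarrow> (nat \<Rightarrow> 'x) \<Rightarrow> (nat \<Rightarrow> 'x)) \<Rightarrow>
   ((nat \<Rightarrow> 'x) \<Rightarrow> (nat \<Rightarrow> 'x) option) set" where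
  "partial_maps G \<phi> =
     {prepend u\<^sub>1 \<circ>\<^sub>m (Some \<circ> \<phi> g) \<circ>\<^sub>m unprepend u\<^sub>2 | u\<^sub>1 u\<^sub>2 g. g \<in> carrier G}"

definition strictly_generic ::
  "('g, 'm) monoid_scheme \<Rightarrow> ('g \<Rightarrow> (nat \<Rightarrow> 'x) \<Rightarrow> (nat \<Rightarrow> 'x)) \<Rightarrow> (nat \<Rightarrow> 'x) \<Rightarrow> bool" where
  "strictly_generic G \<phi> w \<longleftrightarrow> (\<forall>f\<in>partial_maps G \<phi>. f w = None \<or> f w \<noteq> Some w \<or>
     (\<exists>U. openin word_topology U \<and> w \<in> U \<and> (\<forall>v\<in>U. f v = Some v)))"

definition partial_orbit ::
  "('g, 'm) monoid_scheme \<Rightarrow> ('g \<Rightarrow> (nat \<Rightarrow> 'x) \<Rightarrow> (nat \<Rightarrow> 'x)) \<Rightarrow> (nat \<Rightarrow> 'x) \<Rightarrow> (nat \<Rightarrow> 'x) set" where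
  "partial_orbit G \<phi> w = {v. \<exists>f\<in>partial_maps G \<phi>. f w = Some v}"


section \<open>The Cuntz--Pimsner type algebras of a self-similar action\<close>

datatype ('g, 'x) gen = Grp 'g | Iso 'x

definition gens :: "('g, 'm) monoid_scheme \<Rightarrow> ('g, 'x) gen set" where
  "gens G = Grp ` carrier G \<union> range Iso"

definition relations ::
  "('g, 'm) monoid_scheme \<Rightarrow> ('g \<Rightarrow> (nat \<Rightarrow> 'x::finite) \<Rightarrow> (nat \<Rightarrow> 'x)) \<Rightarrow>
   (('g, 'x) gen free_elem \<times> ('g, 'x) gen free_elem) set" where
  "relations G \<phi> =
    (let F = free_star_algebra (gens G :: ('g, 'x) gen set);
         U = (\<lambda>g. free_gen (Grp g)); S = (\<lambda>x. free_gen (Iso x))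
     in {(U g \<otimes>\<^bsub>F\<^esub> U h, U (g \<otimes>\<^bsub>G\<^esub> h)) | g h. g \<in> carrier G \<and> h \<in> carrier G} \<union>
        {(U \<one>\<^bsub>G\<^esub>, \<one>\<^bsub>F\<^esub>)} \<union>
        {(adj F (U g) \<otimes>\<^bsub>F\<^esub> U g, \<one>\<^bsub>F\<^esub>) | g. g \<in> carrier G} \<union>
        {(U g \<otimes>\<^bsub>F\<^esub> adj F (U g), \<one>\<^bsub>F\<^esub>) | g. g \<in> carrier G} \<union>
        {(adj F (S x) \<otimes>\<^bsub>F\<^esub> S y, if x = y then \<one>\<^bsub>F\<^esub> else \<zero>\<^bsub>F\<^esub>) | x y. True} \<union>
        {(\<Oplus>\<^bsub>F\<^esub>x\<in>UNIV. S x \<otimes>\<^bsub>F\<^esub> adj F (S x), \<one>\<^bsub>F\<^esub>)} \<union>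
        {(U g \<otimes>\<^bsub>F\<^esub> S x, S y \<otimes>\<^bsub>F\<^esub> U h) | g x y h. g \<in> carrier G \<and> h \<in> carrier G \<and>
           (\<forall>w. \<phi> g ([x] \<frown> w) = [y] \<frown> \<phi> h w)})"

definition O_max ::
  "('g, 'm) monoid_scheme \<Rightarrow> ('g \<Rightarrow> (nat \<Rightarrow> 'x::finite) \<Rightarrow> (nat \<Rightarrow> 'x)) \<Rightarrow>
   (nat \<Rightarrow> ('g, 'x) gen free_elem) set normed_star_algebra" where
  "O_max G \<phi> = universal_cstar (gens G) (relations G \<phi>)"

definition O_max_gen ::
  "('g, 'm) monoid_scheme \<Rightarrow> ('g \<Rightarrow> (nat \<Rightarrow> 'x::finite) \<Rightarrow> (nat \<Rightarrow> 'x)) \<Rightarrow>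
   ('g, 'x) gen \<Rightarrow> (nat \<Rightarrow> ('g, 'x) gen free_elem) set" where
  "O_max_gen G \<phi> = universal_gen (gens G) (relations G \<phi>)"

definition orbit_rep ::
  "('g, 'm) monoid_scheme \<Rightarrow> ('g \<Rightarrow> (nat \<Rightarrow> 'x::finite) \<Rightarrow> (nat \<Rightarrow> 'x)) \<Rightarrow> (nat \<Rightarrow> 'x) \<Rightarrow>
   (nat \<Rightarrow> ('g, 'x) gen free_elem) set \<Rightarrow> ((nat \<Rightarrow> 'x) \<Rightarrow> complex) \<Rightarrow> ((nat \<Rightarrow> 'x) \<Rightarrow> complex)" where
  "orbit_rep G \<phi> w = universal_hom (bounded_op_algebra (partial_orbit G \<phi> w))
     (\<lambda>z. case z of
        Grp g \<Rightarrow> basis_op (partial_orbit G \<phi> w) (\<phi> g)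
      | Iso x \<Rightarrow> basis_op (partial_orbit G \<phi> w) (\<lambda>v. [x] \<frown> v))"

definition O_min ::
  "('g, 'm) monoid_scheme \<Rightarrow> ('g \<Rightarrow> (nat \<Rightarrow> 'x::finite) \<Rightarrow> (nat \<Rightarrow> 'x)) \<Rightarrow> (nat \<Rightarrow> 'x) \<Rightarrow>
   (((nat \<Rightarrow> 'x) \<Rightarrow> complex) \<Rightarrow> ((nat \<Rightarrow> 'x) \<Rightarrow> complex)) normed_star_algebra" where
  "O_min G \<phi> w = (bounded_op_algebra (partial_orbit G \<phi> w))
     \<lparr> carrier := orbit_rep G \<phi> w ` carrier (O_max G \<phi>) \<rparr>"

definition O_min_gen ::
  "('g, 'm) monoid_scheme \<Rightarrow> ('g \<Rightarrow> (nat \<Rightarrow> 'x::finite) \<Rightarrow> (nat \<Rightarrow> 'x)) \<Rightarrow> (nat \<Rightarrow> 'x) \<Rightarrow>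
   ('g, 'x) gen \<Rightarrow> ((nat \<Rightarrow> 'x) \<Rightarrow> complex) \<Rightarrow> ((nat \<Rightarrow> 'x) \<Rightarrow> complex)" where
  "O_min_gen G \<phi> w z = orbit_rep G \<phi> w (O_max_gen G \<phi> z)"


section \<open>Gauge action and tracial states\<close>

text \<open>
  Isometry is included because it is automatic for star-automorphisms of C*-algebras.
\<close>

definition star_automorphism :: "('a, 'm) normed_star_algebra_scheme \<Rightarrow> ('a \<Rightarrow> 'a) \<Rightarrow> bool" where
  "star_automorphism A \<alpha> \<longleftrightarrow>
     \<alpha> \<in> extensional (carrier A) \<and> bij_betw \<alpha> (carrier A) (carrier A) \<and>
     (\<forall>a\<in>carrier A. \<forall>b\<in>carrier A. \<alpha> (a \<oplus>\<^bsub>A\<^esub> b) = \<alpha> a \<oplus>\<^bsub>A\<^esub> \<alpha> b) \<and>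
     (\<forall>c. \<forall>a\<in>carrier A. \<alpha> (scal A c a) = scal A c (\<alpha> a)) \<and>
     (\<forall>a\<in>carrier A. \<forall>b\<in>carrier A. \<alpha> (a \<otimes>\<^bsub>A\<^esub> b) = \<alpha> a \<otimes>\<^bsub>A\<^esub> \<alpha> b) \<and>
     (\<forall>a\<in>carrier A. \<alpha> (adj A a) = adj A (\<alpha> a)) \<and>
     (\<forall>a\<in>carrier A. nrm A (\<alpha> a) = nrm A a)"

text \<open>
  In the next two definitions \<open>s\<close> gives the canonical generators inside the algebra \<open>A\<close>.
\<close>

definition gauge_action ::
  "('g, 'n) monoid_scheme \<Rightarrow> ('a, 'm) normed_star_algebra_scheme \<Rightarrow> (('g, 'x) gen \<Rightarrow> 'a) \<Rightarrow>
   real \<Rightarrow> 'a \<Rightarrow> 'a" where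
  "gauge_action G A s t = (THE \<alpha>. star_automorphism A \<alpha> \<and>
     (\<forall>g\<in>carrier G. \<alpha> (s (Grp g)) = s (Grp g)) \<and>
     (\<forall>x. \<alpha> (s (Iso x)) = scal A (cis t) (s (Iso x))))"

definition gauge_invariant ::
  "('g, 'n) monoid_scheme \<Rightarrow> ('a, 'm) normed_star_algebra_scheme \<Rightarrow> (('g, 'x) gen \<Rightarrow> 'a) \<Rightarrow>
   ('a, 'm) normed_star_algebra_scheme" where
  "gauge_invariant G A s =
     A \<lparr> carrier := {a \<in> carrier A. \<forall>t. gauge_action G A s t a = a} \<rparr>"

text \<open>
  A state of a unital C*-algebra is a positive linear functional of value 1 at the unit. The
  functional is required to be extensional so that it is determined by its values on the algebra.
\<close>

definition tracial_state :: "('a, 'm) star_algebra_scheme \<Rightarrow> ('a \<Rightarrow> complex) \<Rightarrow> bool" where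
  "tracial_state A \<tau> \<longleftrightarrow>
     \<tau> \<in> extensional (carrier A) \<and>
     (\<forall>a\<in>carrier A. \<forall>b\<in>carrier A. \<tau> (a \<oplus>\<^bsub>A\<^esub> b) = \<tau> a + \<tau> b) \<and>
     (\<forall>c. \<forall>a\<in>carrier A. \<tau> (scal A c a) = c * \<tau> a) \<and>
     (\<forall>a\<in>carrier A. \<tau> (adj A a \<otimes>\<^bsub>A\<^esub> a) \<in> \<real> \<and> 0 \<le> Re (\<tau> (adj A a \<otimes>\<^bsub>A\<^esub> a))) \<and>
     \<tau> \<one>\<^bsub>A\<^esub> = 1 \<and>
     (\<forall>a\<in>carrier A. \<forall>b\<in>carrier A. \<tau> (a \<otimes>\<^bsub>A\<^esub> b) = \<tau> (b \<otimes>\<^bsub>A\<^esub> a))"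

end

theory Submission
  imports Defs "HOL-Library.Function_Algebras"
begin

text \<open>
  Write \<open>k\<close> for the size of the alphabet, \<open>S\<^sub>u\<close> for the product of the isometries of the letters of a
  word \<open>u\<close>, and let the degree of a word in the generators and their adjoints be the number of its
  isometries minus the number of its adjoint isometries. The gauge action multiplies a word of degree
  \<open>d\<close> by \<open>cis (t d)\<close>, so the polynomials of degree zero are dense in the gauge invariant subalgebra:
  averaging over the circle, which on a polynomial is a finite mean over roots of unity, projects
  onto degree zero without increasing the norm.

  The value of a tracial state \<open>T\<close> on polynomials of degree zero is forced. The projections
  \<open>S\<^sub>u S\<^sub>u\<^sup>*\<close> with \<open>u\<close> of length \<open>n\<close> sum to \<open>1\<close> and are equivalent in degree zero, so \<open>T\<close> takes the value
  \<open>1/k\<^sup>n\<close> on each of them (\<open>T_projection\<close>). A word \<open>W\<close> of degree zero satisfies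
  \<open>W S\<^sub>u = S\<^sub>v g\<close> with \<open>v\<close> of the same length as \<open>u\<close>, or \<open>W S\<^sub>u = 0\<close>, as soon as \<open>u\<close> is at least as long as
  \<open>W\<close> (\<open>run_realize\<close>). Hence \<open>W\<close> is the sum of elements \<open>S\<^sub>v g S\<^sub>u\<^sup>*\<close>. On these \<open>T\<close> vanishes if \<open>v\<close> differs
  from \<open>u\<close>, equals \<open>1/k\<^sup>n\<close> if \<open>v = u\<close> and \<open>g = 1\<close>, and is at most \<open>1/k\<^sup>n\<close> in absolute value if
  \<open>v = u\<close> and \<open>g\<close> is not \<open>1\<close>. So \<open>T W\<close> is the proportion of the words \<open>u\<close> that \<open>W\<close> fixes with \<open>g = 1\<close>, up to
  the proportion of the undecided words, those fixed with \<open>g\<close> different from \<open>1\<close> (\<open>T_word\<close>). The cylinders of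
  the words of length \<open>n\<close> that are fixed by \<open>g\<close> with nontrivial section decrease, as \<open>n\<close> grows, to a set
  of points that are not \<open>g\<close>-generic, which is a null set by hypothesis. Therefore the proportion of
  undecided words tends to \<open>0\<close> (\<open>undecided_words_density\<close>), and \<open>T W\<close> is the limit \<open>word_trace W\<close> of the
  proportion of fixed words, whatever \<open>T\<close> is.

  The same count gives existence. In the representation on the orbit of a point \<open>w\<close> the mean
  of the vector states at the basis vectors \<open>u w\<close> with \<open>u\<close> of length \<open>n\<close> differs on \<open>W\<close> from the proportion of
  fixed words by at most the proportion of undecided words. So its limit is \<open>word_trace\<close>, which is
  therefore positive and bounded by the norm of the orbit representation (\<open>trace_bound\<close>,
  \<open>trace_positive\<close>). It is a trace because \<open>V W\<close> and \<open>W V\<close> have equally many fixed words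
  (\<open>word_trace_commute\<close>).

  Both algebras are completions of the free algebra of words. The locale \<open>dense_model\<close> collects
  what is common to them and proves existence and uniqueness once (\<open>unique_trace\<close>). Passing from
  polynomials to the completion needs the continuity of a tracial state, which follows from positivity,
  because \<open>1 - h\<close> is a square when \<open>h\<close> is self-adjoint and small. For the full algebra the norm is the universal
  seminorm, which is gauge invariant because the relations are homogeneous for the degree. For the orbit
  algebra the gauge action is implemented by diagonal unitaries: the point \<open>u\<^sub>1 g(z)\<close> of the
  orbit of \<open>u\<^sub>2 z\<close> gets the degree \<open>|u\<^sub>1| - |u\<^sub>2|\<close>, and strict genericity makes this number
  well defined (\<open>degree_unique\<close>).
\<close>

section \<open>The free star-algebra\<close>

text \<open>
  Elements of the free algebra, vectors and operators are all functions. Their sums and differences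
  are rewritten pointwise only where this is asked for.
\<close>

declare plus_fun_apply [simp del] zero_fun_apply [simp del] minus_apply [simp del]
  uminus_apply [simp del] times_fun_apply [simp del] one_fun_apply [simp del]

definition conv :: "'z free_elem \<Rightarrow> 'z free_elem \<Rightarrow> 'z free_elem" (infixl "\<diamondop>" 70) where
  "f \<diamondop> g = (\<lambda>w. \<Sum>k\<le>length w. f (take k w) * g (drop k w))"

definition scale :: "complex \<Rightarrow> ('i \<Rightarrow> complex) \<Rightarrow> ('i \<Rightarrow> complex)" (infixr "\<bullet>\<^sub>c" 75) where
  "c \<bullet>\<^sub>c f = (\<lambda>i. c * f i)"

definition flip :: "('z \<times> bool) list \<Rightarrow> ('z \<times> bool) list" where
  "flip w = rev (map (apsnd Not) w)"

definition star :: "'z free_elem \<Rightarrow> 'z free_elem" where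
  "star f = (\<lambda>w. cnj (f (flip w)))"

definition word :: "('z \<times> bool) list \<Rightarrow> 'z free_elem" where
  "word w = (\<lambda>v. if v = w then 1 else 0)"

definition fcar :: "'z set \<Rightarrow> 'z free_elem set" where
  "fcar Z = {f. finite {w. f w \<noteq> 0} \<and> (\<forall>w. f w \<noteq> 0 \<longrightarrow> fst ` set w \<subseteq> Z)}"

lemma scale_apply: "(c \<bullet>\<^sub>c f) i = c * f i"
  by (simp add: scale_def)

lemmas fun_simps = fun_eq_iff scale_apply plus_fun_apply zero_fun_apply minus_apply uminus_apply

lemma free_star_algebra_simps [simp]:
  "carrier (free_star_algebra Z) = fcar Z"
  "mult (free_star_algebra Z) = conv"
  "one (free_star_algebra Z) = word []"
  "zero (free_star_algebra Z) = 0"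
  "add (free_star_algebra Z) = (+)"
  "scal (free_star_algebra Z) = scale"
  "adj (free_star_algebra Z) = star"
  by (auto simp: free_star_algebra_def fcar_def conv_def[abs_def] word_def plus_fun_def zero_fun_def fun_eq_iff
      star_def flip_def scale_def)

lemma diff_free [simp]: "diff (free_star_algebra Z) f g = f - g"
  by (simp add: diff_def fun_simps)

lemma free_gen_word: "free_gen z = word [(z, False)]"
  by (simp add: free_gen_def word_def)

lemma conv_Nil: "(f \<diamondop> g) [] = f [] * g []"
  by (simp add: conv_def)

text \<open>Splitting off the first letter makes the product accessible to induction on words.\<close>

lemma conv_Cons: "(f \<diamondop> g) (a # w) = f [] * g (a # w) + ((\<lambda>v. f (a # v)) \<diamondop> g) w"
  by (simp add: conv_def sum.atMost_Suc_shift del: sum.atMost_Suc)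

lemma conv_add_left: "(f + g) \<diamondop> h = f \<diamondop> h + g \<diamondop> h"
  by (simp add: conv_def fun_simps distrib_right sum.distrib)

lemma conv_add_right: "h \<diamondop> (f + g) = h \<diamondop> f + h \<diamondop> g"
  by (simp add: conv_def fun_simps distrib_left sum.distrib)

lemma conv_diff_left: "(f - g) \<diamondop> h = f \<diamondop> h - g \<diamondop> h"
  by (simp add: conv_def fun_simps left_diff_distrib sum_subtractf)

lemma conv_diff_right: "h \<diamondop> (f - g) = h \<diamondop> f - h \<diamondop> g"
  by (simp add: conv_def fun_simps right_diff_distrib sum_subtractf)

lemma conv_zero [simp]: "0 \<diamondop> g = 0" "g \<diamondop> 0 = 0"
  by (simp_all add: conv_def fun_simps)

lemma conv_scale_left: "(c \<bullet>\<^sub>c f) \<diamondop> g = c \<bullet>\<^sub>c (f \<diamondop> g)"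
  by (simp add: conv_def fun_simps sum_distrib_left mult.assoc)

lemma conv_scale_right: "f \<diamondop> (c \<bullet>\<^sub>c g) = c \<bullet>\<^sub>c (f \<diamondop> g)"
  by (simp add: conv_def fun_simps sum_distrib_left mult.left_commute)

lemma conv_assoc: "(f \<diamondop> g) \<diamondop> h = f \<diamondop> (g \<diamondop> h)"
proof
  fix w show "((f \<diamondop> g) \<diamondop> h) w = (f \<diamondop> (g \<diamondop> h)) w"
  proof (induction w arbitrary: f g)
    case Nil
    show ?case by (simp add: conv_Nil)
  next
    case (Cons a w)
    have "(\<lambda>v. (f \<diamondop> g) (a # v)) = f [] \<bullet>\<^sub>c (\<lambda>v. g (a # v)) + (\<lambda>v. f (a # v)) \<diamondop> g"
      by (simp add: fun_simps conv_Cons)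
    then show ?case
      by (simp add: conv_Cons conv_Nil conv_add_left conv_scale_left Cons.IH algebra_simps
          scale_apply plus_fun_apply)
  qed
qed

lemma word_conv_word: "word u \<diamondop> word v = word (u @ v)"
proof (induction u)
  case Nil
  have "(word [] \<diamondop> word v) w = (word v :: 'a free_elem) w" for w
  proof (cases w)
    case (Cons a w')
    have "(\<lambda>v. word [] (a # v)) = (0 :: 'a free_elem)"
      by (simp add: word_def fun_simps)
    then show ?thesis using Cons by (simp add: conv_Cons word_def[of "[]"] zero_fun_apply)
  qed (simp add: conv_Nil word_def)
  then show ?case by auto
next
  case (Cons b u)
  have "(word (b # u) \<diamondop> word v) w = (word (b # u @ v) :: 'a free_elem) w" for w
  proof (cases w)
    case (Cons a w')
    have "(\<lambda>v. word (b # u) (a # v)) = (if a = b then word u else (0 :: 'a free_elem))"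
      by (simp add: word_def fun_simps)
    then show ?thesis using Cons Cons.IH by (simp add: conv_Cons) (simp add: word_def zero_fun_apply)
  qed (simp add: conv_Nil word_def)
  then show ?case by auto
qed

lemma word_Nil_left [simp]: "word [] \<diamondop> f = f"
proof
  fix w :: "('a \<times> bool) list" show "(word [] \<diamondop> f) w = f w"
  proof (cases w)
    case (Cons a w')
    have "(\<lambda>v. word [] (a # v)) = (0 :: 'a free_elem)"
      by (simp add: word_def fun_simps)
    then show ?thesis using Cons by (simp add: conv_Cons word_def[of "[]"] zero_fun_apply)
  qed (simp add: conv_Nil word_def)
qed

lemma flip_flip [simp]: "flip (flip w) = w"
  by (simp add: flip_def rev_map o_def apsnd_def map_prod_def case_prod_beta)

lemma flip_simps [simp]: "flip [] = []" "flip (a # w) = flip w @ [apsnd Not a]"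
  "flip (u @ v) = flip v @ flip u" "length (flip w) = length w"
  by (simp_all add: flip_def)

lemma flip_fst [simp]: "fst ` set (flip w) = fst ` set w"
  by (force simp: flip_def)

lemma star_star [simp]: "star (star f) = f"
  by (simp add: star_def)

lemma star_conv: "star (f \<diamondop> g) = star g \<diamondop> star f"
proof
  fix w :: "('a \<times> bool) list"
  have 1: "flip (take k w) = drop (length w - k) (flip w)"
          "flip (drop k w) = take (length w - k) (flip w)" for k
    by (simp_all add: flip_def take_map drop_map rev_map rev_take rev_drop)
  show "star (f \<diamondop> g) w = (star g \<diamondop> star f) w"
    unfolding star_def conv_def 1 flip_simps cnj_sum
    by (rule sum.reindex_bij_witness[of _ "\<lambda>k. length w - k" "\<lambda>k. length w - k"]) auto
qed

lemma star_add: "star (f + g) = star f + star g"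
  by (simp add: star_def fun_simps)

lemma star_diff: "star (f - g) = star f - star g"
  by (simp add: star_def fun_simps)

lemma star_scale: "star (c \<bullet>\<^sub>c f) = cnj c \<bullet>\<^sub>c star f"
  by (simp add: star_def fun_simps)

lemma star_zero [simp]: "star 0 = 0"
  by (simp add: star_def fun_simps)

lemma star_word: "star (word w) = word (flip w)"
  by (auto simp: star_def word_def fun_simps)

lemma word_Nil_right [simp]: "f \<diamondop> word [] = f"
proof -
  have "star (f \<diamondop> word []) = star f" by (simp add: star_conv star_word)
  then show ?thesis by (metis star_star)
qed

lemma fcar_zero [simp]: "0 \<in> fcar Z" by (simp add: fcar_def zero_fun_def)

lemma fcar_word [simp]: "word w \<in> fcar Z \<longleftrightarrow> fst ` set w \<subseteq> Z"
  by (auto simp: fcar_def word_def)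

lemma fcar_scale [simp]: "f \<in> fcar Z \<Longrightarrow> c \<bullet>\<^sub>c f \<in> fcar Z"
  by (auto simp: fcar_def scale_apply elim: finite_subset[rotated])

lemma fcar_add [simp]:
  assumes "f \<in> fcar Z" "g \<in> fcar Z" shows "f + g \<in> fcar Z"
proof -
  have sub: "{w. (f + g) w \<noteq> 0} \<subseteq> {w. f w \<noteq> 0} \<union> {w. g w \<noteq> 0}"
    by (auto simp: plus_fun_apply)
  have "finite {w. (f + g) w \<noteq> 0}"
    using assms by (intro finite_subset[OF sub]) (simp add: fcar_def)
  moreover have "fst ` set w \<subseteq> Z" if "(f + g) w \<noteq> 0" for w
    using sub that assms unfolding fcar_def by blast
  ultimately show ?thesis by (simp add: fcar_def)
qed

lemma fcar_diff [simp]: "f \<in> fcar Z \<Longrightarrow> g \<in> fcar Z \<Longrightarrow> f - g \<in> fcar Z"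
proof -
  assume "f \<in> fcar Z" "g \<in> fcar Z"
  then have "f + (-1) \<bullet>\<^sub>c g \<in> fcar Z" by (intro fcar_add fcar_scale)
  moreover have "f + (-1) \<bullet>\<^sub>c g = f - g" by (simp add: fun_simps)
  ultimately show ?thesis by simp
qed

lemma fcar_sum: "(\<And>i. i \<in> S \<Longrightarrow> f i \<in> fcar Z) \<Longrightarrow> sum f S \<in> fcar Z"
  by (induction S rule: infinite_finite_induct) auto

lemma sum_fun_apply: "(sum f S) x = (\<Sum>i\<in>S. f i x)"
  by (induction S rule: infinite_finite_induct) (auto simp: fun_simps)

text \<open>
  The free algebra is spanned by words, so a linear statement about it needs a proof only for
  words.
\<close>

lemma fcar_expand: "f \<in> fcar Z \<Longrightarrow> f = (\<Sum>w\<in>{w. f w \<noteq> 0}. f w \<bullet>\<^sub>c word w)"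
  by (auto simp: fcar_def fun_simps sum_fun_apply word_def if_distrib cong: if_cong)

lemma fcar_induct [consumes 1, case_names zero add word]:
  assumes "f \<in> fcar Z" and "Q 0"
    and add: "\<And>f g. f \<in> fcar Z \<Longrightarrow> g \<in> fcar Z \<Longrightarrow> Q f \<Longrightarrow> Q g \<Longrightarrow> Q (f + g)"
    and word: "\<And>c w. fst ` set w \<subseteq> Z \<Longrightarrow> Q (c \<bullet>\<^sub>c word w)"
  shows "Q f"
proof -
  have *: "(\<forall>w\<in>S. fst ` set w \<subseteq> Z) \<Longrightarrow> Q (\<Sum>w\<in>S. f w \<bullet>\<^sub>c word w)" if "finite S" for S
    using that
  proof (induction S rule: finite_induct)
    case (insert x F)
    then have "Q (f x \<bullet>\<^sub>c word x + (\<Sum>w\<in>F. f w \<bullet>\<^sub>c word w))"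
      by (intro add word fcar_sum fcar_scale) auto
    with insert show ?case by simp
  qed (simp add: assms)
  have "Q (\<Sum>w\<in>{w. f w \<noteq> 0}. f w \<bullet>\<^sub>c word w)"
    using assms(1) by (intro *) (auto simp: fcar_def)
  then show ?thesis using fcar_expand[OF assms(1)] by simp
qed

lemma fcar_conv [simp]:
  assumes "f \<in> fcar Z" "g \<in> fcar Z" shows "f \<diamondop> g \<in> fcar Z"
  using assms(1)
proof (induction rule: fcar_induct)
  case (word c u)
  from assms(2) show ?case
  proof (induction rule: fcar_induct)
    case (word d v)
    with \<open>fst ` set u \<subseteq> Z\<close> show ?case
      by (auto simp: conv_scale_left conv_scale_right word_conv_word image_Un intro!: fcar_scale)
  qed (auto simp: conv_add_right)
qed (auto simp: conv_add_left)

lemma fcar_star [simp]: "f \<in> fcar Z \<Longrightarrow> star f \<in> fcar Z"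
proof (induction rule: fcar_induct)
  case (word c w)
  then show ?case by (auto simp: star_scale star_word intro!: fcar_scale)
qed (auto simp: star_add)

lemma scale_scale [simp]: "a \<bullet>\<^sub>c b \<bullet>\<^sub>c f = (a * b) \<bullet>\<^sub>c f"
  and scale_add_right: "a \<bullet>\<^sub>c (f + g) = a \<bullet>\<^sub>c f + a \<bullet>\<^sub>c g"
  and scale_diff_right: "a \<bullet>\<^sub>c (f - g) = a \<bullet>\<^sub>c f - a \<bullet>\<^sub>c g"
  and scale_one [simp]: "1 \<bullet>\<^sub>c f = f"
  and scale_zero_left [simp]: "0 \<bullet>\<^sub>c f = 0"
  and scale_zero_right [simp]: "a \<bullet>\<^sub>c 0 = 0"
  by (simp_all add: fun_simps algebra_simps)

lemma scale_minus: "(- 1) \<bullet>\<^sub>c f = - f"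
  by (simp add: fun_simps)

lemma abelian_monoid_free: "abelian_monoid (free_star_algebra Z)"
  by (rule abelian_monoidI) (auto simp: add.assoc add.commute)

lemma finsum_free:
  assumes "finite S" "\<And>i. i \<in> S \<Longrightarrow> f i \<in> fcar Z"
  shows "finsum (free_star_algebra Z) f S = sum f S"
proof -
  interpret abelian_monoid "free_star_algebra Z" by (rule abelian_monoid_free)
  from assms show ?thesis
  proof (induction S rule: finite_induct)
    case (insert x F)
    then have "finsum (free_star_algebra Z) f (insert x F) = f x + finsum (free_star_algebra Z) f F"
      by (subst finsum_insert) auto
    with insert show ?case by simp
  qed simp
qed

section \<open>C*-seminorms on the free star-algebra\<close>

locale cstar_seminormed =
  fixes Z :: "'z set" and p :: "'z free_elem \<Rightarrow> real"
  assumes cstar: "cstar_seminorm (free_star_algebra Z) p"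
begin

lemma nonneg: "a \<in> fcar Z \<Longrightarrow> 0 \<le> p a"
  and triangle: "a \<in> fcar Z \<Longrightarrow> b \<in> fcar Z \<Longrightarrow> p (a + b) \<le> p a + p b"
  and scale: "a \<in> fcar Z \<Longrightarrow> p (c \<bullet>\<^sub>c a) = cmod c * p a"
  and submult: "a \<in> fcar Z \<Longrightarrow> b \<in> fcar Z \<Longrightarrow> p (a \<diamondop> b) \<le> p a * p b"
  and star_square: "a \<in> fcar Z \<Longrightarrow> p (star a \<diamondop> a) = (p a)\<^sup>2"
  using cstar by (auto simp: cstar_seminorm_def)

lemma zero [simp]: "p 0 = 0"
  using scale[of 0 0] by simp

lemma minus: "a \<in> fcar Z \<Longrightarrow> p (- a) = p a"
  using scale[of a "- 1"] by (simp add: scale_minus)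

lemma diff_commute: "a \<in> fcar Z \<Longrightarrow> b \<in> fcar Z \<Longrightarrow> p (a - b) = p (b - a)"
  using minus[of "a - b"] by simp

lemma diff_triangle:
  "a \<in> fcar Z \<Longrightarrow> b \<in> fcar Z \<Longrightarrow> c \<in> fcar Z \<Longrightarrow> p (a - c) \<le> p (a - b) + p (b - c)"
  using triangle[of "a - b" "b - c"] by simp

lemma le_diff: "a \<in> fcar Z \<Longrightarrow> b \<in> fcar Z \<Longrightarrow> p a \<le> p b + p (a - b)"
  using triangle[of "b" "a - b"] by simp

lemma abs_diff_le: "a \<in> fcar Z \<Longrightarrow> b \<in> fcar Z \<Longrightarrow> \<bar>p a - p b\<bar> \<le> p (a - b)"
  using le_diff[of a b] le_diff[of b a] diff_commute[of a b] by linarith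

text \<open>The \<open>C\<^sup>*\<close>-identity and submultiplicativity give \<open>p(a)\<^sup>2 \<le> p(a\<^sup>*) p(a)\<close>.\<close>

lemma star_le: assumes "a \<in> fcar Z" shows "p a \<le> p (star a)"
proof (cases "p a = 0")
  case False
  have "(p a)\<^sup>2 \<le> p (star a) * p a"
    using submult[of "star a" a] star_square[OF assms] assms by simp
  then show ?thesis using False nonneg[OF assms] by (simp add: power2_eq_square)
qed (use assms nonneg in auto)

lemma star: "a \<in> fcar Z \<Longrightarrow> p (star a) = p a"
  using star_le[of a] star_le[of "star a"] by simp

lemma sum: "(\<And>i. i \<in> S \<Longrightarrow> f i \<in> fcar Z) \<Longrightarrow> p (\<Sum>i\<in>S. f i) \<le> (\<Sum>i\<in>S. p (f i))"
proof (induction S rule: infinite_finite_induct)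
  case (insert x F)
  then have "p (\<Sum>i\<in>insert x F. f i) \<le> p (f x) + p (\<Sum>i\<in>F. f i)"
    by (simp add: triangle fcar_sum)
  with insert show ?case by (fastforce simp: )
qed auto

lemma conv_diff_le:
  assumes "a \<in> fcar Z" "b \<in> fcar Z" "c \<in> fcar Z" "d \<in> fcar Z"
  shows "p (a \<diamondop> b - c \<diamondop> d) \<le> p a * p (b - d) + p (a - c) * p d"
proof -
  have "p (a \<diamondop> b - c \<diamondop> d) = p (a \<diamondop> (b - d) + (a - c) \<diamondop> d)"
    by (simp add: conv_diff_left conv_diff_right)
  also have "\<dots> \<le> p (a \<diamondop> (b - d)) + p ((a - c) \<diamondop> d)"
    using assms by (intro triangle) auto
  also have "\<dots> \<le> p a * p (b - d) + p (a - c) * p d"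
    using assms by (intro add_mono submult) auto
  finally show ?thesis .
qed

section \<open>Cauchy sequences and the completion\<close>

definition CS :: "(nat \<Rightarrow> 'z free_elem) set" where
  "CS = {\<xi>. (\<forall>n. \<xi> n \<in> fcar Z) \<and> (\<forall>\<epsilon>>0. \<exists>N. \<forall>m\<ge>N. \<forall>n\<ge>N. p (\<xi> m - \<xi> n) < \<epsilon>)}"

lemma cauchy_seqs_CS: "cauchy_seqs (free_star_algebra Z) p = CS"
  by (simp add: cauchy_seqs_def CS_def)

lemma CS_fcar: "\<xi> \<in> CS \<Longrightarrow> \<xi> n \<in> fcar Z"
  by (simp add: CS_def)

lemma CS_ev: "\<xi> \<in> CS \<Longrightarrow> \<epsilon> > 0 \<Longrightarrow> \<exists>N. \<forall>m\<ge>N. \<forall>n\<ge>N. p (\<xi> m - \<xi> n) < \<epsilon>"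
  by (simp add: CS_def)

lemma CS_const: "(\<lambda>n. a) \<in> CS \<longleftrightarrow> a \<in> fcar Z"
  by (auto simp: CS_def)

lemma CS_convergent:
  fixes r :: "nat \<Rightarrow> real"
  assumes "\<xi> \<in> CS" and "\<And>m n. \<bar>r m - r n\<bar> \<le> p (\<xi> m - \<xi> n)"
  shows "convergent r"
proof (rule Cauchy_convergent, rule metric_CauchyI)
  fix e :: real assume "e > 0"
  then show "\<exists>M. \<forall>m\<ge>M. \<forall>n\<ge>M. dist (r m) (r n) < e"
    using CS_ev[OF assms(1)] assms(2) unfolding dist_real_def by (meson order_le_less_trans)
qed

lemma CS_norm_convergent: "\<xi> \<in> CS \<Longrightarrow> convergent (\<lambda>n. p (\<xi> n))"
  by (rule CS_convergent) (auto intro: abs_diff_le CS_fcar)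

lemma CS_bounded:
  assumes "\<xi> \<in> CS" obtains K where "K > 0" "\<And>n. p (\<xi> n) \<le> K"
proof -
  have "Bseq (\<lambda>n. p (\<xi> n))" using CS_norm_convergent[OF assms] by (rule convergent_imp_Bseq)
  then obtain K where "K > 0" "\<And>n. norm (p (\<xi> n)) \<le> K" by (auto simp: Bseq_def)
  then show ?thesis by (intro that[of K]) (auto simp: abs_le_iff)
qed

text \<open>
  The operations on the completion come from Lipschitz maps of the free algebra, applied to the
  terms of a Cauchy sequence.
\<close>

lemma CS_Lipschitz:
  assumes "\<xi> \<in> CS" and "\<And>a. a \<in> fcar Z \<Longrightarrow> T a \<in> fcar Z"
    and "\<And>a b. a \<in> fcar Z \<Longrightarrow> b \<in> fcar Z \<Longrightarrow> p (T a - T b) \<le> K * p (a - b)"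
  shows "(\<lambda>n. T (\<xi> n)) \<in> CS"
  unfolding CS_def
proof (safe)
  fix \<epsilon> :: real assume "\<epsilon> > 0"
  let ?K = "max K 1"
  obtain N where N: "\<forall>m\<ge>N. \<forall>n\<ge>N. p (\<xi> m - \<xi> n) < \<epsilon> / ?K"
    using CS_ev[OF assms(1), of "\<epsilon> / ?K"] \<open>\<epsilon> > 0\<close> by auto
  have "p (T (\<xi> m) - T (\<xi> n)) < \<epsilon>" if "m \<ge> N" "n \<ge> N" for m n
  proof -
    have "p (T (\<xi> m) - T (\<xi> n)) \<le> K * p (\<xi> m - \<xi> n)"
      by (intro assms(3) CS_fcar assms(1))
    also have "\<dots> \<le> ?K * p (\<xi> m - \<xi> n)"
      by (intro mult_right_mono nonneg fcar_diff CS_fcar assms(1)) auto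
    also have "\<dots> < \<epsilon>" using N that by (simp add: field_simps)
    finally show ?thesis .
  qed
  then show "\<exists>N. \<forall>m\<ge>N. \<forall>n\<ge>N. p (T (\<xi> m) - T (\<xi> n)) < \<epsilon>" by blast
qed (intro assms(2) CS_fcar assms(1))

lemma CS_scale: "\<xi> \<in> CS \<Longrightarrow> (\<lambda>n. c \<bullet>\<^sub>c \<xi> n) \<in> CS"
  by (rule CS_Lipschitz[where K = "cmod c"]) (auto simp flip: scale_diff_right simp: scale)

lemma CS_star: "\<xi> \<in> CS \<Longrightarrow> (\<lambda>n. star (\<xi> n)) \<in> CS"
  by (rule CS_Lipschitz[where K = 1]) (auto simp flip: star_diff simp: star)

lemma CS_add:
  assumes "\<xi> \<in> CS" "\<eta> \<in> CS" shows "(\<lambda>n. \<xi> n + \<eta> n) \<in> CS"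
  unfolding CS_def
proof (safe)
  fix \<epsilon> :: real assume "\<epsilon> > 0"
  then obtain N M where N: "\<forall>m\<ge>N. \<forall>n\<ge>N. p (\<xi> m - \<xi> n) < \<epsilon> / 2"
    and M: "\<forall>m\<ge>M. \<forall>n\<ge>M. p (\<eta> m - \<eta> n) < \<epsilon> / 2"
    using CS_ev[OF assms(1), of "\<epsilon>/2"] CS_ev[OF assms(2), of "\<epsilon>/2"] by auto
  have "p (\<xi> m + \<eta> m - (\<xi> n + \<eta> n)) < \<epsilon>" if "m \<ge> max N M" "n \<ge> max N M" for m n
  proof -
    have "p (\<xi> m + \<eta> m - (\<xi> n + \<eta> n)) = p ((\<xi> m - \<xi> n) + (\<eta> m - \<eta> n))"
      by (simp add: algebra_simps)
    also have "\<dots> \<le> p (\<xi> m - \<xi> n) + p (\<eta> m - \<eta> n)"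
      by (intro triangle fcar_diff CS_fcar assms)
    also have "\<dots> < \<epsilon>" using N[rule_format, of m n] M[rule_format, of m n] that by simp
    finally show ?thesis .
  qed
  then show "\<exists>N. \<forall>m\<ge>N. \<forall>n\<ge>N. p (\<xi> m + \<eta> m - (\<xi> n + \<eta> n)) < \<epsilon>" by blast
qed (auto intro!: fcar_add CS_fcar[OF assms(1)] CS_fcar[OF assms(2)])

lemma CS_diff: "\<xi> \<in> CS \<Longrightarrow> \<eta> \<in> CS \<Longrightarrow> (\<lambda>n. \<xi> n - \<eta> n) \<in> CS"
  using CS_add[of \<xi> "\<lambda>n. (-1) \<bullet>\<^sub>c \<eta> n"] CS_scale[of \<eta> "-1"] by (simp add: scale_minus)

lemma CS_conv:
  assumes "\<xi> \<in> CS" "\<eta> \<in> CS" shows "(\<lambda>n. \<xi> n \<diamondop> \<eta> n) \<in> CS"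
  unfolding CS_def
proof (safe)
  fix \<epsilon> :: real assume "\<epsilon> > 0"
  obtain K where K: "K > 0" "\<And>n. p (\<xi> n) \<le> K" using CS_bounded[OF assms(1)] by blast
  obtain L where L: "L > 0" "\<And>n. p (\<eta> n) \<le> L" using CS_bounded[OF assms(2)] by blast
  obtain N M where N: "\<forall>m\<ge>N. \<forall>n\<ge>N. p (\<xi> m - \<xi> n) < \<epsilon> / (2 * L)"
    and M: "\<forall>m\<ge>M. \<forall>n\<ge>M. p (\<eta> m - \<eta> n) < \<epsilon> / (2 * K)"
    using CS_ev[OF assms(1), of "\<epsilon>/(2*L)"] CS_ev[OF assms(2), of "\<epsilon>/(2*K)"] K L \<open>\<epsilon> > 0\<close> by auto
  have "p (\<xi> m \<diamondop> \<eta> m - \<xi> n \<diamondop> \<eta> n) < \<epsilon>" if "m \<ge> max N M" "n \<ge> max N M" for m n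
  proof -
    have "p (\<xi> m \<diamondop> \<eta> m - \<xi> n \<diamondop> \<eta> n) \<le> p (\<xi> m) * p (\<eta> m - \<eta> n) + p (\<xi> m - \<xi> n) * p (\<eta> n)"
      by (intro conv_diff_le CS_fcar assms)
    also have "\<dots> \<le> K * p (\<eta> m - \<eta> n) + p (\<xi> m - \<xi> n) * L"
      using K L by (intro add_mono mult_mono nonneg fcar_diff CS_fcar assms order_refl) auto
    also have "\<dots> < K * (\<epsilon> / (2 * K)) + \<epsilon> / (2 * L) * L"
      using N[rule_format, of m n] M[rule_format, of m n] that K L
      by (intro add_strict_mono mult_strict_left_mono mult_strict_right_mono) auto
    also have "\<dots> = \<epsilon>" using K L by (simp add: field_simps)
    finally show ?thesis .
  qed
  then show "\<exists>N. \<forall>m\<ge>N. \<forall>n\<ge>N. p (\<xi> m \<diamondop> \<eta> m - \<xi> n \<diamondop> \<eta> n) < \<epsilon>"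
    by (intro exI[of _ "max N M"] allI impI)
qed (auto intro!: fcar_add fcar_conv CS_fcar[OF assms(1)] CS_fcar[OF assms(2)])

abbreviation cls :: "(nat \<Rightarrow> 'z free_elem) \<Rightarrow> (nat \<Rightarrow> 'z free_elem) set" where
  "cls \<equiv> cauchy_class (free_star_algebra Z) p"

lemma null_rel_iff:
  "(\<xi>, \<eta>) \<in> null_rel (free_star_algebra Z) p \<longleftrightarrow>
     \<xi> \<in> CS \<and> \<eta> \<in> CS \<and> (\<lambda>n. p (\<xi> n - \<eta> n)) \<longlonglongrightarrow> 0"
  by (simp add: null_rel_def cauchy_seqs_CS)

lemma tendsto_zero_le:
  assumes "g \<longlonglongrightarrow> (0::real)" "\<And>n. 0 \<le> f n" "\<And>n. f n \<le> g n" shows "f \<longlonglongrightarrow> 0"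
  by (rule tendsto_sandwich[OF _ _ tendsto_const assms(1)]) (use assms in auto)

lemma equiv_null_rel: "equiv CS (null_rel (free_star_algebra Z) p)"
proof (rule equivI)
  show "null_rel (free_star_algebra Z) p \<subseteq> CS \<times> CS" by (auto simp: null_rel_iff)
  show "refl_on CS (null_rel (free_star_algebra Z) p)" by (auto simp: refl_on_def null_rel_iff)
  show "sym (null_rel (free_star_algebra Z) p)"
  proof (rule symI)
    fix x y assume 1: "(x, y) \<in> null_rel (free_star_algebra Z) p"
    then have "x \<in> CS" "y \<in> CS" by (simp_all add: null_rel_iff)
    then have "p (y n - x n) = p (x n - y n)" for n by (intro diff_commute CS_fcar)
    with 1 show "(y, x) \<in> null_rel (free_star_algebra Z) p" by (simp add: null_rel_iff)
  qed
  show "trans (null_rel (free_star_algebra Z) p)"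
  proof (rule transI)
    fix x y z assume 1: "(x, y) \<in> null_rel (free_star_algebra Z) p"
      "(y, z) \<in> null_rel (free_star_algebra Z) p"
    then have "(\<lambda>n. p (x n - y n) + p (y n - z n)) \<longlonglongrightarrow> 0 + 0"
      by (intro tendsto_add) (auto simp: null_rel_iff)
    then have "(\<lambda>n. p (x n - z n)) \<longlonglongrightarrow> 0"
      using 1 by (intro tendsto_zero_le[where f = "\<lambda>n. p (x n - z n)"])
         (auto simp: null_rel_iff intro!: nonneg diff_triangle fcar_diff intro: CS_fcar)
    with 1 show "(x, z) \<in> null_rel (free_star_algebra Z) p" by (auto simp: null_rel_iff)
  qed
qed

lemma cls_eq_iff: "\<xi> \<in> CS \<Longrightarrow> \<eta> \<in> CS \<Longrightarrow> cls \<xi> = cls \<eta> \<longleftrightarrow> (\<lambda>n. p (\<xi> n - \<eta> n)) \<longlonglongrightarrow> 0"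
  using eq_equiv_class_iff[OF equiv_null_rel] by (simp add: null_rel_iff)

lemma self_in_cls: "\<xi> \<in> CS \<Longrightarrow> \<xi> \<in> cls \<xi>"
  by (simp add: null_rel_iff)

text \<open>
  The operations of the completion are unions over all representatives of a class. When the value
  does not depend on the representative, the union is that value.
\<close>

lemma UN_cls:
  assumes "\<xi> \<in> CS"
    and "\<And>\<xi>'. \<xi>' \<in> CS \<Longrightarrow> (\<lambda>n. p (\<xi> n - \<xi>' n)) \<longlonglongrightarrow> 0 \<Longrightarrow> h \<xi>' = h \<xi>"
  shows "(\<Union>\<xi>'\<in>cls \<xi>. h \<xi>') = (h \<xi> :: 'c set)"
proof -
  show ?thesis
  proof (rule SUP_eq_const)
    show "cls \<xi> \<noteq> {}"
    proof
      assume "cls \<xi> = {}"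
      with self_in_cls[OF assms(1)] show False by (simp only: empty_iff)
    qed
    show "h \<xi>' = h \<xi>" if "\<xi>' \<in> cls \<xi>" for \<xi>'
      by (rule assms(2)) (use that in \<open>simp_all add: null_rel_iff\<close>)
  qed
qed

lemma completion_carrier: "carrier (completion (free_star_algebra Z) p) = cls ` CS"
  by (auto simp: completion_def cauchy_seqs_CS quotient_def)

lemma completion_one: "one (completion (free_star_algebra Z) p) = cls (\<lambda>n. word [])"
  by (simp add: completion_def)

lemma completion_scal:
  assumes "\<xi> \<in> CS"
  shows "scal (completion (free_star_algebra Z) p) c (cls \<xi>) = cls (\<lambda>n. c \<bullet>\<^sub>c \<xi> n)"
proof -
  have "(\<Union>\<xi>'\<in>cls \<xi>. cls (\<lambda>n. c \<bullet>\<^sub>c \<xi>' n)) = cls (\<lambda>n. c \<bullet>\<^sub>c \<xi> n)"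
  proof (rule UN_cls[OF assms])
    fix \<eta> assume \<eta>: "\<eta> \<in> CS" "(\<lambda>n. p (\<xi> n - \<eta> n)) \<longlonglongrightarrow> 0"
    then have "(\<lambda>n. cmod c * p (\<xi> n - \<eta> n)) \<longlonglongrightarrow> cmod c * 0" by (intro tendsto_intros)
    then have "cls (\<lambda>n. c \<bullet>\<^sub>c \<xi> n) = cls (\<lambda>n. c \<bullet>\<^sub>c \<eta> n)"
      using \<eta> assms by (subst cls_eq_iff) (auto simp: CS_scale scale CS_fcar[OF assms] CS_fcar[OF \<eta>(1)] simp flip: scale_diff_right)
    then show "cls (\<lambda>n. c \<bullet>\<^sub>c \<eta> n) = cls (\<lambda>n. c \<bullet>\<^sub>c \<xi> n)" ..
  qed
  then show ?thesis by (simp add: completion_def)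
qed

lemma completion_adj:
  assumes "\<xi> \<in> CS"
  shows "adj (completion (free_star_algebra Z) p) (cls \<xi>) = cls (\<lambda>n. star (\<xi> n))"
proof -
  have "(\<Union>\<xi>'\<in>cls \<xi>. cls (\<lambda>n. star (\<xi>' n))) = cls (\<lambda>n. star (\<xi> n))"
  proof (rule UN_cls[OF assms])
    fix \<eta> assume \<eta>: "\<eta> \<in> CS" "(\<lambda>n. p (\<xi> n - \<eta> n)) \<longlonglongrightarrow> 0"
    have "p (star (\<xi> n) - star (\<eta> n)) = p (\<xi> n - \<eta> n)" for n
      using \<eta> assms star[of "\<xi> n - \<eta> n"] by (simp add: star_diff CS_fcar[OF assms] CS_fcar[OF \<eta>(1)])
    then have "cls (\<lambda>n. star (\<xi> n)) = cls (\<lambda>n. star (\<eta> n))"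
      using \<eta> assms by (subst cls_eq_iff) (auto simp: CS_star)
    then show "cls (\<lambda>n. star (\<eta> n)) = cls (\<lambda>n. star (\<xi> n))" ..
  qed
  then show ?thesis by (simp add: completion_def)
qed

lemma completion_add:
  assumes "\<xi> \<in> CS" "\<eta> \<in> CS"
  shows "add (completion (free_star_algebra Z) p) (cls \<xi>) (cls \<eta>) = cls (\<lambda>n. \<xi> n + \<eta> n)"
proof -
  have *: "cls (\<lambda>n. a' n + b' n) = cls (\<lambda>n. a n + b n)"
    if h: "a \<in> CS" "b \<in> CS" "a' \<in> CS" "b' \<in> CS"
      "(\<lambda>n. p (a n - a' n)) \<longlonglongrightarrow> 0" "(\<lambda>n. p (b n - b' n)) \<longlonglongrightarrow> 0" for a b a' b'
  proof -
    have "(\<lambda>n. p (a n - a' n) + p (b n - b' n)) \<longlonglongrightarrow> 0 + 0"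
      using h by (intro tendsto_intros)
    then have lim: "(\<lambda>n. p (a n - a' n) + p (b n - b' n)) \<longlonglongrightarrow> 0" by simp
    have le: "p (a n + b n - (a' n + b' n)) \<le> p (a n - a' n) + p (b n - b' n)" for n
      using triangle[of "a n - a' n" "b n - b' n"] h(1-4)[THEN CS_fcar] by (simp add: algebra_simps)
    have "(\<lambda>n. p (a n + b n - (a' n + b' n))) \<longlonglongrightarrow> 0"
      by (rule tendsto_zero_le[OF lim _ le]) (intro nonneg fcar_diff fcar_add CS_fcar h)
    then have "cls (\<lambda>n. a n + b n) = cls (\<lambda>n. a' n + b' n)"
      using h by (subst cls_eq_iff) (auto simp: CS_add)
    then show ?thesis ..
  qed
  have "(\<Union>\<xi>'\<in>cls \<xi>. \<Union>\<eta>'\<in>cls \<eta>. cls (\<lambda>n. \<xi>' n + \<eta>' n)) = (\<Union>\<eta>'\<in>cls \<eta>. cls (\<lambda>n. \<xi> n + \<eta>' n))"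
  proof (rule UN_cls[OF assms(1)], rule SUP_cong[OF refl])
    fix \<xi>' x assume 1: "\<xi>' \<in> CS" "(\<lambda>n. p (\<xi> n - \<xi>' n)) \<longlonglongrightarrow> 0" and "x \<in> cls \<eta>"
    then have "x \<in> CS" by (simp add: null_rel_iff)
    then show "cls (\<lambda>n. \<xi>' n + x n) = cls (\<lambda>n. \<xi> n + x n)"
      by (intro *) (use assms 1 in simp_all)
  qed
  also have "\<dots> = cls (\<lambda>n. \<xi> n + \<eta> n)"
    by (rule UN_cls[OF assms(2)], rule *) (use assms in simp_all)
  finally show ?thesis by (simp add: completion_def)
qed

lemma completion_mult:
  assumes "\<xi> \<in> CS" "\<eta> \<in> CS"
  shows "mult (completion (free_star_algebra Z) p) (cls \<xi>) (cls \<eta>) = cls (\<lambda>n. \<xi> n \<diamondop> \<eta> n)"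
proof -
  have *: "cls (\<lambda>n. a' n \<diamondop> b' n) = cls (\<lambda>n. a n \<diamondop> b n)"
    if h: "a \<in> CS" "b \<in> CS" "a' \<in> CS" "b' \<in> CS"
      "(\<lambda>n. p (a n - a' n)) \<longlonglongrightarrow> 0" "(\<lambda>n. p (b n - b' n)) \<longlonglongrightarrow> 0" for a b a' b'
  proof -
    obtain K where K: "K > 0" "\<And>n. p (a n) \<le> K" using CS_bounded[OF h(1)] by blast
    obtain L where L: "L > 0" "\<And>n. p (b' n) \<le> L" using CS_bounded[OF h(4)] by blast
    have "(\<lambda>n. K * p (b n - b' n) + p (a n - a' n) * L) \<longlonglongrightarrow> K * 0 + 0 * L"
      using h by (intro tendsto_intros)
    then have lim: "(\<lambda>n. K * p (b n - b' n) + p (a n - a' n) * L) \<longlonglongrightarrow> 0" by simp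
    have le: "p (a n \<diamondop> b n - a' n \<diamondop> b' n) \<le> K * p (b n - b' n) + p (a n - a' n) * L" for n
    proof -
      have "p (a n \<diamondop> b n - a' n \<diamondop> b' n) \<le> p (a n) * p (b n - b' n) + p (a n - a' n) * p (b' n)"
        by (intro conv_diff_le CS_fcar h)
      also have "\<dots> \<le> K * p (b n - b' n) + p (a n - a' n) * L"
        using K L by (intro add_mono mult_mono nonneg fcar_diff CS_fcar h order_refl) auto
      finally show ?thesis .
    qed
    have "(\<lambda>n. p (a n \<diamondop> b n - a' n \<diamondop> b' n)) \<longlonglongrightarrow> 0"
      by (rule tendsto_zero_le[OF lim _ le]) (intro nonneg fcar_diff fcar_conv CS_fcar h)
    then have "cls (\<lambda>n. a n \<diamondop> b n) = cls (\<lambda>n. a' n \<diamondop> b' n)"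
      using h by (subst cls_eq_iff) (auto simp: CS_conv)
    then show ?thesis ..
  qed
  have "(\<Union>\<xi>'\<in>cls \<xi>. \<Union>\<eta>'\<in>cls \<eta>. cls (\<lambda>n. \<xi>' n \<diamondop> \<eta>' n)) = (\<Union>\<eta>'\<in>cls \<eta>. cls (\<lambda>n. \<xi> n \<diamondop> \<eta>' n))"
  proof (rule UN_cls[OF assms(1)], rule SUP_cong[OF refl])
    fix \<xi>' x assume 1: "\<xi>' \<in> CS" "(\<lambda>n. p (\<xi> n - \<xi>' n)) \<longlonglongrightarrow> 0" and "x \<in> cls \<eta>"
    then have "x \<in> CS" by (simp add: null_rel_iff)
    then show "cls (\<lambda>n. \<xi>' n \<diamondop> x n) = cls (\<lambda>n. \<xi> n \<diamondop> x n)"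
      by (intro *) (use assms 1 in simp_all)
  qed
  also have "\<dots> = cls (\<lambda>n. \<xi> n \<diamondop> \<eta> n)"
    by (rule UN_cls[OF assms(2)], rule *) (use assms in simp_all)
  finally show ?thesis by (simp add: completion_def)
qed

lemma completion_nrm:
  assumes "\<xi> \<in> CS"
  shows "(\<lambda>n. p (\<xi> n)) \<longlonglongrightarrow> nrm (completion (free_star_algebra Z) p) (cls \<xi>)"
proof -
  obtain r where r: "(\<lambda>n. p (\<xi> n)) \<longlonglongrightarrow> r"
    using CS_norm_convergent[OF assms] by (auto simp: convergent_def)
  have all: "(\<lambda>n. p (\<eta> n)) \<longlonglongrightarrow> r" if "\<eta> \<in> cls \<xi>" for \<eta>
  proof -
    have \<eta>: "\<eta> \<in> CS" "(\<lambda>n. p (\<xi> n - \<eta> n)) \<longlonglongrightarrow> 0" using that assms by (simp_all add: null_rel_iff)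
    have "(\<lambda>n. \<bar>p (\<xi> n) - p (\<eta> n)\<bar>) \<longlonglongrightarrow> 0"
      by (rule tendsto_zero_le[OF \<eta>(2)]) (auto intro!: abs_diff_le CS_fcar \<eta> assms)
    then have "(\<lambda>n. p (\<xi> n) - p (\<eta> n)) \<longlonglongrightarrow> 0" by (simp add: tendsto_rabs_zero_iff)
    from tendsto_diff[OF r this] show ?thesis by simp
  qed
  have "(THE r. \<forall>\<eta>\<in>cls \<xi>. (\<lambda>n. p (\<eta> n)) \<longlonglongrightarrow> r) = r"
  proof (rule the_equality)
    fix s assume "\<forall>\<eta>\<in>cls \<xi>. (\<lambda>n. p (\<eta> n)) \<longlonglongrightarrow> s"
    then have "(\<lambda>n. p (\<xi> n)) \<longlonglongrightarrow> s" using self_in_cls[OF assms] by blast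
    then show "s = r" using r by (rule LIMSEQ_unique)
  qed (use all in blast)
  then show ?thesis using r by (simp add: completion_def)
qed

end

section \<open>Square summable functions\<close>

context fixes I :: "'i set"
begin

abbreviation l2 :: "('i \<Rightarrow> complex) \<Rightarrow> 'i set \<Rightarrow> real" where
  "l2 f F \<equiv> L2_set (\<lambda>i. cmod (f i)) F"

lemma ell2_outside: "f \<in> ell2 I \<Longrightarrow> i \<notin> I \<Longrightarrow> f i = 0"
  by (simp add: ell2_def)

lemma ell2_norm_nonneg [simp]: "0 \<le> ell2_norm I f"
  by (simp add: ell2_norm_def infsum_nonneg)

lemma ell2_norm_square: "(ell2_norm I f)\<^sup>2 = (\<Sum>\<^sub>\<infinity>i\<in>I. (cmod (f i))\<^sup>2)"
  by (simp add: ell2_norm_def infsum_nonneg)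

lemma L2_le_ell2_norm:
  assumes "f \<in> ell2 I" "finite F" "F \<subseteq> I" shows "l2 f F \<le> ell2_norm I f"
  unfolding L2_set_def ell2_norm_def
  by (rule real_sqrt_le_mono, rule finite_sum_le_infsum) (use assms in \<open>auto simp: ell2_def\<close>)

text \<open>
  Membership in the Hilbert space and bounds for the norm can be tested on finite sets of
  coordinates.
\<close>

lemma ell2_bound:
  assumes "\<And>i. i \<notin> I \<Longrightarrow> f i = 0" and "\<And>F. finite F \<Longrightarrow> F \<subseteq> I \<Longrightarrow> l2 f F \<le> K"
  shows "f \<in> ell2 I" "ell2_norm I f \<le> K"
proof -
  have K: "0 \<le> K" using assms(2)[of "{}"] by simp
  have le: "(\<Sum>i\<in>F. (cmod (f i))\<^sup>2) \<le> K\<^sup>2" if "finite F" "F \<subseteq> I" for F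
  proof -
    have "sqrt (\<Sum>i\<in>F. (cmod (f i))\<^sup>2) \<le> K" using assms(2)[OF that] by (simp add: L2_set_def)
    then show ?thesis by (metis real_sqrt_le_iff real_sqrt_abs K abs_of_nonneg)
  qed
  have s: "(\<lambda>i. (cmod (f i))\<^sup>2) summable_on I"
    by (rule nonneg_bdd_above_summable_on) (use le in \<open>auto simp: bdd_above_def\<close>)
  then show "f \<in> ell2 I" using assms(1) by (simp add: ell2_def)
  have "(\<Sum>\<^sub>\<infinity>i\<in>I. (cmod (f i))\<^sup>2) \<le> K\<^sup>2"
    by (rule infsum_le_finite_sums[OF s]) (use le in auto)
  then show "ell2_norm I f \<le> K" unfolding ell2_norm_def using K real_le_lsqrt real_sqrt_le_iff
    by (metis real_sqrt_abs abs_of_nonneg)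
qed

lemma ell2_cmod_le: "f \<in> ell2 I \<Longrightarrow> cmod (f i) \<le> ell2_norm I f"
  using L2_le_ell2_norm[of f "{i}"] by (cases "i \<in> I") (auto simp: ell2_outside)

lemma ell2_zero [simp]: "0 \<in> ell2 I" "ell2_norm I 0 = 0"
  by (auto simp: ell2_def ell2_norm_def zero_fun_apply)

lemma ell2_norm_eq_0: "f \<in> ell2 I \<Longrightarrow> ell2_norm I f = 0 \<Longrightarrow> f = 0"
  using ell2_cmod_le[of f] by (auto simp: fun_simps)

lemma ell2_add:
  assumes "f \<in> ell2 I" "g \<in> ell2 I"
  shows "f + g \<in> ell2 I" "ell2_norm I (f + g) \<le> ell2_norm I f + ell2_norm I g"
proof -
  have "l2 (f + g) F \<le> ell2_norm I f + ell2_norm I g" if "finite F" "F \<subseteq> I" for F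
  proof -
    have "l2 (f + g) F \<le> L2_set (\<lambda>i. cmod (f i) + cmod (g i)) F"
      by (rule L2_set_mono) (auto simp: plus_fun_apply norm_triangle_ineq)
    also have "\<dots> \<le> l2 f F + l2 g F" by (rule L2_set_triangle_ineq)
    also have "\<dots> \<le> ell2_norm I f + ell2_norm I g"
      using that assms by (intro add_mono L2_le_ell2_norm)
    finally show ?thesis .
  qed
  then show "f + g \<in> ell2 I" "ell2_norm I (f + g) \<le> ell2_norm I f + ell2_norm I g"
    using assms by (auto intro!: ell2_bound simp: plus_fun_apply ell2_outside)
qed

lemma ell2_scale:
  assumes "f \<in> ell2 I"
  shows "c \<bullet>\<^sub>c f \<in> ell2 I" "ell2_norm I (c \<bullet>\<^sub>c f) = cmod c * ell2_norm I f"
proof -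
  show "c \<bullet>\<^sub>c f \<in> ell2 I" using assms
    by (auto simp: ell2_def scale_apply norm_mult power_mult_distrib intro: summable_on_cmult_right)
  show "ell2_norm I (c \<bullet>\<^sub>c f) = cmod c * ell2_norm I f"
    by (simp add: ell2_norm_def scale_apply norm_mult power_mult_distrib infsum_cmult_right'
        real_sqrt_mult)
qed

lemma ell2_diff:
  assumes "f \<in> ell2 I" "g \<in> ell2 I"
  shows "f - g \<in> ell2 I" "ell2_norm I (f - g) \<le> ell2_norm I f + ell2_norm I g"
  using ell2_add[OF assms(1) ell2_scale(1)[OF assms(2), of "-1"]] ell2_scale(2)[OF assms(2), of "-1"]
  by (simp_all add: scale_minus)

lemma ell2_sum: "(\<And>k. k \<in> S \<Longrightarrow> f k \<in> ell2 I) \<Longrightarrow> sum f S \<in> ell2 I"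
  by (induction S rule: infinite_finite_induct) (auto intro: ell2_add)

lemma inner_summable:
  assumes "f \<in> ell2 I" "g \<in> ell2 I"
  shows "(\<lambda>i. norm (cnj (f i) * g i)) summable_on I"
    and "(\<Sum>\<^sub>\<infinity>i\<in>I. norm (cnj (f i) * g i)) \<le> ell2_norm I f * ell2_norm I g"
proof -
  have le: "(\<Sum>i\<in>F. norm (cnj (f i) * g i)) \<le> ell2_norm I f * ell2_norm I g"
    if "finite F" "F \<subseteq> I" for F
  proof -
    have "(\<Sum>i\<in>F. norm (cnj (f i) * g i)) \<le> l2 f F * l2 g F"
      using L2_set_mult_ineq[of "\<lambda>i. cmod (f i)" "\<lambda>i. cmod (g i)" F] by (simp add: norm_mult)
    also have "\<dots> \<le> ell2_norm I f * ell2_norm I g"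
      using that assms by (intro mult_mono L2_le_ell2_norm) auto
    finally show ?thesis .
  qed
  show s: "(\<lambda>i. norm (cnj (f i) * g i)) summable_on I"
    by (rule nonneg_bdd_above_summable_on) (use le in \<open>auto simp: bdd_above_def\<close>)
  show "(\<Sum>\<^sub>\<infinity>i\<in>I. norm (cnj (f i) * g i)) \<le> ell2_norm I f * ell2_norm I g"
    by (rule infsum_le_finite_sums[OF s]) (use le in auto)
qed

lemma inner_summable':
  "f \<in> ell2 I \<Longrightarrow> g \<in> ell2 I \<Longrightarrow> (\<lambda>i. cnj (f i) * g i) summable_on I"
  by (rule abs_summable_summable, rule inner_summable)

lemma Cauchy_Schwarz:
  "f \<in> ell2 I \<Longrightarrow> g \<in> ell2 I \<Longrightarrow> cmod (ell2_inner I f g) \<le> ell2_norm I f * ell2_norm I g"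
  unfolding ell2_inner_def
  by (rule order_trans[OF norm_infsum_bound inner_summable(2)]) (rule inner_summable)

lemma inner_add_right:
  "f \<in> ell2 I \<Longrightarrow> g \<in> ell2 I \<Longrightarrow> h \<in> ell2 I \<Longrightarrow>
     ell2_inner I f (g + h) = ell2_inner I f g + ell2_inner I f h"
  by (simp add: ell2_inner_def plus_fun_apply distrib_left infsum_add inner_summable')

lemma inner_scale_right: "ell2_inner I f (c \<bullet>\<^sub>c g) = c * ell2_inner I f g"
  by (simp add: ell2_inner_def scale_apply mult.left_commute infsum_cmult_right')

lemma inner_commute: "ell2_inner I g f = cnj (ell2_inner I f g)"
  by (simp add: ell2_inner_def mult.commute flip: infsum_cnj)

lemma inner_add_left:
  "f \<in> ell2 I \<Longrightarrow> g \<in> ell2 I \<Longrightarrow> h \<in> ell2 I \<Longrightarrow>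
     ell2_inner I (g + h) f = ell2_inner I g f + ell2_inner I h f"
  using inner_add_right[of f g h] by (subst (1 2 3) inner_commute) simp

lemma inner_scale_left: "ell2_inner I (c \<bullet>\<^sub>c g) f = cnj c * ell2_inner I g f"
  using inner_scale_right[of f c g] by (subst (1 2) inner_commute) simp

lemma inner_diff_right:
  "f \<in> ell2 I \<Longrightarrow> g \<in> ell2 I \<Longrightarrow> h \<in> ell2 I \<Longrightarrow>
     ell2_inner I f (g - h) = ell2_inner I f g - ell2_inner I f h"
  using inner_add_right[of f "g - h" h] by (simp add: ell2_diff)

lemma inner_diff_left:
  "f \<in> ell2 I \<Longrightarrow> g \<in> ell2 I \<Longrightarrow> h \<in> ell2 I \<Longrightarrow>
     ell2_inner I (g - h) f = ell2_inner I g f - ell2_inner I h f"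
  using inner_add_left[of f "g - h" h] by (simp add: ell2_diff)

lemma inner_zero [simp]: "ell2_inner I f 0 = 0" "ell2_inner I 0 f = 0"
  by (simp_all add: ell2_inner_def zero_fun_apply)

lemma inner_sum_left:
  "g \<in> ell2 I \<Longrightarrow> (\<And>k. k \<in> S \<Longrightarrow> f k \<in> ell2 I) \<Longrightarrow>
     ell2_inner I (sum f S) g = (\<Sum>k\<in>S. ell2_inner I (f k) g)"
  by (induction S rule: infinite_finite_induct) (auto simp: inner_add_left ell2_sum)

lemma inner_self: "f \<in> ell2 I \<Longrightarrow> ell2_inner I f f = of_real ((ell2_norm I f)\<^sup>2)"
proof -
  assume "f \<in> ell2 I"
  then have "(\<lambda>i. (cmod (f i))\<^sup>2) summable_on I" by (simp add: ell2_def)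
  then have "((\<lambda>i. (cmod (f i))\<^sup>2) has_sum (ell2_norm I f)\<^sup>2) I"
    by (simp add: ell2_norm_square)
  then have "((\<lambda>i. complex_of_real ((cmod (f i))\<^sup>2)) has_sum of_real ((ell2_norm I f)\<^sup>2)) I"
    by (rule has_sum_of_real)
  then show ?thesis unfolding ell2_inner_def
    by (intro infsumI) (simp del: of_real_power add: mult.commute complex_norm_square)
qed

lemma inner_delta: "i \<in> I \<Longrightarrow> ell2_inner I (ell2_delta i) f = f i"
proof -
  assume "i \<in> I"
  then have "ell2_inner I (ell2_delta i) f = (\<Sum>\<^sub>\<infinity>j\<in>{i}. cnj (ell2_delta i j) * f j)"
    unfolding ell2_inner_def by (intro infsum_cong_neutral) (auto simp: ell2_delta_def)
  then show ?thesis by (simp add: ell2_delta_def)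
qed

lemma delta_norm: "i \<in> I \<Longrightarrow> ell2_norm I (ell2_delta i) = 1"
proof -
  assume i: "i \<in> I"
  have "of_real ((ell2_norm I (ell2_delta i))\<^sup>2) = (1 :: complex)"
    using inner_self[OF ell2_delta_in_ell2[OF i]] inner_delta[OF i, of "ell2_delta i"]
    by (simp add: ell2_delta_def)
  then have "(ell2_norm I (ell2_delta i))\<^sup>2 = 1" by (metis of_real_eq_1_iff)
  then show ?thesis using ell2_norm_nonneg[of "ell2_delta i"] by (simp add: power2_eq_1_iff)
qed

definition trunc :: "'i set \<Rightarrow> ('i \<Rightarrow> complex) \<Rightarrow> ('i \<Rightarrow> complex)" where
  "trunc F f = (\<lambda>i. if i \<in> F then f i else 0)"

lemma trunc_sum: "finite F \<Longrightarrow> trunc F f = (\<Sum>i\<in>F. f i \<bullet>\<^sub>c ell2_delta i)"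
  by (auto simp: trunc_def fun_eq_iff sum_fun_apply scale_apply ell2_delta_def if_distrib cong: if_cong)

lemma trunc_ell2: "finite F \<Longrightarrow> F \<subseteq> I \<Longrightarrow> trunc F f \<in> ell2 I"
  unfolding trunc_sum by (intro ell2_sum ell2_scale ell2_delta_in_ell2) auto

lemma trunc_norm: "finite F \<Longrightarrow> F \<subseteq> I \<Longrightarrow> ell2_norm I (trunc F f) = l2 f F"
proof -
  assume F: "finite F" "F \<subseteq> I"
  have "(\<Sum>\<^sub>\<infinity>i\<in>I. (cmod (trunc F f i))\<^sup>2) = (\<Sum>\<^sub>\<infinity>i\<in>F. (cmod (f i))\<^sup>2)"
    using F by (intro infsum_cong_neutral) (auto simp: trunc_def)
  then show ?thesis using F by (simp add: ell2_norm_def L2_set_def)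
qed

lemma trunc_dense:
  assumes "f \<in> ell2 I" "e > 0"
  obtains F where "finite F" "F \<subseteq> I" "ell2_norm I (f - trunc F f) < e"
proof -
  let ?s = "\<lambda>i. (cmod (f i))\<^sup>2"
  have s: "?s summable_on I" using assms by (simp add: ell2_def)
  have "(sum ?s \<longlongrightarrow> infsum ?s I) (finite_subsets_at_top I)" by (rule infsum_tendsto[OF s])
  then have "\<forall>\<^sub>F F in finite_subsets_at_top I. dist (sum ?s F) (infsum ?s I) < e\<^sup>2"
    using assms(2) by (intro tendstoD) auto
  then obtain F where F: "finite F" "F \<subseteq> I" "dist (sum ?s F) (infsum ?s I) < e\<^sup>2"
    unfolding eventually_finite_subsets_at_top by blast
  have "(\<Sum>\<^sub>\<infinity>i\<in>I. (cmod ((f - trunc F f) i))\<^sup>2) = infsum ?s (I - F)"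
    by (rule infsum_cong_neutral) (auto simp: trunc_def minus_apply)
  also have "\<dots> = infsum ?s I - infsum ?s F"
    by (rule infsum_Diff) (use F s in auto)
  also have "\<dots> < e\<^sup>2" using F by (simp add: dist_real_def)
  finally have "ell2_norm I (f - trunc F f) < sqrt (e\<^sup>2)"
    unfolding ell2_norm_def by (rule real_sqrt_less_mono)
  then show ?thesis using F that assms(2) by simp
qed

section \<open>Bounded operators\<close>

abbreviation "BO \<equiv> bounded_op_algebra I"
abbreviation "opn \<equiv> nrm (bounded_op_algebra I)"

lemma BO_simps:
  "carrier BO = bounded_ops I"
  "f \<in> ell2 I \<Longrightarrow> (S \<otimes>\<^bsub>BO\<^esub> T) f = S (T f)"
  "f \<in> ell2 I \<Longrightarrow> \<one>\<^bsub>BO\<^esub> f = f"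
  "f \<in> ell2 I \<Longrightarrow> \<zero>\<^bsub>BO\<^esub> f = 0"
  "f \<in> ell2 I \<Longrightarrow> (S \<oplus>\<^bsub>BO\<^esub> T) f = S f + T f"
  "f \<in> ell2 I \<Longrightarrow> scal BO c T f = c \<bullet>\<^sub>c T f"
  "f \<in> ell2 I \<Longrightarrow> diff BO S T f = S f - T f"
  by (auto simp: bounded_op_algebra_def compose_def fun_simps diff_def)

lemma op_in: "T \<in> bounded_ops I \<Longrightarrow> f \<in> ell2 I \<Longrightarrow> T f \<in> ell2 I"
  and op_ext: "T \<in> bounded_ops I \<Longrightarrow> T \<in> extensional (ell2 I)"
  by (auto simp: bounded_ops_def PiE_def)

lemma op_add: "T \<in> bounded_ops I \<Longrightarrow> f \<in> ell2 I \<Longrightarrow> g \<in> ell2 I \<Longrightarrow> T (f + g) = T f + T g"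
  by (simp add: bounded_ops_def plus_fun_def)

lemma op_scale: "T \<in> bounded_ops I \<Longrightarrow> f \<in> ell2 I \<Longrightarrow> T (c \<bullet>\<^sub>c f) = c \<bullet>\<^sub>c T f"
  by (simp add: bounded_ops_def scale_def)

lemma op_diff: "T \<in> bounded_ops I \<Longrightarrow> f \<in> ell2 I \<Longrightarrow> g \<in> ell2 I \<Longrightarrow> T (f - g) = T f - T g"
  using op_add[of T "f - g" g] by (simp add: ell2_diff)

lemma op_zero: "T \<in> bounded_ops I \<Longrightarrow> T 0 = 0"
  using op_scale[of T 0 0] by simp

lemma op_sum: "T \<in> bounded_ops I \<Longrightarrow> (\<And>k. k \<in> S \<Longrightarrow> f k \<in> ell2 I) \<Longrightarrow> T (sum f S) = (\<Sum>k\<in>S. T (f k))"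
  by (induction S rule: infinite_finite_induct) (auto simp: op_zero op_add ell2_sum)

lemma opI:
  assumes "T \<in> extensional (ell2 I)" "\<And>f. f \<in> ell2 I \<Longrightarrow> T f \<in> ell2 I"
    "\<And>f g. f \<in> ell2 I \<Longrightarrow> g \<in> ell2 I \<Longrightarrow> T (f + g) = T f + T g"
    "\<And>c f. f \<in> ell2 I \<Longrightarrow> T (c \<bullet>\<^sub>c f) = c \<bullet>\<^sub>c T f"
    "\<And>f. f \<in> ell2 I \<Longrightarrow> ell2_norm I (T f) \<le> K * ell2_norm I f"
  shows "T \<in> bounded_ops I"
proof -
  have "T \<in> ell2 I \<rightarrow>\<^sub>E ell2 I" using assms(1,2) by (auto simp: PiE_def)
  moreover have "\<forall>f\<in>ell2 I. \<forall>g\<in>ell2 I. T (\<lambda>i. f i + g i) = (\<lambda>i. T f i + T g i)"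
    using assms(3) by (simp add: plus_fun_def)
  moreover have "\<forall>c. \<forall>f\<in>ell2 I. T (\<lambda>i. c * f i) = (\<lambda>i. c * T f i)"
    using assms(4) by (simp add: scale_def)
  moreover have "\<exists>K. \<forall>f\<in>ell2 I. ell2_norm I (T f) \<le> K * ell2_norm I f"
    using assms(5) by (intro exI ballI)
  ultimately show ?thesis by (simp add: bounded_ops_def)
qed

lemma opn_def: "opn T = Sup {ell2_norm I (T f) | f. f \<in> ell2 I \<and> ell2_norm I f \<le> 1}"
  by (simp add: bounded_op_algebra_def)

lemma opn_bdd:
  assumes "T \<in> bounded_ops I"
  shows "bdd_above {ell2_norm I (T f) | f. f \<in> ell2 I \<and> ell2_norm I f \<le> 1}"
proof -
  obtain K where K: "\<And>f. f \<in> ell2 I \<Longrightarrow> ell2_norm I (T f) \<le> K * ell2_norm I f"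
    using assms unfolding bounded_ops_def by blast
  have "ell2_norm I (T f) \<le> max K 0" if "f \<in> ell2 I" "ell2_norm I f \<le> 1" for f
  proof -
    have "ell2_norm I (T f) \<le> K * ell2_norm I f" by (rule K[OF that(1)])
    also have "\<dots> \<le> max K 0 * 1" using that by (intro mult_mono) auto
    finally show ?thesis by simp
  qed
  then show ?thesis by (auto simp: bdd_above_def)
qed

lemma opn_le:
  assumes "T \<in> bounded_ops I" "f \<in> ell2 I"
  shows "ell2_norm I (T f) \<le> opn T * ell2_norm I f"
proof (cases "ell2_norm I f = 0")
  case True
  then have "f = 0" using assms ell2_norm_eq_0 by blast
  then show ?thesis using assms by (simp add: op_zero)
next
  case False
  then have pos: "ell2_norm I f > 0" using ell2_norm_nonneg[of f] by linarith
  let ?g = "of_real (1 / ell2_norm I f) \<bullet>\<^sub>c f"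
  have g: "?g \<in> ell2 I" "ell2_norm I ?g = 1"
    using assms pos by (auto simp: ell2_scale norm_divide)
  then have "ell2_norm I (T ?g) \<le> opn T"
    unfolding opn_def by (intro cSup_upper opn_bdd assms) (auto intro!: exI[of _ ?g])
  moreover have "ell2_norm I (T ?g) = ell2_norm I (T f) / ell2_norm I f"
    using assms pos by (simp add: op_scale[OF assms(1)] ell2_scale op_in[OF assms] norm_divide)
  ultimately have "ell2_norm I (T f) / ell2_norm I f \<le> opn T" by simp
  then show ?thesis using pos by (simp add: pos_divide_le_eq)
qed

lemma opn_nonneg: "T \<in> bounded_ops I \<Longrightarrow> 0 \<le> opn T"
  unfolding opn_def by (rule cSup_upper2[of "ell2_norm I (T 0)"]) (auto simp: opn_bdd intro!: exI[of _ 0])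

lemma opn_leI:
  assumes "K \<ge> 0" "\<And>f. f \<in> ell2 I \<Longrightarrow> ell2_norm I (T f) \<le> K * ell2_norm I f"
  shows "opn T \<le> K"
  unfolding opn_def
proof (rule cSup_least)
  show "{ell2_norm I (T f) |f. f \<in> ell2 I \<and> ell2_norm I f \<le> 1} \<noteq> {}"
    by (auto intro!: exI[of _ "0 :: 'i \<Rightarrow> complex"])
  fix x assume "x \<in> {ell2_norm I (T f) |f. f \<in> ell2 I \<and> ell2_norm I f \<le> 1}"
  then obtain f where f: "x = ell2_norm I (T f)" "f \<in> ell2 I" "ell2_norm I f \<le> 1" by blast
  have "x \<le> K * ell2_norm I f" using assms(2) f by simp
  also have "\<dots> \<le> K" using assms(1) f by (simp add: mult_left_le)
  finally show "x \<le> K" .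
qed

lemma op_eqI:
  "S \<in> bounded_ops I \<Longrightarrow> T \<in> bounded_ops I \<Longrightarrow> (\<And>f. f \<in> ell2 I \<Longrightarrow> S f = T f) \<Longrightarrow> S = T"
  by (rule extensionalityI[of _ "ell2 I"]) (auto intro: op_ext)

lemma BO_ext:
  "S \<otimes>\<^bsub>BO\<^esub> T \<in> extensional (ell2 I)" "\<one>\<^bsub>BO\<^esub> \<in> extensional (ell2 I)"
  "\<zero>\<^bsub>BO\<^esub> \<in> extensional (ell2 I)" "S \<oplus>\<^bsub>BO\<^esub> T \<in> extensional (ell2 I)"
  "scal BO c T \<in> extensional (ell2 I)"
  by (auto simp: bounded_op_algebra_def compose_def)

lemma op_one: "\<one>\<^bsub>BO\<^esub> \<in> bounded_ops I"
  by (rule opI[of _ 1]) (auto simp: BO_simps BO_ext ell2_add ell2_scale)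

lemma op_zero_in: "\<zero>\<^bsub>BO\<^esub> \<in> bounded_ops I"
  by (rule opI[of _ 0]) (auto simp: BO_simps BO_ext ell2_add ell2_scale)

lemma op_plus:
  assumes "S \<in> bounded_ops I" "T \<in> bounded_ops I"
  shows "S \<oplus>\<^bsub>BO\<^esub> T \<in> bounded_ops I" "opn (S \<oplus>\<^bsub>BO\<^esub> T) \<le> opn S + opn T"
proof -
  have b: "ell2_norm I ((S \<oplus>\<^bsub>BO\<^esub> T) f) \<le> (opn S + opn T) * ell2_norm I f" if "f \<in> ell2 I" for f
    using ell2_add(2)[OF op_in[OF assms(1) that] op_in[OF assms(2) that]]
      opn_le[OF assms(1) that] opn_le[OF assms(2) that] that
    by (simp add: BO_simps distrib_right)
  show "S \<oplus>\<^bsub>BO\<^esub> T \<in> bounded_ops I"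
    by (rule opI[OF _ _ _ _ b])
       (auto simp: BO_simps BO_ext ell2_add ell2_scale op_in[OF assms(1)] op_in[OF assms(2)]
          op_add[OF assms(1)] op_add[OF assms(2)] op_scale[OF assms(1)] op_scale[OF assms(2)]
          scale_add_right)
  show "opn (S \<oplus>\<^bsub>BO\<^esub> T) \<le> opn S + opn T"
    by (rule opn_leI[OF _ b]) (use assms opn_nonneg in auto)
qed

lemma op_scal:
  assumes "T \<in> bounded_ops I"
  shows "scal BO c T \<in> bounded_ops I" "opn (scal BO c T) = cmod c * opn T"
proof -
  have b: "ell2_norm I (scal BO c T f) \<le> (cmod c * opn T) * ell2_norm I f"
    if "f \<in> ell2 I" "T \<in> bounded_ops I" for f c T
    using opn_le[OF that(2,1)] op_in[OF that(2,1)] that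
    by (simp add: BO_simps ell2_scale mult.assoc mult_left_mono)
  show in_op: "scal BO c T \<in> bounded_ops I" for c
    by (rule opI[OF _ _ _ _ b])
       (use assms in \<open>auto simp: BO_simps BO_ext ell2_add ell2_scale op_in[OF assms] op_add[OF assms]
          op_scale[OF assms] scale_add_right mult.commute\<close>)
  have le: "opn (scal BO c T) \<le> cmod c * opn T" if "T \<in> bounded_ops I" for c T
    by (rule opn_leI[OF _ b]) (use that opn_nonneg in auto)
  show "opn (scal BO c T) = cmod c * opn T"
  proof (cases "c = 0")
    case True
    have "0 \<le> opn (scal BO c T)" by (rule opn_nonneg[OF in_op])
    with le[OF assms, of c] True show ?thesis by simp
  next
    case False
    have "scal BO (1 / c) (scal BO c T) = T"
      by (rule extensionalityI[of _ "ell2 I"])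
         (use assms False in_op in \<open>auto simp: BO_simps BO_ext op_ext\<close>)
    then have "opn T \<le> cmod (1 / c) * opn (scal BO c T)" using le[OF in_op] by metis
    then have "cmod c * opn T \<le> opn (scal BO c T)" using False by (simp add: norm_divide field_simps)
    with le[OF assms, of c] show ?thesis by simp
  qed
qed

lemma op_minus:
  assumes "S \<in> bounded_ops I" "T \<in> bounded_ops I"
  shows "diff BO S T \<in> bounded_ops I"
  unfolding diff_def by (intro op_plus op_scal assms)

lemma op_mult:
  assumes "S \<in> bounded_ops I" "T \<in> bounded_ops I"
  shows "S \<otimes>\<^bsub>BO\<^esub> T \<in> bounded_ops I" "opn (S \<otimes>\<^bsub>BO\<^esub> T) \<le> opn S * opn T"
proof -
  have b: "ell2_norm I ((S \<otimes>\<^bsub>BO\<^esub> T) f) \<le> (opn S * opn T) * ell2_norm I f" if "f \<in> ell2 I" for f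
  proof -
    have "ell2_norm I (S (T f)) \<le> opn S * ell2_norm I (T f)"
      by (intro opn_le op_in[OF assms(2)] assms that)
    also have "\<dots> \<le> opn S * (opn T * ell2_norm I f)"
      by (intro mult_left_mono opn_le opn_nonneg assms that)
    finally show ?thesis using that by (simp add: BO_simps mult.assoc)
  qed
  show "S \<otimes>\<^bsub>BO\<^esub> T \<in> bounded_ops I"
    by (rule opI[OF _ _ _ _ b])
       (auto simp: BO_simps BO_ext ell2_add ell2_scale op_in[OF assms(1)] op_in[OF assms(2)]
          op_add[OF assms(1)] op_add[OF assms(2)] op_scale[OF assms(1)] op_scale[OF assms(2)])
  show "opn (S \<otimes>\<^bsub>BO\<^esub> T) \<le> opn S * opn T"
    by (rule opn_leI[OF _ b]) (use assms opn_nonneg in auto)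
qed

text \<open>
  The adjoint is given by its coordinates: \<open>T' f\<close> has the coordinate \<open>\<langle>T \<delta>\<^sub>i, f\<rangle>\<close> at \<open>i\<close>. This
  avoids the representation theorem for functionals.
\<close>

lemma adjoint_exists:
  assumes T: "T \<in> bounded_ops I"
  obtains T' where "T' \<in> bounded_ops I" "opn T' \<le> opn T"
    "\<And>f g. f \<in> ell2 I \<Longrightarrow> g \<in> ell2 I \<Longrightarrow> ell2_inner I (T' f) g = ell2_inner I f (T g)"
proof -
  define T' where "T' = (\<lambda>f\<in>ell2 I. \<lambda>i. if i \<in> I then ell2_inner I (T (ell2_delta i)) f else 0)"
  have td: "T (ell2_delta i) \<in> ell2 I" if "i \<in> I" for i
    by (rule op_in[OF T ell2_delta_in_ell2[OF that]])
  have bound: "l2 (T' f) F \<le> opn T * ell2_norm I f" if f: "f \<in> ell2 I" and F: "finite F" "F \<subseteq> I" for f F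
  proof (cases "l2 (T' f) F = 0")
    case True
    then show ?thesis using opn_nonneg[OF T] by simp
  next
    case False
    \<comment> \<open>Paired with the truncation of \<open>T' f\<close> itself, \<open>T\<close> gives the square of the norm of \<open>T' f\<close> on \<open>F\<close>.\<close>
    let ?g = "trunc F (T' f)"
    have g: "?g \<in> ell2 I" "ell2_norm I ?g = l2 (T' f) F"
      using F by (auto simp: trunc_ell2 trunc_norm)
    have "T ?g = (\<Sum>i\<in>F. T' f i \<bullet>\<^sub>c T (ell2_delta i))"
      using F T unfolding trunc_sum[OF F(1)]
      by (subst op_sum) (auto intro!: sum.cong op_scale ell2_scale ell2_delta_in_ell2)
    then have "ell2_inner I (T ?g) f = (\<Sum>i\<in>F. cnj (T' f i) * ell2_inner I (T (ell2_delta i)) f)"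
      using F f td by (auto simp: inner_sum_left inner_scale_left ell2_scale subset_iff)
    also have "\<dots> = (\<Sum>i\<in>F. complex_of_real ((cmod (T' f i))\<^sup>2))"
      using F f by (intro sum.cong)
        (auto simp: T'_def complex_norm_square mult.commute simp del: of_real_power)
    also have "\<dots> = of_real ((l2 (T' f) F)\<^sup>2)"
      by (simp add: L2_set_def sum_nonneg)
    finally have "(l2 (T' f) F)\<^sup>2 = cmod (ell2_inner I (T ?g) f)" by (simp add: norm_power)
    also have "\<dots> \<le> ell2_norm I (T ?g) * ell2_norm I f"
      by (intro Cauchy_Schwarz op_in[OF T] g f)
    also have "\<dots> \<le> (opn T * ell2_norm I ?g) * ell2_norm I f"
      by (intro mult_right_mono opn_le T g) auto
    finally have "l2 (T' f) F * l2 (T' f) F \<le> l2 (T' f) F * (opn T * ell2_norm I f)"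
      using g by (simp add: power2_eq_square mult_ac)
    moreover have "l2 (T' f) F > 0" using False L2_set_nonneg[of _ F] by (metis order_le_less)
    ultimately show ?thesis by simp
  qed
  have T'f: "T' f \<in> ell2 I" "ell2_norm I (T' f) \<le> opn T * ell2_norm I f" if "f \<in> ell2 I" for f
    by (rule ell2_bound[OF _ bound]; use that in \<open>auto simp: T'_def\<close>)+
  have op: "T' \<in> bounded_ops I"
  proof (rule opI[OF _ T'f(1) _ _ T'f(2)])
    show "T' \<in> extensional (ell2 I)" by (simp only: T'_def restrict_extensional)
    show "T' (f + g) = T' f + T' g" if "f \<in> ell2 I" "g \<in> ell2 I" for f g
      using that by (auto simp: T'_def fun_eq_iff plus_fun_apply ell2_add td inner_add_right)
    show "T' (c \<bullet>\<^sub>c f) = c \<bullet>\<^sub>c T' f" if "f \<in> ell2 I" for c f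
      using that by (auto simp: T'_def fun_eq_iff scale_apply ell2_scale inner_scale_right)
  qed
  have adj: "ell2_inner I (T' f) g = ell2_inner I f (T g)" if fg: "f \<in> ell2 I" "g \<in> ell2 I" for f g
  proof -
    have fin: "ell2_inner I (T' f) (trunc F g) = ell2_inner I f (T (trunc F g))"
      if F: "finite F" "F \<subseteq> I" for F
    proof -
      have "cnj (ell2_inner I (T' f) (trunc F g)) = ell2_inner I (trunc F g) (T' f)"
        using inner_commute by metis
      also have "\<dots> = (\<Sum>i\<in>F. cnj (g i) * T' f i)"
        using F T'f(1)[OF fg(1)] unfolding trunc_sum[OF F(1)]
        by (auto simp: inner_sum_left inner_scale_left ell2_scale ell2_delta_in_ell2 subset_iff inner_delta)
      also have "\<dots> = (\<Sum>i\<in>F. cnj (g i) * ell2_inner I (T (ell2_delta i)) f)"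
        using F fg by (intro sum.cong) (auto simp: T'_def)
      also have "\<dots> = ell2_inner I (\<Sum>i\<in>F. g i \<bullet>\<^sub>c T (ell2_delta i)) f"
        using F fg td by (auto simp: inner_sum_left inner_scale_left ell2_scale subset_iff)
      also have "(\<Sum>i\<in>F. g i \<bullet>\<^sub>c T (ell2_delta i)) = T (trunc F g)"
        using F T unfolding trunc_sum[OF F(1)]
        by (subst op_sum) (auto intro!: sum.cong op_scale[symmetric] ell2_scale ell2_delta_in_ell2)
      also have "ell2_inner I (T (trunc F g)) f = cnj (ell2_inner I f (T (trunc F g)))"
        by (rule inner_commute)
      finally show ?thesis by (metis complex_cnj_cnj)
    qed
    have "cmod (ell2_inner I (T' f) g - ell2_inner I f (T g)) \<le> 0"
    proof (rule field_le_epsilon)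
      fix e :: real assume "e > 0"
      \<comment> \<open>Both sides are bounded in \<open>g\<close>, so agreement on finitely supported vectors suffices.\<close>
      define K where "K = 2 * opn T * ell2_norm I f + 1"
      have K: "K > 0" using opn_nonneg[OF T] ell2_norm_nonneg[of f] unfolding K_def
        by (meson add_nonneg_pos mult_nonneg_nonneg zero_le_numeral zero_less_one)
      obtain F where F: "finite F" "F \<subseteq> I" "ell2_norm I (g - trunc F g) < e / K"
        using trunc_dense[OF fg(2), of "e / K"] \<open>e > 0\<close> K by auto
      let ?h = "g - trunc F g"
      have h: "trunc F g \<in> ell2 I" "?h \<in> ell2 I" using F fg by (auto intro: trunc_ell2 ell2_diff)
      have "ell2_inner I (T' f) g - ell2_inner I f (T g)
          = ell2_inner I (T' f) ?h - ell2_inner I f (T ?h)"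
        using fin[OF F(1,2)] fg h
        by (simp add: inner_diff_right op_diff[OF T] op_in[OF T] op_in[OF op])
      also have "cmod \<dots> \<le> cmod (ell2_inner I (T' f) ?h) + cmod (ell2_inner I f (T ?h))"
        by (rule norm_triangle_ineq4)
      also have "\<dots> \<le> ell2_norm I (T' f) * ell2_norm I ?h + ell2_norm I f * ell2_norm I (T ?h)"
        by (intro add_mono Cauchy_Schwarz op_in[OF T] op_in[OF op] fg h)
      also have "\<dots> \<le> (opn T * ell2_norm I f) * ell2_norm I ?h
          + ell2_norm I f * (opn T * ell2_norm I ?h)"
        by (intro add_mono mult_right_mono mult_left_mono opn_le T T'f fg h) auto
      also have "\<dots> \<le> K * ell2_norm I ?h"
        unfolding K_def by (simp add: algebra_simps)
      also have "\<dots> \<le> 0 + e" using F K by (simp add: field_simps)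
      finally show "cmod (ell2_inner I (T' f) g - ell2_inner I f (T g)) \<le> 0 + e" .
    qed
    then show ?thesis by simp
  qed
  show ?thesis
    by (rule that[OF op _ adj]) (use T'f opn_nonneg[OF T] in \<open>auto intro!: opn_leI\<close>)
qed

lemma inner_ext:
  assumes "f \<in> ell2 I" "g \<in> ell2 I" "\<And>h. h \<in> ell2 I \<Longrightarrow> ell2_inner I f h = ell2_inner I g h"
  shows "f = g"
proof -
  have "ell2_inner I (f - g) (f - g) = 0"
    using assms by (simp add: inner_diff_left ell2_diff)
  then have "ell2_norm I (f - g) = 0" using inner_self[of "f - g"] assms by (simp add: ell2_diff)
  then have "f - g = 0" using assms by (intro ell2_norm_eq_0 ell2_diff)
  then show ?thesis by simp
qed

lemma adj_unique:
  assumes "T' \<in> bounded_ops I"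
    and "\<And>f g. f \<in> ell2 I \<Longrightarrow> g \<in> ell2 I \<Longrightarrow> ell2_inner I (T' f) g = ell2_inner I f (T g)"
  shows "adj BO T = T'"
proof -
  have "(THE T'. T' \<in> bounded_ops I \<and>
     (\<forall>f\<in>ell2 I. \<forall>g\<in>ell2 I. ell2_inner I (T' f) g = ell2_inner I f (T g))) = T'"
  proof (rule the_equality)
    fix S assume S: "S \<in> bounded_ops I \<and>
      (\<forall>f\<in>ell2 I. \<forall>g\<in>ell2 I. ell2_inner I (S f) g = ell2_inner I f (T g))"
    then show "S = T'"
      using assms by (intro op_eqI inner_ext) (auto intro: op_in[of S] op_in[OF assms(1)])
  qed (use assms in auto)
  then show ?thesis by (simp add: bounded_op_algebra_def)
qed

lemma op_adj:
  assumes "T \<in> bounded_ops I"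
  shows "adj BO T \<in> bounded_ops I" "opn (adj BO T) \<le> opn T"
    "f \<in> ell2 I \<Longrightarrow> g \<in> ell2 I \<Longrightarrow> ell2_inner I (adj BO T f) g = ell2_inner I f (T g)"
proof -
  obtain T' where T': "T' \<in> bounded_ops I" "opn T' \<le> opn T"
    "\<And>f g. f \<in> ell2 I \<Longrightarrow> g \<in> ell2 I \<Longrightarrow> ell2_inner I (T' f) g = ell2_inner I f (T g)"
    using adjoint_exists[OF assms] by blast
  then have "adj BO T = T'" by (intro adj_unique)
  with T' show "adj BO T \<in> bounded_ops I" "opn (adj BO T) \<le> opn T"
    "f \<in> ell2 I \<Longrightarrow> g \<in> ell2 I \<Longrightarrow> ell2_inner I (adj BO T f) g = ell2_inner I f (T g)"
    by auto
qed

lemma adj_diff: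
  "S \<in> bounded_ops I \<Longrightarrow> T \<in> bounded_ops I \<Longrightarrow> adj BO (diff BO S T) = diff BO (adj BO S) (adj BO T)"
proof (rule adj_unique)
  assume S: "S \<in> bounded_ops I" and T: "T \<in> bounded_ops I"
  then show "diff BO (adj BO S) (adj BO T) \<in> bounded_ops I" by (intro op_minus op_adj)
  show "ell2_inner I (diff BO (adj BO S) (adj BO T) f) g = ell2_inner I f (diff BO S T g)"
    if "f \<in> ell2 I" "g \<in> ell2 I" for f g
    using that op_adj(3)[OF S that] op_adj(3)[OF T that]
    by (simp add: BO_simps inner_diff_left inner_diff_right op_in[OF S] op_in[OF T]
        op_in[OF op_adj(1)[OF S]] op_in[OF op_adj(1)[OF T]])
qed

text \<open>Half of the identity is \<open>\<parallel>T f\<parallel>\<^sup>2 = \<langle>T\<^sup>* T f, f\<rangle>\<close> with the inequality of Cauchy and Schwarz.\<close>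

lemma op_cstar:
  assumes "T \<in> bounded_ops I" shows "opn (adj BO T \<otimes>\<^bsub>BO\<^esub> T) = (opn T)\<^sup>2"
proof (rule antisym)
  let ?S = "adj BO T \<otimes>\<^bsub>BO\<^esub> T"
  have S: "?S \<in> bounded_ops I" by (intro op_mult op_adj assms)
  have "opn ?S \<le> opn (adj BO T) * opn T" by (intro op_mult op_adj assms)
  also have "\<dots> \<le> opn T * opn T" by (intro mult_right_mono op_adj opn_nonneg assms)
  finally show "opn ?S \<le> (opn T)\<^sup>2" by (simp add: power2_eq_square)
  have "opn T \<le> sqrt (opn ?S)"
  proof (rule opn_leI)
    show "0 \<le> sqrt (opn ?S)" using opn_nonneg[OF S] by simp
    fix f assume f: "f \<in> ell2 I"
    have "of_real ((ell2_norm I (T f))\<^sup>2) = ell2_inner I (?S f) f"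
      using f op_in[OF assms f] by (simp add: inner_self BO_simps op_adj(3)[OF assms])
    then have "(ell2_norm I (T f))\<^sup>2 = cmod (ell2_inner I (?S f) f)"
      by (metis norm_of_real abs_of_nonneg zero_le_power2)
    also have "\<dots> \<le> ell2_norm I (?S f) * ell2_norm I f"
      by (intro Cauchy_Schwarz op_in[OF S] f)
    also have "\<dots> \<le> (opn ?S * ell2_norm I f) * ell2_norm I f"
      by (intro mult_right_mono opn_le S f) auto
    finally have "(ell2_norm I (T f))\<^sup>2 \<le> opn ?S * (ell2_norm I f)\<^sup>2"
      by (simp add: power2_eq_square mult.assoc)
    then have "ell2_norm I (T f) \<le> sqrt (opn ?S * (ell2_norm I f)\<^sup>2)" by (rule real_le_rsqrt)
    then show "ell2_norm I (T f) \<le> sqrt (opn ?S) * ell2_norm I f"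
      by (simp add: real_sqrt_mult)
  qed
  then have "(opn T)\<^sup>2 \<le> (sqrt (opn ?S))\<^sup>2" by (intro power_mono opn_nonneg assms)
  then show "(opn T)\<^sup>2 \<le> opn ?S" using opn_nonneg[OF S] by simp
qed

lemma op_abelian_monoid: "abelian_monoid BO"
  by (rule abelian_monoidI)
     (auto simp: op_zero_in BO_simps(1) op_plus
       intro!: extensionalityI[of _ "ell2 I"] simp: BO_simps BO_ext op_ext add.assoc add.commute)

lemma op_finsum:
  assumes "finite S" "\<And>k. k \<in> S \<Longrightarrow> T k \<in> bounded_ops I"
  shows "finsum BO T S \<in> bounded_ops I"
    and "f \<in> ell2 I \<Longrightarrow> finsum BO T S f = (\<Sum>k\<in>S. T k f)"
proof -
  interpret abelian_monoid BO by (rule op_abelian_monoid)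
  show "finsum BO T S \<in> bounded_ops I"
    using finsum_closed[of T S] assms by (auto simp: BO_simps)
  show "finsum BO T S f = (\<Sum>k\<in>S. T k f)" if "f \<in> ell2 I"
    using assms
  proof (induction S rule: finite_induct)
    case (insert x F)
    then have "finsum BO T (insert x F) = T x \<oplus>\<^bsub>BO\<^esub> finsum BO T F"
      by (subst finsum_insert) (auto simp: BO_simps)
    with insert that show ?case by (simp add: BO_simps)
  qed (simp add: BO_simps that)
qed

text \<open>
  The limit is taken coordinate by coordinate. The Cauchy estimate passes to the limit on each
  finite set of coordinates, and these control the norm.
\<close>

lemma op_complete:
  assumes T: "\<And>n. T n \<in> bounded_ops I"
    and C: "\<And>\<epsilon>. \<epsilon> > 0 \<Longrightarrow> \<exists>N. \<forall>m\<ge>N. \<forall>n\<ge>N. opn (diff BO (T m) (T n)) < \<epsilon>"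
  obtains S where "S \<in> bounded_ops I" "(\<lambda>n. opn (diff BO (T n) S)) \<longlonglongrightarrow> 0"
proof -
  define S where "S = (\<lambda>f\<in>ell2 I. \<lambda>i. lim (\<lambda>n. T n f i))"
  have pt: "cmod (T m f i - T n f i) \<le> opn (diff BO (T m) (T n)) * ell2_norm I f"
    if f: "f \<in> ell2 I" for m n f i
  proof -
    have d: "diff BO (T m) (T n) \<in> bounded_ops I" by (intro op_minus T)
    have "cmod (diff BO (T m) (T n) f i) \<le> ell2_norm I (diff BO (T m) (T n) f)"
      by (intro ell2_cmod_le op_in[OF d] f)
    also have "\<dots> \<le> opn (diff BO (T m) (T n)) * ell2_norm I f"
      by (intro opn_le d f)
    finally show ?thesis using f by (simp add: BO_simps minus_apply)
  qed
  have lim: "(\<lambda>n. T n f i) \<longlonglongrightarrow> S f i" if f: "f \<in> ell2 I" for f i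
  proof -
    have "Cauchy (\<lambda>n. T n f i)"
    proof (rule metric_CauchyI)
      fix e :: real assume "e > 0"
      let ?k = "ell2_norm I f + 1"
      have k: "?k > 0" using ell2_norm_nonneg[of f] by linarith
      obtain N where N: "\<forall>m\<ge>N. \<forall>n\<ge>N. opn (diff BO (T m) (T n)) < e / ?k"
        using C[of "e / ?k"] \<open>e > 0\<close> k by auto
      have "dist (T m f i) (T n f i) < e" if "m \<ge> N" "n \<ge> N" for m n
      proof -
        have "cmod (T m f i - T n f i) \<le> opn (diff BO (T m) (T n)) * ell2_norm I f" by (rule pt[OF f])
        also have "\<dots> \<le> opn (diff BO (T m) (T n)) * ?k"
          by (intro mult_left_mono opn_nonneg op_minus T) auto
        also have "\<dots> < e" using N that k by (simp add: field_simps)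
        finally show ?thesis by (simp add: dist_norm)
      qed
      then show "\<exists>M. \<forall>m\<ge>M. \<forall>n\<ge>M. dist (T m f i) (T n f i) < e" by blast
    qed
    then show ?thesis using f by (simp add: S_def Cauchy_convergent convergent_LIMSEQ_iff[symmetric])
  qed
  have ap: "T n f - S f \<in> ell2 I \<and> ell2_norm I (T n f - S f) \<le> \<epsilon> * ell2_norm I f"
    if f: "f \<in> ell2 I" and N: "\<forall>m\<ge>N. \<forall>n\<ge>N. opn (diff BO (T m) (T n)) < \<epsilon>" "n \<ge> N" for f n N \<epsilon>
  proof -
    have "l2 (T n f - S f) F \<le> \<epsilon> * ell2_norm I f" if F: "finite F" "F \<subseteq> I" for F
    proof (rule LIMSEQ_le_const2)
      show "(\<lambda>m. l2 (T n f - T m f) F) \<longlonglongrightarrow> l2 (T n f - S f) F"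
        unfolding L2_set_def minus_apply by (intro tendsto_intros lim f)
      have "l2 (T n f - T m f) F \<le> \<epsilon> * ell2_norm I f" if "m \<ge> N" for m
      proof -
        have d: "diff BO (T n) (T m) \<in> bounded_ops I" by (intro op_minus T)
        have "l2 (T n f - T m f) F = l2 (diff BO (T n) (T m) f) F" using f by (simp add: BO_simps)
        also have "\<dots> \<le> ell2_norm I (diff BO (T n) (T m) f)"
          by (intro L2_le_ell2_norm op_in[OF d] f F)
        also have "\<dots> \<le> opn (diff BO (T n) (T m)) * ell2_norm I f" by (intro opn_le d f)
        also have "\<dots> \<le> \<epsilon> * ell2_norm I f" using N that by (intro mult_right_mono) (auto intro: less_imp_le)
        finally show ?thesis .
      qed
      then show "\<exists>M. \<forall>m\<ge>M. l2 (T n f - T m f) F \<le> \<epsilon> * ell2_norm I f" by blast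
    qed
    moreover have "(T n f - S f) i = 0" if "i \<notin> I" for i
    proof -
      have z: "(\<lambda>n. T n f i) = (\<lambda>n. 0)" using ell2_outside[OF op_in[OF T f] that] by auto
      have "S f i = 0" using lim[OF f, of i] unfolding z by (simp add: LIMSEQ_const_iff)
      then show ?thesis using ell2_outside[OF op_in[OF T f] that] by (simp add: minus_apply)
    qed
    ultimately show ?thesis using ell2_bound[of "T n f - S f"] by blast
  qed
  obtain N1 where N1: "\<forall>m\<ge>N1. \<forall>n\<ge>N1. opn (diff BO (T m) (T n)) < 1" using C[of 1] by auto
  have S: "S \<in> bounded_ops I"
  proof (rule opI[where K = "opn (T N1) + 1"])
    show "S \<in> extensional (ell2 I)" by (simp add: S_def)
    show "S f \<in> ell2 I" if "f \<in> ell2 I" for f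
      using ell2_diff(1)[OF op_in[OF T that], of "T N1 f - S f" N1] ap[OF that N1, of N1] by simp
    show "ell2_norm I (S f) \<le> (opn (T N1) + 1) * ell2_norm I f" if "f \<in> ell2 I" for f
      using ell2_diff(2)[of "T N1 f" "T N1 f - S f"] ap[OF that N1, of N1] op_in[OF T that]
        opn_le[OF T that, of N1] by (simp add: distrib_right)
    show "S (f + g) = S f + S g" if fg: "f \<in> ell2 I" "g \<in> ell2 I" for f g
    proof
      fix i
      have "(\<lambda>n. T n f i + T n g i) \<longlonglongrightarrow> S f i + S g i" by (intro tendsto_intros lim fg)
      moreover have "(\<lambda>n. T n f i + T n g i) \<longlonglongrightarrow> S (f + g) i"
        using lim[of "f + g" i] fg by (simp add: op_add[OF T] ell2_add plus_fun_apply)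
      ultimately show "S (f + g) i = (S f + S g) i" using LIMSEQ_unique by (auto simp: plus_fun_apply)
    qed
    show "S (c \<bullet>\<^sub>c f) = c \<bullet>\<^sub>c S f" if f: "f \<in> ell2 I" for c f
    proof
      fix i
      have "(\<lambda>n. c * T n f i) \<longlonglongrightarrow> c * S f i" by (intro tendsto_intros lim f)
      moreover have "(\<lambda>n. c * T n f i) \<longlonglongrightarrow> S (c \<bullet>\<^sub>c f) i"
        using lim[of "c \<bullet>\<^sub>c f" i] f by (simp add: op_scale[OF T] ell2_scale scale_apply)
      ultimately show "S (c \<bullet>\<^sub>c f) i = (c \<bullet>\<^sub>c S f) i" using LIMSEQ_unique by (auto simp: scale_apply)
    qed
  qed
  moreover have "(\<lambda>n. opn (diff BO (T n) S)) \<longlonglongrightarrow> 0"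
  proof (rule LIMSEQ_I)
    fix r :: real assume "r > 0"
    then obtain N where N: "\<forall>m\<ge>N. \<forall>n\<ge>N. opn (diff BO (T m) (T n)) < r / 2" using C[of "r/2"] by auto
    have "norm (opn (diff BO (T n) S) - 0) < r" if "n \<ge> N" for n
    proof -
      have "opn (diff BO (T n) S) \<le> r / 2"
        by (rule opn_leI) (use \<open>r > 0\<close> ap[OF _ N that] in \<open>auto simp: BO_simps\<close>)
      then show ?thesis using \<open>r > 0\<close> opn_nonneg[OF op_minus[OF T S], of n] by simp
    qed
    then show "\<exists>no. \<forall>n\<ge>no. norm (opn (diff BO (T n) S) - 0) < r" by blast
  qed
  ultimately show ?thesis by (rule that)
qed

end

section \<open>Self-similar actions on finite words\<close>

lemma conc_eq_iff:
  assumes "length u = length v"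
  shows "u \<frown> w = v \<frown> z \<longleftrightarrow> u = v \<and> w = z"
proof
  assume eq: "u \<frown> w = v \<frown> z"
  have "prefix (length u) (u \<frown> w) = prefix (length v) (v \<frown> z)" using eq assms by simp
  then have "u = v" by (simp only: prefix_conc_length)
  then show "u = v \<and> w = z" using eq by simp
qed auto

lemma conc_prefix_suffix: "prefix n w \<frown> suffix n w = w"
  by (rule prefix_suffix[symmetric])

text \<open>
  The degree of a word in the generators: the power of \<open>cis t\<close> by which the gauge
  automorphism multiplies it.
\<close>

fun letter_deg :: "('g, 'x) gen \<times> bool \<Rightarrow> int" where
  "letter_deg (Grp g, b) = 0"
| "letter_deg (Iso x, b) = (if b then - 1 else 1)"

definition deg :: "(('g, 'x) gen \<times> bool) list \<Rightarrow> int" where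
  "deg w = sum_list (map letter_deg w)"

lemma deg_simps [simp]: "deg [] = 0" "deg (l # w) = letter_deg l + deg w"
  "deg (u @ v) = deg u + deg v"
  by (simp_all add: deg_def)

lemma letter_deg_flip: "letter_deg (apsnd Not l) = - letter_deg l"
  by (cases l rule: letter_deg.cases) auto

lemma deg_flip [simp]: "deg (flip w) = - deg w"
  by (induction w) (auto simp: letter_deg_flip)

locale self_similar =
  fixes G :: "('g, 'm) monoid_scheme" (structure)
    and \<phi> :: "'g \<Rightarrow> (nat \<Rightarrow> 'x::finite) \<Rightarrow> (nat \<Rightarrow> 'x)"
  assumes self_similar: "self_similar_action G \<phi>"
    and card_alphabet: "CARD('x) \<ge> 2"
begin

lemma faithful: "faithful_action G UNIV \<phi>"
  using self_similar by (simp add: self_similar_action_def)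

sublocale group G
  using faithful unfolding faithful_action_def group_action_def group_hom_def by blast

lemma action_hom: "\<phi> \<in> hom G (BijGroup UNIV)"
  using faithful unfolding faithful_action_def group_action_def group_hom_def group_hom_axioms_def
  by blast

lemma action_mult:
  assumes "g \<in> carrier G" "h \<in> carrier G" shows "\<phi> (g \<otimes> h) w = \<phi> g (\<phi> h w)"
proof -
  have "\<phi> g \<in> Bij UNIV" "\<phi> h \<in> Bij UNIV"
    using action_hom assms by (auto simp: hom_def BijGroup_def)
  then have "\<phi> (g \<otimes> h) = compose UNIV (\<phi> g) (\<phi> h)"
    using action_hom assms by (simp add: hom_def BijGroup_def)
  then show ?thesis by (simp add: compose_def)
qed

lemma action_one: "\<phi> \<one> w = w"
proof -
  have "\<phi> \<one> = \<one>\<^bsub>BijGroup (UNIV :: (nat \<Rightarrow> 'x) set)\<^esub>"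
    by (rule hom_one[OF action_hom]) (auto intro: group_BijGroup is_group)
  then show ?thesis by (simp add: BijGroup_def)
qed

lemma action_inv:
  assumes "g \<in> carrier G" shows "\<phi> (inv g) (\<phi> g w) = w" "\<phi> g (\<phi> (inv g) w) = w"
  using assms action_mult[of "inv g" g w] action_mult[of g "inv g" w] by (simp_all add: action_one)

lemma action_inj: "g \<in> carrier G \<Longrightarrow> h \<in> carrier G \<Longrightarrow> (\<And>w. \<phi> g w = \<phi> h w) \<Longrightarrow> g = h"
  using faithful unfolding faithful_action_def faithful_action_axioms_def inj_on_def by blast

lemma action_cancel: "g \<in> carrier G \<Longrightarrow> \<phi> g w = \<phi> g z \<longleftrightarrow> w = z"
  by (metis action_inv(1))

text \<open>The pair chosen here is the only possible one by faithfulness (\<open>section_unique\<close>).\<close>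

definition letter_step :: "'g \<Rightarrow> 'x \<Rightarrow> 'x \<times> 'g" where
  "letter_step g x = (SOME (y, h). h \<in> carrier G \<and> (\<forall>w. \<phi> g ([x] \<frown> w) = [y] \<frown> \<phi> h w))"

lemma letter_step:
  assumes "g \<in> carrier G"
  shows "snd (letter_step g x) \<in> carrier G"
    and "\<phi> g ([x] \<frown> w) = [fst (letter_step g x)] \<frown> \<phi> (snd (letter_step g x)) w"
proof -
  have "\<exists>p. (case p of (y, h) \<Rightarrow> h \<in> carrier G \<and> (\<forall>w. \<phi> g ([x] \<frown> w) = [y] \<frown> \<phi> h w))"
  proof -
    obtain h y where "h \<in> carrier G" "\<forall>w. \<phi> g ([x] \<frown> w) = [y] \<frown> \<phi> h w"
      using self_similar assms unfolding self_similar_action_def by blast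
    then show ?thesis by (intro exI[of _ "(y, h)"]) simp
  qed
  from someI_ex[OF this]
  have "case letter_step g x of (y, h) \<Rightarrow> h \<in> carrier G \<and> (\<forall>w. \<phi> g ([x] \<frown> w) = [y] \<frown> \<phi> h w)"
    unfolding letter_step_def .
  then show "snd (letter_step g x) \<in> carrier G"
    and "\<phi> g ([x] \<frown> w) = [fst (letter_step g x)] \<frown> \<phi> (snd (letter_step g x)) w"
    by (simp_all add: case_prod_beta)
qed

text \<open>The action on finite words, and the section of a group element at a finite word.\<close>

fun act :: "'g \<Rightarrow> 'x list \<Rightarrow> 'x list" where
  "act g [] = []"
| "act g (x # u) = fst (letter_step g x) # act (snd (letter_step g x)) u"

fun sec :: "'g \<Rightarrow> 'x list \<Rightarrow> 'g" where
  "sec g [] = g"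
| "sec g (x # u) = sec (snd (letter_step g x)) u"

lemma length_act [simp]: "length (act g u) = length u"
  by (induction u arbitrary: g) auto

lemma sec_in [simp]: "g \<in> carrier G \<Longrightarrow> sec g u \<in> carrier G"
  by (induction u arbitrary: g) (auto simp: letter_step)

lemma action_conc: "g \<in> carrier G \<Longrightarrow> \<phi> g (u \<frown> w) = act g u \<frown> \<phi> (sec g u) w"
proof (induction u arbitrary: g)
  case (Cons x u)
  have "\<phi> g ((x # u) \<frown> w) = \<phi> g ([x] \<frown> (u \<frown> w))" by simp
  also have "\<dots> = [fst (letter_step g x)] \<frown> \<phi> (snd (letter_step g x)) (u \<frown> w)"
    by (rule letter_step[OF Cons.prems])
  also have "\<dots> = act g (x # u) \<frown> \<phi> (sec g (x # u)) w"
    using Cons by (simp add: letter_step)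
  finally show ?case .
qed simp

text \<open>
  Comparing the first \<open>length u\<close> letters determines the image of \<open>u\<close>, and faithfulness determines the
  section.
\<close>

lemma section_unique:
  assumes "g \<in> carrier G" "h \<in> carrier G" "length v = length u"
    and "\<And>w. \<phi> g (u \<frown> w) = v \<frown> \<phi> h w"
  shows "act g u = v" "sec g u = h"
proof -
  have *: "act g u = v \<and> \<phi> (sec g u) w = \<phi> h w" for w
    using assms(4)[of w] assms(1,3) by (simp add: action_conc conc_eq_iff)
  then show "act g u = v" by blast
  show "sec g u = h" by (rule action_inj) (use * assms in auto)
qed

lemma act_append: "act g (u @ v) = act g u @ act (sec g u) v"
  and sec_append: "sec g (u @ v) = sec (sec g u) v"
  by (induction u arbitrary: g) auto

lemma act_mult:
  assumes "g \<in> carrier G" "h \<in> carrier G"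
  shows "act (g \<otimes> h) u = act g (act h u)" "sec (g \<otimes> h) u = sec g (act h u) \<otimes> sec h u"
proof -
  have *: "\<phi> (g \<otimes> h) (u \<frown> w) = act g (act h u) \<frown> \<phi> (sec g (act h u) \<otimes> sec h u) w" for w
    unfolding action_mult[OF assms] using assms by (simp add: action_conc action_mult)
  show "act (g \<otimes> h) u = act g (act h u)" "sec (g \<otimes> h) u = sec g (act h u) \<otimes> sec h u"
    by (rule section_unique[OF _ _ _ *]; use assms in simp)+
qed

lemma act_one [simp]: "act \<one> u = u" "sec \<one> u = \<one>"
  using section_unique[of \<one> \<one> u u] by (simp_all add: action_one)

text \<open>
  For a word fixed by \<open>g\<close> the section decides whether \<open>g\<close> fixes the whole cylinder of the word. This
  connects the section with genericity.
\<close>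

lemma sec_eq_one_iff:
  assumes "g \<in> carrier G" "act g u = u"
  shows "sec g u = \<one> \<longleftrightarrow> (\<forall>w. \<phi> g (u \<frown> w) = u \<frown> w)"
proof
  assume "\<forall>w. \<phi> g (u \<frown> w) = u \<frown> w"
  then show "sec g u = \<one>" by (intro section_unique(2)[OF assms(1)]) (auto simp: action_one)
qed (use assms in \<open>simp add: action_conc action_one\<close>)

section \<open>Words in the generators as partial maps\<close>

text \<open>
  The pair \<open>(u, g)\<close> stands for \<open>S\<^sub>u g\<close>. Multiplying it from the left by a generator or the
  adjoint of a generator gives \<open>0\<close> or again an element of this form, as long as no adjoint of an
  isometry meets an empty \<open>u\<close>; in that last case the value \<open>None\<close> is a dummy, and words are
  only applied to \<open>u\<close> that are at least as long as the word.
\<close>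

fun step :: "('g, 'x) gen \<times> bool \<Rightarrow> 'x list \<times> 'g \<Rightarrow> ('x list \<times> 'g) option" where
  "step (Grp k, b) (u, g) =
     (let k' = if b then inv k else k in Some (act k' u, sec k' u \<otimes> g))"
| "step (Iso x, False) (u, g) = Some (x # u, g)"
| "step (Iso x, True) (u, g) =
     (case u of [] \<Rightarrow> None | y # u' \<Rightarrow> if y = x then Some (u', g) else None)"

fun run :: "(('g, 'x) gen \<times> bool) list \<Rightarrow> 'x list \<times> 'g \<Rightarrow> ('x list \<times> 'g) option" where
  "run [] s = Some s"
| "run (l # W) s = Option.bind (run W s) (step l)"

abbreviation letters :: "(('g, 'x) gen \<times> bool) list \<Rightarrow> bool" where
  "letters W \<equiv> fst ` set W \<subseteq> gens G"

lemma gens_simps [simp]: "Grp k \<in> gens G \<longleftrightarrow> k \<in> carrier G" "Iso x \<in> gens G"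
  by (auto simp: gens_def)

lemma step_in:
  "step l (u, g) = Some (u', g') \<Longrightarrow> fst l \<in> gens G \<Longrightarrow> g \<in> carrier G \<Longrightarrow> g' \<in> carrier G"
  by (induction l "(u, g)" rule: step.induct) (auto simp: Let_def split: list.splits if_splits)

lemma run_in: "run W (u, g) = Some (u', g') \<Longrightarrow> letters W \<Longrightarrow> g \<in> carrier G \<Longrightarrow> g' \<in> carrier G"
proof (induction W arbitrary: u' g')
  case (Cons l W)
  then obtain u1 g1 where "run W (u, g) = Some (u1, g1)" "step l (u1, g1) = Some (u', g')"
    by (auto simp: bind_eq_Some_conv)
  with Cons step_in[of l u1 g1 u' g'] show ?case by auto
qed auto

lemma step_length: "step l (u, g) = Some (u', g') \<Longrightarrow> int (length u') = int (length u) + letter_deg l"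
  by (induction l "(u, g)" rule: step.induct) (auto simp: Let_def split: list.splits if_splits)

lemma run_length: "run W (u, g) = Some (u', g') \<Longrightarrow> int (length u') = int (length u) + deg W"
proof (induction W arbitrary: u' g')
  case (Cons l W)
  then obtain u1 g1 where "run W (u, g) = Some (u1, g1)" "step l (u1, g1) = Some (u', g')"
    by (auto simp: bind_eq_Some_conv)
  with Cons.IH step_length[of l u1 g1 u' g'] show ?case by auto
qed auto

lemma deg_ge: "deg W \<ge> - int (length W)"
proof (induction W)
  case (Cons l W)
  moreover have "letter_deg l \<ge> - 1" by (cases l rule: letter_deg.cases) auto
  ultimately show ?case by simp
qed simp

lemma run_append: "run (V @ W) s = Option.bind (run W s) (run V)"
  by (induction V) (auto split: Option.bind_splits)

text \<open>
  Multiplication by \<open>h\<close> from the right, \<open>(u, g) \<mapsto> (u, g h)\<close>, commutes with the action of the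
  generators from the left.
\<close>

lemma step_right:
  "g \<in> carrier G \<Longrightarrow> h \<in> carrier G \<Longrightarrow> fst l \<in> gens G \<Longrightarrow>
     step l (u, g \<otimes> h) = map_option (\<lambda>(u', g'). (u', g' \<otimes> h)) (step l (u, g))"
  by (induction l "(u, g)" rule: step.induct) (auto simp: Let_def m_assoc split: list.splits)

lemma run_right:
  "g \<in> carrier G \<Longrightarrow> h \<in> carrier G \<Longrightarrow> letters W \<Longrightarrow>
     run W (u, g \<otimes> h) = map_option (\<lambda>(u', g'). (u', g' \<otimes> h)) (run W (u, g))"
proof (induction W)
  case (Cons l W)
  show ?case
  proof (cases "run W (u, g)")
    case (Some s)
    then obtain u1 g1 where s: "run W (u, g) = Some (u1, g1)" by (cases s) auto
    then have "g1 \<in> carrier G" using run_in[OF s] Cons.prems by auto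
    with Cons s show ?thesis by (simp add: step_right)
  qed (use Cons in auto)
qed auto

text \<open>Right multiplication by \<open>S\<^sub>v\<close>: \<open>S\<^sub>u g S\<^sub>v = S\<^sub>u\<^sub>' g'\<close> with \<open>u' = u g(v)\<close> and \<open>g'\<close> the section of \<open>g\<close> at \<open>v\<close>.\<close>

definition extend :: "'x list \<Rightarrow> 'x list \<times> 'g \<Rightarrow> 'x list \<times> 'g" where
  "extend v = (\<lambda>(u, g). (u @ act g v, sec g v))"

lemma extend_one: "extend v (u, \<one>) = (u @ v, \<one>)"
  by (simp add: extend_def)

lemma step_extend:
  assumes "g \<in> carrier G" "fst l \<in> gens G" "u \<noteq> []"
  shows "step l (extend v (u, g)) = map_option (extend v) (step l (u, g))"
  using assms
  by (induction l "(u, g)" rule: step.induct)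
     (auto simp: extend_def Let_def act_append sec_append act_mult split: list.splits)

text \<open>
  A word of length at most \<open>length u\<close> acts on \<open>S\<^sub>u\<close> without reaching the end of \<open>u\<close>, so letters
  appended to \<open>u\<close> are only moved by the resulting group element.
\<close>

lemma run_extend:
  assumes "g \<in> carrier G" "letters W" "length W \<le> length u"
  shows "run W (extend v (u, g)) = map_option (extend v) (run W (u, g))"
  using assms
proof (induction W)
  case (Cons l W)
  show ?case
  proof (cases "run W (u, g)")
    case (Some s)
    then obtain u1 g1 where s: "run W (u, g) = Some (u1, g1)" by (cases s) auto
    then have "g1 \<in> carrier G" using run_in[OF s] Cons.prems by auto
    moreover have "u1 \<noteq> []"
      using run_length[OF s] deg_ge[of W] Cons.prems by auto
    ultimately have "step l (extend v (u1, g1)) = map_option (extend v) (step l (u1, g1))"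
      using Cons.prems by (intro step_extend) auto
    with Cons s show ?thesis by simp
  qed (use Cons in auto)
qed auto

section \<open>Counting fixed words\<close>

definition fixed_words :: "(('g, 'x) gen \<times> bool) list \<Rightarrow> nat \<Rightarrow> 'x list set" where
  "fixed_words W n = {u. length u = n \<and> run W (u, \<one>) = Some (u, \<one>)}"

text \<open>
  \<open>W\<close> maps the cylinder of such a word to itself without being the identity there, so extensions of
  the word may or may not be fixed.
\<close>

definition undecided_words :: "(('g, 'x) gen \<times> bool) list \<Rightarrow> nat \<Rightarrow> 'x list set" where
  "undecided_words W n = {u. length u = n \<and> (\<exists>g. run W (u, \<one>) = Some (u, g) \<and> g \<noteq> \<one>)}"

definition nontrivially_fixed_words :: "'g \<Rightarrow> nat \<Rightarrow> 'x list set" where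
  "nontrivially_fixed_words g n = {v. length v = n \<and> act g v = v \<and> sec g v \<noteq> \<one>}"

lemma card_pos: "real CARD('x) > 0" using card_alphabet by simp

lemma words_finite: "finite {u :: 'x list. length u = n}"
  and words_card: "card {u :: 'x list. length u = n} = CARD('x) ^ n"
  using finite_lists_length_eq[of "UNIV :: 'x set" n] card_lists_length_eq[of "UNIV :: 'x set" n]
  by simp_all

lemma words_sets_finite [simp]:
  "finite (fixed_words W n)" "finite (undecided_words W n)" "finite (nontrivially_fixed_words g n)"
  by (rule finite_subset[OF _ words_finite[of n]],
      force simp: fixed_words_def undecided_words_def nontrivially_fixed_words_def)+

lemma fixed_words_extend:
  assumes "letters W" "length W \<le> n" "u \<in> fixed_words W n"
  shows "u @ [x] \<in> fixed_words W (Suc n)"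
  using run_extend[of \<one> W u "[x]"] assms by (simp add: fixed_words_def extend_one)

lemma card_fixed_words_Suc:
  assumes "letters W" "length W \<le> n"
  shows "CARD('x) * card (fixed_words W n) \<le> card (fixed_words W (Suc n))"
proof -
  have "card ((\<lambda>(x, u). u @ [x]) ` (UNIV \<times> fixed_words W n)) = card ((UNIV :: 'x set) \<times> fixed_words W n)"
    by (rule card_image) (auto simp: inj_on_def)
  moreover have "(\<lambda>(x, u). u @ [x]) ` (UNIV \<times> fixed_words W n) \<subseteq> fixed_words W (Suc n)"
    using fixed_words_extend[OF assms] by auto
  ultimately show ?thesis
    by (metis card_mono words_sets_finite(1) card_cartesian_product)
qed

definition density :: "(('g, 'x) gen \<times> bool) list \<Rightarrow> nat \<Rightarrow> real" where
  "density W n = real (card (fixed_words W n)) / real CARD('x) ^ n"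

text \<open>Extensions of a fixed word are fixed, so the density increases from the length of \<open>W\<close> on.\<close>

lemma density_convergent:
  assumes "letters W" shows "convergent (density W)"
proof -
  have "incseq (\<lambda>n. density W (n + length W))"
  proof (rule incseq_SucI)
    fix n
    have "real CARD('x) * real (card (fixed_words W (n + length W))) \<le> real (card (fixed_words W (Suc (n + length W))))"
      using card_fixed_words_Suc[OF assms, of "n + length W"] by (metis le_add2 of_nat_le_iff of_nat_mult)
    then show "density W (n + length W) \<le> density W (Suc n + length W)"
      using card_pos by (simp add: density_def field_simps)
  qed
  moreover have "density W n \<le> 1" for n
  proof -
    have "card (fixed_words W n) \<le> CARD('x) ^ n"
      unfolding words_card[symmetric] by (rule card_mono[OF words_finite]) (auto simp: fixed_words_def)
    then have "real (card (fixed_words W n)) \<le> real CARD('x) ^ n" by (metis of_nat_le_iff of_nat_power)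
    then show ?thesis using card_pos by (simp add: density_def field_simps)
  qed
  ultimately obtain L where "(\<lambda>n. density W (n + length W)) \<longlonglongrightarrow> L"
    using incseq_convergent[of "\<lambda>n. density W (n + length W)" 1] by metis
  then show ?thesis using LIMSEQ_offset convergentI by blast
qed

text \<open>
  The value of the trace at \<open>W\<close>. In nonzero degree the word is not gauge invariant, and \<open>0\<close> is a
  dummy.
\<close>

definition word_trace :: "(('g, 'x) gen \<times> bool) list \<Rightarrow> real" where
  "word_trace W = (if deg W = 0 then lim (density W) else 0)"

lemma density_tendsto: "letters W \<Longrightarrow> deg W = 0 \<Longrightarrow> density W \<longlonglongrightarrow> word_trace W"
  using density_convergent by (simp add: word_trace_def convergent_LIMSEQ_iff)

text \<open>
  If \<open>W\<close> moves \<open>u\<close> to \<open>u'\<close> and \<open>V\<close> moves \<open>u'\<close> back to \<open>u\<close>, then \<open>V W\<close> fixes \<open>u\<close> and \<open>W V\<close> fixes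
  \<open>u'\<close>. So the two products have equally many fixed words.
\<close>

lemma card_fixed_words_commute_le:
  assumes "letters V" "letters W" "deg W = 0"
  shows "card (fixed_words (V @ W) n) \<le> card (fixed_words (W @ V) n)"
proof (rule card_inj_on_le)
  let ?f = "\<lambda>u. fst (the (run W (u, \<one>)))"
  let ?b = "\<lambda>u. fst (the (run V (u, \<one>)))"
  have *: "?f u \<in> fixed_words (W @ V) n \<and> ?b (?f u) = u" if u: "u \<in> fixed_words (V @ W) n" for u
  proof -
    obtain u1 g1 where 1: "run W (u, \<one>) = Some (u1, g1)" "run V (u1, g1) = Some (u, \<one>)"
      using u by (auto simp: fixed_words_def run_append bind_eq_Some_conv)
    have g1: "g1 \<in> carrier G" using run_in[OF 1(1)] assms by simp
    have "map_option (\<lambda>(u', g'). (u', g' \<otimes> g1)) (run V (u1, \<one>)) = Some (u, \<one>)"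
      using run_right[of \<one> g1 V u1] 1 g1 assms by simp
    then obtain g2 where 2: "run V (u1, \<one>) = Some (u, g2)" "g2 \<otimes> g1 = \<one>"
      by auto
    have g2: "g2 \<in> carrier G" using run_in[OF 2(1)] assms by simp
    \<comment> \<open>The group elements picked up on the two halves of the cycle are inverse to each other, in either order.\<close>
    have "g1 \<otimes> g2 = \<one>" using 2 g1 g2 inv_comm by blast
    moreover have "run W (u, \<one> \<otimes> g2) = Some (u1, g1 \<otimes> g2)"
      using run_right[of \<one> g2 W u] g2 1 assms by simp
    ultimately have "run (W @ V) (u1, \<one>) = Some (u1, \<one>)"
      using 2 g2 by (simp add: run_append)
    moreover have "length u1 = n" using run_length[OF 1(1)] u assms by (simp add: fixed_words_def)
    ultimately show ?thesis using 1 2 by (simp add: fixed_words_def)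
  qed
  show "inj_on ?f (fixed_words (V @ W) n)"
    by (rule inj_on_inverseI[where g = ?b]) (use * in blast)
  show "?f ` fixed_words (V @ W) n \<subseteq> fixed_words (W @ V) n" using * by blast
qed simp

lemma word_trace_commute:
  assumes "letters V" "letters W" "deg V = 0" "deg W = 0"
  shows "word_trace (V @ W) = word_trace (W @ V)"
proof -
  have "density (V @ W) = density (W @ V)"
    using card_fixed_words_commute_le[of V W] card_fixed_words_commute_le[of W V] assms
    by (auto simp: density_def fun_eq_iff intro!: arg_cong2[where f = "(/)"] antisym)
  then show ?thesis using assms by (simp add: word_trace_def)
qed

text \<open>
  The first \<open>length W\<close> letters of an undecided word determine a group element. The remaining letters
  form a word that this element fixes with nontrivial section.
\<close>

lemma card_undecided_words:
  assumes W: "letters W" "deg W = 0"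
  shows "card (undecided_words W (length W + m)) \<le>
     (\<Sum>u\<in>{u. length u = length W \<and> run W (u, \<one>) \<noteq> None}. card (nontrivially_fixed_words (snd (the (run W (u, \<one>)))) m))"
proof -
  have "undecided_words W (length W + m) \<subseteq>
     (\<Union>u\<in>{u. length u = length W \<and> run W (u, \<one>) \<noteq> None}. (\<lambda>v. u @ v) ` nontrivially_fixed_words (snd (the (run W (u, \<one>)))) m)"
  proof
    fix w assume w: "w \<in> undecided_words W (length W + m)"
    define u v where "u = take (length W) w" and "v = drop (length W) w"
    have uv: "w = u @ v" "length u = length W" "length v = m"
      using w by (auto simp: u_def v_def undecided_words_def)
    obtain g where g: "run W (w, \<one>) = Some (w, g)" "g \<noteq> \<one>"
      using w by (auto simp: undecided_words_def)
    have "map_option (extend v) (run W (u, \<one>)) = Some (w, g)"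
      using run_extend[of \<one> W u v] uv W g by (simp add: extend_one)
    then obtain u1 g1 where 1: "run W (u, \<one>) = Some (u1, g1)" "u1 @ act g1 v = w" "sec g1 v = g"
      by (auto simp: extend_def)
    have "length u1 = length u" using run_length[OF 1(1)] W by simp
    then have "u1 = u" "act g1 v = v" using 1 uv by auto
    then have "v \<in> nontrivially_fixed_words (snd (the (run W (u, \<one>)))) m"
      using 1 g uv by (simp add: nontrivially_fixed_words_def)
    then show "w \<in> (\<Union>u\<in>{u. length u = length W \<and> run W (u, \<one>) \<noteq> None}. (\<lambda>v. u @ v) ` nontrivially_fixed_words (snd (the (run W (u, \<one>)))) m)"
      using uv 1 by blast
  qed
  moreover have fin: "finite {u. length u = length W \<and> run W (u, \<one>) \<noteq> None}"
    by (rule finite_subset[OF _ words_finite[of "length W"]]) auto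
  ultimately have "card (undecided_words W (length W + m)) \<le>
     card (\<Union>u\<in>{u. length u = length W \<and> run W (u, \<one>) \<noteq> None}. (\<lambda>v. u @ v) ` nontrivially_fixed_words (snd (the (run W (u, \<one>)))) m)"
    by (intro card_mono) auto
  also have "\<dots> \<le> (\<Sum>u\<in>{u. length u = length W \<and> run W (u, \<one>) \<noteq> None}.
      card ((\<lambda>v. u @ v) ` nontrivially_fixed_words (snd (the (run W (u, \<one>)))) m))"
    by (rule card_UN_le) (rule fin)
  also have "\<dots> = (\<Sum>u\<in>{u. length u = length W \<and> run W (u, \<one>) \<noteq> None}. card (nontrivially_fixed_words (snd (the (run W (u, \<one>)))) m))"
    by (intro sum.cong card_image) (auto simp: inj_on_def)
  finally show ?thesis .
qed

end

section \<open>Genericity of almost every point\<close>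

lemma open_contains_cylinder:
  assumes "openin word_topology U" "w \<in> U"
  obtains n where "\<And>z. prefix n w \<frown> z \<in> U"
proof -
  have "\<exists>V. finite {i \<in> UNIV. V i \<noteq> topspace (discrete_topology UNIV)} \<and>
      (\<forall>i\<in>UNIV. openin (discrete_topology UNIV) (V i)) \<and> w \<in> Pi\<^sub>E UNIV V \<and> Pi\<^sub>E UNIV V \<subseteq> U"
    using assms unfolding word_topology_def openin_product_topology_alt by blast
  then obtain V :: "nat \<Rightarrow> 'a set" where V: "finite {i. V i \<noteq> UNIV}" "\<And>i. w i \<in> V i" "Pi UNIV V \<subseteq> U"
    by (auto simp: PiE_UNIV_domain)
  obtain n where n: "\<And>i. V i \<noteq> UNIV \<Longrightarrow> i < n"
    using finite_nat_bounded[OF V(1)] by auto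
  have "prefix n w \<frown> z \<in> Pi UNIV V" for z
  proof
    fix i show "(prefix n w \<frown> z) i \<in> V i"
    proof (cases "i < n")
      case True
      then have "(prefix n w \<frown> z) i = w i" by simp
      then show ?thesis using V(2) by simp
    next
      case False
      then show ?thesis using n by blast
    qed
  qed
  then show ?thesis using that V(3) by blast
qed

lemma prob_bernoulli: "prob_space (bernoulli :: (nat \<Rightarrow> 'x::finite) measure)"
  unfolding bernoulli_def by (intro prob_space_PiM prob_space_uniform_count_measure) auto

lemma space_bernoulli [simp]: "space (bernoulli :: (nat \<Rightarrow> 'x::finite) measure) = UNIV"
  by (simp add: bernoulli_def space_PiM space_uniform_count_measure PiE_UNIV_domain)

lemma prefix_eq_iff: "prefix (length u) w = u \<longleftrightarrow> (\<forall>i<length u. w i = u ! i)"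
  by (auto simp only: list_eq_iff_nth_eq subsequence_length) simp_all

text \<open>
  A cylinder is a product set with finitely many constrained coordinates, the form in which the
  product measure is computed.
\<close>

lemma cylinder_emb:
  "{w. prefix (length u) w = u} =
     prod_emb UNIV (\<lambda>_::nat. uniform_count_measure UNIV) {..<length u} (\<Pi>\<^sub>E i\<in>{..<length u}. {u ! i})"
  (is "?C = ?E")
proof -
  have "w \<in> ?C \<longleftrightarrow> restrict w {..<length u} \<in> (\<Pi>\<^sub>E i\<in>{..<length u}. {u ! i})" for w
    unfolding mem_Collect_eq prefix_eq_iff by (auto simp: PiE_iff)
  also have "restrict w {..<length u} \<in> (\<Pi>\<^sub>E i\<in>{..<length u}. {u ! i}) \<longleftrightarrow> w \<in> ?E" for w
    by (simp add: prod_emb_def space_uniform_count_measure PiE_UNIV_domain)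
  finally show ?thesis by blast
qed

lemma cylinder_measure:
  fixes u :: "'x::finite list"
  shows "{w. prefix (length u) w = u} \<in> sets bernoulli"
    and "measure bernoulli {w. prefix (length u) w = u} = 1 / real CARD('x) ^ length u"
proof -
  let ?M = "\<lambda>_::nat. uniform_count_measure (UNIV :: 'x set)"
  interpret product_prob_space ?M UNIV
    by (intro product_prob_spaceI prob_space_uniform_count_measure) auto
  show "{w. prefix (length u) w = u} \<in> sets bernoulli"
    unfolding cylinder_emb bernoulli_def
    by (intro sets_PiM_I) (auto simp: sets_uniform_count_measure)
  have "measure bernoulli {w. prefix (length u) w = u} = (\<Prod>i<length u. measure (?M i) {u ! i})"
    unfolding cylinder_emb bernoulli_def
    by (rule measure_PiM_emb) (auto simp: sets_uniform_count_measure)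
  also have "\<dots> = 1 / real CARD('x) ^ length u"
    by (simp add: measure_uniform_count_measure power_one_over)
  finally show "measure bernoulli {w. prefix (length u) w = u} = 1 / real CARD('x) ^ length u" .
qed

lemma cylinders_measure:
  fixes A :: "'x::finite list set"
  assumes "A \<subseteq> {u. length u = n}"
  shows "{w. prefix n w \<in> A} \<in> sets bernoulli"
    "measure bernoulli {w. prefix n w \<in> A} = real (card A) / real CARD('x) ^ n"
proof -
  interpret prob_space "bernoulli :: (nat \<Rightarrow> 'x) measure" by (rule prob_bernoulli)
  have fin: "finite A"
    using finite_subset[OF assms] finite_lists_length_eq[of "UNIV :: 'x set" n] by simp
  have eq: "{w. prefix n w \<in> A} = (\<Union>u\<in>A. {w. prefix n w = u})" by auto
  have n: "n = length u" if "u \<in> A" for u using assms that by auto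
  show "{w. prefix n w \<in> A} \<in> sets bernoulli"
    unfolding eq by (intro sets.finite_UN fin) (simp add: n cylinder_measure)
  have "measure bernoulli {w. prefix n w \<in> A} = (\<Sum>u\<in>A. measure bernoulli {w. prefix n w = u})"
    unfolding eq
    by (rule finite_measure_finite_Union[OF fin])
       (auto simp: n cylinder_measure disjoint_family_on_def)
  also have "\<dots> = (\<Sum>u\<in>A. 1 / real CARD('x) ^ n)"
    by (rule sum.cong) (auto simp: n cylinder_measure)
  finally show "measure bernoulli {w. prefix n w \<in> A} = real (card A) / real CARD('x) ^ n" by simp
qed

locale generic_action = self_similar G \<phi>
  for G :: "('g, 'm) monoid_scheme" (structure)
    and \<phi> :: "'g \<Rightarrow> (nat \<Rightarrow> 'x::finite) \<Rightarrow> (nat \<Rightarrow> 'x)" +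
  assumes generic: "measure bernoulli (generic_points G \<phi>) = 1"
begin

text \<open>
  The cylinders of these words decrease with \<open>n\<close>. A point in all of them is fixed by \<open>g\<close>, but \<open>g\<close>
  fixes no cylinder around it, so it is not \<open>g\<close>-generic.
\<close>

lemma nontrivially_fixed_words_density:
  assumes g: "g \<in> carrier G"
  shows "(\<lambda>n. real (card (nontrivially_fixed_words g n)) / real CARD('x) ^ n) \<longlonglongrightarrow> 0"
proof -
  interpret prob_space "bernoulli :: (nat \<Rightarrow> 'x) measure" by (rule prob_bernoulli)
  let ?D = "\<lambda>n. {w :: nat \<Rightarrow> 'x. prefix n w \<in> nontrivially_fixed_words g n}"
  have D: "?D n \<in> sets bernoulli"
    "measure bernoulli (?D n) = real (card (nontrivially_fixed_words g n)) / real CARD('x) ^ n" for n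
    by (rule cylinders_measure; auto simp: nontrivially_fixed_words_def)+
  have "decseq ?D"
  proof (rule decseq_SucI, rule subsetI)
    fix n w assume "w \<in> ?D (Suc n)"
    moreover have "prefix (Suc n) w = prefix n w @ [w n]" by (simp add: subsequence_def)
    ultimately have "act g (prefix n w) @ act (sec g (prefix n w)) [w n] = prefix n w @ [w n]"
      "sec (sec g (prefix n w)) [w n] \<noteq> \<one>"
      by (auto simp: nontrivially_fixed_words_def act_append sec_append simp del: act.simps sec.simps)
    moreover from this have "sec g (prefix n w) \<noteq> \<one>" by (metis act_one(2))
    ultimately show "w \<in> ?D n" by (simp add: nontrivially_fixed_words_def)
  qed
  then have lim: "(\<lambda>n. measure bernoulli (?D n)) \<longlonglongrightarrow> measure bernoulli (\<Inter>n. ?D n)"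
    by (intro finite_Lim_measure_decseq) (use D in auto)
  have gen: "generic_points G \<phi> \<in> sets bernoulli"
    using generic measure_notin_sets by fastforce
  have "(\<Inter>n. ?D n) \<subseteq> space bernoulli - generic_points G \<phi>"
  proof
    fix w assume "w \<in> (\<Inter>n. ?D n)"
    then have w: "act g (prefix n w) = prefix n w" "sec g (prefix n w) \<noteq> \<one>" for n
      by (auto simp: nontrivially_fixed_words_def)
    have "\<phi> g w = w"
    proof
      fix i
      have "\<phi> g w = \<phi> g (prefix (Suc i) w \<frown> suffix (Suc i) w)" by simp
      also have "\<dots> = act g (prefix (Suc i) w) \<frown> \<phi> (sec g (prefix (Suc i) w)) (suffix (Suc i) w)"
        by (rule action_conc[OF g])
      finally have "\<phi> g w = prefix (Suc i) w \<frown> \<phi> (sec g (prefix (Suc i) w)) (suffix (Suc i) w)"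
        by (simp only: w)
      then show "\<phi> g w i = w i" by simp
    qed
    moreover have False if U: "openin word_topology U" "w \<in> U" "\<forall>v\<in>U. \<phi> g v = v" for U
    proof -
      obtain n where "\<And>z. prefix n w \<frown> z \<in> U" using open_contains_cylinder[OF U(1,2)] by blast
      then have "sec g (prefix n w) = \<one>"
        using U(3) w(1) g by (subst sec_eq_one_iff) auto
      then show False using w(2) by blast
    qed
    ultimately have "w \<notin> generic_points G \<phi>"
      unfolding generic_points_def using g by blast
    then show "w \<in> space bernoulli - generic_points G \<phi>" by simp
  qed
  then have "measure bernoulli (\<Inter>n. ?D n) \<le> measure bernoulli (space bernoulli - generic_points G \<phi>)"
    by (rule finite_measure_mono) (rule sets.compl_sets[OF gen])
  also have "\<dots> = 0" using prob_compl[OF gen] generic by simp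
  finally have "measure bernoulli (\<Inter>n. ?D n) = 0" by (simp add: measure_le_0_iff)
  then show ?thesis using lim D by simp
qed

lemma undecided_words_density:
  assumes W: "letters W" "deg W = 0"
  shows "(\<lambda>n. real (card (undecided_words W n)) / real CARD('x) ^ n) \<longlonglongrightarrow> 0"
proof (rule LIMSEQ_offset)
  let ?K = "real CARD('x)"
  let ?g = "\<lambda>u. snd (the (run W (u, \<one>)))"
  let ?U = "{u. length u = length W \<and> run W (u, \<one>) \<noteq> None}"
  have "(\<lambda>m. \<Sum>u\<in>?U. real (card (nontrivially_fixed_words (?g u) m)) / ?K ^ m) \<longlonglongrightarrow>
      (\<Sum>u\<in>?U. 0)"
  proof (intro tendsto_sum nontrivially_fixed_words_density)
    fix u :: "'x list" assume "u \<in> ?U"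
    then show "?g u \<in> carrier G" using run_in[of W u \<one>] W by auto
  qed
  then have lim: "(\<lambda>m. \<Sum>u\<in>?U. real (card (nontrivially_fixed_words (?g u) m)) / ?K ^ m)
      \<longlonglongrightarrow> 0" by simp
  show "(\<lambda>m. real (card (undecided_words W (m + length W))) / ?K ^ (m + length W)) \<longlonglongrightarrow> 0"
  proof (rule tendsto_sandwich[OF _ _ tendsto_const lim]; intro always_eventually allI)
    fix m
    have "card (undecided_words W (length W + m)) \<le>
        (\<Sum>u\<in>?U. card (nontrivially_fixed_words (?g u) m))"
      by (rule card_undecided_words[OF W])
    then have "real (card (undecided_words W (length W + m))) \<le>
        (\<Sum>u\<in>?U. real (card (nontrivially_fixed_words (?g u) m)))"
      unfolding of_nat_sum[symmetric] of_nat_le_iff .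
    then have "real (card (undecided_words W (length W + m))) / ?K ^ (m + length W) \<le>
        (\<Sum>u\<in>?U. real (card (nontrivially_fixed_words (?g u) m))) / ?K ^ (m + length W)"
      by (intro divide_right_mono) auto
    also have "\<dots> \<le> (\<Sum>u\<in>?U. real (card (nontrivially_fixed_words (?g u) m))) / ?K ^ m"
      using card_alphabet by (intro divide_left_mono power_increasing sum_nonneg mult_pos_pos) auto
    finally show "real (card (undecided_words W (m + length W))) / ?K ^ (m + length W) \<le>
        (\<Sum>u\<in>?U. real (card (nontrivially_fixed_words (?g u) m)) / ?K ^ m)"
      by (simp add: sum_divide_distrib add.commute)
  qed auto
qed

end

section \<open>The gauge automorphisms of the free star-algebra\<close>

definition gauge_aut :: "real \<Rightarrow> ('g, 'x) gen free_elem \<Rightarrow> ('g, 'x) gen free_elem" where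
  "gauge_aut t f = (\<lambda>w. cis (t * real_of_int (deg w)) * f w)"

lemma gauge_aut_add: "gauge_aut t (f + g) = gauge_aut t f + gauge_aut t g"
  by (simp add: gauge_aut_def fun_simps distrib_left)

lemma gauge_aut_diff: "gauge_aut t (f - g) = gauge_aut t f - gauge_aut t g"
  by (simp add: gauge_aut_def fun_simps right_diff_distrib)

lemma gauge_aut_scale: "gauge_aut t (c \<bullet>\<^sub>c f) = c \<bullet>\<^sub>c gauge_aut t f"
  by (simp add: gauge_aut_def fun_simps mult.left_commute)

lemma gauge_aut_star: "gauge_aut t (star f) = star (gauge_aut t f)"
  by (simp add: gauge_aut_def star_def fun_eq_iff cis_cnj)

lemma gauge_aut_conv: "gauge_aut t (f \<diamondop> g) = gauge_aut t f \<diamondop> gauge_aut t g"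
proof
  fix w
  have "cis (t * deg w) * (f (take k w) * g (drop k w)) =
      (cis (t * deg (take k w)) * f (take k w)) * (cis (t * deg (drop k w)) * g (drop k w))" for k
  proof -
    have "deg w = deg (take k w) + deg (drop k w)"
      by (metis append_take_drop_id deg_simps(3))
    then show ?thesis by (simp add: cis_mult[symmetric] distrib_left)
  qed
  then show "gauge_aut t (f \<diamondop> g) w = (gauge_aut t f \<diamondop> gauge_aut t g) w"
    unfolding gauge_aut_def conv_def sum_distrib_left by (intro sum.cong refl)
qed

lemma gauge_aut_word: "gauge_aut t (word w) = cis (t * real_of_int (deg w)) \<bullet>\<^sub>c word w"
  by (auto simp: gauge_aut_def word_def fun_eq_iff scale_apply)

lemma gauge_aut_gauge_aut: "gauge_aut s (gauge_aut t f) = gauge_aut (s + t) f"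
  by (simp add: gauge_aut_def fun_eq_iff distrib_right flip: cis_mult)

lemma gauge_aut_zero [simp]: "gauge_aut 0 f = f"
  by (simp add: gauge_aut_def)

lemma gauge_aut_fcar [simp]: "f \<in> fcar Z \<Longrightarrow> gauge_aut t f \<in> fcar Z"
  by (simp add: fcar_def gauge_aut_def)

definition degree_zero_part :: "('g, 'x) gen free_elem \<Rightarrow> ('g, 'x) gen free_elem" where
  "degree_zero_part f = (\<lambda>w. if deg w = 0 then f w else 0)"

lemma degree_zero_part_fcar [simp]: "f \<in> fcar Z \<Longrightarrow> degree_zero_part f \<in> fcar Z"
  by (auto simp: fcar_def degree_zero_part_def elim: finite_subset[rotated])

lemma degree_zero_part_diff: "degree_zero_part (f - g) = degree_zero_part f - degree_zero_part g"
  by (auto simp: degree_zero_part_def fun_simps)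

definition degree_zero :: "('g, 'x) gen free_elem \<Rightarrow> bool" where
  "degree_zero f \<longleftrightarrow> degree_zero_part f = f"

lemma degree_zero_iff: "degree_zero f \<longleftrightarrow> (\<forall>w. deg w \<noteq> 0 \<longrightarrow> f w = 0)"
  by (auto simp: degree_zero_def degree_zero_part_def fun_eq_iff)

lemma degree_zero_gauge:
  assumes "degree_zero f" shows "gauge_aut t f = f"
proof
  fix w show "gauge_aut t f w = f w"
    using assms by (cases "deg w = 0") (simp_all add: degree_zero_iff gauge_aut_def)
qed

lemma degree_zero_simps:
  "degree_zero f \<Longrightarrow> degree_zero g \<Longrightarrow> degree_zero (f + g)"
  "degree_zero f \<Longrightarrow> degree_zero g \<Longrightarrow> degree_zero (f - g)"
  "degree_zero f \<Longrightarrow> degree_zero (c \<bullet>\<^sub>c f)"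
  "degree_zero f \<Longrightarrow> degree_zero (star f)"
  "degree_zero (0 :: ('g, 'x) gen free_elem)"
  "degree_zero (word w) \<longleftrightarrow> deg w = 0"
  "degree_zero (degree_zero_part f)"
  by (auto simp: degree_zero_iff plus_fun_apply minus_apply scale_apply zero_fun_apply star_def
      word_def degree_zero_part_def)

lemma degree_zero_conv:
  assumes "degree_zero f" "degree_zero g" shows "degree_zero (f \<diamondop> g)"
  unfolding degree_zero_iff
proof (intro allI impI)
  fix w :: "(('a, 'b) gen \<times> bool) list" assume w: "deg w \<noteq> 0"
  have "f (take k w) * g (drop k w) = 0" for k
  proof -
    have "deg w = deg (take k w) + deg (drop k w)" by (metis append_take_drop_id deg_simps(3))
    with w have "deg (take k w) \<noteq> 0 \<or> deg (drop k w) \<noteq> 0" by auto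
    then show ?thesis using assms by (auto simp: degree_zero_iff)
  qed
  then show "(f \<diamondop> g) w = 0" unfolding conv_def by (intro sum.neutral ballI)
qed

text \<open>
  For an element of the free algebra, which involves only finitely many degrees, the integral over
  the circle that projects to degree zero is a finite mean over roots of unity.
\<close>

lemma mean_roots_of_unity:
  assumes "N > 0" "\<bar>d\<bar> < int N"
  shows "(\<Sum>j<N. cis (2 * pi * real j / real N * real_of_int d)) = (if d = 0 then of_nat N else 0)"
proof (cases "d = 0")
  case False
  let ?z = "cis (2 * pi * real_of_int d / real N)"
  have pow: "cis (2 * pi * real j / real N * real_of_int d) = ?z ^ j" for j
    by (simp add: Complex.DeMoivre mult_ac)
  have "?z \<noteq> 1"
  proof
    assume "?z = 1"
    then have "cos (2 * pi * real_of_int d / real N) = 1" by (simp add: complex_eq_iff)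
    then obtain m :: int where "2 * pi * real_of_int d / real N = real_of_int m * 2 * pi"
      using cos_one_2pi_int by blast
    then have "real_of_int d = real_of_int (m * int N)" using assms(1) by (simp add: field_simps)
    then have "d = m * int N" by linarith
    then show False using assms False
      by (metis abs_mult abs_of_nat mult_le_cancel_right1 not_le abs_ge_zero zero_less_abs_iff
          mult_zero_left int_one_le_iff_zero_less of_nat_0_le_iff)
  qed
  moreover have "?z ^ N = 1"
  proof -
    have "?z ^ N = cis (2 * pi * real_of_int d)" using assms(1) by (simp add: Complex.DeMoivre)
    also have "\<dots> = 1" by (simp add: cis_multiple_2pi)
    finally show ?thesis .
  qed
  ultimately show ?thesis using False unfolding pow by (simp add: geometric_sum)
qed (use assms in simp)

lemma degree_zero_part_mean:
  assumes "f \<in> fcar Z"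
  obtains N where "N > 0"
    "degree_zero_part f = (\<Sum>j<N. (1 / of_nat N) \<bullet>\<^sub>c gauge_aut (2 * pi * real j / real N) f)"
proof -
  have "finite ((\<lambda>w. nat \<bar>deg w\<bar>) ` {w. f w \<noteq> 0})" using assms by (simp add: fcar_def)
  then obtain N where "(\<lambda>w. nat \<bar>deg w\<bar>) ` {w. f w \<noteq> 0} \<subseteq> {..<N}"
    using finite_nat_bounded by blast
  then have N: "nat \<bar>deg w\<bar> < N" if "f w \<noteq> 0" for w
    using that by (auto simp: image_subset_iff)
  define M where "M = Suc N"
  have M: "M > 0" by (simp add: M_def)
  have "degree_zero_part f w = (\<Sum>j<M. (1 / of_nat M) * (cis (2 * pi * real j / real M * deg w) * f w))" for w
  proof (cases "f w = 0")
    case False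
    have "(\<Sum>j<M. (1 / of_nat M) * (cis (2 * pi * real j / real M * deg w) * f w)) =
        (\<Sum>j<M. cis (2 * pi * real j / real M * deg w)) * (f w / of_nat M)"
      unfolding sum_distrib_right by (simp add: mult_ac)
    also have "\<dots> = (if deg w = 0 then of_nat M else 0) * (f w / of_nat M)"
      using N[OF False] by (subst mean_roots_of_unity) (auto simp: M_def)
    also have "\<dots> = degree_zero_part f w"
      using M by (simp add: degree_zero_part_def)
    finally show ?thesis by simp
  qed (simp add: degree_zero_part_def)
  then have "degree_zero_part f = (\<Sum>j<M. (1 / of_nat M) \<bullet>\<^sub>c gauge_aut (2 * pi * real j / real M) f)"
    by (intro ext) (simp only: sum_fun_apply scale_apply gauge_aut_def)
  then show ?thesis using that[of M] M by simp
qed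

context cstar_seminormed
begin

lemma mean_le:
  assumes "N > 0" "\<And>j. g j \<in> fcar Z" "\<And>j. p (g j) \<le> K"
  shows "p (\<Sum>j<N. (1 / of_nat N) \<bullet>\<^sub>c g j) \<le> K"
proof -
  have "p (\<Sum>j<N. (1 / of_nat N) \<bullet>\<^sub>c g j) \<le> (\<Sum>j<N. p ((1 / of_nat N) \<bullet>\<^sub>c g j))"
    using assms by (intro sum) auto
  also have "\<dots> = (\<Sum>j<N. p (g j) / N)" using assms by (simp add: scale norm_divide)
  also have "\<dots> \<le> (\<Sum>j<N. K / N)" using assms by (intro sum_mono divide_right_mono) auto
  also have "\<dots> = K" using assms(1) by simp
  finally show ?thesis .
qed

lemma mean_diff_le:
  assumes "N > 0" "\<And>j. g j \<in> fcar Z" "f \<in> fcar Z" "\<And>j. p (g j - f) \<le> K"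
  shows "p ((\<Sum>j<N. (1 / of_nat N) \<bullet>\<^sub>c g j) - f) \<le> K"
proof -
  have "(\<Sum>j<N. (1 / of_nat N) \<bullet>\<^sub>c g j) - f = (\<Sum>j<N. (1 / of_nat N) \<bullet>\<^sub>c (g j - f))"
    using assms(1) by (simp add: fun_simps sum_fun_apply sum_subtractf right_diff_distrib)
  then show ?thesis using mean_le[of N "\<lambda>j. g j - f" K] assms by simp
qed

end

section \<open>The universal seminorm\<close>

context self_similar
begin

abbreviation alg :: "('g, 'x) gen free_elem set" where "alg \<equiv> fcar (gens G)"

definition admissible :: "(('g, 'x) gen free_elem \<Rightarrow> real) \<Rightarrow> bool" where
  "admissible p \<longleftrightarrow> cstar_seminorm (free_star_algebra (gens G)) p \<and>
     (\<forall>(a, b)\<in>relations G \<phi>. p (a - b) = 0)"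

definition univ :: "('g, 'x) gen free_elem \<Rightarrow> real" where
  "univ = universal_seminorm (gens G) (relations G \<phi>)"

lemma univ_eq: "univ f = Sup {p f | p. admissible p}"
  by (simp add: univ_def universal_seminorm_def admissible_def)

abbreviation U :: "'g \<Rightarrow> ('g, 'x) gen free_elem" where "U g \<equiv> word [(Grp g, False)]"
abbreviation S :: "'x list \<Rightarrow> ('g, 'x) gen free_elem" where
  "S u \<equiv> word (map (\<lambda>x. (Iso x, False)) u)"

lemma S_fcar [simp]: "S u \<in> alg" by auto

lemma S_U_fcar [simp]: "g \<in> carrier G \<Longrightarrow> S u \<diamondop> U g \<in> alg"
  by (intro fcar_conv S_fcar) simp

lemma relations_eq:
  "relations G \<phi> =
     {(U g \<diamondop> U h, U (g \<otimes> h)) | g h. g \<in> carrier G \<and> h \<in> carrier G} \<union>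
     {(U \<one>, word [])} \<union>
     {(star (U g) \<diamondop> U g, word []) | g. g \<in> carrier G} \<union>
     {(U g \<diamondop> star (U g), word []) | g. g \<in> carrier G} \<union>
     {(star (S [x]) \<diamondop> S [y], if x = y then word [] else 0) | x y. True} \<union>
     {(\<Sum>x\<in>UNIV. S [x] \<diamondop> star (S [x]), word [])} \<union>
     {(U g \<diamondop> S [x], S [y] \<diamondop> U h) | g x y h. g \<in> carrier G \<and> h \<in> carrier G \<and>
        (\<forall>w. \<phi> g ([x] \<frown> w) = [y] \<frown> \<phi> h w)}"
proof -
  have "finsum (free_star_algebra (gens G)) (\<lambda>x. S [x] \<diamondop> star (S [x])) UNIV
      = (\<Sum>x\<in>UNIV. S [x] \<diamondop> star (S [x]))"
    by (rule finsum_free) auto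
  then show ?thesis
    unfolding relations_def Let_def free_star_algebra_simps free_gen_word by simp
qed

lemma relation_cases [consumes 1, case_names mult one left right iso sum self_similar]:
  assumes "(a, b) \<in> relations G \<phi>"
  obtains (mult) g h where "g \<in> carrier G" "h \<in> carrier G" "a = U g \<diamondop> U h" "b = U (g \<otimes> h)"
  | (one) "a = U \<one>" "b = word []"
  | (left) g where "g \<in> carrier G" "a = star (U g) \<diamondop> U g" "b = word []"
  | (right) g where "g \<in> carrier G" "a = U g \<diamondop> star (U g)" "b = word []"
  | (iso) x y where "a = star (S [x]) \<diamondop> S [y]" "b = (if x = y then word [] else 0)"
  | (sum) "a = (\<Sum>x\<in>UNIV. S [x] \<diamondop> star (S [x]))" "b = word []"
  | (self_similar) g x y h where "g \<in> carrier G" "h \<in> carrier G"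
      "\<forall>w. \<phi> g ([x] \<frown> w) = [y] \<frown> \<phi> h w" "a = U g \<diamondop> S [x]" "b = S [y] \<diamondop> U h"
  using assms unfolding relations_eq
  by (elim UnE CollectE exE conjE insertE emptyE; simp only: prod.inject; elim conjE;
      (rule mult, assumption+ | rule one, assumption+ | rule left, assumption+ | rule right, assumption+
       | rule iso, assumption+ | rule sum, assumption+ | rule self_similar, assumption+))

lemma relations_alg: "(a, b) \<in> relations G \<phi> \<Longrightarrow> a \<in> alg \<and> b \<in> alg"
  by (cases rule: relation_cases) (auto intro!: fcar_sum)

text \<open>
  The two sides of a relation have the same degree: \<open>1\<close> for the self-similarity relations and \<open>0\<close>
  for the others.
\<close>

lemma relation_gauge:
  assumes "(a, b) \<in> relations G \<phi>"
  obtains c where "cmod c = 1" "gauge_aut t (a - b) = c \<bullet>\<^sub>c (a - b)"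
proof -
  have sum0: "gauge_aut t (\<Sum>x\<in>X. word [(Iso x, False), (Iso x, True)]) =
      (\<Sum>x\<in>X. word [(Iso x, False), (Iso x, True)] :: ('g, 'x) gen free_elem)" for X :: "'x set"
    by (rule degree_zero_gauge, induction X rule: infinite_finite_induct)
       (auto intro!: degree_zero_simps(1,5) simp: degree_zero_simps(6))
  have "gauge_aut t a = 1 \<bullet>\<^sub>c a \<and> gauge_aut t b = 1 \<bullet>\<^sub>c b \<or> gauge_aut t a = cis t \<bullet>\<^sub>c a \<and> gauge_aut t b = cis t \<bullet>\<^sub>c b"
    using assms
    by (cases rule: relation_cases)
       (auto simp: star_word word_conv_word gauge_aut_word sum0 degree_zero_gauge degree_zero_simps)
  then show ?thesis
    using that[of 1] that[of "cis t"] by (auto simp: gauge_aut_diff scale_diff_right)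
qed

lemma admissible_zero: "admissible (\<lambda>f. 0)"
  by (simp add: admissible_def cstar_seminorm_def)

lemma admissible_gauge: assumes "admissible p" shows "admissible (\<lambda>f. p (gauge_aut t f))"
proof -
  interpret cstar_seminormed "gens G" p using assms by (simp add: admissible_def cstar_seminormed_def)
  have "p (gauge_aut t (a - b)) = 0" if ab: "(a, b) \<in> relations G \<phi>" for a b
  proof -
    obtain c where c: "gauge_aut t (a - b) = c \<bullet>\<^sub>c (a - b)" by (rule relation_gauge[OF ab])
    have "p (c \<bullet>\<^sub>c (a - b)) = cmod c * p (a - b)" by (rule scale) (use relations_alg[OF ab] in auto)
    also have "p (a - b) = 0" using assms ab by (auto simp: admissible_def)
    finally show ?thesis using c by simp
  qed
  then show ?thesis
    unfolding admissible_def cstar_seminorm_def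
    by (auto simp: gauge_aut_add gauge_aut_scale gauge_aut_conv gauge_aut_star nonneg triangle scale submult star_square)
qed

lemma admissible_null:
  assumes "admissible p" "(a, b) \<in> relations G \<phi>" shows "p a = p b"
proof -
  interpret cstar_seminormed "gens G" p using assms by (simp add: admissible_def cstar_seminormed_def)
  have "p (a - b) = 0" using assms by (auto simp: admissible_def)
  then show ?thesis using abs_diff_le[of a b] relations_alg[OF assms(2)] by simp
qed

text \<open>The \<open>C\<^sup>*\<close>-identity turns \<open>z\<^sup>* z = 1\<close> into a bound for the generator \<open>z\<close>.\<close>

lemma admissible_letter_le: assumes "admissible p" "fst l \<in> gens G" shows "p (word [l]) \<le> 1"
proof -
  interpret cstar_seminormed "gens G" p using assms by (simp add: admissible_def cstar_seminormed_def)
  have "(p (word []))\<^sup>2 = p (word [])" using star_square[of "word []"] by (simp add: star_word)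
  then have one: "p (word []) \<le> 1"
    by (metis order_refl mult_cancel_right1 power2_eq_square zero_le_one)
  have sq: "(p (word [(fst l, False)]))\<^sup>2 \<le> 1"
  proof (cases "fst l")
    case (Grp g)
    then have "(star (U g) \<diamondop> U g, word []) \<in> relations G \<phi>"
      using assms(2) unfolding relations_eq by auto
    then show ?thesis using admissible_null[OF assms(1)] star_square[of "U g"] Grp one assms(2) by simp
  next
    case (Iso x)
    have "(star (S [x]) \<diamondop> S [x], if x = x then word [] else 0) \<in> relations G \<phi>"
      unfolding relations_eq by blast
    then show ?thesis using admissible_null[OF assms(1)] star_square[of "S [x]"] Iso one by simp
  qed
  have le: "p (word [(fst l, False)]) \<le> 1"
    using power2_le_imp_le[of "p (word [(fst l, False)])" 1] sq by simp
  show ?thesis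
  proof (cases "snd l")
    case True
    then have "word [l] = star (word [(fst l, False)])" by (cases l) (simp add: star_word)
    then show ?thesis using le assms(2) by (simp add: star)
  next
    case False
    then have "l = (fst l, False)" by (cases l) simp
    then show ?thesis using le by metis
  qed
qed

lemma admissible_word_le: assumes "admissible p" "letters w" shows "p (word w) \<le> 1"
  using assms(2)
proof (induction w)
  interpret cstar_seminormed "gens G" p using assms by (simp add: admissible_def cstar_seminormed_def)
  {
    case Nil
    have "(p (word []))\<^sup>2 = p (word [])" using star_square[of "word []"] by (simp add: star_word)
    then show ?case
      by (metis order_refl mult_cancel_right1 power2_eq_square zero_le_one)
  next
    case (Cons l w)
    have "p (word (l # w)) = p (word [l] \<diamondop> word w)" by (simp add: word_conv_word)
    also have "\<dots> \<le> p (word [l]) * p (word w)" using Cons.prems by (intro submult) auto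
    also have "\<dots> \<le> 1 * 1"
      using Cons admissible_letter_le[OF assms(1), of l] by (intro mult_mono nonneg) auto
    finally show ?case by simp
  }
qed

text \<open>This bound does not depend on \<open>p\<close>, so the supremum in the universal seminorm is finite.\<close>

lemma admissible_bound:
  assumes "admissible p" "f \<in> alg" shows "p f \<le> (\<Sum>w\<in>{w. f w \<noteq> 0}. cmod (f w))"
proof -
  interpret cstar_seminormed "gens G" p using assms by (simp add: admissible_def cstar_seminormed_def)
  have w: "letters w" if "f w \<noteq> 0" for w using assms that by (simp add: fcar_def)
  have "p f = p (\<Sum>w\<in>{w. f w \<noteq> 0}. f w \<bullet>\<^sub>c word w)" using fcar_expand[OF assms(2)] by simp
  also have "\<dots> \<le> (\<Sum>w\<in>{w. f w \<noteq> 0}. p (f w \<bullet>\<^sub>c word w))" using w by (intro sum fcar_scale) auto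
  also have "\<dots> = (\<Sum>w\<in>{w. f w \<noteq> 0}. cmod (f w) * p (word w))" using w by (intro sum.cong) (auto simp: scale)
  also have "\<dots> \<le> (\<Sum>w\<in>{w. f w \<noteq> 0}. cmod (f w))"
    using w admissible_word_le[OF assms(1)] by (intro sum_mono mult_left_le) auto
  finally show ?thesis .
qed

lemma univ_upper: "admissible p \<Longrightarrow> f \<in> alg \<Longrightarrow> p f \<le> univ f"
  unfolding univ_eq using admissible_bound[of _ f] by (intro cSup_upper) (auto simp: bdd_above_def)

lemma univ_least: "(\<And>p. admissible p \<Longrightarrow> p f \<le> K) \<Longrightarrow> univ f \<le> K"
  unfolding univ_eq using admissible_zero by (intro cSup_least) auto

lemma univ_nonneg: "f \<in> alg \<Longrightarrow> 0 \<le> univ f"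
  using univ_upper[OF admissible_zero] .

text \<open>The defining conditions of an admissible seminorm pass to pointwise suprema, the \<open>C\<^sup>*\<close>-identity
  because the square root is monotone.\<close>

lemma admissible_univ: "admissible univ"
  unfolding admissible_def cstar_seminorm_def free_star_algebra_simps
proof (intro conjI ballI allI)
  have sn: "cstar_seminormed (gens G) p" if "admissible p" for p
    using that by (simp add: admissible_def cstar_seminormed_def)
  note r = cstar_seminormed.triangle[OF sn] cstar_seminormed.submult[OF sn] cstar_seminormed.scale[OF sn]
    cstar_seminormed.nonneg[OF sn] cstar_seminormed.star_square[OF sn]
  show "0 \<le> univ a" if "a \<in> alg" for a using that by (rule univ_nonneg)
  show "univ (a + b) \<le> univ a + univ b" if ab: "a \<in> alg" "b \<in> alg" for a b
  proof (rule univ_least)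
    fix p assume p: "admissible p"
    have "p (a + b) \<le> p a + p b" by (rule r(1)[OF p ab])
    also have "\<dots> \<le> univ a + univ b" by (intro add_mono univ_upper p ab)
    finally show "p (a + b) \<le> univ a + univ b" .
  qed
  show "univ (a \<diamondop> b) \<le> univ a * univ b" if ab: "a \<in> alg" "b \<in> alg" for a b
  proof (rule univ_least)
    fix p assume p: "admissible p"
    have "p (a \<diamondop> b) \<le> p a * p b" by (rule r(2)[OF p ab])
    also have "\<dots> \<le> univ a * univ b"
      by (intro mult_mono univ_upper p ab univ_nonneg r(4)[OF p])
    finally show "p (a \<diamondop> b) \<le> univ a * univ b" .
  qed
  have le: "univ (c \<bullet>\<^sub>c a) \<le> cmod c * univ a" if a: "a \<in> alg" for a c
  proof (rule univ_least)
    fix p assume p: "admissible p"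
    have "p (c \<bullet>\<^sub>c a) = cmod c * p a" by (rule r(3)[OF p a])
    also have "\<dots> \<le> cmod c * univ a" by (intro mult_left_mono univ_upper p a) auto
    finally show "p (c \<bullet>\<^sub>c a) \<le> cmod c * univ a" .
  qed
  show "univ (c \<bullet>\<^sub>c a) = cmod c * univ a" if a: "a \<in> alg" for a c
  proof (cases "c = 0")
    case True
    then show ?thesis using le[OF a, of c] univ_nonneg[of "c \<bullet>\<^sub>c a"] a by simp
  next
    case False
    have "univ a \<le> cmod (1 / c) * univ (c \<bullet>\<^sub>c a)"
      using le[of "c \<bullet>\<^sub>c a" "1 / c"] a False by simp
    then have "cmod c * univ a \<le> univ (c \<bullet>\<^sub>c a)" using False by (simp add: norm_divide field_simps)
    then show ?thesis using le[OF a, of c] by simp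
  qed
  show "univ (star a \<diamondop> a) = (univ a)\<^sup>2" if a: "a \<in> alg" for a
  proof (rule antisym)
    show "univ (star a \<diamondop> a) \<le> (univ a)\<^sup>2"
    proof (rule univ_least)
      fix p assume p: "admissible p"
      have "p (star a \<diamondop> a) = (p a)\<^sup>2" by (rule r(5)[OF p a])
      also have "\<dots> \<le> (univ a)\<^sup>2" by (intro power_mono univ_upper p a r(4)[OF p])
      finally show "p (star a \<diamondop> a) \<le> (univ a)\<^sup>2" .
    qed
    have "univ a \<le> sqrt (univ (star a \<diamondop> a))"
    proof (rule univ_least)
      fix p assume p: "admissible p"
      have "(p a)\<^sup>2 \<le> univ (star a \<diamondop> a)"
        using r(5)[OF p a] univ_upper[OF p, of "star a \<diamondop> a"] a by simp
      then show "p a \<le> sqrt (univ (star a \<diamondop> a))" by (rule real_le_rsqrt)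
    qed
    then have "(univ a)\<^sup>2 \<le> (sqrt (univ (star a \<diamondop> a)))\<^sup>2"
      by (intro power_mono univ_nonneg a)
    then show "(univ a)\<^sup>2 \<le> univ (star a \<diamondop> a)" using univ_nonneg[of "star a \<diamondop> a"] a by simp
  qed
next
  fix r assume "r \<in> relations G \<phi>"
  then obtain a b where ab: "r = (a, b)" "(a, b) \<in> relations G \<phi>" by (cases r) auto
  have "univ (a - b) \<le> 0" by (rule univ_least) (use ab in \<open>auto simp: admissible_def\<close>)
  then show "case r of (a, b) \<Rightarrow> univ (a - b) = 0"
    using ab univ_nonneg[of "a - b"] relations_alg[OF ab(2)] by simp
qed

text \<open>Composition with a gauge automorphism permutes the admissible seminorms.\<close>

lemma univ_gauge: assumes "f \<in> alg" shows "univ (gauge_aut t f) = univ f"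
proof -
  have le: "univ (gauge_aut t f) \<le> univ f" if "f \<in> alg" for t f
    by (rule univ_least) (rule univ_upper[OF admissible_gauge that])
  show ?thesis
    using le[OF assms, of t] le[of "gauge_aut t f" "- t"] assms by (simp add: gauge_aut_gauge_aut)
qed

sublocale univ: cstar_seminormed "gens G" univ
  using admissible_univ by (simp add: admissible_def cstar_seminormed_def)

section \<open>Consequences of the relations\<close>

text \<open>Equality in the universal \<open>C\<^sup>*\<close>-algebra.\<close>

definition eqv :: "('g, 'x) gen free_elem \<Rightarrow> ('g, 'x) gen free_elem \<Rightarrow> bool" (infix "\<doteq>" 50) where
  "a \<doteq> b \<longleftrightarrow> a \<in> alg \<and> b \<in> alg \<and> univ (a - b) = 0"

lemma eqv_refl: "a \<in> alg \<Longrightarrow> a \<doteq> a" by (simp add: eqv_def)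

lemma eqv_sym: "a \<doteq> b \<Longrightarrow> b \<doteq> a" by (auto simp: eqv_def univ.diff_commute)

lemma eqv_trans [trans]: "a \<doteq> b \<Longrightarrow> b \<doteq> c \<Longrightarrow> a \<doteq> c"
  using univ.diff_triangle[of a b c] univ.nonneg[of "a - c"] by (auto simp: eqv_def)

lemma eqv_add: "a \<doteq> b \<Longrightarrow> c \<doteq> d \<Longrightarrow> a + c \<doteq> b + d"
  using univ.triangle[of "a - b" "c - d"] univ.nonneg[of "(a + c) - (b + d)"]
  by (auto simp: eqv_def algebra_simps)

lemma eqv_conv: "a \<doteq> b \<Longrightarrow> c \<doteq> d \<Longrightarrow> a \<diamondop> c \<doteq> b \<diamondop> d"
  using univ.conv_diff_le[of a c b d] univ.nonneg[of "a \<diamondop> c - b \<diamondop> d"] by (auto simp: eqv_def)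

lemma eqv_left: "a \<in> alg \<Longrightarrow> c \<doteq> d \<Longrightarrow> a \<diamondop> c \<doteq> a \<diamondop> d"
  and eqv_right: "a \<in> alg \<Longrightarrow> c \<doteq> d \<Longrightarrow> c \<diamondop> a \<doteq> d \<diamondop> a"
  by (auto intro: eqv_conv eqv_refl)

lemma eqv_sum: "(\<And>i. i \<in> X \<Longrightarrow> f i \<doteq> h i) \<Longrightarrow> sum f X \<doteq> sum h X"
  by (induction X rule: infinite_finite_induct) (auto intro: eqv_add eqv_refl)

lemma eqv_relation: "(a, b) \<in> relations G \<phi> \<Longrightarrow> a \<doteq> b"
  using admissible_univ relations_alg[of a b] by (auto simp: eqv_def admissible_def)

lemma rel_mult: "g \<in> carrier G \<Longrightarrow> h \<in> carrier G \<Longrightarrow> U g \<diamondop> U h \<doteq> U (g \<otimes> h)"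
  and rel_one: "U \<one> \<doteq> word []"
  and rel_left: "g \<in> carrier G \<Longrightarrow> star (U g) \<diamondop> U g \<doteq> word []"
  and rel_iso: "star (S [x]) \<diamondop> S [y] \<doteq> (if x = y then word [] else 0)"
  and rel_sum: "(\<Sum>x\<in>UNIV. S [x] \<diamondop> star (S [x])) \<doteq> word []"
  and rel_self_similar: "g \<in> carrier G \<Longrightarrow> h \<in> carrier G \<Longrightarrow>
     (\<And>w. \<phi> g ([x] \<frown> w) = [y] \<frown> \<phi> h w) \<Longrightarrow> U g \<diamondop> S [x] \<doteq> S [y] \<diamondop> U h"
  by (rule eqv_relation; unfold relations_eq; blast)+

lemma U_alg: "g \<in> carrier G \<Longrightarrow> U g \<in> alg" by simp

lemma star_U: assumes g: "g \<in> carrier G" shows "star (U g) \<doteq> U (inv g)"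
proof -
  have "word [] \<doteq> U g \<diamondop> U (inv g)"
    using eqv_trans[OF rel_mult[of g "inv g"]] rel_one g by (auto intro: eqv_sym)
  then have "star (U g) \<diamondop> word [] \<doteq> star (U g) \<diamondop> (U g \<diamondop> U (inv g))"
    using g by (intro eqv_left) auto
  also have "\<dots> \<doteq> word [] \<diamondop> U (inv g)"
    unfolding conv_assoc[symmetric] using g by (intro eqv_right rel_left) auto
  finally show ?thesis by simp
qed

lemma S_Cons: "S (x # u) = S [x] \<diamondop> S u" and S_append: "S (u @ v) = S u \<diamondop> S v"
  by (simp_all add: word_conv_word)

lemma U_S: "g \<in> carrier G \<Longrightarrow> U g \<diamondop> S u \<doteq> S (act g u) \<diamondop> U (sec g u)"
proof (induction u arbitrary: g)
  case Nil
  then show ?case by (simp add: eqv_refl)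
next
  case (Cons x u)
  let ?h = "snd (letter_step g x)" and ?y = "fst (letter_step g x)"
  have h: "?h \<in> carrier G" using letter_step Cons.prems by blast
  have "U g \<diamondop> S [x] \<diamondop> S u \<doteq> S [?y] \<diamondop> U ?h \<diamondop> S u"
    using Cons.prems h by (intro eqv_right rel_self_similar letter_step) auto
  also have "S [?y] \<diamondop> U ?h \<diamondop> S u \<doteq> S [?y] \<diamondop> (S (act ?h u) \<diamondop> U (sec ?h u))"
    unfolding conv_assoc by (intro eqv_left Cons.IH h) auto
  finally show ?case
    unfolding S_Cons[of x u] act.simps sec.simps S_Cons[of ?y "act ?h u"] conv_assoc .
qed

text \<open>
  The element of the free algebra for which a state of \<open>run\<close> stands. The failure \<open>None\<close> stands for
  \<open>0\<close>; this is justified as long as \<open>u\<close> is not exhausted.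
\<close>

definition realize :: "('x list \<times> 'g) option \<Rightarrow> ('g, 'x) gen free_elem" where
  "realize s = (case s of None \<Rightarrow> 0 | Some (u, g) \<Rightarrow> S u \<diamondop> U g)"

lemma U_realize:
  assumes "a \<in> carrier G" "g \<in> carrier G"
  shows "U a \<diamondop> (S u \<diamondop> U g) \<doteq> S (act a u) \<diamondop> U (sec a u \<otimes> g)"
proof -
  have "U a \<diamondop> (S u \<diamondop> U g) \<doteq> S (act a u) \<diamondop> U (sec a u) \<diamondop> U g"
    unfolding conv_assoc[symmetric] using assms by (intro eqv_right U_S) auto
  also have "\<dots> \<doteq> S (act a u) \<diamondop> U (sec a u \<otimes> g)"
    unfolding conv_assoc using assms by (intro eqv_left rel_mult S_fcar) auto
  finally show ?thesis .
qed

lemma step_realize: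
  assumes "g \<in> carrier G" "fst l \<in> gens G" "u \<noteq> []"
  shows "word [l] \<diamondop> (S u \<diamondop> U g) \<doteq> realize (step l (u, g))"
proof (cases "(l, (u, g))" rule: step.cases)
  case (1 a b u' g')
  show ?thesis
  proof (cases b)
    case False
    then show ?thesis using 1 assms U_realize[of a g u] by (simp add: realize_def)
  next
    case True
    have "word [l] \<diamondop> (S u \<diamondop> U g) \<doteq> U (inv a) \<diamondop> (S u \<diamondop> U g)"
    proof (intro eqv_right fcar_conv S_fcar U_alg assms(1))
      have "a \<in> carrier G" "word [l] = star (U a)" using 1 assms True by (auto simp: star_word)
      then show "word [l] \<doteq> U (inv a)" using star_U by simp
    qed
    also have "\<dots> \<doteq> realize (step l (u, g))"
      using 1 assms True U_realize[of "inv a" g u] by (simp add: realize_def Let_def)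
    finally show ?thesis .
  qed
next
  case (2 x u' g')
  then show ?thesis
    using assms eqv_refl[of "S (x # u) \<diamondop> U g"] S_U_fcar[of g "x # u"]
    by (simp add: realize_def word_conv_word)
next
  case (3 x u' g')
  obtain y v where u: "u = y # v" using assms(3) by (cases u) auto
  have eq: "word [l] \<diamondop> (S u \<diamondop> U g) = (star (S [x]) \<diamondop> S [y]) \<diamondop> (S v \<diamondop> U g)"
    using 3 u by (auto simp: word_conv_word star_word)
  have "(star (S [x]) \<diamondop> S [y]) \<diamondop> (S v \<diamondop> U g) \<doteq> (if x = y then word [] else 0) \<diamondop> (S v \<diamondop> U g)"
    using assms by (intro eqv_right rel_iso S_U_fcar)
  moreover have "(if x = y then word [] else 0) \<diamondop> (S v \<diamondop> U g) = realize (step l (u, g))"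
    using 3 u by (auto simp: realize_def)
  ultimately show ?thesis unfolding eq by simp
qed

text \<open>Every letter removes at most one letter from \<open>u\<close>, so \<open>u\<close> is nonempty at each step.\<close>

lemma run_realize:
  assumes "g \<in> carrier G" "letters W" "length W \<le> length u"
  shows "word W \<diamondop> (S u \<diamondop> U g) \<doteq> realize (run W (u, g))"
  using assms
proof (induction W)
  case Nil
  then show ?case using eqv_refl[OF S_U_fcar] by (simp add: realize_def)
next
  case (Cons l W)
  have eq: "word (l # W) \<diamondop> (S u \<diamondop> U g) = word [l] \<diamondop> (word W \<diamondop> (S u \<diamondop> U g))"
    by (simp add: word_conv_word flip: conv_assoc)
  have "word [l] \<diamondop> (word W \<diamondop> (S u \<diamondop> U g)) \<doteq> word [l] \<diamondop> realize (run W (u, g))"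
    using Cons by (intro eqv_left Cons.IH) auto
  also have "\<dots> \<doteq> realize (run (l # W) (u, g))"
  proof (cases "run W (u, g)")
    case None
    then show ?thesis by (simp add: realize_def eqv_refl)
  next
    case (Some s)
    then obtain u1 g1 where s: "run W (u, g) = Some (u1, g1)" by (cases s) auto
    have "u1 \<noteq> []" using run_length[OF s] deg_ge[of W] Cons.prems by auto
    then show ?thesis
      using step_realize[of g1 l u1] run_in[OF s] Cons.prems s by (simp add: realize_def)
  qed
  finally show ?case unfolding eq .
qed

lemma S_star_S: "length u = length v \<Longrightarrow> star (S u) \<diamondop> S v \<doteq> (if u = v then word [] else 0)"
proof (induction u v rule: list_induct2)
  case Nil
  then show ?case by (simp add: star_word word_conv_word eqv_refl)
next
  case (Cons x u y v)
  have eq: "star (S (x # u)) \<diamondop> S (y # v) = star (S u) \<diamondop> (star (S [x]) \<diamondop> S [y]) \<diamondop> S v"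
    by (simp add: star_word word_conv_word)
  have 1: "star (S (x # u)) \<diamondop> S (y # v) \<doteq> star (S u) \<diamondop> (if x = y then word [] else 0) \<diamondop> S v"
    unfolding eq by (intro eqv_right eqv_left rel_iso fcar_star S_fcar)
  show ?case
  proof (cases "x = y")
    case True
    then show ?thesis using eqv_trans[OF 1] Cons.IH by simp
  next
    case False
    then show ?thesis using 1 by simp
  qed
qed

lemma sum_projections: "(\<Sum>u | length u = n. S u \<diamondop> star (S u)) \<doteq> word []"
proof (induction n)
  case 0
  then show ?case by (simp add: star_word word_conv_word eqv_refl)
next
  case (Suc n)
  have eq: "(\<Sum>u | length u = Suc n. S u \<diamondop> star (S u)) =
      (\<Sum>x\<in>UNIV. S [x] \<diamondop> (\<Sum>u | length u = n. S u \<diamondop> star (S u)) \<diamondop> star (S [x]))"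
  proof -
  have "(\<Sum>u | length u = Suc n. S u \<diamondop> star (S u)) =
      (\<Sum>(x, u)\<in>UNIV \<times> {u. length u = n}. S (x # u) \<diamondop> star (S (x # u)))"
    by (rule sum.reindex_bij_witness[of _ "\<lambda>(x, u). x # u" "\<lambda>u. (hd u, tl u)"])
       (auto simp: length_Suc_conv)
  also have "\<dots> = (\<Sum>x\<in>UNIV. \<Sum>u | length u = n. S [x] \<diamondop> (S u \<diamondop> star (S u)) \<diamondop> star (S [x]))"
  proof -
    have "S (x # u) \<diamondop> star (S (x # u)) = S [x] \<diamondop> (S u \<diamondop> star (S u)) \<diamondop> star (S [x])" for x u
      by (simp only: S_Cons[of x u] star_conv conv_assoc)
    then show ?thesis by (simp only: sum.cartesian_product[symmetric])
  qed
  also have "\<dots> = (\<Sum>x\<in>UNIV. S [x] \<diamondop> (\<Sum>u | length u = n. S u \<diamondop> star (S u)) \<diamondop> star (S [x]))"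
  proof (rule sum.cong)
    have *: "(\<Sum>u\<in>X. a \<diamondop> f u \<diamondop> b) = a \<diamondop> (\<Sum>u\<in>X. f u) \<diamondop> b"
      for a b and f :: "'x list \<Rightarrow> ('g, 'x) gen free_elem" and X
      by (induction X rule: infinite_finite_induct) (auto simp: conv_add_left conv_add_right)
    show "(\<Sum>u | length u = n. S [x] \<diamondop> (S u \<diamondop> star (S u)) \<diamondop> star (S [x])) =
      S [x] \<diamondop> (\<Sum>u | length u = n. S u \<diamondop> star (S u)) \<diamondop> star (S [x])" for x
      by (rule *)
  qed simp
  finally show ?thesis .
  qed
  have "(\<Sum>x\<in>UNIV. S [x] \<diamondop> (\<Sum>u | length u = n. S u \<diamondop> star (S u)) \<diamondop> star (S [x])) \<doteq>
      (\<Sum>x\<in>UNIV. S [x] \<diamondop> word [] \<diamondop> star (S [x]))"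
    by (rule eqv_sum, rule eqv_right[OF fcar_star[OF S_fcar] eqv_left[OF S_fcar Suc]])
  also have "\<dots> \<doteq> word []" using rel_sum by simp
  finally show ?case unfolding eq .
qed

section \<open>The trace of an element of the free algebra\<close>

definition tr :: "('g, 'x) gen free_elem \<Rightarrow> complex" where
  "tr f = (\<Sum>w\<in>{w. f w \<noteq> 0}. f w * of_real (word_trace w))"

lemma tr_superset: "finite X \<Longrightarrow> {w. f w \<noteq> 0} \<subseteq> X \<Longrightarrow> tr f = (\<Sum>w\<in>X. f w * of_real (word_trace w))"
  unfolding tr_def by (intro sum.mono_neutral_left) auto

lemma tr_add:
  assumes "f \<in> alg" "g \<in> alg" shows "tr (f + g) = tr f + tr g"
proof -
  let ?X = "{w. f w \<noteq> 0} \<union> {w. g w \<noteq> 0}"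
  have "finite ?X" using assms by (simp add: fcar_def)
  then show ?thesis
    by (subst (1 2 3) tr_superset[of ?X]) (auto simp: plus_fun_apply distrib_right sum.distrib)
qed

lemma tr_scale: assumes "f \<in> alg" shows "tr (c \<bullet>\<^sub>c f) = c * tr f"
proof -
  let ?X = "{w. f w \<noteq> 0}"
  have "finite ?X" using assms by (simp add: fcar_def)
  then show ?thesis
    by (subst (1 2) tr_superset[of ?X]) (auto simp: scale_apply mult.assoc sum_distrib_left)
qed

lemma tr_diff: "f \<in> alg \<Longrightarrow> g \<in> alg \<Longrightarrow> tr (f - g) = tr f - tr g"
  using tr_add[of "f - g" g] by simp

lemma tr_zero [simp]: "tr 0 = 0" by (simp add: tr_def zero_fun_apply)

lemma tr_word: "tr (word w) = of_real (word_trace w)"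
  by (subst tr_superset[of "{w}"]) (auto simp: word_def)

lemma word_trace_Nil: "word_trace [] = 1"
proof -
  have "fixed_words [] n = {u. length u = n}" for n by (auto simp: fixed_words_def)
  then have "density [] = (\<lambda>n. 1)" using card_pos by (simp add: density_def fun_eq_iff words_card)
  then show ?thesis by (simp add: word_trace_def)
qed

text \<open>
  A polynomial of degree zero is a combination of words of degree zero, so statements linear in
  the polynomial reduce to such words.
\<close>

lemma degree_zero_induct [consumes 2, case_names zero add word]:
  assumes "f \<in> alg" "degree_zero f" and "Q 0"
    and add: "\<And>f g. f \<in> alg \<Longrightarrow> g \<in> alg \<Longrightarrow> degree_zero f \<Longrightarrow> degree_zero g \<Longrightarrow> Q f \<Longrightarrow> Q g \<Longrightarrow> Q (f + g)"
    and word: "\<And>c w. letters w \<Longrightarrow> deg w = 0 \<Longrightarrow> Q (c \<bullet>\<^sub>c word w)"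
  shows "Q f"
proof -
  have "Q (degree_zero_part f)" using assms(1)
  proof (induction rule: fcar_induct)
    case zero
    have "degree_zero_part 0 = (0 :: ('g, 'x) gen free_elem)" by (auto simp: degree_zero_part_def fun_simps)
    then show ?case using assms(3) by simp
  next
    case (add f g)
    have "degree_zero_part (f + g) = degree_zero_part f + degree_zero_part g"
      by (auto simp: degree_zero_part_def fun_simps)
    then show ?case using add assms(4) by (simp add: degree_zero_simps)
  next
    case (word c w)
    have "degree_zero_part (c \<bullet>\<^sub>c word w) = (if deg w = 0 then c \<bullet>\<^sub>c word w else 0)"
      by (auto simp: degree_zero_part_def fun_simps word_def)
    then show ?case using word assms(3,5) by simp
  qed
  then show ?thesis using assms(2) by (simp add: degree_zero_def)
qed

lemma tr_commute:
  assumes "f \<in> alg" "degree_zero f" "g \<in> alg" "degree_zero g"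
  shows "tr (f \<diamondop> g) = tr (g \<diamondop> f)"
  using assms(1,2)
proof (induction rule: degree_zero_induct)
  case (add f1 f2)
  then show ?case using assms by (simp add: conv_add_left conv_add_right tr_add)
next
  case (word c v)
  from assms(3,4) show ?case
  proof (induction rule: degree_zero_induct)
    case (add f1 f2)
    then show ?case using word
      by (simp add: conv_add_left conv_add_right tr_add)
  next
    case (word d w)
    then show ?case using \<open>letters v\<close> \<open>deg v = 0\<close> word_trace_commute[of v w]
      by (simp add: conv_scale_left conv_scale_right word_conv_word tr_scale tr_word image_Un mult.left_commute)
  qed simp
qed simp

end

section \<open>Operators permuting the standard basis\<close>

text \<open>The adjoint of \<open>basis_op I f\<close>, see \<open>adj_basis_op\<close>.\<close>

definition pullback :: "'i set \<Rightarrow> ('i \<Rightarrow> 'i) \<Rightarrow> ('i \<Rightarrow> complex) \<Rightarrow> ('i \<Rightarrow> complex)" where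
  "pullback I f \<psi> = (\<lambda>i. if i \<in> I then \<psi> (f i) else 0)"

context
  fixes I :: "'i set" and f :: "'i \<Rightarrow> 'i"
  assumes inj: "inj_on f I" and into: "f ` I \<subseteq> I"
begin

lemma basis_op_ell2:
  assumes "\<psi> \<in> ell2 I"
  shows "basis_op I f \<psi> \<in> ell2 I" "ell2_norm I (basis_op I f \<psi>) \<le> ell2_norm I \<psi>"
proof -
  have "L2_set (\<lambda>i. cmod (basis_op I f \<psi> i)) F \<le> ell2_norm I \<psi>" if F: "finite F" "F \<subseteq> I" for F
  proof -
    let ?F = "{i \<in> I. f i \<in> F}"
    have F': "finite ?F" "?F \<subseteq> I"
      using finite_vimage_IntI[OF F(1) inj] by (auto simp: vimage_def Int_def conj_commute)
    have "(\<Sum>j\<in>F. (cmod (basis_op I f \<psi> j))\<^sup>2) = (\<Sum>j\<in>f ` ?F. (cmod (basis_op I f \<psi> j))\<^sup>2)"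
      by (rule sum.mono_neutral_right) (use F assms in \<open>auto simp: basis_op_def\<close>)
    also have "\<dots> = (\<Sum>i\<in>?F. (cmod (basis_op I f \<psi> (f i)))\<^sup>2)"
      by (rule sum.reindex[unfolded o_def]) (rule inj_on_subset[OF inj F'(2)])
    also have "\<dots> = (\<Sum>i\<in>?F. (cmod (\<psi> i))\<^sup>2)"
      by (rule sum.cong) (use assms inj in \<open>auto simp: basis_op_def inv_into_f_f\<close>)
    finally have "L2_set (\<lambda>i. cmod (basis_op I f \<psi> i)) F = L2_set (\<lambda>i. cmod (\<psi> i)) ?F"
      by (simp add: L2_set_def)
    also have "\<dots> \<le> ell2_norm I \<psi>" by (rule L2_le_ell2_norm[OF assms F'])
    finally show ?thesis .
  qed
  moreover have "basis_op I f \<psi> i = 0" if "i \<notin> I" for i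
    using that assms into by (auto simp: basis_op_def)
  ultimately show "basis_op I f \<psi> \<in> ell2 I" "ell2_norm I (basis_op I f \<psi>) \<le> ell2_norm I \<psi>"
    using ell2_bound[of I "basis_op I f \<psi>" "ell2_norm I \<psi>"] by blast+
qed

lemma pullback_ell2:
  assumes "\<psi> \<in> ell2 I"
  shows "pullback I f \<psi> \<in> ell2 I" "ell2_norm I (pullback I f \<psi>) \<le> ell2_norm I \<psi>"
proof -
  have "L2_set (\<lambda>i. cmod (pullback I f \<psi> i)) F \<le> ell2_norm I \<psi>" if F: "finite F" "F \<subseteq> I" for F
  proof -
    have "(\<Sum>i\<in>F. (cmod (pullback I f \<psi> i))\<^sup>2) = (\<Sum>i\<in>F. (cmod (\<psi> (f i)))\<^sup>2)"
      by (rule sum.cong) (use F in \<open>auto simp: pullback_def\<close>)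
    also have "\<dots> = (\<Sum>j\<in>f ` F. (cmod (\<psi> j))\<^sup>2)"
      by (rule sum.reindex[unfolded o_def, symmetric]) (rule inj_on_subset[OF inj F(2)])
    finally have "L2_set (\<lambda>i. cmod (pullback I f \<psi> i)) F = L2_set (\<lambda>i. cmod (\<psi> i)) (f ` F)"
      by (simp add: L2_set_def)
    also have "\<dots> \<le> ell2_norm I \<psi>" by (rule L2_le_ell2_norm[OF assms]) (use F into in auto)
    finally show ?thesis .
  qed
  then show "pullback I f \<psi> \<in> ell2 I" "ell2_norm I (pullback I f \<psi>) \<le> ell2_norm I \<psi>"
    using ell2_bound[of I "pullback I f \<psi>" "ell2_norm I \<psi>"] by (auto simp: pullback_def)
qed

lemma basis_op_bounded: "basis_op I f \<in> bounded_ops I"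
proof (rule opI[where K = 1])
  show "basis_op I f \<in> extensional (ell2 I)" unfolding basis_op_def by (rule restrict_extensional)
qed (use basis_op_ell2 in \<open>auto simp: basis_op_def fun_simps ell2_add ell2_scale\<close>)

lemma pullback_bounded: "restrict (pullback I f) (ell2 I) \<in> bounded_ops I"
proof (rule opI[where K = 1])
  show "restrict (pullback I f) (ell2 I) \<in> extensional (ell2 I)" by (rule restrict_extensional)
qed (use pullback_ell2 in \<open>auto simp: pullback_def fun_simps ell2_add ell2_scale\<close>)

lemma adj_basis_op: "adj (bounded_op_algebra I) (basis_op I f) = restrict (pullback I f) (ell2 I)"
proof (rule adj_unique[OF pullback_bounded])
  fix \<psi> \<eta> assume \<psi>: "\<psi> \<in> ell2 I" and \<eta>: "\<eta> \<in> ell2 I"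
  have "ell2_inner I \<psi> (basis_op I f \<eta>) = (\<Sum>\<^sub>\<infinity>j\<in>f ` I. cnj (\<psi> j) * basis_op I f \<eta> j)"
    unfolding ell2_inner_def
    by (rule infsum_cong_neutral) (use \<eta> into in \<open>auto simp: basis_op_def\<close>)
  also have "\<dots> = (\<Sum>\<^sub>\<infinity>i\<in>I. cnj (\<psi> (f i)) * basis_op I f \<eta> (f i))"
    by (simp add: infsum_reindex[OF inj] o_def)
  also have "\<dots> = ell2_inner I (pullback I f \<psi>) \<eta>"
    unfolding ell2_inner_def
    by (rule infsum_cong) (use \<eta> inj in \<open>auto simp: basis_op_def pullback_def inv_into_f_f\<close>)
  finally show "ell2_inner I (restrict (pullback I f) (ell2 I) \<psi>) \<eta> = ell2_inner I \<psi> (basis_op I f \<eta>)"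
    using \<psi> by simp
qed

end

section \<open>The representation on an orbit\<close>

lemma partial_map_apply:
  "(prepend u\<^sub>1 \<circ>\<^sub>m (Some \<circ> h) \<circ>\<^sub>m unprepend u\<^sub>2) w = Some v \<longleftrightarrow> (\<exists>z. w = u\<^sub>2 \<frown> z \<and> v = u\<^sub>1 \<frown> h z)"
  by (auto simp: map_comp_def prepend_def unprepend_def)

context self_similar
begin

lemma partial_orbit_iff:
  "v \<in> partial_orbit G \<phi> w \<longleftrightarrow>
     (\<exists>u\<^sub>1 u\<^sub>2 g z. g \<in> carrier G \<and> w = u\<^sub>2 \<frown> z \<and> v = u\<^sub>1 \<frown> \<phi> g z)"
proof -
  have "v \<in> partial_orbit G \<phi> w \<longleftrightarrow> (\<exists>u\<^sub>1 u\<^sub>2 g. g \<in> carrier G \<and>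
      (prepend u\<^sub>1 \<circ>\<^sub>m (Some \<circ> \<phi> g) \<circ>\<^sub>m unprepend u\<^sub>2) w = Some v)"
    unfolding partial_orbit_def partial_maps_def by blast
  then show ?thesis unfolding partial_map_apply by blast
qed

end

locale orbit_representation = self_similar G \<phi>
  for G :: "('g, 'm) monoid_scheme" (structure)
    and \<phi> :: "'g \<Rightarrow> (nat \<Rightarrow> 'x::finite) \<Rightarrow> (nat \<Rightarrow> 'x)" +
  fixes pt :: "nat \<Rightarrow> 'x"
begin

abbreviation orb :: "(nat \<Rightarrow> 'x) set" where "orb \<equiv> partial_orbit G \<phi> pt"
abbreviation BB where "BB \<equiv> bounded_op_algebra orb"

lemma orb_prepend: "v \<in> orb \<Longrightarrow> u \<frown> v \<in> orb"
  unfolding partial_orbit_iff by (metis conc_conc)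

lemma orb_build: "v \<in> orb \<Longrightarrow> build x v \<in> orb"
  using orb_prepend[of v "[x]"] by simp

lemma suffix_build [simp]: "suffix (Suc 0) (build x v) = v"
  by (rule ext) simp

lemma build_eq_iff: "build x v = j \<longleftrightarrow> j 0 = x \<and> suffix (Suc 0) j = v"
  using conc_prefix_suffix[of j 1] by (auto simp: subsequence_def suffix_build)

lemma orb_pt: "u \<frown> pt \<in> orb"
  unfolding partial_orbit_iff
  by (rule exI[of _ u], rule exI[of _ "[]"], rule exI[of _ \<one>], rule exI[of _ pt]) (simp add: action_one)

lemma orb_act:
  assumes "v \<in> orb" "g \<in> carrier G" shows "\<phi> g v \<in> orb"
proof -
  obtain u1 u2 h z where h: "h \<in> carrier G" "pt = u2 \<frown> z" "v = u1 \<frown> \<phi> h z"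
    using assms(1) unfolding partial_orbit_iff by blast
  have "\<phi> g v = act g u1 \<frown> \<phi> (sec g u1 \<otimes> h) z"
    unfolding h(3) using assms(2) h(1) by (simp add: action_conc action_mult)
  moreover have "sec g u1 \<otimes> h \<in> carrier G" using assms h by simp
  ultimately show ?thesis unfolding partial_orbit_iff using h(2) by blast
qed

text \<open>
  If the point arises with an empty prefix \<open>u\<^sub>1\<close>, one letter of \<open>z\<close> has to be moved to
  \<open>u\<^sub>2\<close> before the first letter can be deleted.
\<close>

lemma orb_tail:
  assumes "[x] \<frown> v \<in> orb" shows "v \<in> orb"
proof -
  obtain u1 u2 h z where h: "h \<in> carrier G" "pt = u2 \<frown> z" "[x] \<frown> v = u1 \<frown> \<phi> h z"
    using assms unfolding partial_orbit_iff by blast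
  show ?thesis
  proof (cases u1)
    case (Cons y u)
    then have "[x] \<frown> v = [y] \<frown> (u \<frown> \<phi> h z)" using h(3) by simp
    then have "v = u \<frown> \<phi> h z" by (simp only: conc_eq_iff list.size)
    then show ?thesis unfolding partial_orbit_iff using h by blast
  next
    case Nil
    have "z = [z 0] \<frown> suffix 1 z" using conc_prefix_suffix[of z 1] by (simp add: subsequence_def)
    then have "[x] \<frown> v = act h [z 0] \<frown> \<phi> (sec h [z 0]) (suffix 1 z)"
      using h Nil action_conc[OF h(1), of "[z 0]" "suffix 1 z"] by simp
    moreover have "length [x] = length (act h [z 0])" by (simp only: length_act list.size)
    ultimately have "v = \<phi> (sec h [z 0]) (suffix 1 z)" using conc_eq_iff by blast
    then have "v = [] \<frown> \<phi> (sec h [z 0]) (suffix 1 z)" by (simp only: conc_empty)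
    moreover have "pt = (u2 @ [z 0]) \<frown> suffix 1 z"
      using h(2) \<open>z = [z 0] \<frown> suffix 1 z\<close> by (metis conc_conc)
    moreover have "sec h [z 0] \<in> carrier G" by (rule sec_in[OF h(1)])
    ultimately show ?thesis unfolding partial_orbit_iff by blast
  qed
qed

fun gen_map :: "('g, 'x) gen \<Rightarrow> (nat \<Rightarrow> 'x) \<Rightarrow> (nat \<Rightarrow> 'x)" where
  "gen_map (Grp g) = \<phi> g"
| "gen_map (Iso x) = (\<lambda>v. [x] \<frown> v)"

definition gen_op :: "('g, 'x) gen \<Rightarrow> ((nat \<Rightarrow> 'x) \<Rightarrow> complex) \<Rightarrow> ((nat \<Rightarrow> 'x) \<Rightarrow> complex)" where
  "gen_op z = (case z of Grp g \<Rightarrow> basis_op orb (\<phi> g) | Iso x \<Rightarrow> basis_op orb (\<lambda>v. [x] \<frown> v))"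

lemma gen_op_eq: "gen_op z = basis_op orb (gen_map z)"
  by (cases z) (simp_all add: gen_op_def)

lemma gen_map_inj: "z \<in> gens G \<Longrightarrow> inj_on (gen_map z) orb"
  by (cases z) (auto simp: inj_on_def action_cancel)

lemma gen_map_into: "z \<in> gens G \<Longrightarrow> gen_map z ` orb \<subseteq> orb"
  by (cases z) (auto intro: orb_act orb_prepend[of _ "[_]", simplified])

text \<open>
  Explicit formulas for the operators of the generators and their adjoints. Unlike \<open>gen_op\<close> they
  are defined on all functions and involve no inverse of a map and no choice of an adjoint.
\<close>

fun letter_op :: "('g, 'x) gen \<times> bool \<Rightarrow> ((nat \<Rightarrow> 'x) \<Rightarrow> complex) \<Rightarrow> ((nat \<Rightarrow> 'x) \<Rightarrow> complex)" where
  "letter_op (Grp g, b) \<psi> = (\<lambda>j. if j \<in> orb then \<psi> (\<phi> (if b then g else inv g) j) else 0)"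
| "letter_op (Iso x, False) \<psi> = (\<lambda>j. if j \<in> orb \<and> j 0 = x then \<psi> (suffix 1 j) else 0)"
| "letter_op (Iso x, True) \<psi> = (\<lambda>j. if j \<in> orb then \<psi> ([x] \<frown> j) else 0)"

lemma letter_op_gen:
  assumes "z \<in> gens G" "\<psi> \<in> ell2 orb" shows "gen_op z \<psi> = letter_op (z, False) \<psi>"
proof
  fix j
  show "gen_op z \<psi> j = letter_op (z, False) \<psi> j"
  proof (cases z)
    case (Grp g)
    then have g: "g \<in> carrier G" using assms by simp
    have eq: "j \<in> gen_map z ` orb \<longleftrightarrow> j \<in> orb"
      using Grp g orb_act[of _ g] orb_act[of j "inv g"] action_inv(2)[OF g]
      by (auto simp: image_iff) (metis action_inv(2) inv_closed)
    have "inv_into orb (gen_map z) j = \<phi> (inv g) j" if "j \<in> orb"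
    proof (rule inv_into_f_eq[OF gen_map_inj[OF assms(1)]])
      show "\<phi> (inv g) j \<in> orb" using that g by (intro orb_act) auto
      show "gen_map z (\<phi> (inv g) j) = j" using Grp g action_inv(2) by simp
    qed
    then show ?thesis using Grp assms eq by (simp add: gen_op_eq basis_op_def)
  next
    case (Iso x)
    have split: "j = [x] \<frown> suffix 1 j" if "j 0 = x"
      using conc_prefix_suffix[of j 1] that by (simp add: subsequence_def)
    have eq: "j \<in> gen_map z ` orb \<longleftrightarrow> j \<in> orb \<and> j 0 = x"
    proof
      assume "j \<in> orb \<and> j 0 = x"
      then have "j = [x] \<frown> suffix 1 j" "suffix 1 j \<in> orb" using split orb_tail[of x "suffix 1 j"] by metis+
      then show "j \<in> gen_map z ` orb" using Iso by (metis gen_map.simps(2) image_eqI)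
    next
      assume "j \<in> gen_map z ` orb"
      then obtain v where "v \<in> orb" "j = [x] \<frown> v" using Iso by auto
      then show "j \<in> orb \<and> j 0 = x" using orb_build by auto
    qed
    have "inv_into orb (gen_map z) j = suffix 1 j" if j: "j \<in> orb" "j 0 = x"
    proof (rule inv_into_f_eq[OF gen_map_inj[OF assms(1)]])
      show "suffix 1 j \<in> orb" using j split orb_tail[of x "suffix 1 j"] by metis
      show "gen_map z (suffix 1 j) = j" using Iso split[OF j(2)] by simp
    qed
    then show ?thesis using Iso assms eq by (simp add: gen_op_eq basis_op_def)
  qed
qed

lemma letter_op_adj:
  assumes "z \<in> gens G" "\<psi> \<in> ell2 orb" shows "adj BB (gen_op z) \<psi> = letter_op (z, True) \<psi>"
  unfolding gen_op_eq adj_basis_op[OF gen_map_inj[OF assms(1)] gen_map_into[OF assms(1)]]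
  using assms by (cases z) (auto simp: pullback_def)

lemma gen_op_bounded: "z \<in> gens G \<Longrightarrow> gen_op z \<in> bounded_ops orb"
  unfolding gen_op_eq by (intro basis_op_bounded gen_map_inj gen_map_into)

abbreviation word_op :: "(('g, 'x) gen \<times> bool) list \<Rightarrow> ((nat \<Rightarrow> 'x) \<Rightarrow> complex) \<Rightarrow> ((nat \<Rightarrow> 'x) \<Rightarrow> complex)" where
  "word_op w \<psi> \<equiv> foldr letter_op w \<psi>"

definition eval_word :: "(('g, 'x) gen \<times> bool) list \<Rightarrow> ((nat \<Rightarrow> 'x) \<Rightarrow> complex) \<Rightarrow> ((nat \<Rightarrow> 'x) \<Rightarrow> complex)" where
  "eval_word w = foldr (\<lambda>(z, b) r. (if b then adj BB (gen_op z) else gen_op z) \<otimes>\<^bsub>BB\<^esub> r) w \<one>\<^bsub>BB\<^esub>"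

lemma eval_word:
  assumes "letters w"
  shows "eval_word w \<in> bounded_ops orb" "\<psi> \<in> ell2 orb \<Longrightarrow> eval_word w \<psi> = word_op w \<psi>"
proof -
  have "eval_word w \<in> bounded_ops orb \<and> (\<forall>\<psi>\<in>ell2 orb. eval_word w \<psi> = word_op w \<psi>)"
    using assms
  proof (induction w)
    case Nil
    then show ?case by (simp add: eval_word_def op_one BO_simps)
  next
    case (Cons l w)
    obtain z b where l: "l = (z, b)" by (cases l)
    let ?L = "if b then adj BB (gen_op z) else gen_op z"
    have z: "z \<in> gens G" using Cons.prems l by simp
    have L: "?L \<in> bounded_ops orb" using gen_op_bounded[OF z] op_adj(1)[OF gen_op_bounded[OF z]] by simp
    have w: "eval_word w \<in> bounded_ops orb" using Cons by simp
    have eq: "eval_word (l # w) = ?L \<otimes>\<^bsub>BB\<^esub> eval_word w" by (simp add: eval_word_def l)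
    have "eval_word (l # w) \<psi> = word_op (l # w) \<psi>" if \<psi>: "\<psi> \<in> ell2 orb" for \<psi>
    proof -
      have "eval_word w \<psi> = word_op w \<psi>" using Cons \<psi> by simp
      moreover have "eval_word w \<psi> \<in> ell2 orb" by (rule op_in[OF w \<psi>])
      ultimately show ?thesis
        unfolding eq using \<psi> z l by (auto simp: BO_simps letter_op_gen letter_op_adj)
    qed
    moreover have "eval_word (l # w) \<in> bounded_ops orb" unfolding eq by (rule op_mult(1)[OF L w])
    ultimately show ?case by blast
  qed
  then show "eval_word w \<in> bounded_ops orb" "\<psi> \<in> ell2 orb \<Longrightarrow> eval_word w \<psi> = word_op w \<psi>" by auto
qed

lemma word_op_in: "letters w \<Longrightarrow> \<psi> \<in> ell2 orb \<Longrightarrow> word_op w \<psi> \<in> ell2 orb"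
  using op_in[OF eval_word(1)] eval_word(2) by metis

definition rep :: "('g, 'x) gen free_elem \<Rightarrow> ((nat \<Rightarrow> 'x) \<Rightarrow> complex) \<Rightarrow> ((nat \<Rightarrow> 'x) \<Rightarrow> complex)" where
  "rep f = free_eval BB gen_op f"

lemma rep_bounded: "f \<in> alg \<Longrightarrow> rep f \<in> bounded_ops orb"
  unfolding rep_def free_eval_def eval_word_def[symmetric]
  by (intro op_finsum op_scal eval_word) (auto simp: fcar_def)

lemma rep_apply:
  assumes "f \<in> alg" "finite X" "{w. f w \<noteq> 0} \<subseteq> X" "\<psi> \<in> ell2 orb"
  shows "rep f \<psi> = (\<Sum>w\<in>X. f w \<bullet>\<^sub>c word_op w \<psi>)"
proof -
  have w: "letters w" if "f w \<noteq> 0" for w using assms(1) that by (simp add: fcar_def)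
  have "rep f \<psi> = (\<Sum>w\<in>{w. f w \<noteq> 0}. scal BB (f w) (eval_word w) \<psi>)"
    unfolding rep_def free_eval_def eval_word_def[symmetric]
    by (rule op_finsum(2)) (use assms w in \<open>auto intro!: op_scal eval_word simp: fcar_def\<close>)
  also have "\<dots> = (\<Sum>w\<in>{w. f w \<noteq> 0}. f w \<bullet>\<^sub>c word_op w \<psi>)"
    by (rule sum.cong) (use assms w in \<open>auto simp: BO_simps eval_word\<close>)
  also have "\<dots> = (\<Sum>w\<in>X. f w \<bullet>\<^sub>c word_op w \<psi>)"
    by (rule sum.mono_neutral_left) (use assms in auto)
  finally show ?thesis .
qed

lemma rep_word: "letters w \<Longrightarrow> \<psi> \<in> ell2 orb \<Longrightarrow> rep (word w) \<psi> = word_op w \<psi>"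
proof -
  assume "letters w" "\<psi> \<in> ell2 orb"
  moreover have "{v. word w v \<noteq> 0} \<subseteq> {w}" by (auto simp: word_def)
  ultimately have "rep (word w) \<psi> = (\<Sum>v\<in>{w}. word w v \<bullet>\<^sub>c word_op v \<psi>)"
    by (intro rep_apply) auto
  then show "rep (word w) \<psi> = word_op w \<psi>" by (simp add: word_def)
qed

lemma rep_add:
  assumes "f \<in> alg" "g \<in> alg" "\<psi> \<in> ell2 orb" shows "rep (f + g) \<psi> = rep f \<psi> + rep g \<psi>"
proof -
  let ?X = "{w. f w \<noteq> 0} \<union> {w. g w \<noteq> 0}"
  have X: "finite ?X" using assms by (simp add: fcar_def)
  have "(f w + g w) \<bullet>\<^sub>c a = f w \<bullet>\<^sub>c a + g w \<bullet>\<^sub>c a" for w and a :: "(nat \<Rightarrow> 'x) \<Rightarrow> complex"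
    by (simp add: fun_simps distrib_right)
  then show ?thesis
    using assms X by (subst (1 2 3) rep_apply[of _ ?X]) (auto simp: plus_fun_apply sum.distrib)
qed

lemma rep_scale:
  assumes "f \<in> alg" "\<psi> \<in> ell2 orb" shows "rep (c \<bullet>\<^sub>c f) \<psi> = c \<bullet>\<^sub>c rep f \<psi>"
proof -
  let ?X = "{w. f w \<noteq> 0}"
  have X: "finite ?X" using assms by (simp add: fcar_def)
  have *: "c \<bullet>\<^sub>c (\<Sum>w\<in>?X. h w) = (\<Sum>w\<in>?X. c \<bullet>\<^sub>c h w)" for h :: "_ \<Rightarrow> (nat \<Rightarrow> 'x) \<Rightarrow> complex"
    by (simp add: fun_simps sum_fun_apply sum_distrib_left)
  show ?thesis
    using assms X by (subst (1 2) rep_apply[of _ ?X]) (auto simp: * scale_apply)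
qed

lemma rep_zero: "\<psi> \<in> ell2 orb \<Longrightarrow> rep 0 \<psi> = 0"
  using rep_scale[of 0 \<psi> 0] by simp

lemma rep_diff: "f \<in> alg \<Longrightarrow> g \<in> alg \<Longrightarrow> \<psi> \<in> ell2 orb \<Longrightarrow> rep (f - g) \<psi> = rep f \<psi> - rep g \<psi>"
  using rep_add[of "f - g" g \<psi>] by simp

lemma rep_sum:
  "(\<And>i. i \<in> X \<Longrightarrow> f i \<in> alg) \<Longrightarrow> \<psi> \<in> ell2 orb \<Longrightarrow> rep (sum f X) \<psi> = (\<Sum>i\<in>X. rep (f i) \<psi>)"
  by (induction X rule: infinite_finite_induct) (auto simp: rep_zero rep_add fcar_sum)

lemma rep_conv:
  assumes "f \<in> alg" "g \<in> alg" "\<psi> \<in> ell2 orb" shows "rep (f \<diamondop> g) \<psi> = rep f (rep g \<psi>)"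
  using assms(1)
proof (induction rule: fcar_induct)
  case zero
  have "rep g \<psi> \<in> ell2 orb" by (rule op_in[OF rep_bounded]) (use assms in auto)
  then show ?case using assms by (simp add: rep_zero)
next
  case (add f1 f2)
  have "rep g \<psi> \<in> ell2 orb" by (rule op_in[OF rep_bounded]) (use assms in auto)
  then show ?case using add assms by (simp add: conv_add_left rep_add)
next
  case (word c u)
  have u: "word u \<in> alg" using word by simp
  note opu = rep_bounded[OF u]
  from assms(2) have "rep (word u \<diamondop> g) \<psi> = rep (word u) (rep g \<psi>)"
  proof (induction rule: fcar_induct)
    case zero
    then show ?case using assms(3) by (simp add: rep_zero op_zero[OF opu])
  next
    case (add g1 g2)
    have "rep g1 \<psi> \<in> ell2 orb" "rep g2 \<psi> \<in> ell2 orb" by (rule op_in[OF rep_bounded]; use add assms in simp)+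
    then show ?case using add assms(3) u
      by (simp add: conv_add_right rep_add op_add[OF opu])
  next
    case (word d v)
    have v: "word v \<in> alg" using word by simp
    have uv: "letters (u @ v)" using \<open>letters u\<close> word by (simp add: image_Un)
    have "word_op v \<psi> \<in> ell2 orb" using word assms(3) by (intro word_op_in)
    moreover have "rep (word u \<diamondop> d \<bullet>\<^sub>c word v) \<psi> = d \<bullet>\<^sub>c word_op (u @ v) \<psi>"
      using uv assms(3) rep_scale[of "word (u @ v)" \<psi> d] rep_word[OF uv assms(3)]
      by (simp add: conv_scale_right word_conv_word del: foldr_append)
    ultimately show ?case
      using word assms(3) v \<open>letters u\<close> by (simp add: rep_scale rep_word op_scale[OF opu])
  qed
  moreover have "rep g \<psi> \<in> ell2 orb" by (rule op_in[OF rep_bounded]) (use assms in auto)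
  moreover have "word u \<diamondop> g \<in> alg" using u assms(2) by (rule fcar_conv)
  ultimately show ?case using u assms(3) by (simp add: conv_scale_left rep_scale)
qed

lemma letter_op_inner:
  assumes "fst l \<in> gens G" "\<psi> \<in> ell2 orb" "\<eta> \<in> ell2 orb"
  shows "ell2_inner orb (letter_op (apsnd Not l) \<psi>) \<eta> = ell2_inner orb \<psi> (letter_op l \<eta>)"
proof -
  obtain z b where l: "l = (z, b)" by (cases l)
  have z: "z \<in> gens G" using assms l by simp
  note op = gen_op_bounded[OF z]
  have 1: "ell2_inner orb (letter_op (z, True) \<psi>) \<eta> = ell2_inner orb \<psi> (letter_op (z, False) \<eta>)"
    if "\<psi> \<in> ell2 orb" "\<eta> \<in> ell2 orb" for \<psi> \<eta>
    using op_adj(3)[OF op that] letter_op_gen[OF z that(2)] letter_op_adj[OF z that(1)] by simp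
  show ?thesis
  proof (cases b)
    case False
    then show ?thesis using 1[OF assms(2,3)] l by simp
  next
    case True
    then show ?thesis
      using 1[OF assms(3,2)] l inner_commute[of orb \<psi> "letter_op (z, True) \<eta>"]
        inner_commute[of orb "letter_op (z, False) \<psi>" \<eta>] by simp
  qed
qed

lemma word_op_inner:
  "letters w \<Longrightarrow> \<psi> \<in> ell2 orb \<Longrightarrow> \<eta> \<in> ell2 orb \<Longrightarrow>
     ell2_inner orb (word_op (flip w) \<psi>) \<eta> = ell2_inner orb \<psi> (word_op w \<eta>)"
proof (induction w arbitrary: \<psi>)
  case (Cons l w)
  have "letters [apsnd Not l]" "letters w" using Cons.prems by (auto simp: apsnd_def map_prod_def split: prod.splits)
  then have in1: "word_op [apsnd Not l] \<psi> \<in> ell2 orb" and in2: "word_op w \<eta> \<in> ell2 orb"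
    using Cons.prems by (auto intro!: word_op_in simp del: foldr.simps)
  have "word_op (flip (l # w)) \<psi> = word_op (flip w) (letter_op (apsnd Not l) \<psi>)" by simp
  then have "ell2_inner orb (word_op (flip (l # w)) \<psi>) \<eta> = ell2_inner orb (letter_op (apsnd Not l) \<psi>) (word_op w \<eta>)"
    using Cons in1 \<open>letters w\<close> by simp
  also have "\<dots> = ell2_inner orb \<psi> (letter_op l (word_op w \<eta>))"
    by (rule letter_op_inner) (use Cons.prems in2 in auto)
  finally show ?case by simp
qed simp

lemma rep_inner:
  assumes "f \<in> alg" "\<psi> \<in> ell2 orb" "\<eta> \<in> ell2 orb"
  shows "ell2_inner orb (rep (star f) \<psi>) \<eta> = ell2_inner orb \<psi> (rep f \<eta>)"
  using assms(1)
proof (induction rule: fcar_induct)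
  case zero
  then show ?case using assms by (simp add: rep_zero)
next
  case (add f g)
  have in1: "rep (star f) \<psi> \<in> ell2 orb" "rep (star g) \<psi> \<in> ell2 orb"
    by (rule op_in[OF rep_bounded]; use add assms in simp)+
  have in2: "rep f \<eta> \<in> ell2 orb" "rep g \<eta> \<in> ell2 orb"
    by (rule op_in[OF rep_bounded]; use add assms in simp)+
  show ?case using add assms in1 in2
    by (simp add: star_add rep_add inner_add_left inner_add_right)
next
  case (word c w)
  have fw: "letters (flip w)" using word by (simp only: flip_fst)
  have "word (flip w) \<in> alg" "word w \<in> alg" using fw word by (simp_all only: fcar_word)
  then show ?case using word fw assms
    by (simp add: star_scale star_word rep_scale rep_word inner_scale_left inner_scale_right word_op_inner
        del: flip_fst)
qed

lemma rep_star: "f \<in> alg \<Longrightarrow> adj BB (rep f) = rep (star f)"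
  by (rule adj_unique) (auto intro: rep_bounded rep_inner)

text \<open>All relations are checked on functions, where both sides are given by explicit formulas.\<close>

lemma rep_relation:
  assumes "(a, b) \<in> relations G \<phi>" "\<psi> \<in> ell2 orb" shows "rep a \<psi> = rep b \<psi>"
proof -
  have out: "\<psi> j = 0" if "j \<notin> orb" for j using ell2_outside[OF assms(2) that] .
  have split: "[x] \<frown> suffix 1 j = j" if "j 0 = x" for j :: "nat \<Rightarrow> 'x" and x
    using conc_prefix_suffix[of j 1] that by (simp add: subsequence_def)
  have tail: "suffix 1 j \<in> orb" if "j \<in> orb" for j
    using orb_tail[of "j 0" "suffix 1 j"] split[of j "j 0"] that by simp
  from assms(1) show ?thesis
  proof (cases rule: relation_cases)
    case (mult g h)
    have "word_op [(Grp g, False), (Grp h, False)] \<psi> = word_op [(Grp (g \<otimes> h), False)] \<psi>"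
      using mult by (auto simp: fun_eq_iff orb_act inv_mult_group action_mult)
    then show ?thesis using mult assms(2) by (simp add: word_conv_word rep_word)
  next
    case one
    have "word_op [(Grp \<one>, False)] \<psi> = \<psi>" using out by (auto simp: fun_eq_iff action_one)
    then show ?thesis using one assms(2) by (simp add: rep_word)
  next
    case (left g)
    have "word_op [(Grp g, True), (Grp g, False)] \<psi> = \<psi>"
      using left out by (auto simp: fun_eq_iff orb_act action_inv)
    then show ?thesis using left assms(2) by (simp add: star_word word_conv_word rep_word)
  next
    case (right g)
    have "word_op [(Grp g, False), (Grp g, True)] \<psi> = \<psi>"
      using right out by (auto simp: fun_eq_iff orb_act action_inv)
    then show ?thesis using right assms(2) by (simp add: star_word word_conv_word rep_word)
  next
    case (iso x y)
    have "word_op [(Iso x, True), (Iso y, False)] \<psi> = (if x = y then \<psi> else 0)"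
      using out by (intro ext) (auto simp: zero_fun_apply orb_build suffix_build)
    then show ?thesis using iso assms(2) by (auto simp: star_word word_conv_word rep_word rep_zero)
  next
    case sum
    have "rep a \<psi> = (\<Sum>x\<in>UNIV. word_op [(Iso x, False), (Iso x, True)] \<psi>)"
      using sum assms(2) by (simp add: rep_sum star_word word_conv_word rep_word)
    also have "\<dots> = \<psi>"
    proof
      fix j
      have "word_op [(Iso x, False), (Iso x, True)] \<psi> j = (if x = j 0 then \<psi> j else 0)" for x
        using out tail split[of j x] by auto
      then show "(\<Sum>x\<in>UNIV. word_op [(Iso x, False), (Iso x, True)] \<psi>) j = \<psi> j"
        by (simp only: sum_fun_apply) simp
    qed
    finally show ?thesis using sum assms(2) by (simp add: rep_word)
  next
    case (self_similar g x y h)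
    have "word_op [(Grp g, False), (Iso x, False)] \<psi> j = word_op [(Iso y, False), (Grp h, False)] \<psi> j" for j
    proof (cases "j \<in> orb")
      case j: True
      have gx: "\<phi> g ([x] \<frown> w) = [y] \<frown> \<phi> h w" for w using self_similar by simp
      have gj: "\<phi> (inv g) j \<in> orb" using self_similar j by (intro orb_act) auto
      show ?thesis
      proof (cases "j 0 = y")
        case True
        have "\<phi> (inv g) j = [x] \<frown> \<phi> (inv h) (suffix 1 j)"
        proof -
          have "\<phi> g ([x] \<frown> \<phi> (inv h) (suffix 1 j)) = j"
            unfolding gx using self_similar split[of j y] True by (simp add: action_inv)
          then show ?thesis using self_similar action_inv(1) by metis
        qed
        then show ?thesis using True j gj tail[OF j] by (simp add: suffix_build)
      next
        case False
        have "\<phi> (inv g) j 0 \<noteq> x"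
        proof
          assume "\<phi> (inv g) j 0 = x"
          then have "\<phi> (inv g) j = [x] \<frown> suffix 1 (\<phi> (inv g) j)" using split by metis
          then have "j = [y] \<frown> \<phi> h (suffix 1 (\<phi> (inv g) j))"
            using gx self_similar action_inv(2) by metis
          then have "j 0 = ([y] \<frown> \<phi> h (suffix 1 (\<phi> (inv g) j))) 0" by (rule arg_cong)
          then show False using False by simp
        qed
        then show ?thesis using False by simp
      qed
    qed simp
    then have "word_op [(Grp g, False), (Iso x, False)] \<psi> = word_op [(Iso y, False), (Grp h, False)] \<psi>" by blast
    then show ?thesis using self_similar assms(2) by (simp add: word_conv_word rep_word)
  qed
qed

definition orbit_norm :: "('g, 'x) gen free_elem \<Rightarrow> real" where
  "orbit_norm f = nrm BB (rep f)"

text \<open>The operator norm in the representation is one of the seminorms that the universal one dominates.\<close>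

lemma admissible_rep: "admissible orbit_norm"
  unfolding admissible_def cstar_seminorm_def free_star_algebra_simps
proof (intro conjI ballI allI)
  note op = rep_bounded
  show "0 \<le> orbit_norm a" if "a \<in> alg" for a unfolding orbit_norm_def by (rule opn_nonneg[OF op[OF that]])
  show "orbit_norm (a + b) \<le> orbit_norm a + orbit_norm b" if "a \<in> alg" "b \<in> alg" for a b
  proof -
    have "rep (a + b) = rep a \<oplus>\<^bsub>BB\<^esub> rep b"
      by (rule op_eqI[OF op op_plus(1)[OF op op]]) (use that in \<open>auto simp: rep_add BO_simps\<close>)
    then show ?thesis using op_plus(2)[OF op[OF that(1)] op[OF that(2)]] by (simp add: orbit_norm_def)
  qed
  show "orbit_norm (c \<bullet>\<^sub>c a) = cmod c * orbit_norm a" if "a \<in> alg" for a c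
  proof -
    have "rep (c \<bullet>\<^sub>c a) = scal BB c (rep a)"
      by (rule op_eqI[OF op op_scal(1)[OF op]]) (use that in \<open>auto simp: rep_scale BO_simps\<close>)
    then show ?thesis using op_scal(2)[OF op[OF that], of c] by (simp add: orbit_norm_def)
  qed
  have mult: "rep (a \<diamondop> b) = rep a \<otimes>\<^bsub>BB\<^esub> rep b" if "a \<in> alg" "b \<in> alg" for a b
    by (rule op_eqI[OF op op_mult(1)[OF op op]]) (use that in \<open>auto simp: rep_conv BO_simps\<close>)
  show "orbit_norm (a \<diamondop> b) \<le> orbit_norm a * orbit_norm b" if "a \<in> alg" "b \<in> alg" for a b
    using op_mult(2)[OF op[OF that(1)] op[OF that(2)]] mult[OF that] by (simp add: orbit_norm_def)
  show "orbit_norm (star a \<diamondop> a) = (orbit_norm a)\<^sup>2" if "a \<in> alg" for a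
    using op_cstar[OF op[OF that]] mult[of "star a" a] rep_star[OF that] that by (simp add: orbit_norm_def)
next
  fix r assume "r \<in> relations G \<phi>"
  then obtain a b where ab: "r = (a, b)" "(a, b) \<in> relations G \<phi>" by (cases r) auto
  have alg: "a \<in> alg" "b \<in> alg" using relations_alg[OF ab(2)] by auto
  have "orbit_norm (a - b) \<le> 0"
    unfolding orbit_norm_def
    by (rule opn_leI) (use rep_relation[OF ab(2)] alg in \<open>auto simp: rep_diff\<close>)
  moreover have "0 \<le> orbit_norm (a - b)"
    unfolding orbit_norm_def by (rule opn_nonneg[OF rep_bounded]) (use alg in simp)
  ultimately show "case r of (a, b) \<Rightarrow> orbit_norm (a - b) = 0" using ab(1) by simp
qed

section \<open>Vector states approximating the trace\<close>

lemma letter_op_delta: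
  assumes "fst l \<in> gens G" "g \<in> carrier G" "u \<noteq> []" "u \<frown> \<phi> g pt \<in> orb"
  shows "letter_op l (ell2_delta (u \<frown> \<phi> g pt)) =
    (case step l (u, g) of None \<Rightarrow> 0 | Some (u', g') \<Rightarrow> ell2_delta (u' \<frown> \<phi> g' pt))"
proof (cases "(l, (u, g))" rule: step.cases)
  case (1 k b u0 g0)
  define h where "h = (if b then inv k else k)"
  have h: "h \<in> carrier G" using 1 assms by (auto simp: h_def)
  have hinv: "(if b then k else inv k) = inv h" using 1 assms by (auto simp: h_def)
  have eq: "u \<frown> \<phi> g pt = \<phi> (inv h) j \<longleftrightarrow> j = \<phi> h (u \<frown> \<phi> g pt)" for j
    using h action_inv by metis
  have z: "\<phi> h (u \<frown> \<phi> g pt) = act h u \<frown> \<phi> (sec h u \<otimes> g) pt"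
    using h assms by (simp add: action_conc action_mult)
  have l: "l = (Grp k, b)" using 1 by simp
  have s: "step l (u, g) = Some (act h u, sec h u \<otimes> g)" by (simp add: l h_def Let_def)
  have "letter_op l (ell2_delta (u \<frown> \<phi> g pt)) j = ell2_delta (\<phi> h (u \<frown> \<phi> g pt)) j" for j
    unfolding l letter_op.simps hinv ell2_delta_def
    using eq[of j] orb_act[OF assms(4) h] by (cases "j = \<phi> h (u \<frown> \<phi> g pt)") auto
  then show ?thesis unfolding s z by auto
next
  case (2 x u0 g0)
  have "build x (u \<frown> \<phi> g pt) \<in> orb" using assms(4) by (rule orb_build)
  moreover have l: "l = (Iso x, False)" and s: "step l (u, g) = Some (x # u, g)" using 2 by simp_all
  ultimately have "letter_op l (ell2_delta (u \<frown> \<phi> g pt)) j = ell2_delta (build x (u \<frown> \<phi> g pt)) j" for j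
    unfolding l letter_op.simps ell2_delta_def
    using build_eq_iff[of x "u \<frown> \<phi> g pt" j] by (cases "j = build x (u \<frown> \<phi> g pt)") auto
  then show ?thesis unfolding s by auto
next
  case (3 x u0 g0)
  obtain y v where u: "u = y # v" using assms(3) by (cases u) auto
  have eq: "[x] \<frown> j = u \<frown> \<phi> g pt \<longleftrightarrow> x = y \<and> j = v \<frown> \<phi> g pt" for j
  proof -
    have "u \<frown> \<phi> g pt = [y] \<frown> (v \<frown> \<phi> g pt)" using u by simp
    then show ?thesis using conc_eq_iff[of "[x]" "[y]" j "v \<frown> \<phi> g pt"] by simp
  qed
  have "v \<frown> \<phi> g pt \<in> orb" using orb_tail[of y "v \<frown> \<phi> g pt"] assms(4) u by simp
  moreover have l: "l = (Iso x, True)"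
    and s: "step l (u, g) = (if y = x then Some (v, g) else None)" using 3 u by auto
  ultimately have "letter_op l (ell2_delta (u \<frown> \<phi> g pt)) j =
      (if y = x then ell2_delta (v \<frown> \<phi> g pt) j else 0)" for j
    unfolding l letter_op.simps ell2_delta_def eq by auto
  then show ?thesis unfolding s by (auto simp: zero_fun_apply)
qed

lemma orb_act_pt: "g \<in> carrier G \<Longrightarrow> u \<frown> \<phi> g pt \<in> orb"
  using orb_prepend[OF orb_act[OF orb_pt[of "[]"]], of g u] by simp

text \<open>
  On basis vectors the representation is computed by \<open>run\<close>, with the same restriction on lengths as
  in the free algebra.
\<close>

lemma word_op_delta:
  assumes "letters W" "g \<in> carrier G" "length W \<le> length u"
  shows "word_op W (ell2_delta (u \<frown> \<phi> g pt)) =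
    (case run W (u, g) of None \<Rightarrow> 0 | Some (u', g') \<Rightarrow> ell2_delta (u' \<frown> \<phi> g' pt))"
  using assms
proof (induction W)
  case (Cons l W)
  then have IH: "word_op W (ell2_delta (u \<frown> \<phi> g pt)) =
    (case run W (u, g) of None \<Rightarrow> 0 | Some (u', g') \<Rightarrow> ell2_delta (u' \<frown> \<phi> g' pt))" by simp
  show ?case
  proof (cases "run W (u, g)")
    case None
    have "letter_op l 0 = 0" by (cases l rule: letter_deg.cases; rename_tac b; case_tac b)
      (auto simp: fun_eq_iff zero_fun_apply)
    then show ?thesis using None IH by simp
  next
    case (Some s)
    then obtain u1 g1 where s: "run W (u, g) = Some (u1, g1)" by (cases s) auto
    have g1: "g1 \<in> carrier G" using run_in[OF s] Cons.prems by simp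
    have "u1 \<noteq> []" using run_length[OF s] deg_ge[of W] Cons.prems by auto
    then show ?thesis
      using IH s letter_op_delta[of l g1 u1] Cons.prems orb_act_pt[OF g1] g1 by simp
  qed
qed simp

text \<open>A mean of vector states; its limit for large \<open>n\<close> is the trace (\<open>vstate_tendsto_trace\<close>).\<close>

definition vstate :: "nat \<Rightarrow> ('g, 'x) gen free_elem \<Rightarrow> complex" where
  "vstate n f = (\<Sum>u | length u = n. rep f (ell2_delta (u \<frown> pt)) (u \<frown> pt)) / of_nat (CARD('x) ^ n)"

lemma delta_in: "ell2_delta (u \<frown> pt) \<in> ell2 orb"
  by (rule ell2_delta_in_ell2[OF orb_pt])

lemma vstate_bound: assumes "f \<in> alg" shows "cmod (vstate n f) \<le> orbit_norm f"
proof -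
  have "cmod (rep f (ell2_delta (u \<frown> pt)) (u \<frown> pt)) \<le> orbit_norm f" for u
  proof -
    have "cmod (rep f (ell2_delta (u \<frown> pt)) (u \<frown> pt)) \<le> ell2_norm orb (rep f (ell2_delta (u \<frown> pt)))"
      by (intro ell2_cmod_le op_in[OF rep_bounded[OF assms]] delta_in)
    also have "\<dots> \<le> nrm BB (rep f) * ell2_norm orb (ell2_delta (u \<frown> pt))"
      by (intro opn_le rep_bounded assms delta_in)
    finally show ?thesis by (simp add: orbit_norm_def delta_norm[OF orb_pt])
  qed
  then have "cmod (\<Sum>u | length u = n. rep f (ell2_delta (u \<frown> pt)) (u \<frown> pt)) \<le>
      (\<Sum>u\<in>{u :: 'x list. length u = n}. orbit_norm f)"
    by (intro sum_norm_le)
  also have "\<dots> = real (CARD('x) ^ n) * orbit_norm f" by (simp add: words_card)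
  finally show ?thesis
    using card_pos by (simp add: vstate_def norm_divide norm_power field_simps)
qed

lemma vstate_positive:
  assumes "f \<in> alg" shows "vstate n (star f \<diamondop> f) \<in> \<real>" "0 \<le> Re (vstate n (star f \<diamondop> f))"
proof -
  have "rep (star f \<diamondop> f) (ell2_delta (u \<frown> pt)) (u \<frown> pt) =
      of_real ((ell2_norm orb (rep f (ell2_delta (u \<frown> pt))))\<^sup>2)" for u
  proof -
    let ?d = "ell2_delta (u \<frown> pt)"
    have fd: "rep f ?d \<in> ell2 orb" by (intro op_in[OF rep_bounded[OF assms]] delta_in)
    have "rep (star f \<diamondop> f) ?d (u \<frown> pt) = ell2_inner orb ?d (rep (star f) (rep f ?d))"
      using assms delta_in by (simp add: rep_conv inner_delta[OF orb_pt])
    also have "\<dots> = ell2_inner orb (rep (star (star f)) ?d) (rep f ?d)"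
      by (rule rep_inner[symmetric]) (use assms delta_in fd in auto)
    also have "\<dots> = of_real ((ell2_norm orb (rep f ?d))\<^sup>2)"
      using inner_self[OF fd] by simp
    finally show ?thesis .
  qed
  then have "vstate n (star f \<diamondop> f) = of_real ((\<Sum>u | length u = n.
      (ell2_norm orb (rep f (ell2_delta (u \<frown> pt))))\<^sup>2) / real (CARD('x) ^ n))"
    by (simp add: vstate_def)
  moreover have "0 \<le> (\<Sum>u | length u = n.
      (ell2_norm orb (rep f (ell2_delta (u \<frown> pt))))\<^sup>2) / real (CARD('x) ^ n)"
    by (intro divide_nonneg_nonneg sum_nonneg) auto
  ultimately show "vstate n (star f \<diamondop> f) \<in> \<real>" "0 \<le> Re (vstate n (star f \<diamondop> f))"
    by (simp_all del: of_real_divide of_real_sum)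
qed

lemma vstate_add: "f \<in> alg \<Longrightarrow> g \<in> alg \<Longrightarrow> vstate n (f + g) = vstate n f + vstate n g"
  by (simp add: vstate_def rep_add delta_in plus_fun_apply sum.distrib add_divide_distrib)

lemma vstate_scale: "f \<in> alg \<Longrightarrow> vstate n (c \<bullet>\<^sub>c f) = c * vstate n f"
  by (simp add: vstate_def rep_scale delta_in scale_apply sum_distrib_left)

text \<open>
  The diagonal coefficient at \<open>u pt\<close> is \<open>1\<close> if \<open>W\<close> fixes \<open>u\<close> and \<open>0\<close> if it moves or annihilates \<open>u\<close>. If \<open>u\<close> is
  undecided, the coefficient depends on whether the group element fixes \<open>pt\<close>, and it is counted as an
  error.
\<close>

lemma vstate_word:
  assumes W: "letters W" "deg W = 0" and n: "length W \<le> n"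
  shows "cmod (vstate n (word W) - of_real (density W n)) \<le>
     real (card (undecided_words W n)) / real CARD('x) ^ n"
proof -
  let ?c = "\<lambda>u. rep (word W) (ell2_delta (u \<frown> pt)) (u \<frown> pt)"
  let ?N = "{u :: 'x list. length u = n}"
  have c: "cmod (?c u - (if u \<in> fixed_words W n then 1 else 0)) \<le> (if u \<in> undecided_words W n then 1 else 0)"
    if u: "u \<in> ?N" for u
  proof -
    have cu: "?c u = (case run W (u, \<one>) of None \<Rightarrow> 0 | Some (u', g') \<Rightarrow> ell2_delta (u' \<frown> \<phi> g' pt)) (u \<frown> pt)"
      using word_op_delta[of W \<one> u] W n u delta_in by (simp add: rep_word action_one)
    show ?thesis
    proof (cases "run W (u, \<one>)")
      case None
      have "u \<notin> fixed_words W n" by (simp add: fixed_words_def None)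
      then show ?thesis by (simp add: cu None zero_fun_apply)
    next
      case (Some s)
      then obtain u' g' where s: "run W (u, \<one>) = Some (u', g')" by (cases s) auto
      have len: "length u = length u'" using run_length[OF s] W by simp
      have c: "?c u = (if u = u' \<and> pt = \<phi> g' pt then 1 else 0)"
        unfolding cu s option.case prod.case by (simp only: ell2_delta_def conc_eq_iff[OF len])
      show ?thesis
      proof (cases "u' = u \<and> g' = \<one>")
        case True
        then have "u \<in> fixed_words W n" using u s by (simp add: fixed_words_def)
        then show ?thesis using True by (simp add: c action_one)
      next
        case False
        then have f: "u \<notin> fixed_words W n" using s by (auto simp: fixed_words_def)
        show ?thesis
        proof (cases "u' = u")
          case True
          then have "u \<in> undecided_words W n" using False u s by (simp add: undecided_words_def)
          then show ?thesis using f by (simp add: c)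
        next
          case False
          then show ?thesis using f by (simp add: c)
        qed
      qed
    qed
  qed
  have "(\<Sum>u\<in>?N. if u \<in> fixed_words W n then 1 else 0 :: complex) = of_nat (card (fixed_words W n))"
    by (subst sum.inter_filter[symmetric]) (auto simp: words_finite fixed_words_def intro!: arg_cong[where f = card])
  moreover have "(\<Sum>u\<in>?N. if u \<in> undecided_words W n then 1 else 0 :: real) = real (card (undecided_words W n))"
    by (subst sum.inter_filter[symmetric]) (auto simp: words_finite undecided_words_def intro!: arg_cong[where f = card])
  moreover have "cmod (\<Sum>u\<in>?N. ?c u - (if u \<in> fixed_words W n then 1 else 0)) \<le>
      (\<Sum>u\<in>?N. if u \<in> undecided_words W n then 1 else 0)"
    by (rule sum_norm_le) (rule c)
  ultimately have "cmod ((\<Sum>u\<in>?N. ?c u) - of_nat (card (fixed_words W n))) \<le> real (card (undecided_words W n))"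
    by (simp add: sum_subtractf)
  then have "cmod ((\<Sum>u\<in>?N. ?c u) - of_nat (card (fixed_words W n))) / real CARD('x) ^ n \<le>
      real (card (undecided_words W n)) / real CARD('x) ^ n"
    by (intro divide_right_mono) auto
  moreover have "vstate n (word W) - of_real (density W n) =
      ((\<Sum>u\<in>?N. ?c u) - of_nat (card (fixed_words W n))) / of_nat (CARD('x) ^ n)"
    by (simp add: vstate_def density_def diff_divide_distrib)
  ultimately show ?thesis by (simp add: norm_divide norm_power)
qed

end

locale generic_orbit = generic_action G \<phi> + orbit_representation G \<phi> pt
  for G :: "('g, 'm) monoid_scheme" (structure)
    and \<phi> :: "'g \<Rightarrow> (nat \<Rightarrow> 'x::finite) \<Rightarrow> (nat \<Rightarrow> 'x)"
    and pt :: "nat \<Rightarrow> 'x"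
begin

lemma vstate_tendsto_trace:
  assumes "f \<in> alg" "degree_zero f" shows "(\<lambda>n. vstate n f) \<longlonglongrightarrow> tr f"
  using assms
proof (induction rule: degree_zero_induct)
  case zero
  have "vstate n 0 = 0" for n using vstate_scale[of 0 n 0] by simp
  then show ?case by simp
next
  case (add f g)
  then show ?case by (simp add: vstate_add tr_add tendsto_add)
next
  case (word c W)
  have "(\<lambda>n. vstate n (word W) - of_real (density W n)) \<longlonglongrightarrow> 0"
  proof (rule Lim_null_comparison)
    show "\<forall>\<^sub>F n in sequentially. cmod (vstate n (word W) - of_real (density W n)) \<le>
        real (card (undecided_words W n)) / real CARD('x) ^ n"
      using eventually_ge_at_top[of "length W"] by eventually_elim (rule vstate_word[OF word])
    show "(\<lambda>n. real (card (undecided_words W n)) / real CARD('x) ^ n) \<longlonglongrightarrow> 0"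
      by (rule undecided_words_density[OF word])
  qed
  from tendsto_add[OF this tendsto_of_real[OF density_tendsto[OF word]]]
  have "(\<lambda>n. vstate n (word W)) \<longlonglongrightarrow> of_real (word_trace W)" by simp
  then have "(\<lambda>n. c * vstate n (word W)) \<longlonglongrightarrow> c * of_real (word_trace W)" by (rule tendsto_mult_left)
  then show ?case using word by (simp add: vstate_scale tr_scale tr_word)
qed

text \<open>Bounds and positivity of vector states pass to the limit.\<close>

lemma trace_bound: assumes "f \<in> alg" "degree_zero f" shows "cmod (tr f) \<le> orbit_norm f"
  by (rule LIMSEQ_le_const2[OF tendsto_norm[OF vstate_tendsto_trace[OF assms]]])
     (use vstate_bound assms in blast)

lemma trace_positive:
  assumes "f \<in> alg" "degree_zero f"
  shows "tr (star f \<diamondop> f) \<in> \<real>" "0 \<le> Re (tr (star f \<diamondop> f))"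
proof -
  have lim: "(\<lambda>n. vstate n (star f \<diamondop> f)) \<longlonglongrightarrow> tr (star f \<diamondop> f)"
    using assms by (intro vstate_tendsto_trace degree_zero_conv degree_zero_simps) auto
  show "tr (star f \<diamondop> f) \<in> \<real>"
    by (rule closed_sequentially[OF closed_complex_Reals _ lim]) (use vstate_positive assms in auto)
  show "0 \<le> Re (tr (star f \<diamondop> f))"
    by (rule LIMSEQ_le_const[OF tendsto_Re[OF lim]]) (use vstate_positive assms in auto)
qed

end

section \<open>Degree zero parts and corners\<close>

context self_similar
begin

text \<open>The degree zero part is a mean of gauge transforms.\<close>

lemma degree_zero_part_le:
  assumes "admissible p" "\<And>t f. f \<in> alg \<Longrightarrow> p (gauge_aut t f) \<le> p f" "f \<in> alg"
  shows "p (degree_zero_part f) \<le> p f"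
proof -
  interpret cstar_seminormed "gens G" p using assms by (simp add: admissible_def cstar_seminormed_def)
  obtain N where N: "N > 0"
    "degree_zero_part f = (\<Sum>j<N. (1 / of_nat N) \<bullet>\<^sub>c gauge_aut (2 * pi * real j / real N) f)"
    using degree_zero_part_mean[OF assms(3)] by blast
  show ?thesis unfolding N(2) by (rule mean_le) (use N assms in auto)
qed

lemma univ_CS_gauge: "\<xi> \<in> univ.CS \<Longrightarrow> (\<lambda>n. gauge_aut t (\<xi> n)) \<in> univ.CS"
  by (rule univ.CS_Lipschitz[where K = 1]) (auto simp flip: gauge_aut_diff simp: univ_gauge)

lemma univ_CS_degree_zero_part: "\<xi> \<in> univ.CS \<Longrightarrow> (\<lambda>n. degree_zero_part (\<xi> n)) \<in> univ.CS"
  by (rule univ.CS_Lipschitz[where K = 1])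
     (auto simp flip: degree_zero_part_diff intro!: degree_zero_part_le admissible_univ simp: univ_gauge)

text \<open>
  Up to the relations, conjugation by \<open>S\<^sub>u\<close> is a homomorphism onto the corner of the projection
  \<open>S\<^sub>u S\<^sub>u\<^sup>*\<close>. It preserves the degree.
\<close>

definition corner :: "'x list \<Rightarrow> ('g, 'x) gen free_elem \<Rightarrow> ('g, 'x) gen free_elem" where
  "corner u f = S u \<diamondop> f \<diamondop> star (S u)"

lemma corner_alg [simp]: "f \<in> alg \<Longrightarrow> corner u f \<in> alg"
  unfolding corner_def by (intro fcar_conv fcar_star S_fcar)

lemma corner_star: "star (corner u f) = corner u (star f)"
  by (simp add: corner_def star_conv conv_assoc)

lemma corner_eqv: "f \<doteq> g \<Longrightarrow> corner u f \<doteq> corner u g"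
  unfolding corner_def by (intro eqv_right eqv_left fcar_star S_fcar)

lemma corner_mult: assumes "f \<in> alg" "g \<in> alg" shows "corner u f \<diamondop> corner u g \<doteq> corner u (f \<diamondop> g)"
proof -
  have eq: "corner u f \<diamondop> corner u g = S u \<diamondop> f \<diamondop> (star (S u) \<diamondop> S u) \<diamondop> (g \<diamondop> star (S u))"
    by (simp add: corner_def conv_assoc)
  have eq2: "corner u (f \<diamondop> g) = S u \<diamondop> f \<diamondop> word [] \<diamondop> (g \<diamondop> star (S u))"
    by (simp add: corner_def conv_assoc)
  have "star (S u) \<diamondop> S u \<doteq> word []" using S_star_S[of u u] by simp
  then show ?thesis unfolding eq eq2
    by (intro eqv_right eqv_left fcar_conv fcar_star S_fcar assms)
qed

lemma S_deg [simp]: "deg (map (\<lambda>x. (Iso x, False)) u) = int (length u)"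
  by (induction u) auto

lemma degree_zero_corner: assumes "f \<in> alg" "degree_zero f" shows "degree_zero (corner u f)"
  using assms
proof (induction rule: degree_zero_induct)
  case zero
  then show ?case by (simp add: corner_def degree_zero_simps)
next
  case (add f g)
  then show ?case by (simp add: corner_def degree_zero_simps conv_add_left conv_add_right)
next
  case (word c w)
  then show ?case
    by (simp add: corner_def conv_scale_left conv_scale_right star_word word_conv_word degree_zero_simps)
qed

end

section \<open>Uniqueness on the free algebra\<close>

text \<open>
  The properties of a tracial state on the gauge invariant subalgebra that survive its pullback to
  polynomials of degree zero. They determine it there (\<open>T_eq_tr\<close>).
\<close>

locale free_trace = generic_action G \<phi>
  for G :: "('g, 'm) monoid_scheme" (structure)
    and \<phi> :: "'g \<Rightarrow> (nat \<Rightarrow> 'x::finite) \<Rightarrow> (nat \<Rightarrow> 'x)" +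
  fixes T :: "('g, 'x) gen free_elem \<Rightarrow> complex"
  assumes T_add: "f \<in> alg \<Longrightarrow> degree_zero f \<Longrightarrow> g \<in> alg \<Longrightarrow> degree_zero g \<Longrightarrow> T (f + g) = T f + T g"
    and T_scale: "f \<in> alg \<Longrightarrow> degree_zero f \<Longrightarrow> T (c \<bullet>\<^sub>c f) = c * T f"
    and T_commute: "f \<in> alg \<Longrightarrow> degree_zero f \<Longrightarrow> g \<in> alg \<Longrightarrow> degree_zero g \<Longrightarrow> T (f \<diamondop> g) = T (g \<diamondop> f)"
    and T_positive: "f \<in> alg \<Longrightarrow> degree_zero f \<Longrightarrow> T (star f \<diamondop> f) \<in> \<real> \<and> 0 \<le> Re (T (star f \<diamondop> f))"
    and T_one: "T (word []) = 1"
    and T_eqv: "f \<doteq> g \<Longrightarrow> degree_zero f \<Longrightarrow> degree_zero g \<Longrightarrow> T f = T g"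
begin

lemma T_zero: "T 0 = 0"
  using T_scale[of 0 0] by (simp add: degree_zero_simps)

lemma T_sum: "(\<And>i. i \<in> X \<Longrightarrow> f i \<in> alg \<and> degree_zero (f i)) \<Longrightarrow>
    T (sum f X) = (\<Sum>i\<in>X. T (f i)) \<and> degree_zero (sum f X) \<and> sum f X \<in> alg"
  by (induction X rule: infinite_finite_induct) (auto simp: T_zero T_add degree_zero_simps)

abbreviation matrix_unit :: "'x list \<Rightarrow> 'x list \<Rightarrow> ('g, 'x) gen free_elem" where
  "matrix_unit u v \<equiv> S u \<diamondop> star (S v)"

lemma matrix_unit_alg: "matrix_unit u v \<in> alg"
  by (intro fcar_conv fcar_star S_fcar)

lemma matrix_unit_degree_zero: "length u = length v \<Longrightarrow> degree_zero (matrix_unit u v)"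
  by (simp add: star_word word_conv_word degree_zero_simps)

lemma matrix_unit_mult:
  assumes "length v = length w" shows "matrix_unit u v \<diamondop> matrix_unit w z \<doteq> (if v = w then matrix_unit u z else 0)"
proof -
  have eq: "matrix_unit u v \<diamondop> matrix_unit w z = S u \<diamondop> (star (S v) \<diamondop> S w) \<diamondop> star (S z)"
    by (simp add: conv_assoc)
  have "S u \<diamondop> (star (S v) \<diamondop> S w) \<diamondop> star (S z) \<doteq> S u \<diamondop> (if v = w then word [] else 0) \<diamondop> star (S z)"
    by (intro eqv_right eqv_left S_star_S assms fcar_star S_fcar)
  then show ?thesis unfolding eq by (cases "v = w") simp_all
qed

text \<open>
  The projections \<open>S\<^sub>u S\<^sub>u\<^sup>*\<close> for words of length \<open>n\<close> are the products \<open>a a\<^sup>*\<close> and \<open>a\<^sup>* a\<close> of matrix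
  units \<open>a\<close> of degree zero. So \<open>T\<close> takes the same value on all of them, and they sum to \<open>1\<close>.
\<close>

lemma T_projection: fixes u :: "'x list" shows "T (matrix_unit u u) = 1 / of_nat (CARD('x) ^ length u)"
proof -
  let ?N = "{v :: 'x list. length v = length u}"
  have same: "T (matrix_unit v v) = T (matrix_unit u u)" if v: "length v = length u" for v
  proof -
    have "T (matrix_unit v u \<diamondop> matrix_unit u v) = T (matrix_unit u v \<diamondop> matrix_unit v u)"
      using v by (intro T_commute matrix_unit_alg matrix_unit_degree_zero) auto
    moreover have "T (matrix_unit a b \<diamondop> matrix_unit b a) = T (matrix_unit a a)" if "length a = length b" for a b
      using matrix_unit_mult[of b b a a] that
      by (intro T_eqv degree_zero_conv matrix_unit_degree_zero) auto
    ultimately show ?thesis using v by simp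
  qed
  have 1: "(\<Sum>v\<in>?N. T (matrix_unit v v)) = T (\<Sum>v\<in>?N. matrix_unit v v)" "degree_zero (\<Sum>v\<in>?N. matrix_unit v v)"
    using T_sum[of ?N "\<lambda>v. matrix_unit v v"] matrix_unit_alg matrix_unit_degree_zero by auto
  have "T (\<Sum>v\<in>?N. matrix_unit v v) = T (word [])"
    by (rule T_eqv[OF sum_projections 1(2)]) (simp add: degree_zero_simps)
  then have "1 = (\<Sum>v\<in>?N. T (matrix_unit v v))" using 1 T_one by simp
  also have "\<dots> = (\<Sum>v\<in>?N. T (matrix_unit u u))" by (intro sum.cong refl same) simp
  also have "\<dots> = of_nat (CARD('x) ^ length u) * T (matrix_unit u u)" by (simp add: words_card)
  finally show ?thesis using card_pos by (simp add: field_simps)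
qed

lemma corner_one: "corner u (word []) = matrix_unit u u"
  by (simp add: corner_def)

text \<open>
  For \<open>f = S\<^sub>u (1 - c g) S\<^sub>u\<^sup>*\<close> with \<open>|c| = 1\<close> the positive number \<open>T (f\<^sup>* f)\<close> is
  \<open>2 / k\<^sup>n - 2 Re (c T (S\<^sub>u g S\<^sub>u\<^sup>*))\<close>, where \<open>k\<close> is the size of the alphabet and \<open>n\<close> the length of \<open>u\<close>;
  the right choice of \<open>c\<close> gives the bound.
\<close>

lemma T_corner_bound:
  assumes g: "g \<in> carrier G" shows "cmod (T (corner u (U g))) \<le> 1 / real (CARD('x) ^ length u)"
proof -
  define A where "A = T (corner u (U g))"
  define A' where "A' = T (corner u (star (U g)))"
  define d where "d = 1 / real (CARD('x) ^ length u)"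
  have alg: "word [] \<in> alg" "U g \<in> alg" "star (U g) \<in> alg" using g by (auto intro!: fcar_star)
  have hom: "degree_zero (word [] :: ('g, 'x) gen free_elem)" "degree_zero (U g)" "degree_zero (star (U g))"
    by (simp_all add: degree_zero_simps star_word)
  note h = alg hom corner_alg degree_zero_corner degree_zero_conv
  have pos: "2 * of_real d - c * A - cnj c * A' \<in> \<real> \<and> 0 \<le> Re (2 * of_real d - c * A - cnj c * A')"
    if c: "cmod c = 1" for c
  proof -
    let ?f = "corner u (word []) - c \<bullet>\<^sub>c corner u (U g)"
    have f: "?f \<in> alg" "degree_zero ?f" using h by (auto intro!: degree_zero_simps(2,3))
    have sf: "star ?f = corner u (word []) - cnj c \<bullet>\<^sub>c corner u (star (U g))"
      by (simp add: star_diff star_scale corner_star star_word)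
    have cc: "cnj c * c = 1" using c by (metis complex_norm_square mult.commute of_real_1 power_one)
    have prod: "T (corner u a \<diamondop> corner u b) = T (corner u (a \<diamondop> b))"
      if "a \<in> alg" "b \<in> alg" "degree_zero a" "degree_zero b" for a b
      using that by (intro T_eqv corner_mult degree_zero_conv degree_zero_corner) auto
    have one: "T (corner u (word [])) = of_real d" unfolding corner_one d_def T_projection by simp
    have gg: "T (corner u (star (U g) \<diamondop> U g)) = of_real d"
      unfolding one[symmetric]
      by (intro T_eqv corner_eqv rel_left g degree_zero_corner degree_zero_conv h fcar_conv)
    have eq: "star ?f \<diamondop> ?f = corner u (word []) \<diamondop> corner u (word [])
        + (- c) \<bullet>\<^sub>c (corner u (word []) \<diamondop> corner u (U g))
        + ((- cnj c) \<bullet>\<^sub>c (corner u (star (U g)) \<diamondop> corner u (word []))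
        + 1 \<bullet>\<^sub>c (corner u (star (U g)) \<diamondop> corner u (U g)))"
      unfolding sf cc[symmetric]
      by (simp add: conv_diff_left conv_diff_right conv_scale_left conv_scale_right fun_simps algebra_simps)
    have pa: "corner u a \<diamondop> corner u b \<in> alg \<and> degree_zero (corner u a \<diamondop> corner u b)"
      if "a \<in> alg" "b \<in> alg" "degree_zero a" "degree_zero b" for a b
      using that by (auto intro!: fcar_conv degree_zero_conv degree_zero_corner)
    have "T (star ?f \<diamondop> ?f) = of_real d + (- c) * A + ((- cnj c) * A' + 1 * of_real d)"
      unfolding eq using pa h(1-6)
      by (simp add: T_add T_scale degree_zero_simps(1,3) prod one gg A_def A'_def del: scale_one)
    also have "\<dots> = 2 * of_real d - c * A - cnj c * A'" by simp
    finally show ?thesis using T_positive[OF f] by simp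
  qed
  \<comment> \<open>Reality of the values for \<open>c = 1\<close> and \<open>c = \<i>\<close>.\<close>
  have "A' = cnj A"
  proof (rule complex_eqI)
    show "Im A' = Im (cnj A)" using pos[of 1] by (simp add: complex_is_Real_iff)
    show "Re A' = Re (cnj A)" using pos[of \<i>] by (simp add: complex_is_Real_iff)
  qed
  \<comment> \<open>Positivity for all unimodular \<open>c\<close>, to be applied with the phase of \<open>cnj A\<close>.\<close>
  have le: "Re (c * A) \<le> d" if "cmod c = 1" for c
  proof -
    have "Re (2 * of_real d - c * A - cnj c * A') = 2 * d - 2 * Re (c * A)"
      using \<open>A' = cnj A\<close> by (simp add: algebra_simps)
    then show ?thesis using pos[OF that] by linarith
  qed
  have "cmod A \<le> d"
  proof (cases "A = 0")
    case True
    then show ?thesis by (simp add: d_def)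
  next
    case False
    have "cnj A / of_real (cmod A) * A = of_real (cmod A)"
      using False by (simp add: field_simps complex_norm_square[symmetric] power2_eq_square)
    then show ?thesis using le[of "cnj A / of_real (cmod A)"] False by (simp add: norm_divide)
  qed
  then show ?thesis by (simp add: A_def d_def)
qed

text \<open>
  Multiplying \<open>W\<close> from the right by \<open>1 = (\<Sum>u. S\<^sub>u S\<^sub>u\<^sup>*)\<close> writes it as a sum of elements \<open>S\<^sub>v g S\<^sub>u\<^sup>*\<close>, one
  for each word \<open>u\<close> of length \<open>n\<close> that does not lead to \<open>0\<close>. Each of them is evaluated separately.
\<close>

lemma T_word:
  assumes W: "letters W" "deg W = 0" and n: "length W \<le> n"
  shows "cmod (T (word W) - of_real (density W n)) \<le> real (card (undecided_words W n)) / real CARD('x) ^ n"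
proof -
  let ?N = "{u :: 'x list. length u = n}"
  let ?K = "real CARD('x) ^ n"
  let ?r = "\<lambda>u. realize (run W (u, \<one>)) \<diamondop> star (S u)"
  have Wa: "word W \<in> alg" using W by simp
  have out: "run W (u, \<one>) = Some (u', g') \<Longrightarrow> u \<in> ?N \<Longrightarrow> length u' = length u \<and> g' \<in> carrier G" for u u' g'
    using run_length[of W u \<one> u' g'] run_in[of W u \<one> u' g'] W by auto
  have hom: "?r u \<in> alg \<and> degree_zero (?r u)" if u: "u \<in> ?N" for u
  proof (cases "run W (u, \<one>)")
    case None
    then show ?thesis by (simp add: realize_def degree_zero_simps)
  next
    case (Some s)
    then obtain u' g' where s: "run W (u, \<one>) = Some (u', g')" by (cases s) auto
    have r: "?r u = S u' \<diamondop> U g' \<diamondop> star (S u)" by (simp add: s realize_def)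
    have "?r u \<in> alg" unfolding r by (intro fcar_conv fcar_star S_fcar U_alg) (use out[OF s u] in auto)
    moreover have "degree_zero (?r u)"
      unfolding r using out[OF s u] u by (simp add: star_word word_conv_word degree_zero_simps)
    ultimately show ?thesis ..
  qed
  have "word W = word W \<diamondop> word []" by simp
  have one: "word [] \<doteq> (\<Sum>u\<in>?N. matrix_unit u u)" by (rule eqv_sym[OF sum_projections])
  have "word W \<diamondop> word [] \<doteq> word W \<diamondop> (\<Sum>u\<in>?N. matrix_unit u u)" by (rule eqv_left[OF Wa one])
  also have "word W \<diamondop> (\<Sum>u\<in>?N. matrix_unit u u) \<doteq> (\<Sum>u\<in>?N. ?r u)"
  proof -
    have dist: "word W \<diamondop> (\<Sum>u\<in>X. h u) = (\<Sum>u\<in>X. word W \<diamondop> h u)" for X and h :: "'x list \<Rightarrow> ('g, 'x) gen free_elem"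
      by (induction X rule: infinite_finite_induct) (auto simp: conv_add_right)
    show ?thesis unfolding dist
    proof (rule eqv_sum)
      fix u assume u: "u \<in> ?N"
      have eq1: "word W \<diamondop> matrix_unit u u = word W \<diamondop> (S u \<diamondop> word []) \<diamondop> star (S u)"
        by (simp add: conv_assoc)
      have "word W \<diamondop> (S u \<diamondop> word []) \<diamondop> star (S u) \<doteq> word W \<diamondop> (S u \<diamondop> U \<one>) \<diamondop> star (S u)"
        by (intro eqv_right eqv_left eqv_sym[OF rel_one] S_fcar fcar_star Wa)
      also have "\<dots> \<doteq> ?r u"
        by (intro eqv_right run_realize fcar_star S_fcar) (use W n u in auto)
      finally show "word W \<diamondop> matrix_unit u u \<doteq> ?r u" unfolding eq1 .
    qed
  qed
  finally have "word W \<doteq> (\<Sum>u\<in>?N. ?r u)" by simp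
  then have TW: "T (word W) = (\<Sum>u\<in>?N. T (?r u))"
    using T_sum[of ?N ?r] hom W T_eqv[of "word W" "\<Sum>u\<in>?N. ?r u"] by (simp add: degree_zero_simps)
  have c: "cmod (T (?r u) - (if u \<in> fixed_words W n then 1 / of_real ?K else 0)) \<le>
      (if u \<in> undecided_words W n then 1 / ?K else 0)" if u: "u \<in> ?N" for u
  proof (cases "run W (u, \<one>)")
    case None
    have "u \<notin> fixed_words W n" by (simp add: fixed_words_def None)
    then show ?thesis by (simp add: None realize_def T_zero)
  next
    case (Some s)
    then obtain u' g' where s: "run W (u, \<one>) = Some (u', g')" by (cases s) auto
    have o: "length u' = length u" "g' \<in> carrier G" using out[OF s u] by auto
    have r: "?r u = S u' \<diamondop> U g' \<diamondop> star (S u)" by (simp add: s realize_def)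
    show ?thesis
    proof (cases "u' = u")
      case False
      then have f: "u \<notin> fixed_words W n" using s by (simp add: fixed_words_def)
      \<comment> \<open>The trace property moves the projection \<open>S\<^sub>u S\<^sub>u\<^sup>*\<close> from the right to the left, where it meets the orthogonal \<open>S u'\<close>.\<close>
      have eq1: "?r u \<diamondop> matrix_unit u u = S u' \<diamondop> U g' \<diamondop> (star (S u) \<diamondop> S u) \<diamondop> star (S u)"
        by (simp add: r conv_assoc)
      have eq2: "?r u = S u' \<diamondop> U g' \<diamondop> word [] \<diamondop> star (S u)"
        by (simp add: r)
      have "star (S u) \<diamondop> S u \<doteq> word []" using S_star_S[of u u] by simp
      then have "?r u \<diamondop> matrix_unit u u \<doteq> ?r u"
        unfolding eq1 unfolding eq2 by (intro eqv_right eqv_left fcar_star S_fcar S_U_fcar o)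
      moreover have h1: "degree_zero (?r u)" "?r u \<in> alg" using hom[OF u] by auto
      moreover have h2: "degree_zero (matrix_unit u u)" by (rule matrix_unit_degree_zero) simp
      ultimately have "T (?r u) = T (?r u \<diamondop> matrix_unit u u)"
        using T_eqv degree_zero_conv[OF h1(1) h2] by metis
      also have "\<dots> = T (matrix_unit u u \<diamondop> ?r u)"
        by (rule T_commute[OF h1(2,1) matrix_unit_alg h2])
      also have "\<dots> = T 0"
      proof (rule T_eqv)
        have eq3: "matrix_unit u u \<diamondop> ?r u = S u \<diamondop> (star (S u) \<diamondop> S u') \<diamondop> (U g' \<diamondop> star (S u))"
          by (simp add: r conv_assoc)
        have "star (S u) \<diamondop> S u' \<doteq> 0" using S_star_S[of u u'] o False by simp
        then have "S u \<diamondop> (star (S u) \<diamondop> S u') \<diamondop> (U g' \<diamondop> star (S u)) \<doteq> S u \<diamondop> 0 \<diamondop> (U g' \<diamondop> star (S u))"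
          by (intro eqv_right eqv_left fcar_star S_fcar fcar_conv U_alg o)
        then show "matrix_unit u u \<diamondop> ?r u \<doteq> 0" unfolding eq3 by simp
      qed (rule degree_zero_conv[OF h2 h1(1)], rule degree_zero_simps(5))
      finally show ?thesis using f T_zero by simp
    next
      case True
      then have rc: "?r u = corner u (U g')" by (simp add: r corner_def)
      show ?thesis
      proof (cases "g' = \<one>")
        case one: True
        have f: "u \<in> fixed_words W n" using u s True one by (simp add: fixed_words_def)
        have "T (?r u) = T (corner u (word []))"
          unfolding rc one
          by (intro T_eqv corner_eqv rel_one degree_zero_corner) (auto simp: degree_zero_simps)
        also have "\<dots> = 1 / of_real ?K" using u by (simp add: corner_one T_projection)
        finally show ?thesis using f by simp
      next
        case False
        have "u \<notin> fixed_words W n" "u \<in> undecided_words W n"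
          using u s True False by (auto simp: fixed_words_def undecided_words_def)
        then show ?thesis using T_corner_bound[OF o(2), of u] u rc by simp
      qed
    qed
  qed
  have "(\<Sum>u\<in>?N. if u \<in> fixed_words W n then 1 / of_real ?K else 0 :: complex) = of_real (density W n)"
  proof -
    have "(\<Sum>u\<in>?N. if u \<in> fixed_words W n then 1 / of_real ?K else 0 :: complex) =
        (\<Sum>u\<in>fixed_words W n. 1 / of_real ?K)"
      by (subst sum.inter_filter[symmetric])
         (auto simp: words_finite fixed_words_def intro!: sum.cong arg_cong[where f = of_nat] arg_cong[where f = card])
    then show ?thesis by (simp add: density_def)
  qed
  moreover have "(\<Sum>u\<in>?N. if u \<in> undecided_words W n then 1 / ?K else 0) =
      real (card (undecided_words W n)) / ?K"
  proof -
    have "(\<Sum>u\<in>?N. if u \<in> undecided_words W n then 1 / ?K else 0) = (\<Sum>u\<in>undecided_words W n. 1 / ?K)"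
      by (subst sum.inter_filter[symmetric])
         (auto simp: words_finite undecided_words_def intro!: sum.cong arg_cong[where f = of_nat] arg_cong[where f = card])
    then show ?thesis by simp
  qed
  moreover have "cmod (\<Sum>u\<in>?N. T (?r u) - (if u \<in> fixed_words W n then 1 / of_real ?K else 0)) \<le>
      (\<Sum>u\<in>?N. if u \<in> undecided_words W n then 1 / ?K else 0)"
    by (rule sum_norm_le) (rule c)
  ultimately show ?thesis unfolding TW by (simp add: sum_subtractf)
qed

lemma T_eq_tr: assumes "f \<in> alg" "degree_zero f" shows "T f = tr f"
  using assms
proof (induction rule: degree_zero_induct)
  case (word c W)
  have "(\<lambda>n. T (word W) - of_real (density W n)) \<longlonglongrightarrow> 0"
  proof (rule Lim_null_comparison)
    show "\<forall>\<^sub>F n in sequentially. cmod (T (word W) - of_real (density W n)) \<le>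
        real (card (undecided_words W n)) / real CARD('x) ^ n"
      using eventually_ge_at_top[of "length W"] by eventually_elim (rule T_word[OF word])
    show "(\<lambda>n. real (card (undecided_words W n)) / real CARD('x) ^ n) \<longlonglongrightarrow> 0"
      by (rule undecided_words_density[OF word])
  qed
  from tendsto_add[OF this tendsto_of_real[OF density_tendsto[OF word]]]
  have "T (word W) = of_real (word_trace W)" by (simp add: LIMSEQ_const_iff)
  then show ?case using word by (simp add: T_scale tr_scale tr_word degree_zero_simps)
qed (auto simp: T_zero T_add tr_add)

end

section \<open>Algebras with a dense image of the free algebra\<close>

text \<open>
  \<open>B\<close> is a quotient of the universal algebra, presented by the map \<open>q\<close> from sequences of polynomials
  that are Cauchy for the universal seminorm, and \<open>p\<close> is its norm pulled back to polynomials. For the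
  universal algebra itself \<open>p\<close> is the universal seminorm; for the algebra of an orbit it is the
  operator norm. The bound \<open>p_trace\<close> lets the trace on polynomials descend to \<open>B\<close>.
\<close>

locale dense_model = generic_action G \<phi>
  for G :: "('g, 'm) monoid_scheme" (structure)
    and \<phi> :: "'g \<Rightarrow> (nat \<Rightarrow> 'x::finite) \<Rightarrow> (nat \<Rightarrow> 'x)" +
  fixes p :: "('g, 'x) gen free_elem \<Rightarrow> real"
    and B :: "('b, 'n) normed_star_algebra_scheme"
    and q :: "(nat \<Rightarrow> ('g, 'x) gen free_elem) \<Rightarrow> 'b"
  assumes admissible_p: "admissible p"
    and p_gauge: "f \<in> alg \<Longrightarrow> p (gauge_aut t f) = p f"
    and p_trace: "f \<in> alg \<Longrightarrow> degree_zero f \<Longrightarrow> cmod (tr f) \<le> p f"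
    and q_onto: "q ` univ.CS = carrier B"
    and q_eq: "\<xi> \<in> univ.CS \<Longrightarrow> \<eta> \<in> univ.CS \<Longrightarrow> q \<xi> = q \<eta> \<longleftrightarrow> (\<lambda>n. p (\<xi> n - \<eta> n)) \<longlonglongrightarrow> 0"
    and q_add: "\<xi> \<in> univ.CS \<Longrightarrow> \<eta> \<in> univ.CS \<Longrightarrow> q \<xi> \<oplus>\<^bsub>B\<^esub> q \<eta> = q (\<lambda>n. \<xi> n + \<eta> n)"
    and q_mult: "\<xi> \<in> univ.CS \<Longrightarrow> \<eta> \<in> univ.CS \<Longrightarrow> q \<xi> \<otimes>\<^bsub>B\<^esub> q \<eta> = q (\<lambda>n. \<xi> n \<diamondop> \<eta> n)"
    and q_scal: "\<xi> \<in> univ.CS \<Longrightarrow> scal B c (q \<xi>) = q (\<lambda>n. c \<bullet>\<^sub>c \<xi> n)"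
    and q_adj: "\<xi> \<in> univ.CS \<Longrightarrow> adj B (q \<xi>) = q (\<lambda>n. star (\<xi> n))"
    and q_one: "\<one>\<^bsub>B\<^esub> = q (\<lambda>n. word [])"
    and q_nrm: "\<xi> \<in> univ.CS \<Longrightarrow> (\<lambda>n. p (\<xi> n)) \<longlonglongrightarrow> nrm B (q \<xi>)"
begin

abbreviation "CSQ \<equiv> univ.CS"
abbreviation emb :: "('g, 'x) gen free_elem \<Rightarrow> 'b" where "emb f \<equiv> q (\<lambda>n. f)"
abbreviation gen_img :: "('g, 'x) gen \<Rightarrow> 'b" where "gen_img z \<equiv> emb (word [(z, False)])"

sublocale p: cstar_seminormed "gens G" p
  using admissible_p by (simp add: admissible_def cstar_seminormed_def)

lemma p_le_univ: "f \<in> alg \<Longrightarrow> p f \<le> univ f"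
  by (rule univ_upper[OF admissible_p])

lemma q_in: "\<xi> \<in> CSQ \<Longrightarrow> q \<xi> \<in> carrier B"
  using q_onto by blast

lemma q_cases: assumes "b \<in> carrier B" obtains \<xi> where "\<xi> \<in> CSQ" "b = q \<xi>"
  using assms q_onto by blast

lemma const_CS: "f \<in> alg \<Longrightarrow> (\<lambda>n. f) \<in> CSQ"
  by (simp add: univ.CS_const)

lemma q_cong:
  assumes "\<xi> \<in> CSQ" "\<eta> \<in> CSQ" "(\<lambda>n. univ (\<xi> n - \<eta> n)) \<longlonglongrightarrow> 0" shows "q \<xi> = q \<eta>"
  unfolding q_eq[OF assms(1,2)]
  by (rule univ.tendsto_zero_le[OF assms(3)])
     (intro p.nonneg p_le_univ fcar_diff univ.CS_fcar assms)+

lemma p_Cauchy: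
  assumes "\<xi> \<in> CSQ" "\<epsilon> > 0" shows "\<exists>N. \<forall>m\<ge>N. \<forall>n\<ge>N. p (\<xi> m - \<xi> n) < \<epsilon>"
proof -
  obtain N where N: "\<forall>m\<ge>N. \<forall>n\<ge>N. univ (\<xi> m - \<xi> n) < \<epsilon>" using univ.CS_ev[OF assms] by blast
  have "p (\<xi> m - \<xi> n) < \<epsilon>" if "m \<ge> N" "n \<ge> N" for m n
  proof -
    have "p (\<xi> m - \<xi> n) \<le> univ (\<xi> m - \<xi> n)" by (intro p_le_univ fcar_diff univ.CS_fcar assms)
    also have "\<dots> < \<epsilon>" using N that by blast
    finally show ?thesis .
  qed
  then show ?thesis by blast
qed

section \<open>The gauge action\<close>

definition gauge_model :: "real \<Rightarrow> 'b \<Rightarrow> 'b" where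
  "gauge_model t = (\<lambda>b\<in>carrier B. q (\<lambda>n. gauge_aut t ((SOME \<xi>. \<xi> \<in> CSQ \<and> q \<xi> = b) n)))"

lemma gauge_model_q: assumes "\<xi> \<in> CSQ" shows "gauge_model t (q \<xi>) = q (\<lambda>n. gauge_aut t (\<xi> n))"
proof -
  define \<eta> where "\<eta> = (SOME \<eta>. \<eta> \<in> CSQ \<and> q \<eta> = q \<xi>)"
  have \<eta>: "\<eta> \<in> CSQ" "q \<eta> = q \<xi>"
    using someI[of "\<lambda>\<eta>. \<eta> \<in> CSQ \<and> q \<eta> = q \<xi>" \<xi>] assms unfolding \<eta>_def by auto
  have "p (gauge_aut t (\<eta> n) - gauge_aut t (\<xi> n)) = p (\<eta> n - \<xi> n)" for n
    unfolding gauge_aut_diff[symmetric] by (intro p_gauge fcar_diff univ.CS_fcar \<eta> assms)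
  then have "q (\<lambda>n. gauge_aut t (\<eta> n)) = q (\<lambda>n. gauge_aut t (\<xi> n))"
    using \<eta> assms q_eq[OF \<eta>(1) assms] by (subst q_eq) (auto intro: univ_CS_gauge)
  then show ?thesis using q_in[OF assms] by (simp add: gauge_model_def \<eta>_def)
qed

lemma gauge_model_automorphism: "star_automorphism B (gauge_model t)"
  unfolding star_automorphism_def
proof (intro conjI ballI allI)
  show "gauge_model t \<in> extensional (carrier B)" unfolding gauge_model_def by (rule restrict_extensional)
  have inv: "gauge_model (- s) (gauge_model s b) = b" if "b \<in> carrier B" for b s
    using that by (elim q_cases) (simp add: gauge_model_q univ_CS_gauge gauge_aut_gauge_aut)
  have into: "gauge_model s b \<in> carrier B" if "b \<in> carrier B" for b s
    using that by (elim q_cases) (simp add: gauge_model_q univ_CS_gauge q_in)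
  show "bij_betw (gauge_model t) (carrier B) (carrier B)"
    by (rule bij_betw_byWitness[where f' = "gauge_model (- t)"])
       (use inv[of _ t] inv[of _ "- t"] into in auto)
  fix a assume "a \<in> carrier B"
  then obtain \<xi> where \<xi>: "\<xi> \<in> CSQ" "a = q \<xi>" by (rule q_cases)
  show "gauge_model t (scal B c a) = scal B c (gauge_model t a)" for c
    using \<xi> by (simp add: gauge_model_q univ_CS_gauge q_scal univ.CS_scale gauge_aut_scale)
  show "gauge_model t (adj B a) = adj B (gauge_model t a)"
    using \<xi> by (simp add: gauge_model_q univ_CS_gauge q_adj univ.CS_star gauge_aut_star)
  have "p (gauge_aut t (\<xi> n)) = p (\<xi> n)" for n by (intro p_gauge univ.CS_fcar \<xi>)
  then show "nrm B (gauge_model t a) = nrm B a"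
    using q_nrm[OF univ_CS_gauge[OF \<xi>(1), of t]] q_nrm[OF \<xi>(1)] \<xi> LIMSEQ_unique
    by (simp add: gauge_model_q)
  fix b assume "b \<in> carrier B"
  then obtain \<eta> where \<eta>: "\<eta> \<in> CSQ" "b = q \<eta>" by (rule q_cases)
  show "gauge_model t (a \<oplus>\<^bsub>B\<^esub> b) = gauge_model t a \<oplus>\<^bsub>B\<^esub> gauge_model t b"
    using \<xi> \<eta> by (simp add: gauge_model_q univ_CS_gauge q_add univ.CS_add gauge_aut_add)
  show "gauge_model t (a \<otimes>\<^bsub>B\<^esub> b) = gauge_model t a \<otimes>\<^bsub>B\<^esub> gauge_model t b"
    using \<xi> \<eta> by (simp add: gauge_model_q univ_CS_gauge q_mult univ.CS_conv gauge_aut_conv)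
qed

lemma automorphism_on_polynomials:
  assumes \<alpha>: "star_automorphism B \<alpha>"
    and gen: "\<And>z. z \<in> gens G \<Longrightarrow> \<alpha> (gen_img z) = emb (gauge_aut t (word [(z, False)]))"
    and f: "f \<in> alg"
  shows "\<alpha> (emb f) = emb (gauge_aut t f)"
proof -
  have bij: "bij_betw \<alpha> (carrier B) (carrier B)"
    and add: "\<And>a b. a \<in> carrier B \<Longrightarrow> b \<in> carrier B \<Longrightarrow> \<alpha> (a \<oplus>\<^bsub>B\<^esub> b) = \<alpha> a \<oplus>\<^bsub>B\<^esub> \<alpha> b"
    and mult: "\<And>a b. a \<in> carrier B \<Longrightarrow> b \<in> carrier B \<Longrightarrow> \<alpha> (a \<otimes>\<^bsub>B\<^esub> b) = \<alpha> a \<otimes>\<^bsub>B\<^esub> \<alpha> b"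
    and scal: "\<And>c a. a \<in> carrier B \<Longrightarrow> \<alpha> (scal B c a) = scal B c (\<alpha> a)"
    and adj: "\<And>a. a \<in> carrier B \<Longrightarrow> \<alpha> (adj B a) = adj B (\<alpha> a)"
    using \<alpha> by (auto simp: star_automorphism_def)
  have into: "\<alpha> b \<in> carrier B" if "b \<in> carrier B" for b using bij that by (auto dest: bij_betwE)
  have e: "emb (word []) \<in> carrier B" by (intro q_in const_CS) simp
  have one: "\<alpha> (emb (word [])) = emb (word [])"
  proof -
    obtain c where c: "c \<in> carrier B" "\<alpha> c = emb (word [])"
      using bij_betw_imp_surj_on[OF bij] e by (metis imageE)
    have r: "b \<otimes>\<^bsub>B\<^esub> emb (word []) = b" "emb (word []) \<otimes>\<^bsub>B\<^esub> b = b" if "b \<in> carrier B" for b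
      using that by (auto elim!: q_cases simp: q_mult const_CS)
    have "emb (word []) = \<alpha> (c \<otimes>\<^bsub>B\<^esub> emb (word []))" using c r by simp
    also have "\<dots> = \<alpha> (emb (word []))" using mult[OF c(1) e] c r into[OF e] by simp
    finally show ?thesis ..
  qed
  have letter: "\<alpha> (emb (word [l])) = emb (gauge_aut t (word [l]))" if "fst l \<in> gens G" for l
  proof -
    obtain z b where l: "l = (z, b)" by (cases l)
    have z: "z \<in> gens G" using that l by simp
    have za: "word [(z, False)] \<in> alg" using z by simp
    show ?thesis
    proof (cases b)
      case True
      then have w: "word [l] = star (word [(z, False)])" using l by (simp add: star_word)
      have "\<alpha> (emb (word [l])) = \<alpha> (adj B (gen_img z))"
        unfolding w by (simp add: q_adj const_CS[OF za])
      also have "\<dots> = adj B (emb (gauge_aut t (word [(z, False)])))"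
        using adj[OF q_in[OF const_CS[OF za]]] gen[OF z] by simp
      also have "\<dots> = emb (gauge_aut t (word [l]))"
        unfolding w gauge_aut_star by (rule q_adj) (intro const_CS gauge_aut_fcar za)
      finally show ?thesis .
    next
      case False
      then show ?thesis using gen[OF z] l by simp
    qed
  qed
  have words: "\<alpha> (emb (word w)) = emb (gauge_aut t (word w))" if "letters w" for w
    using that
  proof (induction w)
    case Nil
    have "gauge_aut t (word []) = (word [] :: ('g, 'x) gen free_elem)" by (rule degree_zero_gauge) (simp add: degree_zero_simps)
    then show ?case by (simp add: one)
  next
    case (Cons l w)
    have l: "word [l] \<in> alg" and w: "word w \<in> alg" using Cons.prems by auto
    have split: "word (l # w) = word [l] \<diamondop> word w" by (simp add: word_conv_word)
    have "\<alpha> (emb (word (l # w))) = \<alpha> (emb (word [l]) \<otimes>\<^bsub>B\<^esub> emb (word w))"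
      unfolding split by (simp add: q_mult const_CS[OF l] const_CS[OF w])
    also have "\<dots> = emb (gauge_aut t (word [l])) \<otimes>\<^bsub>B\<^esub> emb (gauge_aut t (word w))"
      using mult[OF q_in[OF const_CS[OF l]] q_in[OF const_CS[OF w]]] Cons letter[of l] by simp
    also have "\<dots> = emb (gauge_aut t (word (l # w)))"
      unfolding split gauge_aut_conv by (rule q_mult) (intro const_CS gauge_aut_fcar l w)+
    finally show ?case .
  qed
  show ?thesis using f
  proof (induction rule: fcar_induct)
    case zero
    have z: "emb 0 \<in> carrier B" by (intro q_in const_CS fcar_zero)
    obtain \<eta> where \<eta>: "\<eta> \<in> CSQ" "\<alpha> (emb 0) = q \<eta>" using q_cases[OF into[OF z]] by blast
    have "\<alpha> (emb 0) = \<alpha> (scal B 0 (emb 0))" by (simp add: q_scal const_CS)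
    also have "\<dots> = emb 0" using \<eta> scal[OF z, of 0] by (simp add: q_scal)
    finally show ?case by (simp add: degree_zero_gauge degree_zero_simps)
  next
    case (add f g)
    have "\<alpha> (emb (f + g)) = \<alpha> (emb f \<oplus>\<^bsub>B\<^esub> emb g)" using add by (simp add: q_add const_CS)
    also have "\<dots> = emb (gauge_aut t f) \<oplus>\<^bsub>B\<^esub> emb (gauge_aut t g)"
      using add assms(1) \<open>\<And>a b. a \<in> carrier B \<Longrightarrow> b \<in> carrier B \<Longrightarrow> \<alpha> (a \<oplus>\<^bsub>B\<^esub> b) = \<alpha> a \<oplus>\<^bsub>B\<^esub> \<alpha> b\<close>[OF q_in[OF const_CS[OF add(1)]] q_in[OF const_CS[OF add(2)]]]
      by simp
    also have "\<dots> = emb (gauge_aut t (f + g))" using add by (simp add: q_add const_CS gauge_aut_add)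
    finally show ?case .
  next
    case (word c w)
    have w: "word w \<in> alg" using word by simp
    have "\<alpha> (emb (c \<bullet>\<^sub>c word w)) = \<alpha> (scal B c (emb (word w)))" by (simp add: q_scal const_CS[OF w])
    also have "\<dots> = scal B c (emb (gauge_aut t (word w)))"
      using scal[OF q_in[OF const_CS[OF w]]] words[OF word] by simp
    also have "\<dots> = emb (gauge_aut t (c \<bullet>\<^sub>c word w))"
      unfolding gauge_aut_scale by (rule q_scal) (intro const_CS gauge_aut_fcar w)
    finally show ?case .
  qed
qed

text \<open>
  An automorphism is isometric, so it is determined by its values on the dense set of polynomials,
  and there by its values on the generators.
\<close>

lemma automorphism_eq:
  assumes \<alpha>: "star_automorphism B \<alpha>"
    and gen: "\<And>z. z \<in> gens G \<Longrightarrow> \<alpha> (gen_img z) = emb (gauge_aut t (word [(z, False)]))"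
  shows "\<alpha> = gauge_model t"
proof (rule extensionalityI)
  show "\<alpha> \<in> extensional (carrier B)" using \<alpha> by (simp add: star_automorphism_def)
  show "gauge_model t \<in> extensional (carrier B)" unfolding gauge_model_def by (rule restrict_extensional)
  fix b assume b: "b \<in> carrier B"
  then obtain \<xi> where \<xi>: "\<xi> \<in> CSQ" "b = q \<xi>" by (rule q_cases)
  have "\<alpha> b \<in> carrier B" using \<alpha> b by (auto simp: star_automorphism_def dest: bij_betwE)
  then obtain \<eta> where \<eta>: "\<eta> \<in> CSQ" "\<alpha> b = q \<eta>" by (rule q_cases)
  let ?g = "gauge_aut t"
  have lim: "(\<lambda>n. p (\<eta> n - ?g (\<xi> m))) \<longlonglongrightarrow> nrm B (q (\<lambda>n. \<xi> n - \<xi> m))" for m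
  proof -
    have m: "\<xi> m \<in> alg" "?g (\<xi> m) \<in> alg" using univ.CS_fcar[OF \<xi>(1)] by auto
    note c1 = const_CS[OF m(1)] and c2 = const_CS[OF m(2)]
    have d: "q (\<lambda>n. \<zeta> n - f) = q \<zeta> \<oplus>\<^bsub>B\<^esub> scal B (- 1) (emb f)" if "\<zeta> \<in> CSQ" "f \<in> alg" for \<zeta> f
    proof -
      have "(\<lambda>n. \<zeta> n - f) = (\<lambda>n. \<zeta> n + (- 1) \<bullet>\<^sub>c f)" by (simp add: scale_minus)
      then show ?thesis
        using q_add[OF that(1) univ.CS_scale[OF const_CS[OF that(2)], of "- 1"]] q_scal[OF const_CS[OF that(2)], of "- 1"]
        by simp
    qed
    have in1: "emb (\<xi> m) \<in> carrier B" "scal B (- 1) (emb (\<xi> m)) \<in> carrier B"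
      using q_in[OF c1] q_in[OF univ.CS_scale[OF c1]] by (auto simp: q_scal[OF c1])
    have "\<alpha> (q (\<lambda>n. \<xi> n - \<xi> m)) = \<alpha> b \<oplus>\<^bsub>B\<^esub> scal B (- 1) (\<alpha> (emb (\<xi> m)))"
      unfolding d[OF \<xi>(1) m(1)] using \<alpha> b in1 \<xi>(2) by (simp add: star_automorphism_def)
    also have "\<alpha> (emb (\<xi> m)) = emb (?g (\<xi> m))"
      by (rule automorphism_on_polynomials[OF \<alpha> gen m(1)])
    also have "\<alpha> b \<oplus>\<^bsub>B\<^esub> scal B (- 1) (emb (?g (\<xi> m))) = q (\<lambda>n. \<eta> n - ?g (\<xi> m))"
      unfolding \<eta>(2) by (rule d[OF \<eta>(1) m(2), symmetric])
    finally have eq: "\<alpha> (q (\<lambda>n. \<xi> n - \<xi> m)) = q (\<lambda>n. \<eta> n - ?g (\<xi> m))" .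
    have "nrm B (\<alpha> (q (\<lambda>n. \<xi> n - \<xi> m))) = nrm B (q (\<lambda>n. \<xi> n - \<xi> m))"
      using \<alpha> q_in[OF univ.CS_diff[OF \<xi>(1) c1]] by (simp add: star_automorphism_def)
    then show ?thesis using q_nrm[OF univ.CS_diff[OF \<eta>(1) c2]] eq by simp
  qed
  have "(\<lambda>n. p (\<eta> n - ?g (\<xi> n))) \<longlonglongrightarrow> 0"
  proof (rule LIMSEQ_I)
    fix r :: real assume "r > 0"
    then have posN: "0 < r / 3" by simp
    obtain N where N0: "\<forall>m\<ge>N. \<forall>n\<ge>N. p (\<xi> m - \<xi> n) < r / 3" using p_Cauchy[OF \<xi>(1) posN] by blast
    note N = N0[rule_format]
    have "nrm B (q (\<lambda>n. \<xi> n - \<xi> N)) \<le> r / 3"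
    proof (rule LIMSEQ_le_const2[OF q_nrm])
      show "(\<lambda>n. \<xi> n - \<xi> N) \<in> CSQ" by (intro univ.CS_diff const_CS \<xi> univ.CS_fcar)
      show "\<exists>M. \<forall>n\<ge>M. p (\<xi> n - \<xi> N) \<le> r / 3" using N by (intro exI[of _ N]) (auto intro: less_imp_le)
    qed
    then have "\<forall>\<^sub>F n in sequentially. p (\<eta> n - ?g (\<xi> N)) < 2 * (r / 3)"
      using \<open>r > 0\<close> by (intro order_tendstoD(2)[OF lim]) auto
    then obtain M where M: "\<And>n. n \<ge> M \<Longrightarrow> p (\<eta> n - ?g (\<xi> N)) < 2 * (r / 3)"
      by (auto simp: eventually_sequentially)
    have "norm (p (\<eta> n - ?g (\<xi> n)) - 0) < r" if n: "n \<ge> max M N" for n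
    proof -
      have a: "\<eta> n \<in> alg" "?g (\<xi> N) \<in> alg" "?g (\<xi> n) \<in> alg" "\<xi> N - \<xi> n \<in> alg"
        using univ.CS_fcar[OF \<xi>(1)] univ.CS_fcar[OF \<eta>(1)] by auto
      have "p (\<eta> n - ?g (\<xi> n)) \<le> p (\<eta> n - ?g (\<xi> N)) + p (?g (\<xi> N) - ?g (\<xi> n))"
        by (rule p.diff_triangle[OF a(1-3)])
      also have "p (?g (\<xi> N) - ?g (\<xi> n)) = p (\<xi> N - \<xi> n)"
        unfolding gauge_aut_diff[symmetric] by (rule p_gauge[OF a(4)])
      also have "p (\<eta> n - ?g (\<xi> N)) + p (\<xi> N - \<xi> n) < 2 * (r / 3) + r / 3"
        using M[of n] N[of N n] n by (intro add_strict_mono) auto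
      finally show ?thesis using p.nonneg[OF fcar_diff[OF a(1,3)]] by simp
    qed
    then show "\<exists>no. \<forall>n\<ge>no. norm (p (\<eta> n - ?g (\<xi> n)) - 0) < r" by blast
  qed
  then have "q \<eta> = q (\<lambda>n. ?g (\<xi> n))" by (subst q_eq[OF \<eta>(1) univ_CS_gauge[OF \<xi>(1)]])
  then show "\<alpha> b = gauge_model t b" using \<xi> \<eta> by (simp add: gauge_model_q)
qed

lemma gauge_gen:
  "g \<in> carrier G \<Longrightarrow> emb (gauge_aut t (word [(Grp g, False)])) = gen_img (Grp g)"
  "emb (gauge_aut t (word [(Iso x, False)])) = scal B (cis t) (gen_img (Iso x))"
  by (simp_all add: gauge_aut_word q_scal const_CS)

text \<open>
  The gauge action is defined by a description, so both existence and uniqueness of the automorphism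
  matter here.
\<close>

lemma gauge_action_eq: "gauge_action G B gen_img t = gauge_model t"
  unfolding gauge_action_def
proof (rule the_equality)
  have "gauge_model t (gen_img z) = emb (gauge_aut t (word [(z, False)]))" if "z \<in> gens G" for z
    by (rule gauge_model_q) (use that in \<open>simp add: const_CS\<close>)
  then show "star_automorphism B (gauge_model t) \<and>
     (\<forall>g\<in>carrier G. gauge_model t (gen_img (Grp g)) = gen_img (Grp g)) \<and>
     (\<forall>x. gauge_model t (gen_img (Iso x)) = scal B (cis t) (gen_img (Iso x)))"
    using gauge_model_automorphism by (simp add: gauge_gen)
  fix \<alpha> assume \<alpha>: "star_automorphism B \<alpha> \<and>
     (\<forall>g\<in>carrier G. \<alpha> (gen_img (Grp g)) = gen_img (Grp g)) \<and>
     (\<forall>x. \<alpha> (gen_img (Iso x)) = scal B (cis t) (gen_img (Iso x)))"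
  show "\<alpha> = gauge_model t"
  proof (rule automorphism_eq)
    show "\<alpha> (gen_img z) = emb (gauge_aut t (word [(z, False)]))" if "z \<in> gens G" for z
      using \<alpha> that by (cases z) (simp_all add: gauge_gen)
  qed (use \<alpha> in blast)
qed

text \<open>The sequences that represent the gauge invariant elements, see \<open>BI_carrier\<close>.\<close>

definition CS0 :: "(nat \<Rightarrow> ('g, 'x) gen free_elem) set" where
  "CS0 = {\<xi> \<in> CSQ. \<forall>n. degree_zero (\<xi> n)}"

abbreviation "BI \<equiv> gauge_invariant G B gen_img"

text \<open>
  If a sequence represents a gauge invariant element, its late terms are moved by every gauge
  automorphism by at most a fixed small amount. The average over the roots of unity moves them by no more,
  and it is the degree zero part.
\<close>

lemma BI_carrier: "carrier BI = q ` CS0"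
proof (rule Set.set_eqI, rule iffI)
  have car: "b \<in> carrier BI \<longleftrightarrow> b \<in> carrier B \<and> (\<forall>t. gauge_model t b = b)" for b
    by (simp add: gauge_invariant_def gauge_action_eq)
  {
    fix b assume "b \<in> q ` CS0"
    then obtain \<xi> where \<xi>: "\<xi> \<in> CSQ" "\<And>n. degree_zero (\<xi> n)" "b = q \<xi>" by (auto simp: CS0_def)
    then have "gauge_model t b = b" for t by (simp add: gauge_model_q degree_zero_gauge)
    then show "b \<in> carrier BI" unfolding car using \<xi> q_in by simp
  next
    fix b assume b: "b \<in> carrier BI"
    then have "b \<in> carrier B" by (simp add: car)
    then obtain \<xi> where \<xi>: "\<xi> \<in> CSQ" "b = q \<xi>" by (rule q_cases)
    have lim: "(\<lambda>n. p (gauge_aut t (\<xi> n) - \<xi> n)) \<longlonglongrightarrow> 0" for t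
      using b \<xi> q_eq[OF univ_CS_gauge[OF \<xi>(1)] \<xi>(1)] by (simp add: car gauge_model_q)
    have "(\<lambda>n. p (degree_zero_part (\<xi> n) - \<xi> n)) \<longlonglongrightarrow> 0"
    proof (rule LIMSEQ_I)
      fix r :: real assume "r > 0"
      then have posN: "0 < r / 4" by simp
      obtain N where N0: "\<forall>m\<ge>N. \<forall>n\<ge>N. p (\<xi> m - \<xi> n) < r / 4" using p_Cauchy[OF \<xi>(1) posN] by blast
      note N = N0[rule_format]
      have "norm (p (degree_zero_part (\<xi> m) - \<xi> m) - 0) < r" if m: "m \<ge> N" for m
      proof -
        have a: "\<xi> n \<in> alg" for n using univ.CS_fcar[OF \<xi>(1)] .
        \<comment> \<open>The bound is uniform in \<open>t\<close>, because gauge automorphisms are isometric for \<open>p\<close>.\<close>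
        have g: "p (gauge_aut t (\<xi> m) - \<xi> m) \<le> r / 2" for t
        proof (rule LIMSEQ_le_const)
          show "(\<lambda>n. r / 2 + p (gauge_aut t (\<xi> n) - \<xi> n)) \<longlonglongrightarrow> r / 2"
            using tendsto_add[OF tendsto_const lim[of t], of "r / 2"] by simp
          have "p (gauge_aut t (\<xi> m) - \<xi> m) \<le> r / 2 + p (gauge_aut t (\<xi> n) - \<xi> n)" if n: "n \<ge> N" for n
          proof -
            have 1: "p (gauge_aut t (\<xi> m) - \<xi> m) \<le> p (gauge_aut t (\<xi> m) - gauge_aut t (\<xi> n)) + p (gauge_aut t (\<xi> n) - \<xi> m)"
              by (intro p.diff_triangle gauge_aut_fcar a)
            have 2: "p (gauge_aut t (\<xi> n) - \<xi> m) \<le> p (gauge_aut t (\<xi> n) - \<xi> n) + p (\<xi> n - \<xi> m)"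
              by (intro p.diff_triangle gauge_aut_fcar a)
            have 3: "p (gauge_aut t (\<xi> m) - gauge_aut t (\<xi> n)) = p (\<xi> m - \<xi> n)"
              unfolding gauge_aut_diff[symmetric] by (intro p_gauge fcar_diff a)
            show ?thesis using 1 2 3 N[OF m n] N[OF n m] by linarith
          qed
          then show "\<exists>M. \<forall>n\<ge>M. p (gauge_aut t (\<xi> m) - \<xi> m) \<le> r / 2 + p (gauge_aut t (\<xi> n) - \<xi> n)"
            by blast
        qed
        obtain K where K: "K > 0"
          "degree_zero_part (\<xi> m) = (\<Sum>j<K. (1 / of_nat K) \<bullet>\<^sub>c gauge_aut (2 * pi * real j / real K) (\<xi> m))"
          using degree_zero_part_mean[OF a] by blast
        have "p (degree_zero_part (\<xi> m) - \<xi> m) \<le> r / 2"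
          unfolding K(2) by (rule p.mean_diff_le) (use K a g in auto)
        then show ?thesis using \<open>r > 0\<close> p.nonneg[OF fcar_diff[OF degree_zero_part_fcar[OF a] a]] by simp
      qed
      then show "\<exists>no. \<forall>n\<ge>no. norm (p (degree_zero_part (\<xi> n) - \<xi> n) - 0) < r" by blast
    qed
    then have "q (\<lambda>n. degree_zero_part (\<xi> n)) = q \<xi>" by (subst q_eq[OF univ_CS_degree_zero_part[OF \<xi>(1)] \<xi>(1)])
    moreover have "(\<lambda>n. degree_zero_part (\<xi> n)) \<in> CS0"
      using univ_CS_degree_zero_part[OF \<xi>(1)] by (simp add: CS0_def degree_zero_simps)
    ultimately show "b \<in> q ` CS0" using \<xi> by (metis image_eqI)
  }
qed

lemma BI_ops [simp]:
  "add BI = add B" "mult BI = mult B" "scal BI = scal B" "adj BI = adj B" "one BI = one B"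
  by (simp_all add: gauge_invariant_def)

lemma CS0_closed:
  "\<xi> \<in> CS0 \<Longrightarrow> \<eta> \<in> CS0 \<Longrightarrow> (\<lambda>n. \<xi> n + \<eta> n) \<in> CS0"
  "\<xi> \<in> CS0 \<Longrightarrow> \<eta> \<in> CS0 \<Longrightarrow> (\<lambda>n. \<xi> n - \<eta> n) \<in> CS0"
  "\<xi> \<in> CS0 \<Longrightarrow> \<eta> \<in> CS0 \<Longrightarrow> (\<lambda>n. \<xi> n \<diamondop> \<eta> n) \<in> CS0"
  "\<xi> \<in> CS0 \<Longrightarrow> (\<lambda>n. c \<bullet>\<^sub>c \<xi> n) \<in> CS0"
  "\<xi> \<in> CS0 \<Longrightarrow> (\<lambda>n. star (\<xi> n)) \<in> CS0"
  "f \<in> alg \<Longrightarrow> degree_zero f \<Longrightarrow> (\<lambda>n. f) \<in> CS0"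
  by (simp_all add: CS0_def univ.CS_add univ.CS_diff univ.CS_conv univ.CS_scale univ.CS_star const_CS
      degree_zero_simps degree_zero_conv)

lemma CS0_CS: "\<xi> \<in> CS0 \<Longrightarrow> \<xi> \<in> CSQ"
  and CS0_alg: "\<xi> \<in> CS0 \<Longrightarrow> \<xi> n \<in> alg"
  and CS0_hom: "\<xi> \<in> CS0 \<Longrightarrow> degree_zero (\<xi> n)"
  by (auto simp: CS0_def intro: univ.CS_fcar)

section \<open>Existence of the trace\<close>

text \<open>The bound of \<open>tr\<close> by \<open>p\<close> makes the values on a Cauchy sequence a Cauchy sequence.\<close>

lemma tr_convergent: assumes "\<xi> \<in> CS0" shows "convergent (\<lambda>n. tr (\<xi> n))"
proof (rule Cauchy_convergent, rule metric_CauchyI)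
  fix e :: real assume "e > 0"
  then have posN: "0 < e" by simp
  obtain N where N0: "\<forall>m\<ge>N. \<forall>n\<ge>N. p (\<xi> m - \<xi> n) < e" using p_Cauchy[OF CS0_CS[OF assms] posN] by blast
  note N = N0[rule_format]
  have "dist (tr (\<xi> m)) (tr (\<xi> n)) < e" if "m \<ge> N" "n \<ge> N" for m n
  proof -
    have "dist (tr (\<xi> m)) (tr (\<xi> n)) = cmod (tr (\<xi> m - \<xi> n))"
      using assms by (simp add: dist_norm tr_diff CS0_alg)
    also have "\<dots> \<le> p (\<xi> m - \<xi> n)"
      by (intro p_trace fcar_diff degree_zero_simps(2) CS0_alg CS0_hom assms)
    also have "\<dots> < e" by (rule N[OF that])
    finally show ?thesis .
  qed
  then show "\<exists>M. \<forall>m\<ge>M. \<forall>n\<ge>M. dist (tr (\<xi> m)) (tr (\<xi> n)) < e" by blast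
qed

definition canonical_trace :: "'b \<Rightarrow> complex" where
  "canonical_trace = (\<lambda>b\<in>carrier BI. lim (\<lambda>n. tr ((SOME \<xi>. \<xi> \<in> CS0 \<and> q \<xi> = b) n)))"

lemma canonical_trace_q: assumes "\<xi> \<in> CS0" shows "(\<lambda>n. tr (\<xi> n)) \<longlonglongrightarrow> canonical_trace (q \<xi>)"
proof -
  define \<eta> where "\<eta> = (SOME \<eta>. \<eta> \<in> CS0 \<and> q \<eta> = q \<xi>)"
  have \<eta>: "\<eta> \<in> CS0" "q \<eta> = q \<xi>"
    using someI[of "\<lambda>\<eta>. \<eta> \<in> CS0 \<and> q \<eta> = q \<xi>" \<xi>] assms unfolding \<eta>_def by auto
  have "(\<lambda>n. p (\<xi> n - \<eta> n)) \<longlonglongrightarrow> 0" using q_eq[OF CS0_CS[OF assms] CS0_CS[OF \<eta>(1)]] \<eta>(2) by simp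
  then have "(\<lambda>n. tr (\<xi> n - \<eta> n)) \<longlonglongrightarrow> 0"
  proof (rule Lim_null_comparison[rotated])
    show "\<forall>\<^sub>F n in sequentially. norm (tr (\<xi> n - \<eta> n)) \<le> p (\<xi> n - \<eta> n)"
      by (intro always_eventually allI p_trace fcar_diff degree_zero_simps(2) CS0_alg CS0_hom assms \<eta>)
  qed
  then have "(\<lambda>n. tr (\<xi> n) - tr (\<eta> n)) \<longlonglongrightarrow> 0" using assms \<eta> by (simp add: tr_diff CS0_alg)
  moreover have "(\<lambda>n. tr (\<eta> n)) \<longlonglongrightarrow> lim (\<lambda>n. tr (\<eta> n))"
    using tr_convergent[OF \<eta>(1)] by (simp add: convergent_LIMSEQ_iff)
  ultimately have "(\<lambda>n. (tr (\<xi> n) - tr (\<eta> n)) + tr (\<eta> n)) \<longlonglongrightarrow> 0 + lim (\<lambda>n. tr (\<eta> n))"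
    by (rule tendsto_add)
  moreover have "canonical_trace (q \<xi>) = lim (\<lambda>n. tr (\<eta> n))"
    using assms by (simp add: canonical_trace_def BI_carrier \<eta>_def)
  ultimately show ?thesis by simp
qed

lemma canonical_trace_eq: "\<xi> \<in> CS0 \<Longrightarrow> (\<lambda>n. tr (\<xi> n)) \<longlonglongrightarrow> L \<Longrightarrow> canonical_trace (q \<xi>) = L"
  using canonical_trace_q LIMSEQ_unique by blast

text \<open>The trace on polynomials does not refer to a point, so its positivity may be read off on any orbit.\<close>

lemma free_trace_positive:
  assumes "f \<in> alg" "degree_zero f" shows "tr (star f \<diamondop> f) \<in> \<real>" "0 \<le> Re (tr (star f \<diamondop> f))"
proof -
  interpret generic_orbit G \<phi> "\<lambda>_. undefined" by unfold_locales
  show "tr (star f \<diamondop> f) \<in> \<real>" "0 \<le> Re (tr (star f \<diamondop> f))" by (rule trace_positive[OF assms])+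
qed

lemma canonical_trace_tracial: "tracial_state BI canonical_trace"
  unfolding tracial_state_def BI_ops
proof (intro conjI ballI allI)
  show "canonical_trace \<in> extensional (carrier BI)"
    unfolding canonical_trace_def by (rule restrict_extensional)
  show "canonical_trace \<one>\<^bsub>B\<^esub> = 1"
    unfolding q_one by (rule canonical_trace_eq) (auto intro!: CS0_closed simp: degree_zero_simps tr_word word_trace_Nil)
  fix a assume "a \<in> carrier BI"
  then obtain \<xi> where \<xi>: "\<xi> \<in> CS0" "a = q \<xi>" by (auto simp: BI_carrier)
  note \<xi>a = CS0_alg[OF \<xi>(1)] CS0_hom[OF \<xi>(1)] CS0_CS[OF \<xi>(1)]
  show "canonical_trace (scal B c a) = c * canonical_trace a" for c
    unfolding \<xi>(2) q_scal[OF \<xi>a(3)]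
    by (rule canonical_trace_eq) (use \<xi> \<xi>a canonical_trace_q[OF \<xi>(1)] in \<open>auto intro!: CS0_closed tendsto_intros simp: tr_scale\<close>)
  have sq: "adj B a \<otimes>\<^bsub>B\<^esub> a = q (\<lambda>n. star (\<xi> n) \<diamondop> \<xi> n)"
    unfolding \<xi>(2) q_adj[OF \<xi>a(3)] by (rule q_mult[OF univ.CS_star[OF \<xi>a(3)] \<xi>a(3)])
  have sqlim: "(\<lambda>n. tr (star (\<xi> n) \<diamondop> \<xi> n)) \<longlonglongrightarrow> canonical_trace (adj B a \<otimes>\<^bsub>B\<^esub> a)"
    unfolding sq by (rule canonical_trace_q) (intro CS0_closed \<xi>)
  show "canonical_trace (adj B a \<otimes>\<^bsub>B\<^esub> a) \<in> \<real>"
    by (rule closed_sequentially[OF closed_complex_Reals _ sqlim]) (intro free_trace_positive \<xi>a)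
  show "0 \<le> Re (canonical_trace (adj B a \<otimes>\<^bsub>B\<^esub> a))"
    by (rule LIMSEQ_le_const[OF tendsto_Re[OF sqlim]]) (use free_trace_positive \<xi>a in blast)
  fix b assume "b \<in> carrier BI"
  then obtain \<eta> where \<eta>: "\<eta> \<in> CS0" "b = q \<eta>" by (auto simp: BI_carrier)
  note \<eta>a = CS0_alg[OF \<eta>(1)] CS0_hom[OF \<eta>(1)] CS0_CS[OF \<eta>(1)]
  show "canonical_trace (a \<oplus>\<^bsub>B\<^esub> b) = canonical_trace a + canonical_trace b"
    unfolding \<xi>(2) \<eta>(2) q_add[OF \<xi>a(3) \<eta>a(3)]
  proof (rule canonical_trace_eq)
    show "(\<lambda>n. tr (\<xi> n + \<eta> n)) \<longlonglongrightarrow> canonical_trace (q \<xi>) + canonical_trace (q \<eta>)"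
      unfolding tr_add[OF \<xi>a(1) \<eta>a(1)] by (intro tendsto_add canonical_trace_q \<xi> \<eta>)
  qed (intro CS0_closed \<xi> \<eta>)
  show "canonical_trace (a \<otimes>\<^bsub>B\<^esub> b) = canonical_trace (b \<otimes>\<^bsub>B\<^esub> a)"
    unfolding \<xi>(2) \<eta>(2) q_mult[OF \<xi>a(3) \<eta>a(3)] q_mult[OF \<eta>a(3) \<xi>a(3)]
  proof (rule canonical_trace_eq)
    show "(\<lambda>n. tr (\<xi> n \<diamondop> \<eta> n)) \<longlonglongrightarrow> canonical_trace (q (\<lambda>n. \<eta> n \<diamondop> \<xi> n))"
      unfolding tr_commute[OF \<xi>a(1,2) \<eta>a(1,2)] by (intro canonical_trace_q CS0_closed \<xi> \<eta>)
  qed (intro CS0_closed \<xi> \<eta>)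
qed

section \<open>Uniqueness of the trace\<close>

text \<open>
  The limit \<open>y\<close> of the iteration \<open>y \<mapsto> (h + y\<^sup>2) / 2\<close> satisfies \<open>(1 - y)\<^sup>2 = 1 - h\<close>. Instead of iterating
  in the completion, the \<open>n\<close>-th step uses the \<open>n\<close>-th term of a sequence \<open>h\<close>. So the iterates are
  polynomials and form a sequence representing \<open>y\<close>.
\<close>

fun root_iter :: "(nat \<Rightarrow> ('g, 'x) gen free_elem) \<Rightarrow> nat \<Rightarrow> ('g, 'x) gen free_elem" where
  "root_iter h 0 = 0"
| "root_iter h (Suc n) = (1 / 2) \<bullet>\<^sub>c (h n + root_iter h n \<diamondop> root_iter h n)"

context
  fixes h
  assumes h: "h \<in> CS0" and sa: "\<And>n. star (h n) = h n" and small: "\<And>n. univ (h n) \<le> 1 / 2"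
begin

lemma root_iter_alg: "root_iter h n \<in> alg" "degree_zero (root_iter h n)"
  "star (root_iter h n) = root_iter h n"
  by (induction n) (auto simp: degree_zero_simps degree_zero_conv CS0_hom[OF h] CS0_alg[OF h] sa
      star_scale star_add star_conv intro!: fcar_scale fcar_add fcar_conv)

lemma root_iter_bound: "univ (root_iter h n) \<le> 1 / 2"
proof (induction n)
  case (Suc n)
  note y = root_iter_alg[of n]
  have "univ (root_iter h (Suc n)) = 1 / 2 * univ (h n + root_iter h n \<diamondop> root_iter h n)"
    using y CS0_alg[OF h, of n] by (simp add: univ.scale)
  also have "\<dots> \<le> 1 / 2 * (univ (h n) + univ (root_iter h n) * univ (root_iter h n))"
    using univ.triangle[of "h n" "root_iter h n \<diamondop> root_iter h n"] univ.submult[OF y(1) y(1)] y CS0_alg[OF h, of n]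
    by simp
  also have "\<dots> \<le> 1 / 2 * (1 / 2 + 1 / 2 * (1 / 2))"
    using small[of n] Suc univ.nonneg[OF y(1)] by (intro mult_left_mono add_mono mult_mono) auto
  finally show ?case by simp
qed simp

text \<open>
  On the ball of radius \<open>1 / 2\<close> the difference of squares contributes the factor \<open>1\<close> and the step the
  factor \<open>1 / 2\<close>. So differences of iterates are halved at each step, up to the fluctuation of \<open>h\<close>.
\<close>

lemma root_iter_CS0: "root_iter h \<in> CS0"
proof -
  let ?y = "root_iter h"
  note y = root_iter_alg
  have step: "univ (?y (Suc m) - ?y (Suc n)) \<le> 1 / 2 * (univ (h m - h n) + univ (?y m - ?y n))" for m n
  proof -
    have "?y (Suc m) - ?y (Suc n) = (1 / 2) \<bullet>\<^sub>c ((h m - h n) + (?y m \<diamondop> ?y m - ?y n \<diamondop> ?y n))"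
      by (simp add: fun_simps algebra_simps)
    then have "univ (?y (Suc m) - ?y (Suc n)) = 1 / 2 * univ ((h m - h n) + (?y m \<diamondop> ?y m - ?y n \<diamondop> ?y n))"
      using y CS0_alg[OF h] by (simp add: univ.scale)
    also have "\<dots> \<le> 1 / 2 * (univ (h m - h n) + univ (?y m \<diamondop> ?y m - ?y n \<diamondop> ?y n))"
      using univ.triangle[of "h m - h n" "?y m \<diamondop> ?y m - ?y n \<diamondop> ?y n"] y CS0_alg[OF h] by simp
    also have "univ (?y m \<diamondop> ?y m - ?y n \<diamondop> ?y n) \<le> univ (?y m) * univ (?y m - ?y n) + univ (?y m - ?y n) * univ (?y n)"
      by (intro univ.conv_diff_le y)
    also have "\<dots> \<le> 1 / 2 * univ (?y m - ?y n) + univ (?y m - ?y n) * (1 / 2)"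
      by (intro add_mono mult_right_mono mult_left_mono root_iter_bound univ.nonneg fcar_diff y)
    finally show ?thesis by simp
  qed
  have "?y \<in> CSQ"
    unfolding univ.CS_def
  proof (safe)
    fix \<epsilon> :: real assume "\<epsilon> > 0"
    then have posN: "0 < \<epsilon> / 2" by simp
    obtain N where N0: "\<forall>m\<ge>N. \<forall>n\<ge>N. univ (h m - h n) < \<epsilon> / 2" using univ.CS_ev[OF CS0_CS[OF h] posN] by blast
    note N = N0[rule_format]
    have ind: "univ (?y m - ?y n) \<le> \<epsilon> / 2 + (1 / 2) ^ k" if "m \<ge> N + k" "n \<ge> N + k" for m n k
      using that
    proof (induction k arbitrary: m n)
      case 0
      have "univ (?y m - ?y n) \<le> univ (?y m) + univ (?y n)"
        using univ.triangle[of "?y m" "- ?y n"] univ.minus[OF y(1), of n] y(1)[of m]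
          fcar_scale[OF y(1), of "- 1" n] by (simp add: scale_minus)
      also have "\<dots> \<le> 1 / 2 + 1 / 2" by (intro add_mono root_iter_bound)
      finally show ?case using \<open>\<epsilon> > 0\<close> by simp
    next
      case (Suc k)
      then obtain m' n' where mn: "m = Suc m'" "n = Suc n'" "m' \<ge> N + k" "n' \<ge> N + k"
        by (metis Suc_le_D Suc_le_mono add_Suc_right)
      have "univ (?y m - ?y n) \<le> 1 / 2 * (univ (h m' - h n') + univ (?y m' - ?y n'))"
        unfolding mn(1,2) by (rule step)
      also have "\<dots> \<le> 1 / 2 * (\<epsilon> / 2 + (\<epsilon> / 2 + (1 / 2) ^ k))"
        using Suc.IH[OF mn(3,4)] N[of m' n'] mn by (intro mult_left_mono add_mono) auto
      finally show ?case by simp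
    qed
    obtain k where k: "(1 / 2 :: real) ^ k < \<epsilon> / 2"
      using real_arch_pow_inv[of "\<epsilon> / 2" "1 / 2"] \<open>\<epsilon> > 0\<close> by auto
    have "univ (?y m - ?y n) < \<epsilon>" if "m \<ge> N + k" "n \<ge> N + k" for m n
      using ind[OF that] k by linarith
    then show "\<exists>N. \<forall>m\<ge>N. \<forall>n\<ge>N. univ (?y m - ?y n) < \<epsilon>" by blast
  qed (rule y)
  then show ?thesis by (simp add: CS0_def y)
qed

lemma one_minus_is_square:
  "q (\<lambda>n. word [] - h n) = adj B (q (\<lambda>n. word [] - root_iter h n)) \<otimes>\<^bsub>B\<^esub> q (\<lambda>n. word [] - root_iter h n)"
proof -
  let ?y = "root_iter h"
  note y = root_iter_alg
  have one: "(\<lambda>n. word []) \<in> CS0" by (intro CS0_closed) (auto simp: degree_zero_simps)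
  have z: "(\<lambda>n. word [] - ?y n) \<in> CSQ" by (intro CS0_CS CS0_closed one root_iter_CS0)
  have "adj B (q (\<lambda>n. word [] - ?y n)) \<otimes>\<^bsub>B\<^esub> q (\<lambda>n. word [] - ?y n) =
      q (\<lambda>n. (word [] - ?y n) \<diamondop> (word [] - ?y n))"
    unfolding q_adj[OF z] q_mult[OF univ.CS_star[OF z] z] by (simp add: star_diff star_word y)
  also have "\<dots> = q (\<lambda>n. word [] - h n)"
  proof (rule q_cong)
    show "(\<lambda>n. (word [] - ?y n) \<diamondop> (word [] - ?y n)) \<in> CSQ" by (rule univ.CS_conv[OF z z])
    show "(\<lambda>n. word [] - h n) \<in> CSQ" by (intro CS0_CS CS0_closed one h)
    have sq: "(word [] - ?y n) \<diamondop> (word [] - ?y n) = word [] - ?y n - (?y n - ?y n \<diamondop> ?y n)" for n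
      by (simp add: conv_diff_left conv_diff_right)
    have d: "(word [] - ?y n) \<diamondop> (word [] - ?y n) - (word [] - h n) = 2 \<bullet>\<^sub>c (?y (Suc n) - ?y n)" for n
      unfolding sq
      by (intro ext, simp only: minus_apply plus_fun_apply scale_apply root_iter.simps) (simp add: field_simps)
    have eq: "univ ((word [] - ?y n) \<diamondop> (word [] - ?y n) - (word [] - h n)) = 2 * univ (?y (Suc n) - ?y n)" for n
      unfolding d by (subst univ.scale[OF fcar_diff[OF y(1) y(1)]]) simp
    have "(\<lambda>n. univ (?y (Suc n) - ?y n)) \<longlonglongrightarrow> 0"
    proof (rule LIMSEQ_I)
      fix r :: real assume "r > 0"
      then have posN: "0 < r" by simp
      obtain N where N0: "\<forall>m\<ge>N. \<forall>n\<ge>N. univ (?y m - ?y n) < r" using univ.CS_ev[OF CS0_CS[OF root_iter_CS0] posN] by blast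
      note N = N0[rule_format]
      show "\<exists>no. \<forall>n\<ge>no. norm (univ (?y (Suc n) - ?y n) - 0) < r"
        using N univ.nonneg y by (intro exI[of _ N]) (auto simp del: root_iter.simps)
    qed
    then show "(\<lambda>n. univ ((word [] - ?y n) \<diamondop> (word [] - ?y n) - (word [] - h n))) \<longlonglongrightarrow> 0"
      unfolding eq using tendsto_mult_left[of _ 0 sequentially 2] by simp
  qed
  finally show ?thesis ..
qed

end

context
  fixes \<tau> assumes \<tau>: "tracial_state BI \<tau>"
begin

lemma tau_add: "\<xi> \<in> CS0 \<Longrightarrow> \<eta> \<in> CS0 \<Longrightarrow> \<tau> (q (\<lambda>n. \<xi> n + \<eta> n)) = \<tau> (q \<xi>) + \<tau> (q \<eta>)"
  using \<tau> by (auto simp: tracial_state_def BI_carrier q_add[symmetric] CS0_CS)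

lemma tau_scale: "\<xi> \<in> CS0 \<Longrightarrow> \<tau> (q (\<lambda>n. c \<bullet>\<^sub>c \<xi> n)) = c * \<tau> (q \<xi>)"
  using \<tau> by (auto simp: tracial_state_def BI_carrier q_scal[symmetric] CS0_CS)

lemma tau_diff: "\<xi> \<in> CS0 \<Longrightarrow> \<eta> \<in> CS0 \<Longrightarrow> \<tau> (q (\<lambda>n. \<xi> n - \<eta> n)) = \<tau> (q \<xi>) - \<tau> (q \<eta>)"
  using tau_add[of "\<lambda>n. \<xi> n - \<eta> n" \<eta>] by (simp add: CS0_closed)

lemma tau_positive: "\<xi> \<in> CS0 \<Longrightarrow> \<tau> (adj B (q \<xi>) \<otimes>\<^bsub>B\<^esub> q \<xi>) \<in> \<real> \<and> 0 \<le> Re (\<tau> (adj B (q \<xi>) \<otimes>\<^bsub>B\<^esub> q \<xi>))"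
  using \<tau> by (auto simp: tracial_state_def BI_carrier)

lemma one_CS0: "(\<lambda>n. word []) \<in> CS0"
  by (intro CS0_closed) (auto simp: degree_zero_simps)

lemma tau_one: "\<tau> (emb (word [])) = 1"
  using \<tau> by (simp add: tracial_state_def q_one)

lemma tau_free_trace: "free_trace G \<phi> (\<lambda>f. \<tau> (emb f))"
proof (unfold_locales)
  fix f g :: "('g, 'x) gen free_elem" and c
  assume f: "f \<in> alg" "degree_zero f"
  note cf = CS0_closed(6)[OF f]
  show "\<tau> (emb (c \<bullet>\<^sub>c f)) = c * \<tau> (emb f)" by (rule tau_scale[OF cf])
  show "\<tau> (emb (star f \<diamondop> f)) \<in> \<real> \<and> 0 \<le> Re (\<tau> (emb (star f \<diamondop> f)))"
    using tau_positive[OF cf] f by (simp add: q_adj q_mult const_CS)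
  assume g: "g \<in> alg" "degree_zero g"
  note cg = CS0_closed(6)[OF g]
  show "\<tau> (emb (f + g)) = \<tau> (emb f) + \<tau> (emb g)" by (rule tau_add[OF cf cg])
  have "emb f \<in> carrier BI" "emb g \<in> carrier BI" using cf cg by (auto simp: BI_carrier)
  then have "\<tau> (emb f \<otimes>\<^bsub>B\<^esub> emb g) = \<tau> (emb g \<otimes>\<^bsub>B\<^esub> emb f)" using \<tau> by (simp add: tracial_state_def)
  then show "\<tau> (emb (f \<diamondop> g)) = \<tau> (emb (g \<diamondop> f))" using f g by (simp add: q_mult const_CS)
next
  show "\<tau> (emb (word [])) = 1" by (rule tau_one)
next
  fix f g :: "('g, 'x) gen free_elem"
  assume "f \<doteq> g"
  then have "emb f = emb g" by (intro q_cong const_CS) (auto simp: eqv_def)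
  then show "\<tau> (emb f) = \<tau> (emb g)" by simp
qed

text \<open>Both \<open>1 - h\<close> and \<open>1 + h\<close> are of the form \<open>c\<^sup>* c\<close> with gauge invariant \<open>c\<close>, so \<open>\<tau>\<close> is nonnegative on them.\<close>

lemma tau_self_adjoint:
  assumes h: "h \<in> CS0" "\<And>n. star (h n) = h n" "\<And>n. univ (h n) \<le> 1 / 2"
  shows "cmod (\<tau> (q h)) \<le> 1"
proof -
  have le: "\<tau> (q h') \<in> \<real> \<and> Re (\<tau> (q h')) \<le> 1"
    if h': "h' \<in> CS0" "\<And>n. star (h' n) = h' n" "\<And>n. univ (h' n) \<le> 1 / 2" for h'
  proof -
    have "(\<lambda>n. word [] - root_iter h' n) \<in> CS0" by (intro CS0_closed one_CS0 root_iter_CS0[OF h'])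
    from tau_positive[OF this]
    have "\<tau> (q (\<lambda>n. word [] - h' n)) \<in> \<real> \<and> 0 \<le> Re (\<tau> (q (\<lambda>n. word [] - h' n)))"
      unfolding one_minus_is_square[OF h', symmetric] .
    then show ?thesis unfolding tau_diff[OF one_CS0 h'(1)] tau_one
      by (auto simp: complex_is_Real_iff)
  qed
  have "(\<lambda>n. (- 1) \<bullet>\<^sub>c h n) \<in> CS0" by (rule CS0_closed(4)[OF h(1)])
  moreover have "star ((- 1) \<bullet>\<^sub>c h n) = (- 1) \<bullet>\<^sub>c h n" for n by (simp add: star_scale h)
  moreover have "univ ((- 1) \<bullet>\<^sub>c h n) \<le> 1 / 2" for n using univ.scale[OF CS0_alg[OF h(1)]] h(3) by simp
  ultimately have "Re (\<tau> (q (\<lambda>n. (- 1) \<bullet>\<^sub>c h n))) \<le> 1" using le by blast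
  then have "- 1 \<le> Re (\<tau> (q h))" using tau_scale[OF h(1), of "- 1"] by simp
  then show ?thesis using le[OF h] by (auto simp: complex_is_Real_iff cmod_def)
qed

text \<open>Real and imaginary parts are self-adjoint, with the same bound.\<close>

lemma tau_bounded:
  assumes \<eta>: "\<eta> \<in> CS0" "\<And>n. univ (\<eta> n) \<le> 1 / 2" shows "cmod (\<tau> (q \<eta>)) \<le> 2"
proof -
  have a: "\<eta> n \<in> alg" for n by (rule CS0_alg[OF \<eta>(1)])
  have comb: "cmod (\<tau> (q (\<lambda>n. c \<bullet>\<^sub>c \<eta> n + cnj c \<bullet>\<^sub>c star (\<eta> n)))) \<le> 1" if c: "cmod c = 1 / 2" for c
  proof (rule tau_self_adjoint)
    show "(\<lambda>n. c \<bullet>\<^sub>c \<eta> n + cnj c \<bullet>\<^sub>c star (\<eta> n)) \<in> CS0" by (intro CS0_closed \<eta>)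
    show "star (c \<bullet>\<^sub>c \<eta> n + cnj c \<bullet>\<^sub>c star (\<eta> n)) = c \<bullet>\<^sub>c \<eta> n + cnj c \<bullet>\<^sub>c star (\<eta> n)" for n
      by (simp add: star_add star_scale add.commute)
    show "univ (c \<bullet>\<^sub>c \<eta> n + cnj c \<bullet>\<^sub>c star (\<eta> n)) \<le> 1 / 2" for n
      using univ.triangle[of "c \<bullet>\<^sub>c \<eta> n" "cnj c \<bullet>\<^sub>c star (\<eta> n)"] univ.scale[OF a, of c n]
        univ.scale[OF fcar_star[OF a], of "cnj c" n] univ.star[OF a, of n] c \<eta>(2)[of n] a by simp
  qed
  let ?h1 = "\<lambda>n. (1/2) \<bullet>\<^sub>c \<eta> n + cnj (1/2) \<bullet>\<^sub>c star (\<eta> n)"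
  let ?h2 = "\<lambda>n. (- \<i>/2) \<bullet>\<^sub>c \<eta> n + cnj (- \<i>/2) \<bullet>\<^sub>c star (\<eta> n)"
  have h: "?h1 \<in> CS0" "?h2 \<in> CS0" by (intro CS0_closed \<eta>)+
  have split: "a = (1 / 2) * a + cnj (1 / 2) * b + \<i> * ((- \<i> / 2) * a + cnj (- \<i> / 2) * b)" for a b :: complex
    by (simp add: field_simps)
  have eq: "(\<lambda>n. ?h1 n + \<i> \<bullet>\<^sub>c ?h2 n) = \<eta>"
    unfolding fun_eq_iff plus_fun_apply scale_apply by (intro allI split[symmetric])
  have "\<tau> (q (\<lambda>n. ?h1 n + \<i> \<bullet>\<^sub>c ?h2 n)) = \<tau> (q ?h1) + \<tau> (q (\<lambda>n. \<i> \<bullet>\<^sub>c ?h2 n))"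
    by (rule tau_add[OF h(1) CS0_closed(4)[OF h(2)]])
  then have "\<tau> (q \<eta>) = \<tau> (q ?h1) + \<i> * \<tau> (q ?h2)"
    unfolding eq tau_scale[OF h(2)] .
  moreover have "cmod (\<tau> (q ?h1)) \<le> 1" by (rule comb) (simp add: norm_divide)
  moreover have "cmod (\<tau> (q ?h2)) \<le> 1" by (rule comb) (simp add: norm_divide)
  moreover have "cmod (a + \<i> * b) \<le> 2" if "cmod a \<le> 1" "cmod b \<le> 1" for a b
    using norm_triangle_ineq[of a "\<i> * b"] that by (simp add: norm_mult)
  ultimately show ?thesis by simp
qed

lemma tau_continuous:
  assumes \<eta>: "\<eta> \<in> CS0" "\<And>n. univ (\<eta> n) \<le> \<epsilon>" "\<epsilon> > 0" shows "cmod (\<tau> (q \<eta>)) \<le> 4 * \<epsilon>"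
proof -
  let ?c = "complex_of_real (1 / (2 * \<epsilon>))"
  have c: "cmod ?c = 1 / (2 * \<epsilon>)" using \<eta>(3) by (simp only: norm_of_real) simp
  have "cmod (\<tau> (q (\<lambda>n. ?c \<bullet>\<^sub>c \<eta> n))) \<le> 2"
  proof (rule tau_bounded)
    show "(\<lambda>n. ?c \<bullet>\<^sub>c \<eta> n) \<in> CS0" by (rule CS0_closed(4)[OF \<eta>(1)])
    show "univ (?c \<bullet>\<^sub>c \<eta> n) \<le> 1 / 2" for n
      unfolding univ.scale[OF CS0_alg[OF \<eta>(1)]] c using \<eta>(2)[of n] \<eta>(3) by (simp add: field_simps)
  qed
  then have "1 / (2 * \<epsilon>) * cmod (\<tau> (q \<eta>)) \<le> 2" unfolding tau_scale[OF \<eta>(1)] norm_mult c .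
  then show ?thesis using \<eta>(3) by (simp add: field_simps)
qed

text \<open>
  On polynomials \<open>\<tau>\<close> is \<open>tr\<close>, and \<open>\<tau>\<close> is continuous. Dropping the first \<open>N\<close> terms of a sequence makes all
  its terms close to each other without changing the element that it represents.
\<close>

lemma tau_limit: assumes \<xi>: "\<xi> \<in> CS0" shows "(\<lambda>n. tr (\<xi> n)) \<longlonglongrightarrow> \<tau> (q \<xi>)"
proof (rule LIMSEQ_I)
  interpret ft: free_trace G \<phi> "\<lambda>f. \<tau> (emb f)" by (rule tau_free_trace)
  fix r :: real assume "r > 0"
  then have posN: "0 < r / 8" by simp
  obtain N where N0: "\<forall>m\<ge>N. \<forall>n\<ge>N. univ (\<xi> m - \<xi> n) < r / 8" using univ.CS_ev[OF CS0_CS[OF \<xi>] posN] by blast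
  note N = N0[rule_format]
  have "norm (tr (\<xi> m) - \<tau> (q \<xi>)) < r" if m: "m \<ge> N" for m
  proof -
    let ?s = "\<lambda>n. \<xi> (n + N)"
    have s: "?s \<in> CS0"
      unfolding CS0_def univ.CS_def
    proof (safe)
      fix \<epsilon> :: real assume "\<epsilon> > 0"
      then have posM: "0 < \<epsilon>" by simp
      obtain M where M0: "\<forall>m\<ge>M. \<forall>n\<ge>M. univ (\<xi> m - \<xi> n) < \<epsilon>" using univ.CS_ev[OF CS0_CS[OF \<xi>] posM] by blast
      note M = M0[rule_format]
      show "\<exists>M. \<forall>m\<ge>M. \<forall>n\<ge>M. univ (\<xi> (m + N) - \<xi> (n + N)) < \<epsilon>"
        using M by (intro exI[of _ M]) auto
    qed (rule CS0_alg[OF \<xi>] CS0_hom[OF \<xi>])+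
    have "q ?s = q \<xi>"
    proof (rule q_cong[OF CS0_CS[OF s] CS0_CS[OF \<xi>]], rule LIMSEQ_I)
      fix \<epsilon> :: real assume "\<epsilon> > 0"
      then have posM: "0 < \<epsilon>" by simp
      obtain M where M0: "\<forall>m\<ge>M. \<forall>n\<ge>M. univ (\<xi> m - \<xi> n) < \<epsilon>" using univ.CS_ev[OF CS0_CS[OF \<xi>] posM] by blast
      note M = M0[rule_format]
      have "norm (univ (\<xi> (n + N) - \<xi> n) - 0) < \<epsilon>" if "n \<ge> M" for n
        using M[of "n + N" n] that univ.nonneg[OF fcar_diff[OF CS0_alg[OF \<xi>] CS0_alg[OF \<xi>]], of "n + N" n] by simp
      then show "\<exists>no. \<forall>n\<ge>no. norm (univ (\<xi> (n + N) - \<xi> n) - 0) < \<epsilon>" by blast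
    qed
    moreover have cm: "(\<lambda>n. \<xi> m) \<in> CS0" by (intro CS0_closed CS0_alg CS0_hom \<xi>)
    moreover have "cmod (\<tau> (q (\<lambda>n. ?s n - \<xi> m))) \<le> 4 * (r / 8)"
      by (rule tau_continuous) (use \<open>r > 0\<close> N m s cm in \<open>auto intro!: CS0_closed less_imp_le\<close>)
    ultimately have "cmod (\<tau> (q \<xi>) - \<tau> (emb (\<xi> m))) \<le> r / 2"
      using tau_diff[OF s cm] by simp
    then show ?thesis
      using \<open>r > 0\<close> ft.T_eq_tr[OF CS0_alg[OF \<xi>] CS0_hom[OF \<xi>], of m] by (simp add: norm_minus_commute)
  qed
  then show "\<exists>no. \<forall>n\<ge>no. norm (tr (\<xi> n) - \<tau> (q \<xi>)) < r" by blast
qed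

end

theorem unique_trace: "\<exists>!\<tau>. tracial_state BI \<tau>"
proof (rule ex1I[of "tracial_state BI" canonical_trace, OF canonical_trace_tracial])
  fix \<tau> assume \<tau>: "tracial_state BI \<tau>"
  show "\<tau> = canonical_trace"
  proof (rule extensionalityI)
    show "\<tau> \<in> extensional (carrier BI)" using \<tau> by (simp add: tracial_state_def)
    show "canonical_trace \<in> extensional (carrier BI)" using canonical_trace_tracial by (simp add: tracial_state_def)
    fix b assume "b \<in> carrier BI"
    then obtain \<xi> where "\<xi> \<in> CS0" "b = q \<xi>" by (auto simp: BI_carrier)
    then show "\<tau> b = canonical_trace b"
      using canonical_trace_eq[OF _ tau_limit[OF \<tau>]] by simp
  qed
qed

end

section \<open>The degree of a point in a strictly generic orbit\<close>

lemma not_all_start_with: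
  assumes "CARD('x) \<ge> 2" "\<And>z :: nat \<Rightarrow> 'x. \<exists>z'. z = c \<frown> z'" shows "c = []"
proof (cases c)
  case (Cons x c')
  obtain y :: 'x where y: "y \<noteq> x"
  proof -
    have "(UNIV :: 'x set) \<noteq> {x}" using assms(1) by (metis card.empty card.insert empty_iff finite.emptyI
        numeral_le_one_iff semiring_norm(69) One_nat_def)
    then show ?thesis using that by blast
  qed
  obtain z' where "(\<lambda>_. y) = c \<frown> z'" using assms(2) by blast
  then have "y = (c \<frown> z') 0" by metis
  then show ?thesis using y Cons by simp
qed simp

context orbit_representation
begin

text \<open>For a strictly generic base point the condition determines \<open>d\<close>, see \<open>orbit_degree_eq\<close>.\<close>

definition orbit_degree :: "(nat \<Rightarrow> 'x) \<Rightarrow> int" where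
  "orbit_degree v = (SOME d. \<exists>u\<^sub>1 u\<^sub>2 g z. g \<in> carrier G \<and> pt = u\<^sub>2 \<frown> z \<and> v = u\<^sub>1 \<frown> \<phi> g z \<and>
     d = int (length u\<^sub>1) - int (length u\<^sub>2))"

end

locale strictly_generic_orbit = orbit_representation G \<phi> pt
  for G :: "('g, 'm) monoid_scheme" (structure)
    and \<phi> :: "'g \<Rightarrow> (nat \<Rightarrow> 'x::finite) \<Rightarrow> (nat \<Rightarrow> 'x)"
    and pt :: "nat \<Rightarrow> 'x" +
  assumes strictly_generic: "strictly_generic G \<phi> pt"
begin

text \<open>
  A partial map fixing a strictly generic point fixes a cylinder around it, and a map that changes
  the length of prefixes cannot do that.
\<close>

lemma fixing_map_degree:
  assumes g: "g \<in> carrier G" and pt: "pt = u\<^sub>2 \<frown> z" "pt = u\<^sub>1 \<frown> \<phi> g z"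
  shows "length u\<^sub>1 = length u\<^sub>2"
proof -
  let ?f = "prepend u\<^sub>1 \<circ>\<^sub>m (Some \<circ> \<phi> g) \<circ>\<^sub>m unprepend u\<^sub>2"
  have "?f \<in> partial_maps G \<phi>" using g unfolding partial_maps_def by blast
  moreover have "?f pt = Some pt" unfolding partial_map_apply using pt by blast
  ultimately obtain U where U: "openin word_topology U" "pt \<in> U" "\<forall>v\<in>U. ?f v = Some v"
    using strictly_generic unfolding strictly_generic_def by (metis option.distinct(1))
  obtain m where m: "\<And>y. prefix m pt \<frown> y \<in> U" using open_contains_cylinder[OF U(1,2)] by blast
  define s where "s = prefix m z"
  have fixed: "u\<^sub>2 \<frown> (s \<frown> y) = u\<^sub>1 \<frown> \<phi> g (s \<frown> y)" for y
  proof -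
    have "prefix (m + length u\<^sub>2) pt = u\<^sub>2 @ s"
    proof (rule nth_equalityI)
      fix i assume "i < length (prefix (m + length u\<^sub>2) pt)"
      then show "prefix (m + length u\<^sub>2) pt ! i = (u\<^sub>2 @ s) ! i"
        unfolding s_def by (cases "i < length u\<^sub>2") (simp_all add: pt(1) nth_append)
    qed (simp add: s_def)
    moreover have "prefix (m + length u\<^sub>2) pt = prefix m pt @ subsequence pt m (m + length u\<^sub>2)"
      by (rule subsequence_append)
    ultimately have "(u\<^sub>2 @ s) \<frown> y = prefix m pt \<frown> (subsequence pt m (m + length u\<^sub>2) \<frown> y)" by simp
    then have "(u\<^sub>2 @ s) \<frown> y \<in> U" using m by metis
    then have "?f (u\<^sub>2 \<frown> (s \<frown> y)) = Some (u\<^sub>2 \<frown> (s \<frown> y))" using U(3) by simp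
    then obtain x where "u\<^sub>2 \<frown> (s \<frown> y) = u\<^sub>2 \<frown> x" and "u\<^sub>2 \<frown> (s \<frown> y) = u\<^sub>1 \<frown> \<phi> g x"
      unfolding partial_map_apply by blast
    have "s \<frown> y = x" using \<open>u\<^sub>2 \<frown> (s \<frown> y) = u\<^sub>2 \<frown> x\<close> by (simp del: conc_conc)
    then show ?thesis using \<open>u\<^sub>2 \<frown> (s \<frown> y) = u\<^sub>1 \<frown> \<phi> g x\<close> by metis
  qed
  define a where "a = u\<^sub>1 @ act g s"
  define b where "b = u\<^sub>2 @ s"
  define k where "k = sec g s"
  have k: "k \<in> carrier G" using g by (simp add: k_def)
  have ab: "b \<frown> y = a \<frown> \<phi> k y" for y
    using fixed[of y] g by (simp add: a_def b_def k_def action_conc)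
  have len: "length a = length u\<^sub>1 + length s" "length b = length u\<^sub>2 + length s" by (simp_all add: a_def b_def)
  have pre: "x = x' @ drop (length x') x" if "x \<frown> y = x' \<frown> y'" "length x' \<le> length x" for x x' :: "'x list" and y y'
  proof -
    have "take (length x') x = x'"
    proof (rule nth_equalityI)
      fix i assume "i < length (take (length x') x)"
      then have "i < length x" "i < length x'" using that by auto
      then show "take (length x') x ! i = x' ! i" using that(1) by (metis conc_fst nth_take)
    qed (use that in simp)
    then show ?thesis by (metis append_take_drop_id)
  qed
  \<comment> \<open>If one of \<open>a\<close>, \<open>b\<close> is longer, the surplus \<open>c\<close> would be a prefix of every infinite word.\<close>
  have "length a = length b"
  proof (cases "length a \<le> length b")
    case True
    define c where "c = drop (length a) b"
    have b: "b = a @ c" using pre[OF ab True] by (simp add: c_def)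
    have eq: "c \<frown> y = \<phi> k y" for y using ab[of y] unfolding b by (simp flip: conc_conc)
    have "c = []"
    proof (rule not_all_start_with[OF card_alphabet])
      fix z :: "nat \<Rightarrow> 'x"
      have "z = c \<frown> \<phi> (inv k) z" unfolding eq using k by (simp add: action_inv)
      then show "\<exists>z'. z = c \<frown> z'" by blast
    qed
    then show ?thesis using b by simp
  next
    case False
    define c where "c = drop (length b) a"
    have a: "a = b @ c" using pre[OF ab[symmetric]] False by (simp add: c_def)
    have eq: "y = c \<frown> \<phi> k y" for y using ab[of y] unfolding a by (simp flip: conc_conc)
    have "c = []" by (rule not_all_start_with[OF card_alphabet]) (use eq in blast)
    then show ?thesis using a by simp
  qed
  then show ?thesis using len by simp
qed

text \<open>
  Two descriptions of the same point of the orbit combine to a partial map that fixes the base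
  point. Its prefixes have equal lengths, and this is the claim.
\<close>

lemma degree_unique:
  assumes "g \<in> carrier G" "pt = u\<^sub>2 \<frown> z" "v = u\<^sub>1 \<frown> \<phi> g z"
    and "h \<in> carrier G" "pt = w\<^sub>2 \<frown> y" "v = w\<^sub>1 \<frown> \<phi> h y"
  shows "int (length u\<^sub>1) - int (length u\<^sub>2) = int (length w\<^sub>1) - int (length w\<^sub>2)"
proof -
  have le: "int (length u\<^sub>1) - int (length u\<^sub>2) = int (length w\<^sub>1) - int (length w\<^sub>2)"
    if "g \<in> carrier G" "pt = u\<^sub>2 \<frown> z" "v = u\<^sub>1 \<frown> \<phi> g z"
      "h \<in> carrier G" "pt = w\<^sub>2 \<frown> y" "v = w\<^sub>1 \<frown> \<phi> h y" "length u\<^sub>1 \<le> length w\<^sub>1"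
    for g h u\<^sub>1 u\<^sub>2 w\<^sub>1 w\<^sub>2 z y
  proof -
    define r where "r = drop (length u\<^sub>1) w\<^sub>1"
    have "w\<^sub>1 \<frown> \<phi> h y = (take (length u\<^sub>1) w\<^sub>1 @ r) \<frown> \<phi> h y" by (simp add: r_def)
    then have "u\<^sub>1 \<frown> \<phi> g z = take (length u\<^sub>1) w\<^sub>1 \<frown> (r \<frown> \<phi> h y)" using that by simp
    then have "\<phi> g z = r \<frown> \<phi> h y" using that by (subst (asm) conc_eq_iff) auto
    then have "z = \<phi> (inv g) (r \<frown> \<phi> h y)" using that by (metis action_inv(1))
    also have "\<dots> = act (inv g) r \<frown> \<phi> (sec (inv g) r \<otimes> h) y"
      using that by (simp add: action_conc action_mult)
    finally have "pt = (u\<^sub>2 @ act (inv g) r) \<frown> \<phi> (sec (inv g) r \<otimes> h) y" using that by (metis conc_conc)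
    then have "length (u\<^sub>2 @ act (inv g) r) = length w\<^sub>2"
      by (intro fixing_map_degree[OF _ \<open>pt = w\<^sub>2 \<frown> y\<close>]) (use that in auto)
    then show ?thesis using that by (simp add: r_def)
  qed
  show ?thesis
  proof (cases "length u\<^sub>1 \<le> length w\<^sub>1")
    case True
    then show ?thesis by (rule le[OF assms])
  next
    case False
    then show ?thesis using le[OF assms(4-6) assms(1-3)] by simp
  qed
qed

lemma orbit_degree_eq:
  assumes "g \<in> carrier G" "pt = u\<^sub>2 \<frown> z" "v = u\<^sub>1 \<frown> \<phi> g z"
  shows "orbit_degree v = int (length u\<^sub>1) - int (length u\<^sub>2)"
  unfolding orbit_degree_def
proof (rule some_equality)
  show "\<exists>w\<^sub>1 w\<^sub>2 h y. h \<in> carrier G \<and> pt = w\<^sub>2 \<frown> y \<and> v = w\<^sub>1 \<frown> \<phi> h y \<and>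
      int (length u\<^sub>1) - int (length u\<^sub>2) = int (length w\<^sub>1) - int (length w\<^sub>2)"
    using assms by blast
  fix d assume "\<exists>w\<^sub>1 w\<^sub>2 h y. h \<in> carrier G \<and> pt = w\<^sub>2 \<frown> y \<and> v = w\<^sub>1 \<frown> \<phi> h y \<and>
      d = int (length w\<^sub>1) - int (length w\<^sub>2)"
  then obtain w1 w2 h y where "h \<in> carrier G" "pt = w2 \<frown> y" "v = w1 \<frown> \<phi> h y"
    "d = int (length w1) - int (length w2)" by blast
  then show "d = int (length u\<^sub>1) - int (length u\<^sub>2)" using degree_unique[OF assms] by simp
qed

lemma orbit_degree_act:
  assumes "v \<in> orb" "g \<in> carrier G" shows "orbit_degree (\<phi> g v) = orbit_degree v"
proof -
  obtain u1 u2 h z where h: "h \<in> carrier G" "pt = u2 \<frown> z" "v = u1 \<frown> \<phi> h z"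
    using assms(1) unfolding partial_orbit_iff by blast
  have "\<phi> g v = act g u1 \<frown> \<phi> (sec g u1 \<otimes> h) z"
    unfolding h(3) using assms(2) h(1) by (simp add: action_conc action_mult)
  moreover have "sec g u1 \<otimes> h \<in> carrier G" using assms h by simp
  ultimately have "orbit_degree (\<phi> g v) = int (length (act g u1)) - int (length u2)"
    using orbit_degree_eq h(2) by blast
  then show ?thesis using orbit_degree_eq[OF h] by simp
qed

lemma orbit_degree_cons:
  assumes "v \<in> orb" shows "orbit_degree ([x] \<frown> v) = orbit_degree v + 1"
proof -
  obtain u1 u2 h z where h: "h \<in> carrier G" "pt = u2 \<frown> z" "v = u1 \<frown> \<phi> h z"
    using assms(1) unfolding partial_orbit_iff by blast
  have "[x] \<frown> v = (x # u1) \<frown> \<phi> h z" unfolding h(3) by simp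
  then have "orbit_degree ([x] \<frown> v) = int (length (x # u1)) - int (length u2)"
    by (rule orbit_degree_eq[OF h(1,2)])
  then show ?thesis using orbit_degree_eq[OF h] by simp
qed

text \<open>
  These diagonal unitaries implement the gauge action: an isometry raises the degree of a point by
  one and a group element preserves it.
\<close>

definition phase :: "real \<Rightarrow> ((nat \<Rightarrow> 'x) \<Rightarrow> complex) \<Rightarrow> ((nat \<Rightarrow> 'x) \<Rightarrow> complex)" where
  "phase t \<psi> = (\<lambda>v. cis (t * real_of_int (orbit_degree v)) * \<psi> v)"

lemma phase_ell2 [simp]: "\<psi> \<in> ell2 orb \<Longrightarrow> phase t \<psi> \<in> ell2 orb"
  and phase_norm [simp]: "ell2_norm orb (phase t \<psi>) = ell2_norm orb \<psi>"
  by (simp_all add: ell2_def ell2_norm_def phase_def norm_mult)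

lemma phase_letter:
  assumes "fst l \<in> gens G" "\<psi> \<in> ell2 orb"
  shows "letter_op l (phase t \<psi>) = cis (- t * real_of_int (letter_deg l)) \<bullet>\<^sub>c phase t (letter_op l \<psi>)"
proof -
  have out: "\<psi> j = 0" if "j \<notin> orb" for j using ell2_outside[OF assms(2) that] .
  show ?thesis
  proof (cases "(l, \<psi>)" rule: letter_op.cases)
    case (1 g b \<psi>')
    then have g: "(if b then g else inv g) \<in> carrier G" using assms by auto
    have "orbit_degree (\<phi> (if b then g else inv g) j) = orbit_degree j" if "j \<in> orb" for j
      by (rule orbit_degree_act[OF that g])
    then show ?thesis using 1 by (intro ext) (auto simp: phase_def scale_apply)
  next
    case (2 x \<psi>')
    have *: "cis (t * real_of_int (orbit_degree (suffix (Suc 0) j))) = cis (- t) * cis (t * real_of_int (orbit_degree j))"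
      if "j \<in> orb" "j 0 = x" for j
    proof -
      have j: "j = [x] \<frown> suffix (Suc 0) j" using build_eq_iff[of x "suffix (Suc 0) j" j] that by simp
      then have "suffix (Suc 0) j \<in> orb" using orb_tail[of x "suffix (Suc 0) j"] that by simp
      then have "orbit_degree j = orbit_degree (suffix (Suc 0) j) + 1" using orbit_degree_cons j by metis
      then show ?thesis by (simp add: cis_mult distrib_left)
    qed
    show ?thesis using 2 by (intro ext) (auto simp: phase_def scale_apply *)
  next
    case (3 x \<psi>')
    have *: "cis (t * real_of_int (orbit_degree (build x j))) = cis t * cis (t * real_of_int (orbit_degree j))"
      if "j \<in> orb" for j
      using orbit_degree_cons[OF that, of x] by (simp add: cis_mult distrib_left add.commute)
    show ?thesis using 3 by (intro ext) (auto simp: phase_def scale_apply *)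
  qed
qed

lemma phase_scale: "phase t (c \<bullet>\<^sub>c \<psi>) = c \<bullet>\<^sub>c phase t \<psi>"
  by (simp add: phase_def fun_eq_iff scale_apply mult.left_commute)

lemma phase_sum: "phase t (\<Sum>w\<in>X. h w) = (\<Sum>w\<in>X. phase t (h w))"
  by (simp add: phase_def fun_eq_iff sum_fun_apply sum_distrib_left)

lemma phase_phase: "phase s (phase t \<psi>) = phase (s + t) \<psi>"
  by (simp add: phase_def fun_eq_iff distrib_right flip: cis_mult)

lemma phase_zero: "phase 0 \<psi> = \<psi>"
  by (simp add: phase_def)

lemma letter_op_scale: "letter_op l (c \<bullet>\<^sub>c \<psi>) = c \<bullet>\<^sub>c letter_op l \<psi>"
  by (cases "(l, \<psi>)" rule: letter_op.cases) (auto simp: fun_eq_iff scale_apply)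

lemma phase_word:
  "letters w \<Longrightarrow> \<psi> \<in> ell2 orb \<Longrightarrow>
     word_op w (phase t \<psi>) = cis (- t * real_of_int (deg w)) \<bullet>\<^sub>c phase t (word_op w \<psi>)"
proof (induction w)
  case (Cons l w)
  have l: "fst l \<in> gens G" and w: "letters w" using Cons.prems by auto
  have "word_op (l # w) (phase t \<psi>) =
      letter_op l (cis (- t * real_of_int (deg w)) \<bullet>\<^sub>c phase t (word_op w \<psi>))"
    using Cons w by simp
  then show ?case
    using phase_letter[OF l word_op_in[OF w Cons.prems(2)], of t]
    by (simp add: letter_op_scale cis_mult algebra_simps)
qed simp

lemma rep_gauge:
  assumes "f \<in> alg" "\<psi> \<in> ell2 orb"
  shows "rep (gauge_aut t f) \<psi> = phase t (rep f (phase (- t) \<psi>))"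
proof -
  let ?X = "{w. f w \<noteq> 0}"
  have X: "finite ?X" and w: "\<And>w. w \<in> ?X \<Longrightarrow> letters w" using assms by (auto simp: fcar_def)
  have "phase t (rep f (phase (- t) \<psi>)) = (\<Sum>w\<in>?X. phase t (f w \<bullet>\<^sub>c word_op w (phase (- t) \<psi>)))"
    using assms X by (subst rep_apply[of _ ?X]) (auto simp: phase_sum)
  also have "\<dots> = (\<Sum>w\<in>?X. gauge_aut t f w \<bullet>\<^sub>c word_op w \<psi>)"
  proof (rule sum.cong)
    fix w assume "w \<in> ?X"
    then show "phase t (f w \<bullet>\<^sub>c word_op w (phase (- t) \<psi>)) = gauge_aut t f w \<bullet>\<^sub>c word_op w \<psi>"
      using phase_word[OF w assms(2), of w "- t"]
      by (simp add: phase_scale phase_phase phase_zero gauge_aut_def mult.commute)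
  qed simp
  also have "\<dots> = rep (gauge_aut t f) \<psi>"
    using assms X by (subst rep_apply[OF gauge_aut_fcar[OF assms(1)], of ?X]) (auto simp: gauge_aut_def)
  finally show ?thesis ..
qed

lemma orbit_norm_gauge: assumes "f \<in> alg" shows "orbit_norm (gauge_aut t f) = orbit_norm f"
proof -
  have le: "orbit_norm (gauge_aut t f) \<le> orbit_norm f" if f: "f \<in> alg" for t f
    unfolding orbit_norm_def
  proof (rule opn_leI)
    show "0 \<le> nrm BB (rep f)" by (rule opn_nonneg[OF rep_bounded[OF f]])
    show "ell2_norm orb (rep (gauge_aut t f) \<psi>) \<le> nrm BB (rep f) * ell2_norm orb \<psi>" if "\<psi> \<in> ell2 orb" for \<psi>
      using opn_le[OF rep_bounded[OF f] phase_ell2[OF that, of "- t"]] by (simp add: rep_gauge[OF f that])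
  qed
  show ?thesis
    using le[OF assms, of t] le[of "gauge_aut t f" "- t"] assms by (simp add: gauge_aut_gauge_aut)
qed

end

section \<open>Limits of operators\<close>

context orbit_representation
begin

abbreviation dst where "dst A T \<equiv> nrm BB (diff BB A T)"

lemma diff_rep: "f \<in> alg \<Longrightarrow> g \<in> alg \<Longrightarrow> diff BB (rep f) (rep g) = rep (f - g)"
  by (rule op_eqI) (auto simp: BO_simps rep_diff intro: op_minus rep_bounded)

lemma dst_triangle:
  assumes "A \<in> bounded_ops orb" "T \<in> bounded_ops orb" "V \<in> bounded_ops orb"
  shows "dst A V \<le> dst A T + dst T V"
proof -
  have "diff BB A V = diff BB A T \<oplus>\<^bsub>BB\<^esub> diff BB T V"
    by (rule op_eqI) (use assms in \<open>auto simp: BO_simps intro: op_minus op_plus\<close>)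
  then show ?thesis using op_plus(2)[OF op_minus[OF assms(1,2)] op_minus[OF assms(2,3)]] by simp
qed

lemma dst_commute:
  assumes "A \<in> bounded_ops orb" "T \<in> bounded_ops orb" shows "dst A T = dst T A"
proof -
  have "diff BB A T = scal BB (- 1) (diff BB T A)"
    by (rule op_eqI) (use assms in \<open>auto simp: BO_simps scale_minus intro: op_minus op_scal\<close>)
  then show ?thesis using op_scal(2)[OF op_minus[OF assms(2,1)], of "- 1"] by simp
qed

lemma dst_zero_imp:
  assumes "A \<in> bounded_ops orb" "T \<in> bounded_ops orb" "dst A T \<le> 0" shows "A = T"
proof (rule op_eqI[OF assms(1,2)])
  fix f assume f: "f \<in> ell2 orb"
  note d = op_minus[OF assms(1,2)]
  have "ell2_norm orb (diff BB A T f) \<le> dst A T * ell2_norm orb f" by (rule opn_le[OF d f])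
  also have "\<dots> \<le> 0" using assms(3) by (simp add: mult_nonpos_nonneg)
  finally have "ell2_norm orb (diff BB A T f) = 0" using ell2_norm_nonneg[of orb "diff BB A T f"] by linarith
  then have "diff BB A T f = 0" by (rule ell2_norm_eq_0[OF op_in[OF d f]])
  then show "A f = T f" using f by (simp add: BO_simps)
qed

abbreviation "CSQ \<equiv> univ.CS"

definition converges :: "(nat \<Rightarrow> ('g, 'x) gen free_elem) \<Rightarrow> (((nat \<Rightarrow> 'x) \<Rightarrow> complex) \<Rightarrow> ((nat \<Rightarrow> 'x) \<Rightarrow> complex)) \<Rightarrow> bool"
  where "converges \<xi> b \<longleftrightarrow> b \<in> bounded_ops orb \<and> (\<lambda>n. dst (rep (\<xi> n)) b) \<longlonglongrightarrow> 0"

lemma orbit_norm_le_univ: "f \<in> alg \<Longrightarrow> orbit_norm f \<le> univ f"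
  by (rule univ_upper[OF admissible_rep])

sublocale orbit_norm: cstar_seminormed "gens G" orbit_norm
  using admissible_rep by (simp add: admissible_def cstar_seminormed_def)

lemma converges_exists: assumes "\<xi> \<in> CSQ" obtains b where "converges \<xi> b"
proof -
  have a: "\<xi> n \<in> alg" for n by (rule univ.CS_fcar[OF assms])
  have "\<exists>N. \<forall>m\<ge>N. \<forall>n\<ge>N. dst (rep (\<xi> m)) (rep (\<xi> n)) < \<epsilon>" if e: "\<epsilon> > 0" for \<epsilon>
  proof -
    obtain N where N: "\<forall>m\<ge>N. \<forall>n\<ge>N. univ (\<xi> m - \<xi> n) < \<epsilon>" using univ.CS_ev[OF assms e] by blast
    have "dst (rep (\<xi> m)) (rep (\<xi> n)) < \<epsilon>" if "m \<ge> N" "n \<ge> N" for m n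
    proof -
      have "dst (rep (\<xi> m)) (rep (\<xi> n)) = orbit_norm (\<xi> m - \<xi> n)" unfolding diff_rep[OF a a] orbit_norm_def ..
      also have "\<dots> \<le> univ (\<xi> m - \<xi> n)" by (intro orbit_norm_le_univ fcar_diff a)
      finally show ?thesis using N that by force
    qed
    then show ?thesis by blast
  qed
  then obtain A where "A \<in> bounded_ops orb" "(\<lambda>n. dst (rep (\<xi> n)) A) \<longlonglongrightarrow> 0"
    using op_complete[of "\<lambda>n. rep (\<xi> n)" orb] rep_bounded[OF a] by blast
  then show ?thesis using that by (simp add: converges_def)
qed

lemma converges_transfer:
  assumes "\<xi> \<in> CSQ" "\<eta> \<in> CSQ" "converges \<xi> b" "(\<lambda>n. orbit_norm (\<xi> n - \<eta> n)) \<longlonglongrightarrow> 0"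
  shows "converges \<eta> b"
proof -
  have a: "\<xi> n \<in> alg" "\<eta> n \<in> alg" for n by (rule univ.CS_fcar[OF assms(1)], rule univ.CS_fcar[OF assms(2)])
  have b: "b \<in> bounded_ops orb" using assms(3) by (simp add: converges_def)
  have "(\<lambda>n. orbit_norm (\<xi> n - \<eta> n) + dst (rep (\<xi> n)) b) \<longlonglongrightarrow> 0 + 0"
    using assms(3,4) by (intro tendsto_add) (simp_all add: converges_def)
  then have lim: "(\<lambda>n. orbit_norm (\<xi> n - \<eta> n) + dst (rep (\<xi> n)) b) \<longlonglongrightarrow> 0" by simp
  have "(\<lambda>n. dst (rep (\<eta> n)) b) \<longlonglongrightarrow> 0"
  proof (rule univ.tendsto_zero_le[OF lim])
    show "0 \<le> dst (rep (\<eta> n)) b" for n by (intro opn_nonneg op_minus rep_bounded a b)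
    show "dst (rep (\<eta> n)) b \<le> orbit_norm (\<xi> n - \<eta> n) + dst (rep (\<xi> n)) b" for n
    proof -
      have "dst (rep (\<eta> n)) (rep (\<xi> n)) = orbit_norm (\<xi> n - \<eta> n)"
        unfolding diff_rep[OF a(2) a(1)] orbit_norm_def[symmetric] by (rule orbit_norm.diff_commute[OF a(2) a(1)])
      then show ?thesis using dst_triangle[OF rep_bounded[OF a(2)] rep_bounded[OF a(1)] b, of n n] by simp
    qed
  qed
  then show ?thesis using b by (simp add: converges_def)
qed

lemma converges_unique:
  assumes "\<xi> \<in> CSQ" "converges \<xi> b" "converges \<xi> c" shows "b = c"
proof (rule dst_zero_imp)
  have a: "\<xi> n \<in> alg" for n by (rule univ.CS_fcar[OF assms(1)])
  show b: "b \<in> bounded_ops orb" and c: "c \<in> bounded_ops orb" using assms by (simp_all add: converges_def)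
  have lim: "(\<lambda>n. dst (rep (\<xi> n)) b + dst (rep (\<xi> n)) c) \<longlonglongrightarrow> 0 + 0"
    using assms(2,3) by (intro tendsto_add) (simp_all add: converges_def)
  have "dst b c \<le> dst (rep (\<xi> n)) b + dst (rep (\<xi> n)) c" for n
    using dst_triangle[OF b rep_bounded[OF a] c, of n] dst_commute[OF b rep_bounded[OF a], of n] by simp
  then have "dst b c \<le> 0 + 0" by (intro LIMSEQ_le_const[OF lim]) blast
  then show "dst b c \<le> 0" by simp
qed

lemma converges_diff:
  assumes "\<xi> \<in> CSQ" "\<eta> \<in> CSQ" "converges \<xi> b" "converges \<eta> b"
  shows "(\<lambda>n. orbit_norm (\<xi> n - \<eta> n)) \<longlonglongrightarrow> 0"
proof -
  have a: "\<xi> n \<in> alg" "\<eta> n \<in> alg" for n by (rule univ.CS_fcar[OF assms(1)], rule univ.CS_fcar[OF assms(2)])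
  have b: "b \<in> bounded_ops orb" using assms(3) by (simp add: converges_def)
  have "(\<lambda>n. dst (rep (\<xi> n)) b + dst (rep (\<eta> n)) b) \<longlonglongrightarrow> 0 + 0"
    using assms(3,4) by (intro tendsto_add) (simp_all add: converges_def)
  then have lim: "(\<lambda>n. dst (rep (\<xi> n)) b + dst (rep (\<eta> n)) b) \<longlonglongrightarrow> 0" by simp
  show ?thesis
  proof (rule univ.tendsto_zero_le[OF lim])
    show "0 \<le> orbit_norm (\<xi> n - \<eta> n)" for n by (intro orbit_norm.nonneg fcar_diff a)
    show "orbit_norm (\<xi> n - \<eta> n) \<le> dst (rep (\<xi> n)) b + dst (rep (\<eta> n)) b" for n
      using dst_triangle[OF rep_bounded[OF a(1)] b rep_bounded[OF a(2)], of n n]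
        dst_commute[OF b rep_bounded[OF a(2)], of n] diff_rep[OF a(1) a(2), of n n] by (simp add: orbit_norm_def)
  qed
qed

text \<open>
  Unfolded, the value of \<open>orbit_rep\<close> at a class of Cauchy sequences is the limit of the operators
  \<open>rep (\<xi> n)\<close>, see \<open>ext_rep_eqI\<close>.
\<close>

definition ext_rep :: "(nat \<Rightarrow> ('g, 'x) gen free_elem) \<Rightarrow> (((nat \<Rightarrow> 'x) \<Rightarrow> complex) \<Rightarrow> ((nat \<Rightarrow> 'x) \<Rightarrow> complex))"
  where "ext_rep \<xi> = orbit_rep G \<phi> pt (univ.cls \<xi>)"

lemma ext_rep_eqI: assumes "\<xi> \<in> CSQ" "converges \<xi> b" shows "ext_rep \<xi> = b"
proof -
  have gen: "(\<lambda>z. case z of Grp g \<Rightarrow> basis_op orb (\<phi> g) | Iso x \<Rightarrow> basis_op orb (\<lambda>v. [x] \<frown> v)) = gen_op"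
    by (rule ext) (simp add: gen_op_def)
  have all: "converges \<eta> b" if "\<eta> \<in> univ.cls \<xi>" for \<eta>
  proof -
    have \<eta>: "\<eta> \<in> CSQ" "(\<lambda>n. univ (\<xi> n - \<eta> n)) \<longlonglongrightarrow> 0"
      using that by (simp_all add: univ.null_rel_iff)
    have "(\<lambda>n. orbit_norm (\<xi> n - \<eta> n)) \<longlonglongrightarrow> 0"
      by (rule univ.tendsto_zero_le[OF \<eta>(2)]) (intro orbit_norm.nonneg orbit_norm_le_univ fcar_diff univ.CS_fcar assms \<eta>)+
    then show ?thesis by (rule converges_transfer[OF assms(1) \<eta>(1) assms(2)])
  qed
  have "universal_hom BB gen_op (univ.cls \<xi>) = b"
    unfolding universal_hom_def rep_def[symmetric]
  proof (rule the_equality)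
    show "b \<in> carrier BB \<and> (\<forall>\<eta>\<in>univ.cls \<xi>. (\<lambda>n. dst (rep (\<eta> n)) b) \<longlonglongrightarrow> 0)"
    proof (intro conjI ballI)
      show "b \<in> carrier BB" using assms(2) by (simp add: converges_def BO_simps)
      show "(\<lambda>n. dst (rep (\<eta> n)) b) \<longlonglongrightarrow> 0" if "\<eta> \<in> univ.cls \<xi>" for \<eta>
        using all[OF that] unfolding converges_def by blast
    qed
    fix c assume c: "c \<in> carrier BB \<and> (\<forall>\<eta>\<in>univ.cls \<xi>. (\<lambda>n. dst (rep (\<eta> n)) c) \<longlonglongrightarrow> 0)"
    then have "(\<lambda>n. dst (rep (\<xi> n)) c) \<longlonglongrightarrow> 0"
      using univ.self_in_cls[OF assms(1)] by blast
    then have "converges \<xi> c" using c by (simp add: converges_def BO_simps(1))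
    then show "c = b" by (rule converges_unique[OF assms(1) _ assms(2)])
  qed
  then show ?thesis unfolding ext_rep_def orbit_rep_def gen .
qed

lemma ext_rep_converges: assumes "\<xi> \<in> CSQ" shows "converges \<xi> (ext_rep \<xi>)"
proof -
  obtain b where b: "converges \<xi> b" using converges_exists[OF assms] .
  then show ?thesis using ext_rep_eqI[OF assms b] by simp
qed

lemma ext_rep_in: "\<xi> \<in> CSQ \<Longrightarrow> ext_rep \<xi> \<in> bounded_ops orb"
  using ext_rep_converges by (simp add: converges_def)

lemma ext_rep_lim: "\<xi> \<in> CSQ \<Longrightarrow> (\<lambda>n. dst (rep (\<xi> n)) (ext_rep \<xi>)) \<longlonglongrightarrow> 0"
  using ext_rep_converges by (simp add: converges_def)

text \<open>
  The algebraic identities for limits follow from this criterion with an estimate of the distance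
  to the expected operator.
\<close>

lemma ext_rep_eqI':
  assumes "\<xi> \<in> CSQ" "b \<in> bounded_ops orb" "g \<longlonglongrightarrow> (0::real)" "\<And>n. dst (rep (\<xi> n)) b \<le> g n"
  shows "ext_rep \<xi> = b"
proof (rule ext_rep_eqI[OF assms(1)])
  have "(\<lambda>n. dst (rep (\<xi> n)) b) \<longlonglongrightarrow> 0"
    by (rule univ.tendsto_zero_le[OF assms(3) _ assms(4)])
       (intro opn_nonneg op_minus rep_bounded univ.CS_fcar assms)
  then show "converges \<xi> b" using assms(2) by (simp add: converges_def)
qed

lemma ext_rep_eq:
  assumes "\<xi> \<in> CSQ" "\<eta> \<in> CSQ"
  shows "ext_rep \<xi> = ext_rep \<eta> \<longleftrightarrow> (\<lambda>n. orbit_norm (\<xi> n - \<eta> n)) \<longlonglongrightarrow> 0"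
proof
  assume eq: "ext_rep \<xi> = ext_rep \<eta>"
  show "(\<lambda>n. orbit_norm (\<xi> n - \<eta> n)) \<longlonglongrightarrow> 0"
    by (rule converges_diff[OF assms ext_rep_converges[OF assms(1)]])
       (use ext_rep_converges[OF assms(2)] eq in simp)
next
  assume "(\<lambda>n. orbit_norm (\<xi> n - \<eta> n)) \<longlonglongrightarrow> 0"
  then have "converges \<eta> (ext_rep \<xi>)"
    by (rule converges_transfer[OF assms ext_rep_converges[OF assms(1)]])
  then show "ext_rep \<xi> = ext_rep \<eta>" by (rule ext_rep_eqI[OF assms(2), symmetric])
qed

lemma ext_rep_add:
  assumes "\<xi> \<in> CSQ" "\<eta> \<in> CSQ"
  shows "ext_rep \<xi> \<oplus>\<^bsub>BB\<^esub> ext_rep \<eta> = ext_rep (\<lambda>n. \<xi> n + \<eta> n)"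
proof (rule ext_rep_eqI'[symmetric])
  let ?x = "ext_rep \<xi>" and ?y = "ext_rep \<eta>"
  have a: "\<xi> n \<in> alg" "\<eta> n \<in> alg" for n by (rule univ.CS_fcar[OF assms(1)], rule univ.CS_fcar[OF assms(2)])
  note x = ext_rep_in[OF assms(1)] and y = ext_rep_in[OF assms(2)]
  show "(\<lambda>n. \<xi> n + \<eta> n) \<in> CSQ" by (rule univ.CS_add[OF assms])
  show "?x \<oplus>\<^bsub>BB\<^esub> ?y \<in> bounded_ops orb" by (rule op_plus[OF x y])
  show "(\<lambda>n. dst (rep (\<xi> n)) ?x + dst (rep (\<eta> n)) ?y) \<longlonglongrightarrow> 0"
    using tendsto_add[OF ext_rep_lim[OF assms(1)] ext_rep_lim[OF assms(2)]] by simp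
  fix n
  have "diff BB (rep (\<xi> n + \<eta> n)) (?x \<oplus>\<^bsub>BB\<^esub> ?y) = diff BB (rep (\<xi> n)) ?x \<oplus>\<^bsub>BB\<^esub> diff BB (rep (\<eta> n)) ?y"
  proof (rule op_eqI)
    show "diff BB (rep (\<xi> n + \<eta> n)) (?x \<oplus>\<^bsub>BB\<^esub> ?y) \<in> bounded_ops orb"
      by (intro op_minus op_plus rep_bounded fcar_add a x y)
    show "diff BB (rep (\<xi> n)) ?x \<oplus>\<^bsub>BB\<^esub> diff BB (rep (\<eta> n)) ?y \<in> bounded_ops orb"
      by (intro op_minus op_plus rep_bounded a x y)
    show "diff BB (rep (\<xi> n + \<eta> n)) (?x \<oplus>\<^bsub>BB\<^esub> ?y) f = (diff BB (rep (\<xi> n)) ?x \<oplus>\<^bsub>BB\<^esub> diff BB (rep (\<eta> n)) ?y) f"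
      if "f \<in> ell2 orb" for f
      using that by (simp add: BO_simps rep_add[OF a that])
  qed
  then show "dst (rep (\<xi> n + \<eta> n)) (?x \<oplus>\<^bsub>BB\<^esub> ?y) \<le> dst (rep (\<xi> n)) ?x + dst (rep (\<eta> n)) ?y"
    using op_plus(2)[OF op_minus[OF rep_bounded[OF a(1)] x] op_minus[OF rep_bounded[OF a(2)] y]] by simp
qed

lemma ext_rep_scal:
  assumes "\<xi> \<in> CSQ" shows "scal BB c (ext_rep \<xi>) = ext_rep (\<lambda>n. c \<bullet>\<^sub>c \<xi> n)"
proof (rule ext_rep_eqI'[symmetric])
  let ?x = "ext_rep \<xi>"
  have a: "\<xi> n \<in> alg" for n by (rule univ.CS_fcar[OF assms])
  note x = ext_rep_in[OF assms]
  show "(\<lambda>n. c \<bullet>\<^sub>c \<xi> n) \<in> CSQ" by (rule univ.CS_scale[OF assms])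
  show "scal BB c ?x \<in> bounded_ops orb" by (rule op_scal[OF x])
  show "(\<lambda>n. cmod c * dst (rep (\<xi> n)) ?x) \<longlonglongrightarrow> 0"
    using tendsto_mult_left[OF ext_rep_lim[OF assms], of "cmod c"] by simp
  fix n
  have "diff BB (rep (c \<bullet>\<^sub>c \<xi> n)) (scal BB c ?x) = scal BB c (diff BB (rep (\<xi> n)) ?x)"
  proof (rule op_eqI)
    show "diff BB (rep (c \<bullet>\<^sub>c \<xi> n)) (scal BB c ?x) \<in> bounded_ops orb"
      by (intro op_minus op_scal rep_bounded fcar_scale a x)
    show "scal BB c (diff BB (rep (\<xi> n)) ?x) \<in> bounded_ops orb"
      by (intro op_minus op_scal rep_bounded a x)
    show "diff BB (rep (c \<bullet>\<^sub>c \<xi> n)) (scal BB c ?x) f = scal BB c (diff BB (rep (\<xi> n)) ?x) f"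
      if "f \<in> ell2 orb" for f
      using that by (simp add: BO_simps rep_scale[OF a that] scale_diff_right)
  qed
  then show "dst (rep (c \<bullet>\<^sub>c \<xi> n)) (scal BB c ?x) \<le> cmod c * dst (rep (\<xi> n)) ?x"
    using op_scal(2)[OF op_minus[OF rep_bounded[OF a] x]] by simp
qed

lemma ext_rep_adj:
  assumes "\<xi> \<in> CSQ" shows "adj BB (ext_rep \<xi>) = ext_rep (\<lambda>n. star (\<xi> n))"
proof (rule ext_rep_eqI'[symmetric])
  let ?x = "ext_rep \<xi>"
  have a: "\<xi> n \<in> alg" for n by (rule univ.CS_fcar[OF assms])
  note x = ext_rep_in[OF assms]
  show "(\<lambda>n. star (\<xi> n)) \<in> CSQ" by (rule univ.CS_star[OF assms])
  show "adj BB ?x \<in> bounded_ops orb" by (rule op_adj[OF x])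
  show "(\<lambda>n. dst (rep (\<xi> n)) ?x) \<longlonglongrightarrow> 0" by (rule ext_rep_lim[OF assms])
  fix n
  have "diff BB (rep (star (\<xi> n))) (adj BB ?x) = adj BB (diff BB (rep (\<xi> n)) ?x)"
    using adj_diff[OF rep_bounded[OF a] x] rep_star[OF a] by simp
  then show "dst (rep (star (\<xi> n))) (adj BB ?x) \<le> dst (rep (\<xi> n)) ?x"
    using op_adj(2)[OF op_minus[OF rep_bounded[OF a] x]] by simp
qed

lemma ext_rep_nrm:
  assumes "\<xi> \<in> CSQ" shows "(\<lambda>n. orbit_norm (\<xi> n)) \<longlonglongrightarrow> nrm BB (ext_rep \<xi>)"
proof -
  let ?x = "ext_rep \<xi>"
  have a: "\<xi> n \<in> alg" for n by (rule univ.CS_fcar[OF assms])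
  note x = ext_rep_in[OF assms]
  have le: "nrm BB A \<le> nrm BB T + dst A T" if "A \<in> bounded_ops orb" "T \<in> bounded_ops orb" for A T
  proof -
    have "A = T \<oplus>\<^bsub>BB\<^esub> diff BB A T"
      by (rule op_eqI) (use that in \<open>auto simp: BO_simps intro: op_minus op_plus\<close>)
    then show ?thesis using op_plus(2)[OF that(2) op_minus[OF that]] by simp
  qed
  have "(\<lambda>n. orbit_norm (\<xi> n) - nrm BB ?x) \<longlonglongrightarrow> 0"
  proof (rule Lim_null_comparison[OF always_eventually ext_rep_lim[OF assms]], rule allI)
    fix n
    show "norm (orbit_norm (\<xi> n) - nrm BB ?x) \<le> dst (rep (\<xi> n)) ?x"
      using le[OF rep_bounded[OF a] x, of n] le[OF x rep_bounded[OF a], of n] dst_commute[OF x rep_bounded[OF a], of n]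
      by (simp add: orbit_norm_def abs_le_iff)
  qed
  from tendsto_add[OF this tendsto_const, of "nrm BB ?x"] show ?thesis by simp
qed

lemma ext_rep_mult:
  assumes "\<xi> \<in> CSQ" "\<eta> \<in> CSQ"
  shows "ext_rep \<xi> \<otimes>\<^bsub>BB\<^esub> ext_rep \<eta> = ext_rep (\<lambda>n. \<xi> n \<diamondop> \<eta> n)"
proof (rule ext_rep_eqI'[symmetric])
  let ?x = "ext_rep \<xi>" and ?y = "ext_rep \<eta>"
  have a: "\<xi> n \<in> alg" "\<eta> n \<in> alg" for n by (rule univ.CS_fcar[OF assms(1)], rule univ.CS_fcar[OF assms(2)])
  note x = ext_rep_in[OF assms(1)] and y = ext_rep_in[OF assms(2)]
  note rx = rep_bounded[OF a(1)] and ry = rep_bounded[OF a(2)]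
  show "(\<lambda>n. \<xi> n \<diamondop> \<eta> n) \<in> CSQ" by (rule univ.CS_conv[OF assms])
  show "?x \<otimes>\<^bsub>BB\<^esub> ?y \<in> bounded_ops orb" by (rule op_mult[OF x y])
  show "(\<lambda>n. orbit_norm (\<xi> n) * dst (rep (\<eta> n)) ?y + dst (rep (\<xi> n)) ?x * nrm BB ?y) \<longlonglongrightarrow> 0"
    using tendsto_add[OF tendsto_mult[OF ext_rep_nrm[OF assms(1)] ext_rep_lim[OF assms(2)]]
        tendsto_mult_right[OF ext_rep_lim[OF assms(1)], of "nrm BB ?y"]] by simp
  fix n
  let ?r = "rep (\<xi> n)" and ?s = "rep (\<eta> n)"
  have dxy: "diff BB ?r ?x \<in> bounded_ops orb" "diff BB ?s ?y \<in> bounded_ops orb"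
    by (intro op_minus rx ry x y)+
  have "diff BB (rep (\<xi> n \<diamondop> \<eta> n)) (?x \<otimes>\<^bsub>BB\<^esub> ?y) = ?r \<otimes>\<^bsub>BB\<^esub> diff BB ?s ?y \<oplus>\<^bsub>BB\<^esub> diff BB ?r ?x \<otimes>\<^bsub>BB\<^esub> ?y"
  proof (rule op_eqI)
    show "diff BB (rep (\<xi> n \<diamondop> \<eta> n)) (?x \<otimes>\<^bsub>BB\<^esub> ?y) \<in> bounded_ops orb"
      by (intro op_minus op_mult rep_bounded fcar_conv a x y)
    show "?r \<otimes>\<^bsub>BB\<^esub> diff BB ?s ?y \<oplus>\<^bsub>BB\<^esub> diff BB ?r ?x \<otimes>\<^bsub>BB\<^esub> ?y \<in> bounded_ops orb"
      by (intro op_plus op_mult rx dxy y)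
    show "diff BB (rep (\<xi> n \<diamondop> \<eta> n)) (?x \<otimes>\<^bsub>BB\<^esub> ?y) f =
        (?r \<otimes>\<^bsub>BB\<^esub> diff BB ?s ?y \<oplus>\<^bsub>BB\<^esub> diff BB ?r ?x \<otimes>\<^bsub>BB\<^esub> ?y) f"
      if f: "f \<in> ell2 orb" for f
    proof -
      note sf = op_in[OF ry f, of n] and yf = op_in[OF y f]
      show ?thesis
        using f sf yf op_diff[OF rx sf yf, of n] by (simp add: BO_simps rep_conv[OF a f])
    qed
  qed
  then have "dst (rep (\<xi> n \<diamondop> \<eta> n)) (?x \<otimes>\<^bsub>BB\<^esub> ?y) \<le>
      nrm BB (?r \<otimes>\<^bsub>BB\<^esub> diff BB ?s ?y) + nrm BB (diff BB ?r ?x \<otimes>\<^bsub>BB\<^esub> ?y)"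
    using op_plus(2)[OF op_mult(1)[OF rx dxy(2)] op_mult(1)[OF dxy(1) y]] by simp
  then show "dst (rep (\<xi> n \<diamondop> \<eta> n)) (?x \<otimes>\<^bsub>BB\<^esub> ?y) \<le> orbit_norm (\<xi> n) * dst ?s ?y + dst ?r ?x * nrm BB ?y"
    using op_mult(2)[OF rx dxy(2), of n] op_mult(2)[OF dxy(1) y] unfolding orbit_norm_def by linarith
qed

lemma ext_rep_one: "\<one>\<^bsub>BB\<^esub> = ext_rep (\<lambda>n. word [])"
proof (rule ext_rep_eqI'[symmetric])
  have "rep (word []) = \<one>\<^bsub>BB\<^esub>"
    by (rule op_eqI) (auto simp: op_one BO_simps rep_word intro!: rep_bounded)
  moreover have "dst \<one>\<^bsub>BB\<^esub> \<one>\<^bsub>BB\<^esub> \<le> 0"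
    by (rule opn_leI) (auto simp: BO_simps)
  ultimately show "dst (rep (word [])) \<one>\<^bsub>BB\<^esub> \<le> 0" by simp
  show "(\<lambda>n. 0 :: real) \<longlonglongrightarrow> 0" by simp
  show "(\<lambda>n. word []) \<in> CSQ" by (simp add: univ.CS_const)
qed (rule op_one)

lemma O_max_eq: "O_max G \<phi> = completion (free_star_algebra (gens G)) univ"
  by (simp add: O_max_def universal_cstar_def univ_def)

lemma O_max_gen_eq: "O_max_gen G \<phi> = (\<lambda>z. univ.cls (\<lambda>n. word [(z, False)]))"
  by (rule ext) (simp add: O_max_gen_def universal_gen_def univ_def free_gen_word)

lemma O_min_gen_eq: "O_min_gen G \<phi> pt = (\<lambda>z. ext_rep (\<lambda>n. word [(z, False)]))"
  by (rule ext) (simp add: O_min_gen_def O_max_gen_eq ext_rep_def)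

lemma O_min_simps:
  "carrier (O_min G \<phi> pt) = ext_rep ` CSQ"
  "add (O_min G \<phi> pt) = add BB" "mult (O_min G \<phi> pt) = mult BB" "scal (O_min G \<phi> pt) = scal BB"
  "adj (O_min G \<phi> pt) = adj BB" "one (O_min G \<phi> pt) = one BB" "nrm (O_min G \<phi> pt) = nrm BB"
  by (simp_all add: O_min_def O_max_eq univ.completion_carrier image_image ext_rep_def)

end

section \<open>The two algebras of a self-similar action\<close>

text \<open>
  The trace bound holds for the norm of the representation on any orbit, and the universal seminorm
  dominates that norm.
\<close>

lemma (in generic_action) unique_trace_O_max:
  "\<exists>!\<tau>. tracial_state (gauge_invariant G (O_max G \<phi>) (O_max_gen G \<phi>)) \<tau>"
proof -
  interpret generic_orbit G \<phi> "\<lambda>_. undefined" by unfold_locales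
  interpret model: dense_model G \<phi> univ "O_max G \<phi>" univ.cls
    unfolding O_max_eq
  proof (unfold_locales)
    show "cmod (tr f) \<le> univ f" if "f \<in> alg" "degree_zero f" for f
      using trace_bound[OF that] orbit_norm_le_univ[OF that(1)] by linarith
  qed (simp_all add: admissible_univ univ_gauge univ.completion_carrier univ.cls_eq_iff
      univ.completion_add univ.completion_mult univ.completion_scal univ.completion_adj
      univ.completion_one univ.completion_nrm)
  show ?thesis unfolding O_max_gen_eq by (rule model.unique_trace)
qed

text \<open>
  Here the norm is the operator norm of the representation. It is gauge invariant because
  \<open>w\<close> is strictly generic.
\<close>

lemma (in generic_action) unique_trace_O_min:
  assumes "strictly_generic G \<phi> w"
  shows "\<exists>!\<tau>. tracial_state (gauge_invariant G (O_min G \<phi> w) (O_min_gen G \<phi> w)) \<tau>"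
proof -
  interpret generic_orbit G \<phi> w by unfold_locales
  interpret strictly_generic_orbit G \<phi> w by unfold_locales (rule assms)
  interpret model: dense_model G \<phi> orbit_norm "O_min G \<phi> w" ext_rep
    by unfold_locales
       (simp_all add: O_min_simps admissible_rep orbit_norm_gauge trace_bound ext_rep_eq ext_rep_add
         ext_rep_mult ext_rep_scal ext_rep_adj ext_rep_one ext_rep_nrm)
  show ?thesis unfolding O_min_gen_eq by (rule model.unique_trace)
qed

theorem theorem3p12:
  fixes G :: "('g, 'm) monoid_scheme"
    and \<phi> :: "'g \<Rightarrow> (nat \<Rightarrow> 'x::finite) \<Rightarrow> (nat \<Rightarrow> 'x)"
  assumes "CARD('x) \<ge> 2"
    and "countable (carrier G)"
    and "self_similar_action G \<phi>"
    and "measure bernoulli (generic_points G \<phi>) = 1"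
  shows "(\<forall>w. strictly_generic G \<phi> w \<longrightarrow>
            (\<exists>!\<tau>. tracial_state (gauge_invariant G (O_min G \<phi> w) (O_min_gen G \<phi> w)) \<tau>)) \<and>
         (\<exists>!\<tau>. tracial_state (gauge_invariant G (O_max G \<phi>) (O_max_gen G \<phi>)) \<tau>)"
proof -
  interpret generic_action G \<phi> by unfold_locales (rule assms)+
  show ?thesis using unique_trace_O_min unique_trace_O_max by blast
qed

end
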